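(* Suppose $\mathcal{K}$ is a quasiminimal class, $\mathbb{M}$ is a monster model for $\mathcal{K}$, $A\subset\mathbb{M}$ is a finite set, $(a,b,c,x,y,z)\in\mathbb{M}$ is a strict bounded partial quadrangle over $A$, and the type $t(a,b,c,x,y,z/A)$ is stationary. Then there is a group $G$ in $(\mathbb{M}^{eq})^{eq}$, Galois definable over some finite set $A'\subset\mathbb{M}$. Moreover, a generic element of $G$ has $U$-rank $1$.
   Context: QUASIMINIMAL CLASSES. Let $L$ be a countable language; $\mathrm{tp}$ denotes quantifier-free type. An $L$-structure $M$ with a pregeometry $\mathrm{cl}$ is a quasiminimal pregeometry structure if: (QM1) if $a,a'$ are singletons and $\mathrm{tp}(a,b)=\mathrm{tp}(a',b')$, then $a\in\mathrm{cl}(b)$ iff $a'\in\mathrm{cl}(b')$; (QM2) $M$ is infinite-dimensional; (QM3) $\mathrm{cl}(A)$ is countable for finite $A\subseteq M$; (QM4) if $H,H'\subseteq M$ are countable closed sets enumerated so that $\mathrm{tp}(H)=\mathrm{tp}(H')$ and $a\in M\setminus H$, $a'\in M\setminus H'$ are singletons, then $\mathrm{tp}(H,a)=\mathrm{tp}(H',a')$; (QM5) if $H,H'\subseteq M$ are countable closed sets or empty, enumerated so that $\mathrm{tp}(H)=\mathrm{tp}(H')$, $b,b'$ are finite tuples with $\mathrm{tp}(H,b)=\mathrm{tp}(H',b')$ and $a\in\mathrm{cl}(H,b)$ is a singleton, then there is a singleton $a'\in M$ with $\mathrm{tp}(H,b,a)=\mathrm{tp}(H',b',a')$. Weakly quasiminimal: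 all of these except possibly (QM2). A closed embedding $\theta:M_1\to M_2$ of weakly quasiminimal structures is an isomorphism onto a substructure that is $\mathrm{cl}_{M_2}$-closed, with $\mathrm{cl}_{M_1}$ the restriction of $\mathrm{cl}_{M_2}$. For a quasiminimal pregeometry structure $M$, $\mathcal{K}^-(M)$ is the smallest class of $L$-structures containing $M$ and all its closed substructures and closed under isomorphism; $\mathcal{K}(M)$ is the smallest class containing $\mathcal{K}^-(M)$ and closed also under unions of chains of closed embeddings. A quasiminimal class is $\mathcal{K}=\mathcal{K}(M)$ with all finite-dimensional structures discarded, with $\mathcal{A}\preccurlyeq\mathcal{B}$ iff $\mathcal{A}$ is a closed submodel of $\mathcal{B}$; it is an abstract elementary class (AEC) with Löwenheim–Skolem number $\omega$. The monster model $\mathbb{M}$ is a $\delta$-model homogeneous, $\delta$-universal member of $\mathcal{K}$ for a large cardinal $\delta$; "bounded" means of size $<\delta$. TYPES AND RANK (for a monster model $\mathbb{M}$ of an AEC; also applied with $\mathbb{M}^{eq}$, $(\mathbb{M}^{eq})^{eq}$ in place of $\mathbb{M}$). Models are $\mathcal{A}\preccurlyeq\mathbb{M}$; models and parameter sets are bounded; $a\in X$ may be a finite tuple; juxtaposition denotes union or concatenation. $a,b$ have the same Galois type over $A$ if some $f\in\mathrm{Aut}(\mathbb{M}/A)$ (automorphisms fixing $A$ pointwise) maps $a$ to $b$; they have the same weak type, $t(a/A)=t(b/A)$, if they have the same Galois type over every finite subset of $A$. For finite $A\subseteq B$, or $A$ finite and $B$ arbitrary, $t(a/B)$ splits over $A$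 if there are $b,c\in B$ with $t(b/A)=t(c/A)$ but $t(ab/A)\ne t(ac/A)$. $a\downarrow^{ns}_B C$ means that $t(a/B\cup C)$ does not split over some finite $A\subseteq B$. For a model $\mathcal{A}$: $U(a/\mathcal{A})\ge0$ always; $U(a/\mathcal{A})\ge n+1$ if there is a model $\mathcal{B}\supseteq\mathcal{A}$ with $a\not\downarrow^{ns}_{\mathcal{A}}\mathcal{B}$ and $U(a/\mathcal{B})\ge n$; $U(a/\mathcal A)$ is the largest $n$ with $U(a/\mathcal{A})\ge n$. For finite $A$, $U(a/A)=\max\{U(a/\mathcal{A}) : \mathcal{A}\supset A\text{ a model}\}$; for arbitrary $A$, $U(a/A)=\min\{U(a/B):B\subseteq A\text{ finite}\}$. INDEPENDENCE. For finite $A$, $E(A)$ is the set of $\mathrm{Aut}(\mathbb{M}/A)$-invariant equivalence relations on powers $\mathbb{M}^n$ with boundedly many classes; $Lt(a/B)=Lt(b/B)$ means $(a,b)\in E$ for all finite $A\subseteq B$ and $E\in E(A)$. For $A\subseteq B$ with $A$ finite, $t(a/B)$ Lascar splits over $A$ if there are $b,c\in B$ with $Lt(b/A)=Lt(c/A)$ and $t(ab/A)\neq t(ac/A)$. $a\downarrow_B C$ means: there is a finite $A\subseteq B$ such that for all $D\supseteq B\cup C$ there is $b$ with $t(b/B\cup C)=t(a/B\cup C)$ and $t(b/D)$ not Lascar splitting over $A$. A set $X$ is independent over $B$ if $a\downarrow_B (X\setminus\{a\})$ for each $a\in X$. A type $t(d/B)$ is stationary if for every $C\supset B$ there is a unique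 type $t(d'/C)$ with $t(d'/B)=t(d/B)$ and $d'\downarrow_B C$. IMAGINARIES. Let $\mathcal{E}$ be a countable collection of $\emptyset$-invariant equivalence relations $E\subseteq\mathbb{M}^n\times\mathbb{M}^n$ (various $n$), containing equality, each given by a countable set $G_E$ of Galois types over $\emptyset$ via $(a,b)\in E$ iff $t^g(ab/\emptyset)\in G_E$. For $\mathcal{A}\in\mathcal{K}$, $\mathcal{A}^{eq}=\{a/E: a\in\mathcal{A},E\in\mathcal{E}\}$, with $a$ identified with $a/{=}$, the structure of $\mathcal{A}$ on the copy of $\mathcal{A}$, and additional predicates $P_E$ for $\{a/E:a\in\mathcal{A}\}$ and functions $F_E(a)=a/E$. $\mathcal{K}^{eq}=\{\mathcal{A}^{eq}:\mathcal{A}\in\mathcal{K}\}$, with $\mathcal{A}^{eq}\preccurlyeq^{eq}\mathcal{B}^{eq}$ iff $\mathcal{A}^{eq}$ is a submodel of $\mathcal{B}^{eq}$ and $\mathcal{A}\preccurlyeq\mathcal{B}$; its monster model is $\mathbb{M}^{eq}$. $(\mathbb{M}^{eq})^{eq}$ is formed from $\mathbb{M}^{eq}$ in the same way. The countable collections $\mathcal{E}$ at both stages are assumed chosen to contain the relations needed (e.g. those providing canonical bases, and the relations "$\mathrm{bcl}(x)=\mathrm{bcl}(y)$" on tuples), so the assertion is for a suitable such choice. QUADRANGLE. A strict bounded partial quadrangle over a finite set $A$ is a $6$-tuple $(a,b,c,x,y,z)$ of elements of $\mathbb{M}^{eq}$, each of $U$-rank $1$ over $A$, such that, with lines $\{a,b,c\}$,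 $\{a,x,y\}$, $\{b,y,z\}$, $\{c,x,z\}$: (i) any triple of non-collinear points is independent over $A$, i.e. has $U$-rank $3$ over $A$; (ii) every line has $U$-rank $2$ over $A$. DEFINABILITY. A set $B$ is Galois definable over $A$ if every automorphism fixing $A$ pointwise fixes $B$ setwise. A group is Galois definable over $A$ if both its underlying set and its operation are. An element of a set $B$ Galois definable over $A'$ is generic if its $U$-rank over $A'$ is maximal among elements of $B$; here the $U$-rank of a generic element of $G$ is taken over $A'$. *)

theory Defs
  imports "HOL-Library.Countable_Set" "HOL-Library.Extended_Nat" "HOL-Algebra.Group"
begin

unbundle cardinal_syntax

section \<open>First-order structures and quantifier-free types\<close>

definition tuples :: "'a set \<Rightarrow> nat \<Rightarrow> 'a list set" where
  "tuples U n = {xs. length xs = n \<and> set xs \<subseteq> U}"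

record ('f, 'r) lang =
  fsyms :: "'f set"
  rsyms :: "'r set"
  far :: "'f \<Rightarrow> nat"
  rar :: "'r \<Rightarrow> nat"

definition countable_lang :: "('f, 'r) lang \<Rightarrow> bool" where
  "countable_lang L \<longleftrightarrow> countable (fsyms L) \<and> countable (rsyms L)"

text \<open>The interpretations only matter on tuples from the universe that have the right arity.\<close>

record ('f, 'r, 'a) fo_struct =
  univ :: "'a set"
  fint :: "'f \<Rightarrow> 'a list \<Rightarrow> 'a"
  rint :: "'r \<Rightarrow> 'a list set"

definition is_struct :: "('f, 'r) lang \<Rightarrow> ('f, 'r, 'a, 'm) fo_struct_scheme \<Rightarrow> bool" where
  "is_struct L N \<longleftrightarrow>
     (\<forall>f\<in>fsyms L. \<forall>xs\<in>tuples (univ N) (far L f). fint N f xs \<in> univ N)"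

definition fo_embedding ::
  "('f, 'r) lang \<Rightarrow> ('a \<Rightarrow> 'b) \<Rightarrow> ('f, 'r, 'a, 'm) fo_struct_scheme \<Rightarrow>
   ('f, 'r, 'b, 'n) fo_struct_scheme \<Rightarrow> bool" where
  "fo_embedding L g N N' \<longleftrightarrow>
     inj_on g (univ N) \<and> g ` univ N \<subseteq> univ N' \<and>
     (\<forall>f\<in>fsyms L. \<forall>xs\<in>tuples (univ N) (far L f). g (fint N f xs) = fint N' f (map g xs)) \<and>
     (\<forall>r\<in>rsyms L. \<forall>xs\<in>tuples (univ N) (rar L r). xs \<in> rint N r \<longleftrightarrow> map g xs \<in> rint N' r)"

definition fo_iso ::
  "('f, 'r) lang \<Rightarrow> ('a \<Rightarrow> 'b) \<Rightarrow> ('f, 'r, 'a, 'm) fo_struct_scheme \<Rightarrow>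
   ('f, 'r, 'b, 'n) fo_struct_scheme \<Rightarrow> bool" where
  "fo_iso L g N N' \<longleftrightarrow> fo_embedding L g N N' \<and> g ` univ N = univ N'"

datatype ('f, vars_trm: 'v) trm = Var 'v | App 'f "('f, 'v) trm list"

datatype ('f, 'r, vars_qff: 'v) qff =
    Eql "('f, 'v) trm" "('f, 'v) trm"
  | Rel 'r "('f, 'v) trm list"
  | Neg "('f, 'r, 'v) qff"
  | Conj "('f, 'r, 'v) qff" "('f, 'r, 'v) qff"

fun wf_trm :: "('f, 'r) lang \<Rightarrow> ('f, 'v) trm \<Rightarrow> bool" where
  "wf_trm L (Var v) = True"
| "wf_trm L (App f ts) = (f \<in> fsyms L \<and> length ts = far L f \<and> (\<forall>t\<in>set ts. wf_trm L t))"

fun wf_qff :: "('f, 'r) lang \<Rightarrow> ('f, 'r, 'v) qff \<Rightarrow> bool" where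
  "wf_qff L (Eql t u) = (wf_trm L t \<and> wf_trm L u)"
| "wf_qff L (Rel r ts) = (r \<in> rsyms L \<and> length ts = rar L r \<and> (\<forall>t\<in>set ts. wf_trm L t))"
| "wf_qff L (Neg p) = wf_qff L p"
| "wf_qff L (Conj p q) = (wf_qff L p \<and> wf_qff L q)"

fun val :: "('f, 'r, 'a, 'm) fo_struct_scheme \<Rightarrow> ('v \<Rightarrow> 'a) \<Rightarrow> ('f, 'v) trm \<Rightarrow> 'a" where
  "val N s (Var v) = s v"
| "val N s (App f ts) = fint N f (map (val N s) ts)"

fun holds :: "('f, 'r, 'a, 'm) fo_struct_scheme \<Rightarrow> ('v \<Rightarrow> 'a) \<Rightarrow> ('f, 'r, 'v) qff \<Rightarrow> bool" where
  "holds N s (Eql t u) = (val N s t = val N s u)"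
| "holds N s (Rel r ts) = (map (val N s) ts \<in> rint N r)"
| "holds N s (Neg p) = (\<not> holds N s p)"
| "holds N s (Conj p q) = (holds N s p \<and> holds N s q)"

text \<open>The quantifier-free type of an at most countable family \<open>(h i)\<close>, \<open>i \<in> I\<close>, followed by a
  finite tuple \<open>b\<close>. Since \<open>x = x\<close> belongs to the type exactly for the variables \<open>x\<close> in use, tuples
  with the same type have the same length.\<close>

definition qf_type ::
  "('f, 'r) lang \<Rightarrow> ('f, 'r, 'a, 'm) fo_struct_scheme \<Rightarrow> nat set \<Rightarrow> (nat \<Rightarrow> 'a) \<Rightarrow> 'a list \<Rightarrow>
   ('f, 'r, nat + nat) qff set" where
  "qf_type L N I h b =
     {p. wf_qff L p \<and> vars_qff p \<subseteq> Inl ` I \<union> Inr ` {..<length b} \<and>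
         holds N (case_sum h (\<lambda>k. b ! k)) p}"

abbreviation qf_type_fin ::
  "('f, 'r) lang \<Rightarrow> ('f, 'r, 'a, 'm) fo_struct_scheme \<Rightarrow> 'a list \<Rightarrow> ('f, 'r, nat + nat) qff set" where
  "qf_type_fin L N b \<equiv> qf_type L N {} (\<lambda>_. undefined) b"


section \<open>Quasiminimal pregeometry structures and quasiminimal classes\<close>

record ('f, 'r, 'a) pstruct = "('f, 'r, 'a) fo_struct" +
  cl :: "'a set \<Rightarrow> 'a set"

definition pregeometry :: "'a set \<Rightarrow> ('a set \<Rightarrow> 'a set) \<Rightarrow> bool" where
  "pregeometry U c \<longleftrightarrow>
     (\<forall>X\<subseteq>U. X \<subseteq> c X \<and> c X \<subseteq> U) \<and>
     (\<forall>X Y. X \<subseteq> Y \<and> Y \<subseteq> U \<longrightarrow> c X \<subseteq> c Y) \<and>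
     (\<forall>X\<subseteq>U. c (c X) = c X) \<and>
     (\<forall>X\<subseteq>U. c X = (\<Union>F\<in>{F. finite F \<and> F \<subseteq> X}. c F)) \<and>
     (\<forall>X\<subseteq>U. \<forall>a\<in>U. \<forall>b\<in>U. a \<in> c (insert b X) - c X \<longrightarrow> b \<in> c (insert a X))"

definition is_pstruct :: "('f, 'r) lang \<Rightarrow> ('f, 'r, 'a) pstruct \<Rightarrow> bool" where
  "is_pstruct L N \<longleftrightarrow> is_struct L N \<and> pregeometry (univ N) (cl N)"

definition closed_in :: "('f, 'r, 'a) pstruct \<Rightarrow> 'a set \<Rightarrow> bool" where
  "closed_in N X \<longleftrightarrow> X \<subseteq> univ N \<and> cl N X = X"

definition finite_dimensional :: "('f, 'r, 'a) pstruct \<Rightarrow> bool" where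
  "finite_dimensional N \<longleftrightarrow> (\<exists>X. finite X \<and> X \<subseteq> univ N \<and> cl N X = univ N)"

definition QM1 :: "('f, 'r) lang \<Rightarrow> ('f, 'r, 'a) pstruct \<Rightarrow> bool" where
  "QM1 L N \<longleftrightarrow>
     (\<forall>a\<in>univ N. \<forall>a'\<in>univ N. \<forall>b\<in>lists (univ N). \<forall>b'\<in>lists (univ N).
        qf_type_fin L N (a # b) = qf_type_fin L N (a' # b') \<longrightarrow>
        (a \<in> cl N (set b) \<longleftrightarrow> a' \<in> cl N (set b')))"

definition QM2 :: "('f, 'r, 'a) pstruct \<Rightarrow> bool" where
  "QM2 N \<longleftrightarrow> \<not> finite_dimensional N"

definition QM3 :: "('f, 'r, 'a) pstruct \<Rightarrow> bool" where
  "QM3 N \<longleftrightarrow> (\<forall>X. finite X \<and> X \<subseteq> univ N \<longrightarrow> countable (cl N X))"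

text \<open>A pair of enumerated countable sets \<open>H\<close>, \<open>H'\<close> is given by two families \<open>h\<close>, \<open>h'\<close> over the same
  index set \<open>I \<subseteq> \<nat>\<close>, with \<open>H = h ` I\<close> and \<open>H' = h' ` I\<close>.\<close>

definition QM4 :: "('f, 'r) lang \<Rightarrow> ('f, 'r, 'a) pstruct \<Rightarrow> bool" where
  "QM4 L N \<longleftrightarrow>
     (\<forall>I h h'. closed_in N (h ` I) \<and> closed_in N (h' ` I) \<and>
        qf_type L N I h [] = qf_type L N I h' [] \<longrightarrow>
        (\<forall>a\<in>univ N - h ` I. \<forall>a'\<in>univ N - h' ` I.
           qf_type L N I h [a] = qf_type L N I h' [a']))"

definition QM5 :: "('f, 'r) lang \<Rightarrow> ('f, 'r, 'a) pstruct \<Rightarrow> bool" where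
  "QM5 L N \<longleftrightarrow>
     (\<forall>I h h'. (closed_in N (h ` I) \<or> h ` I = {}) \<and> (closed_in N (h' ` I) \<or> h' ` I = {}) \<and>
        qf_type L N I h [] = qf_type L N I h' [] \<longrightarrow>
        (\<forall>b\<in>lists (univ N). \<forall>b'\<in>lists (univ N).
           qf_type L N I h b = qf_type L N I h' b' \<longrightarrow>
           (\<forall>a\<in>cl N (h ` I \<union> set b). \<exists>a'\<in>univ N.
              qf_type L N I h (b @ [a]) = qf_type L N I h' (b' @ [a']))))"

definition weakly_quasiminimal :: "('f, 'r) lang \<Rightarrow> ('f, 'r, 'a) pstruct \<Rightarrow> bool" where
  "weakly_quasiminimal L N \<longleftrightarrow> is_pstruct L N \<and> QM1 L N \<and> QM3 N \<and> QM4 L N \<and> QM5 L N"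

definition quasiminimal :: "('f, 'r) lang \<Rightarrow> ('f, 'r, 'a) pstruct \<Rightarrow> bool" where
  "quasiminimal L N \<longleftrightarrow> weakly_quasiminimal L N \<and> QM2 N"

definition closed_embedding ::
  "('f, 'r) lang \<Rightarrow> ('a \<Rightarrow> 'b) \<Rightarrow> ('f, 'r, 'a) pstruct \<Rightarrow> ('f, 'r, 'b) pstruct \<Rightarrow> bool" where
  "closed_embedding L g N N' \<longleftrightarrow>
     is_pstruct L N \<and> is_pstruct L N' \<and> fo_embedding L g N N' \<and>
     closed_in N' (g ` univ N) \<and> (\<forall>X\<subseteq>univ N. g ` cl N X = cl N' (g ` X))"

definition closed_submodel :: "('f, 'r) lang \<Rightarrow> ('f, 'r, 'a) pstruct \<Rightarrow> ('f, 'r, 'a) pstruct \<Rightarrow> bool" where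
  "closed_submodel L N N' \<longleftrightarrow> closed_embedding L (\<lambda>x. x) N N'"

definition pstruct_iso ::
  "('f, 'r) lang \<Rightarrow> ('a \<Rightarrow> 'b) \<Rightarrow> ('f, 'r, 'a) pstruct \<Rightarrow> ('f, 'r, 'b) pstruct \<Rightarrow> bool" where
  "pstruct_iso L g N N' \<longleftrightarrow> closed_embedding L g N N' \<and> g ` univ N = univ N'"

text \<open>Because the closure operator of a pregeometry is finitary, \<open>N\<close> is determined on its universe
  by the following condition.\<close>

definition is_chain_union ::
  "('f, 'r) lang \<Rightarrow> ('f, 'r, 'a) pstruct set \<Rightarrow> ('f, 'r, 'a) pstruct \<Rightarrow> bool" where
  "is_chain_union L C N \<longleftrightarrow>
     C \<noteq> {} \<and> (\<forall>A\<in>C. \<forall>B\<in>C. closed_submodel L A B \<or> closed_submodel L B A) \<and>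
     is_pstruct L N \<and> univ N = (\<Union>A\<in>C. univ A) \<and> (\<forall>A\<in>C. closed_submodel L A N)"

text \<open>Classes of structures are rendered as sets of structures with universe in one type. In the
  presence of closure under isomorphism it suffices to consider chains of inclusions.\<close>

inductive_set Kminus :: "('f, 'r) lang \<Rightarrow> ('f, 'r, 'u) pstruct \<Rightarrow> ('f, 'r, 'u) pstruct set"
  for L M where
  self: "M \<in> Kminus L M"
| closed: "closed_submodel L N M \<Longrightarrow> N \<in> Kminus L M"
| iso: "N \<in> Kminus L M \<Longrightarrow> pstruct_iso L g N N' \<Longrightarrow> N' \<in> Kminus L M"

inductive_set Kclass :: "('f, 'r) lang \<Rightarrow> ('f, 'r, 'u) pstruct \<Rightarrow> ('f, 'r, 'u) pstruct set"
  for L M where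
  minus: "N \<in> Kminus L M \<Longrightarrow> N \<in> Kclass L M"
| iso: "N \<in> Kclass L M \<Longrightarrow> pstruct_iso L g N N' \<Longrightarrow> N' \<in> Kclass L M"
| union: "\<forall>A\<in>C. A \<in> Kclass L M \<Longrightarrow> is_chain_union L C N \<Longrightarrow> N \<in> Kclass L M"

definition quasiminimal_class :: "('f, 'r) lang \<Rightarrow> ('f, 'r, 'u) pstruct set \<Rightarrow> bool" where
  "quasiminimal_class L K \<longleftrightarrow>
     (\<exists>M. quasiminimal L M \<and> K = {N \<in> Kclass L M. \<not> finite_dimensional N})"


section \<open>Monster models\<close>

text \<open>The convention for a large cardinal: an uncountable strong limit, not necessarily regular, so
  that no inaccessible cardinals are presupposed.\<close>

definition large_cardinal :: "'u rel \<Rightarrow> bool" where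
  "large_cardinal \<delta> \<longleftrightarrow>
     Card_order \<delta> \<and> natLeq <o \<delta> \<and> (\<forall>X :: 'u set. |X| <o \<delta> \<longrightarrow> |Pow X| <o \<delta>)"

definition model_homogeneous ::
  "('f, 'r) lang \<Rightarrow> ('f, 'r, 'u) pstruct set \<Rightarrow> 'u rel \<Rightarrow> ('f, 'r, 'u) pstruct \<Rightarrow> bool" where
  "model_homogeneous L K \<delta> M \<longleftrightarrow>
     (\<forall>A\<in>K. \<forall>B\<in>K. \<forall>g. closed_submodel L A M \<and> closed_submodel L B M \<and>
        |univ A| <o \<delta> \<and> |univ B| <o \<delta> \<and> fo_iso L g A B \<longrightarrow>
        (\<exists>f. fo_iso L f M M \<and> (\<forall>x\<in>univ A. f x = g x)))"

definition model_universal ::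
  "('f, 'r) lang \<Rightarrow> ('f, 'r, 'u) pstruct set \<Rightarrow> 'u rel \<Rightarrow> ('f, 'r, 'u) pstruct \<Rightarrow> bool" where
  "model_universal L K \<delta> M \<longleftrightarrow>
     (\<forall>A\<in>K. |univ A| <o \<delta> \<longrightarrow> (\<exists>g. closed_embedding L g A M))"

definition monster_model ::
  "('f, 'r) lang \<Rightarrow> ('f, 'r, 'u) pstruct set \<Rightarrow> 'u rel \<Rightarrow> ('f, 'r, 'u) pstruct \<Rightarrow> bool" where
  "monster_model L K \<delta> M \<longleftrightarrow>
     large_cardinal \<delta> \<and> M \<in> K \<and> model_homogeneous L K \<delta> M \<and> model_universal L K \<delta> M"

text \<open>What is needed of a monster model in order to speak about types: the structure itself, the
  universes of its bounded strong submodels, and the cardinal below which sets are bounded. Passing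
  to imaginaries maps such data to such data.\<close>

record ('f, 'r, 'a, 'd) monster =
  lng :: "('f, 'r) lang"
  str :: "('f, 'r, 'a) fo_struct"
  mods :: "'a set set"
  bnd :: "'d rel"

definition monster_of ::
  "('f, 'r) lang \<Rightarrow> ('f, 'r, 'u) pstruct set \<Rightarrow> 'u rel \<Rightarrow> ('f, 'r, 'u) pstruct \<Rightarrow>
   ('f, 'r, 'u, 'u) monster" where
  "monster_of L K \<delta> M =
     \<lparr>lng = L, str = fo_struct.truncate M,
      mods = {univ A |A. A \<in> K \<and> closed_submodel L A M \<and> |univ A| <o \<delta>},
      bnd = \<delta>\<rparr>"

abbreviation points :: "('f, 'r, 'a, 'd) monster \<Rightarrow> 'a set" where
  "points MM \<equiv> univ (str MM)"

definition bounded :: "('f, 'r, 'a, 'd) monster \<Rightarrow> 'b set \<Rightarrow> bool" where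
  "bounded MM X \<longleftrightarrow> |X| <o bnd MM"

definition param_set :: "('f, 'r, 'a, 'd) monster \<Rightarrow> 'a set \<Rightarrow> bool" where
  "param_set MM B \<longleftrightarrow> B \<subseteq> points MM \<and> bounded MM B"

definition Aut :: "('f, 'r, 'a, 'd) monster \<Rightarrow> 'a set \<Rightarrow> ('a \<Rightarrow> 'a) set" where
  "Aut MM A = {f. fo_iso (lng MM) f (str MM) (str MM) \<and> (\<forall>x\<in>A. f x = x)}"


section \<open>Types, splitting and U-rank\<close>

text \<open>Finite tuples are lists. A Galois type is identified with the set of its realisations.\<close>

definition galois_type :: "('f, 'r, 'a, 'd) monster \<Rightarrow> 'a set \<Rightarrow> 'a list \<Rightarrow> 'a list set" where
  "galois_type MM A a = {map f a |f. f \<in> Aut MM A}"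

definition same_galois_type ::
  "('f, 'r, 'a, 'd) monster \<Rightarrow> 'a set \<Rightarrow> 'a list \<Rightarrow> 'a list \<Rightarrow> bool" where
  "same_galois_type MM A a b \<longleftrightarrow> (\<exists>f\<in>Aut MM A. map f a = b)"

definition same_type ::
  "('f, 'r, 'a, 'd) monster \<Rightarrow> 'a set \<Rightarrow> 'a list \<Rightarrow> 'a list \<Rightarrow> bool" where
  "same_type MM A a b \<longleftrightarrow> (\<forall>A0. finite A0 \<and> A0 \<subseteq> A \<longrightarrow> same_galois_type MM A0 a b)"

definition splits :: "('f, 'r, 'a, 'd) monster \<Rightarrow> 'a list \<Rightarrow> 'a set \<Rightarrow> 'a set \<Rightarrow> bool" where
  "splits MM a B A \<longleftrightarrow>
     (\<exists>b\<in>lists B. \<exists>c\<in>lists B. same_type MM A b c \<and> \<not> same_type MM A (a @ b) (a @ c))"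

definition ns_indep :: "('f, 'r, 'a, 'd) monster \<Rightarrow> 'a list \<Rightarrow> 'a set \<Rightarrow> 'a set \<Rightarrow> bool" where
  "ns_indep MM a B C \<longleftrightarrow> (\<exists>A. finite A \<and> A \<subseteq> B \<and> \<not> splits MM a (B \<union> C) A)"

primrec U_ge :: "('f, 'r, 'a, 'd) monster \<Rightarrow> 'a list \<Rightarrow> nat \<Rightarrow> 'a set \<Rightarrow> bool" where
  "U_ge MM a 0 A \<longleftrightarrow> True"
| "U_ge MM a (Suc n) A \<longleftrightarrow>
     (\<exists>B\<in>mods MM. A \<subseteq> B \<and> \<not> ns_indep MM a A B \<and> U_ge MM a n B)"

text \<open>The rank over a model, with value \<open>\<infinity>\<close> if there is no largest \<open>n\<close>.\<close>

definition U_model :: "('f, 'r, 'a, 'd) monster \<Rightarrow> 'a list \<Rightarrow> 'a set \<Rightarrow> enat" where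
  "U_model MM a A = Sup {enat n |n. U_ge MM a n A}"

text \<open>The rank over a finite set. A finite supremum in \<^typ>\<open>enat\<close> is attained.\<close>

definition U_rank :: "('f, 'r, 'a, 'd) monster \<Rightarrow> 'a list \<Rightarrow> 'a set \<Rightarrow> enat" where
  "U_rank MM a A = Sup {U_model MM a B |B. B \<in> mods MM \<and> A \<subseteq> B}"


section \<open>Lascar types, independence and stationarity\<close>

definition bounded_equivs ::
  "('f, 'r, 'a, 'd) monster \<Rightarrow> 'a set \<Rightarrow> nat \<Rightarrow> 'a list rel set" where
  "bounded_equivs MM A n =
     {E. equiv (tuples (points MM) n) E \<and>
         (\<forall>f\<in>Aut MM A. \<forall>a b. (a, b) \<in> E \<longrightarrow> (map f a, map f b) \<in> E) \<and>
         bounded MM (tuples (points MM) n // E)}"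

definition same_Lascar_type ::
  "('f, 'r, 'a, 'd) monster \<Rightarrow> 'a set \<Rightarrow> 'a list \<Rightarrow> 'a list \<Rightarrow> bool" where
  "same_Lascar_type MM B a b \<longleftrightarrow>
     length a = length b \<and>
     (\<forall>A. finite A \<and> A \<subseteq> B \<longrightarrow> (\<forall>E\<in>bounded_equivs MM A (length a). (a, b) \<in> E))"

definition Lascar_splits :: "('f, 'r, 'a, 'd) monster \<Rightarrow> 'a list \<Rightarrow> 'a set \<Rightarrow> 'a set \<Rightarrow> bool" where
  "Lascar_splits MM a B A \<longleftrightarrow>
     (\<exists>b\<in>lists B. \<exists>c\<in>lists B.
        same_Lascar_type MM A b c \<and> \<not> same_type MM A (a @ b) (a @ c))"

definition indep :: "('f, 'r, 'a, 'd) monster \<Rightarrow> 'a list \<Rightarrow> 'a set \<Rightarrow> 'a set \<Rightarrow> bool" where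
  "indep MM a B C \<longleftrightarrow>
     (\<exists>A. finite A \<and> A \<subseteq> B \<and>
        (\<forall>D. param_set MM D \<and> B \<union> C \<subseteq> D \<longrightarrow>
           (\<exists>b\<in>lists (points MM). same_type MM (B \<union> C) b a \<and> \<not> Lascar_splits MM b D A)))"

definition stationary :: "('f, 'r, 'a, 'd) monster \<Rightarrow> 'a list \<Rightarrow> 'a set \<Rightarrow> bool" where
  "stationary MM d B \<longleftrightarrow>
     (\<forall>C. param_set MM C \<and> B \<subseteq> C \<longrightarrow>
        (\<exists>d'\<in>lists (points MM). same_type MM B d' d \<and> indep MM d' B C) \<and>
        (\<forall>d'\<in>lists (points MM). \<forall>d''\<in>lists (points MM).
           same_type MM B d' d \<and> indep MM d' B C \<and> same_type MM B d'' d \<and> indep MM d'' B C \<longrightarrow>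
           same_type MM C d' d''))"


section \<open>Imaginaries\<close>

text \<open>\<open>Imag E X\<close> is the equivalence class \<open>X\<close>, tagged with the relation so that classes of distinct
  relations stay distinct.\<close>

datatype 'a imag = Imag "'a list rel" "'a list set"

definition quot :: "'a list rel \<Rightarrow> 'a list \<Rightarrow> 'a imag" where
  "quot E a = Imag E (E `` {a})"

definition eq_rel :: "('f, 'r, 'a, 'd) monster \<Rightarrow> 'a list rel" where
  "eq_rel MM = Id_on (tuples (points MM) 1)"

text \<open>The identification of \<open>a\<close> with its class under equality.\<close>

definition home :: "('f, 'r, 'a, 'd) monster \<Rightarrow> 'a \<Rightarrow> 'a imag" where
  "home MM a = quot (eq_rel MM) [a]"

definition imag_rels :: "('f, 'r, 'a, 'd) monster \<Rightarrow> 'a list rel set \<Rightarrow> bool" where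
  "imag_rels MM \<E> \<longleftrightarrow>
     countable \<E> \<and> eq_rel MM \<in> \<E> \<and>
     (\<forall>E\<in>\<E>. \<exists>n>0. equiv (tuples (points MM) n) E \<and>
        (\<exists>\<G>. countable \<G> \<and> \<G> \<subseteq> galois_type MM {} ` lists (points MM) \<and>
           E = {(a, b). a \<in> tuples (points MM) n \<and> b \<in> tuples (points MM) n \<and>
                        galois_type MM {} (a @ b) \<in> \<G>}))"

text \<open>The functions of the original language and the quotient maps are defined on the copy of the
  original universe only, so they are represented by their graphs.\<close>

datatype ('f, 'r, 'a) eq_sym =
    Graph 'f
  | Old 'r
  | P "'a list rel"
  | F nat "'a list rel"

definition eq_lang ::
  "('f, 'r, 'a, 'd) monster \<Rightarrow> 'a list rel set \<Rightarrow> ('f, ('f, 'r, 'a) eq_sym) lang" where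
  "eq_lang MM \<E> =
     \<lparr>fsyms = {},
      rsyms = Graph ` fsyms (lng MM) \<union> Old ` rsyms (lng MM) \<union> P ` \<E> \<union>
              {F n E |n E. E \<in> \<E> \<and> equiv (tuples (points MM) n) E},
      far = (\<lambda>_. 0),
      rar = (\<lambda>s. case s of Graph f \<Rightarrow> Suc (far (lng MM) f) | Old r \<Rightarrow> rar (lng MM) r
                         | P E \<Rightarrow> 1 | F n E \<Rightarrow> Suc n)\<rparr>"

definition eq_set :: "'a list rel set \<Rightarrow> 'a set \<Rightarrow> 'a imag set" where
  "eq_set \<E> A = {quot E a |E a. E \<in> \<E> \<and> a \<in> Domain E \<and> set a \<subseteq> A}"

definition eq_struct ::
  "('f, 'r, 'a, 'd) monster \<Rightarrow> 'a list rel set \<Rightarrow> ('f, ('f, 'r, 'a) eq_sym, 'a imag) fo_struct" where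
  "eq_struct MM \<E> =
     \<lparr>univ = eq_set \<E> (points MM),
      fint = (\<lambda>_. undefined),
      rint = (\<lambda>s. case s of
          Graph f \<Rightarrow> {map (home MM) (a @ [fint (str MM) f a]) |a.
                       a \<in> tuples (points MM) (far (lng MM) f)}
        | Old r \<Rightarrow> {map (home MM) a |a.
                       a \<in> tuples (points MM) (rar (lng MM) r) \<and> a \<in> rint (str MM) r}
        | P E \<Rightarrow> {[quot E a] |a. a \<in> Domain E}
        | F n E \<Rightarrow> {map (home MM) a @ [quot E a] |a. a \<in> tuples (points MM) n})\<rparr>"

text \<open>For a strong submodel \<open>A\<close> of the monster model, \<open>a/E\<close> with \<open>a\<close> in \<open>A\<close> is identified with the
  class of \<open>a\<close> in the monster model.\<close>

definition eq_monster ::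
  "('f, 'r, 'a, 'd) monster \<Rightarrow> 'a list rel set \<Rightarrow> ('f, ('f, 'r, 'a) eq_sym, 'a imag, 'd) monster" where
  "eq_monster MM \<E> =
     \<lparr>lng = eq_lang MM \<E>, str = eq_struct MM \<E>, mods = eq_set \<E> ` mods MM, bnd = bnd MM\<rparr>"


section \<open>Quadrangles, definability and generic elements\<close>

text \<open>Points are numbered in the order \<open>a, b, c, x, y, z\<close>; the lines are \<open>{a, b, c}\<close>,
  \<open>{a, x, y}\<close>, \<open>{b, y, z}\<close> and \<open>{c, x, z}\<close>. As elements may be finite tuples, points are lists.\<close>

definition quadrangle_lines :: "nat set set" where
  "quadrangle_lines = {{0, 1, 2}, {0, 3, 4}, {1, 4, 5}, {2, 3, 5}}"

definition strict_bounded_partial_quadrangle ::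
  "('f, 'r, 'a, 'd) monster \<Rightarrow> 'a set \<Rightarrow>
   'a list \<Rightarrow> 'a list \<Rightarrow> 'a list \<Rightarrow> 'a list \<Rightarrow> 'a list \<Rightarrow> 'a list \<Rightarrow> bool" where
  "strict_bounded_partial_quadrangle MM A a b c x y z \<longleftrightarrow>
     (let p = (\<lambda>i. [a, b, c, x, y, z] ! i) in
        (\<forall>i<6. p i \<in> lists (points MM) \<and> U_rank MM (p i) A = 1) \<and>
        (\<forall>i j k. i < j \<and> j < k \<and> k < 6 \<and> {i, j, k} \<notin> quadrangle_lines \<longrightarrow>
           U_rank MM (p i @ p j @ p k) A = 3) \<and>
        (\<forall>i j k. i < j \<and> j < k \<and> k < 6 \<and> {i, j, k} \<in> quadrangle_lines \<longrightarrow>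
           U_rank MM (p i @ p j @ p k) A = 2))"

definition galois_definable ::
  "('f, 'r, 'a, 'd) monster \<Rightarrow> 'a set \<Rightarrow> 'a list set \<Rightarrow> bool" where
  "galois_definable MM A B \<longleftrightarrow>
     B \<subseteq> lists (points MM) \<and> (\<forall>f\<in>Aut MM A. map f ` B = B)"

definition galois_definable_group ::
  "('f, 'r, 'a, 'd) monster \<Rightarrow> 'a set \<Rightarrow> 'a monoid \<Rightarrow> bool" where
  "galois_definable_group MM A G \<longleftrightarrow>
     group G \<and> galois_definable MM A {[g] |g. g \<in> carrier G} \<and>
     galois_definable MM A {[g, h, g \<otimes>\<^bsub>G\<^esub> h] |g h. g \<in> carrier G \<and> h \<in> carrier G}"

definition generic :: "('f, 'r, 'a, 'd) monster \<Rightarrow> 'a set \<Rightarrow> 'a list set \<Rightarrow> 'a list \<Rightarrow> bool" where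
  "generic MM A B g \<longleftrightarrow> g \<in> B \<and> (\<forall>h\<in>B. U_rank MM h A \<le> U_rank MM g A)"

end

theory Submission
  imports Defs
begin

text \<open>Over a finite set, U-rank is dimension in the pregeometry, so a quadrangle can be replaced by one
  whose points are single elements \<open>a, b, c, x, y, z\<close>. After three copies of it have been taken and
  finitely many parameters \<open>A\<close> added, suitable finite tuples interalgebraic with \<open>b\<close> and \<open>z\<close> have
  stationary types, because types do not split over large enough finite sets. A realisation \<open>s\<close> of the
  first type takes a realisation \<open>t\<close> of the second to data interalgebraic with \<open>y\<close>, so a pair \<open>(s, s')\<close>
  acts on generic \<open>t\<close>, by \<open>t \<mapsto> t'\<close> if \<open>s\<close> takes \<open>t\<close> to what \<open>s'\<close> takes \<open>t'\<close> to. The quadrangle shows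
  that the germ of such an action is also the germ of a pair \<open>(e, f)\<close> with \<open>e\<close> prescribed and generic.
  Hence germs compose and form a group, whose elements are the classes of pairs under equality of
  germs. If \<open>e\<close> is chosen inside a model, then the class of \<open>(e, f)\<close> is fixed by the automorphisms
  fixing \<open>e\<close> and \<open>f\<close>, while \<open>f\<close> has rank 1, which bounds its rank by 1.

  The stages \<open>\<E>1\<close> and \<open>\<E>2\<close> may not depend on the quadrangle, but the conclusion does not mention it, so
  one quadrangle serves for all of them. Only one relation besides equality is needed, at the
  first stage.\<close>

section \<open>Homogeneous pregeometries\<close>

text \<open>The obstacle is that lines give algebraicity only: \<open>y\<close> lies in the closure
  of \<open>b\<close> and \<open>z\<close>, but automorphisms fixing \<open>b\<close> and
  \<open>z\<close> may move it. What \<open>s\<close> and \<open>t\<close> are to determine is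
  therefore a pair of closed sets, the closures of \<open>y\<close> and of \<open>x3\<close> over
  the original parameters \<open>A0\<close>. Each is an intersection of two closures of dimension 2
  over \<open>A0\<close>, and the auxiliary quadrangles supply the second closure through the same
  point. Their points \<open>a'\<close>, \<open>b'\<close>, \<open>c'\<close> become parameters, so
  that over \<open>A\<close> the new points depend on \<open>b\<close>, \<open>z\<close> or
  \<open>y\<close> alone, while over \<open>A0\<close> the closures still meet in dimension 1. The
  closure of \<open>y\<close> alone would place \<open>z\<close> only in the closure of
  \<open>b\<close> and \<open>y\<close>; together with that of \<open>x3\<close> it confines
  \<open>z\<close> to dimension 1. So \<open>t\<close> is recovered from \<open>s\<close> and the
  value up to interalgebraicity, and pairs act on classes of such \<open>t\<close> rather than on
  points. Finite bases for nonsplitting come from a generic construction over a countable model,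
  where only countably many values have to be avoided.\<close>

lemma map_inverse: "(\<And>x. x \<in> V \<Longrightarrow> g (f x) = x) \<Longrightarrow> set s \<subseteq> V \<Longrightarrow> map g (map f s) = s"
  unfolding map_map by (rule map_idI) (auto simp: subset_iff)

text \<open>The Rasiowa-Sikorski construction: requirement number \<open>n\<close> of an enumeration
  is met in passing from stage \<open>n\<close> to stage \<open>n + 1\<close>. It has to hold at one
  stage only and need not persist to larger sets.\<close>

lemma generic_chain:
  assumes "Q p0" "countable \<D>"
    and dense: "\<And>D p. D \<in> \<D> \<Longrightarrow> Q p \<Longrightarrow> \<exists>q. p \<subseteq> q \<and> Q q \<and> D q"
  obtains S :: "nat \<Rightarrow> 'a set"
  where "S 0 = p0" "mono S" "\<And>n. Q (S n)" "\<And>D. D \<in> \<D> \<Longrightarrow> \<exists>n. D (S n)"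
proof -
  have "\<exists>f. \<forall>n. (Q (f n) \<and> (n = 0 \<longrightarrow> f n = p0)) \<and>
      (f n \<subseteq> f (Suc n) \<and> (\<D> \<noteq> {} \<longrightarrow> (from_nat_into \<D> n) (f (Suc n))))"
  proof (rule dependent_nat_choice)
    show "\<exists>x. Q x \<and> (0 = (0::nat) \<longrightarrow> x = p0)" using assms(1) by blast
  next
    fix x and n :: nat
    assume "Q x \<and> (n = 0 \<longrightarrow> x = p0)"
    then have "Q x" by simp
    show "\<exists>y. (Q y \<and> (Suc n = 0 \<longrightarrow> y = p0)) \<and>
        (x \<subseteq> y \<and> (\<D> \<noteq> {} \<longrightarrow> (from_nat_into \<D> n) y))"
    proof (cases "\<D> = {}")
      case True
      then show ?thesis using \<open>Q x\<close> by blast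
    next
      case False
      then show ?thesis using dense[OF from_nat_into[OF False] \<open>Q x\<close>, of n] by auto
    qed
  qed
  then obtain S where S: "\<And>n. (Q (S n) \<and> (n = 0 \<longrightarrow> S n = p0)) \<and>
      (S n \<subseteq> S (Suc n) \<and> (\<D> \<noteq> {} \<longrightarrow> (from_nat_into \<D> n) (S (Suc n))))"
    by blast
  show ?thesis
  proof
    show "S 0 = p0" "\<And>n. Q (S n)" using S by auto
    show "mono S" using S by (simp add: mono_iff_le_Suc)
    show "\<exists>n. D (S n)" if D: "D \<in> \<D>" for D
    proof -
      obtain n where "from_nat_into \<D> n = D" using from_nat_into_surj[OF assms(2) D] by blast
      then have "D (S (Suc n))" using S[of n] D by auto
      then show ?thesis by blast
    qed
  qed
qed

text \<open>What the construction of the group uses of the monster model: permutations respecting a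
  pregeometry, with types read as orbits. \<open>cl\<close> is total and ignores points outside
  \<open>U\<close>; the members of \<open>\<Gamma>\<close> are arbitrary outside \<open>U\<close>,
  so inverses are demanded on \<open>U\<close> only. In \<open>hom\<close> the map
  \<open>\<phi>\<close> is realised by \<open>\<Gamma>\<close> merely on finite sets; that it is
  realised as a whole, together with one new generic point, combines uniqueness of generic types
  with model homogeneity.\<close>

locale homogeneous_pregeometry =
  fixes U :: "'a set" and cl :: "'a set \<Rightarrow> 'a set" and \<Gamma> :: "('a \<Rightarrow> 'a) set"
  assumes cl_in_U: "cl X \<subseteq> U"
    and cl_restrict: "cl (X \<inter> U) = cl X"
    and cl_extensive: "x \<in> X \<Longrightarrow> x \<in> U \<Longrightarrow> x \<in> cl X"
    and cl_mono: "X \<subseteq> Y \<Longrightarrow> cl X \<subseteq> cl Y"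
    and cl_idem: "cl (cl X) = cl X"
    and cl_finitary: "x \<in> cl X \<Longrightarrow> \<exists>F. finite F \<and> F \<subseteq> X \<and> x \<in> cl F"
    and cl_exchange: "a \<in> cl (insert b X) \<Longrightarrow> a \<notin> cl X \<Longrightarrow> b \<in> cl (insert a X)"
    and countable_cl_finite: "finite X \<Longrightarrow> countable (cl X)"
    and infinite_dim: "finite X \<Longrightarrow> \<not> U \<subseteq> cl X"
    and id_in: "(\<lambda>x. x) \<in> \<Gamma>"
    and comp_in: "f \<in> \<Gamma> \<Longrightarrow> g \<in> \<Gamma> \<Longrightarrow> (\<lambda>x. f (g x)) \<in> \<Gamma>"
    and inv_ex: "f \<in> \<Gamma> \<Longrightarrow> \<exists>g\<in>\<Gamma>. \<forall>x\<in>U. g (f x) = x \<and> f (g x) = x"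
    and aut_in_U: "f \<in> \<Gamma> \<Longrightarrow> x \<in> U \<Longrightarrow> f x \<in> U"
    and aut_cl: "f \<in> \<Gamma> \<Longrightarrow> X \<subseteq> U \<Longrightarrow> f ` cl X = cl (f ` X)"
    and hom: "countable H \<Longrightarrow> H \<subseteq> U \<Longrightarrow> cl H = H \<Longrightarrow> cl (\<phi> ` H) = \<phi> ` H \<Longrightarrow>
      (\<And>F. finite F \<Longrightarrow> F \<subseteq> H \<Longrightarrow> \<exists>g\<in>\<Gamma>. \<forall>x\<in>F. g x = \<phi> x) \<Longrightarrow>
      u \<in> U \<Longrightarrow> u \<notin> H \<Longrightarrow> u' \<in> U \<Longrightarrow> u' \<notin> \<phi> ` H \<Longrightarrow>
      \<exists>g\<in>\<Gamma>. (\<forall>x\<in>H. g x = \<phi> x) \<and> g u = u'"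
begin

lemma cl_subset: "X \<subseteq> cl Y \<Longrightarrow> cl X \<subseteq> cl Y"
  using cl_mono[of X "cl Y"] cl_idem by simp

lemma cl_U: "x \<in> cl X \<Longrightarrow> x \<in> U"
  using cl_in_U by blast

lemma cl_trans: "x \<in> cl X \<Longrightarrow> X \<subseteq> cl Y \<Longrightarrow> x \<in> cl Y"
  using cl_subset by blast

lemma cl_monoD: "x \<in> cl X \<Longrightarrow> X \<subseteq> Y \<Longrightarrow> x \<in> cl Y"
  using cl_mono by blast

lemma cl_ext: "X \<subseteq> U \<Longrightarrow> X \<subseteq> cl X"
  using cl_extensive by blast

lemma cl_subset': "X \<inter> U \<subseteq> cl Y \<Longrightarrow> cl X \<subseteq> cl Y"
  using cl_subset[of "X \<inter> U"] cl_restrict by simp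

lemma countable_cl: "countable X \<Longrightarrow> countable (cl X)"
proof -
  assume "countable X"
  then have "countable {F. finite F \<and> F \<subseteq> X}"
    using countable_Collect_finite_subset by fastforce
  then have "countable (\<Union>F\<in>{F. finite F \<and> F \<subseteq> X}. cl F)"
    using countable_cl_finite by blast
  moreover have "cl X \<subseteq> (\<Union>F\<in>{F. finite F \<and> F \<subseteq> X}. cl F)"
    using cl_finitary by blast
  ultimately show ?thesis using countable_subset by blast
qed

lemma fresh: "finite D \<Longrightarrow> \<exists>u\<in>U. u \<notin> cl D"
  using infinite_dim by blast

section \<open>Independent sequences and extension of automorphisms\<close>

fun ind :: "'a set \<Rightarrow> 'a list \<Rightarrow> bool" where
  "ind X [] = True"
| "ind X (e # es) = (e \<in> U \<and> e \<notin> cl X \<and> ind (insert e X) es)"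

lemma ind_in_U: "ind X es \<Longrightarrow> set es \<subseteq> U"
  by (induction es arbitrary: X) auto

lemma ind_mono: "ind Y es \<Longrightarrow> X \<subseteq> Y \<Longrightarrow> ind X es"
proof (induction es arbitrary: X Y)
  case (Cons e es)
  then show ?case using cl_mono[of X Y] by (auto intro: Cons.IH[of "insert e Y" "insert e X"])
qed auto

lemma ind_cl_mono: "ind Y es \<Longrightarrow> cl X \<subseteq> cl Y \<Longrightarrow> X \<subseteq> U \<Longrightarrow> Y \<subseteq> U \<Longrightarrow> ind X es"
proof (induction es arbitrary: X Y)
  case (Cons e es)
  have "cl (insert e X) \<subseteq> cl (insert e Y)"
    using Cons.prems cl_ext[of X] cl_mono[of Y "insert e Y", OF subset_insertI] cl_extensive[of e "insert e Y"]
    by (intro cl_subset) auto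
  then show ?case using Cons.prems Cons.IH[of "insert e Y" "insert e X"] by auto
qed auto

text \<open>Exchange, applied along the sequence: if \<open>k\<close> entered the closure with the
  element \<open>e\<close>, then \<open>e\<close> would depend on \<open>k\<close> and the earlier
  elements.\<close>

lemma ind_notin:
  "ind (insert k X) es \<Longrightarrow> k \<notin> cl X \<Longrightarrow> k \<notin> cl (X \<union> set es)"
proof (induction es arbitrary: X)
  case (Cons e es)
  have "k \<notin> cl (insert e X)" using Cons.prems cl_exchange[of k e X] by auto
  then have "k \<notin> cl (insert e X \<union> set es)"
    using Cons.prems Cons.IH[of "insert e X"] by (simp add: insert_commute[of k e])
  then show ?case by simp
qed auto

lemma extend_one:
  assumes "f \<in> \<Gamma>" "countable D" "D \<subseteq> U" "u \<in> U" "u \<notin> cl D" "u' \<in> U" "u' \<notin> cl (f ` D)"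
  shows "\<exists>g\<in>\<Gamma>. (\<forall>x\<in>cl D. g x = f x) \<and> g u = u'"
  using assms cl_in_U[of D] aut_cl[of f D] by (intro hom) (auto simp: countable_cl cl_idem)

lemma extend_list:
  assumes "f \<in> \<Gamma>" "countable D" "D \<subseteq> U" "ind D es" "ind (f ` D) es'" "length es = length es'"
  shows "\<exists>g\<in>\<Gamma>. (\<forall>x\<in>cl D. g x = f x) \<and> map g es = es'"
  using assms
proof (induction es arbitrary: D f es')
  case Nil
  then show ?case by auto
next
  case (Cons e es)
  obtain e' es'' where es': "es' = e' # es''" using Cons.prems by (cases es') auto
  obtain g1 where g1: "g1 \<in> \<Gamma>" "\<forall>x\<in>cl D. g1 x = f x" "g1 e = e'"
    using extend_one[of f D e e'] Cons.prems es' by auto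
  have im: "g1 ` insert e D = insert e' (f ` D)"
    using g1 cl_ext[OF Cons.prems(3)] by force
  have "\<exists>g\<in>\<Gamma>. (\<forall>x\<in>cl (insert e D). g x = g1 x) \<and> map g es = es''"
    using Cons.prems es' g1 by (intro Cons.IH) (auto simp: im simp del: image_insert)
  then obtain g where g: "g \<in> \<Gamma>" "\<forall>x\<in>cl (insert e D). g x = g1 x" "map g es = es''" by blast
  moreover have "e \<in> cl (insert e D)" using Cons.prems by (auto intro: cl_extensive)
  moreover have "cl D \<subseteq> cl (insert e D)" using cl_mono[of D "insert e D"] by auto
  ultimately have "(\<forall>x\<in>cl D. g x = f x) \<and> map g (e # es) = es'"
    using g1 es' by (simp add: subset_iff)
  then show ?case using g(1) by blast
qed

section \<open>Orbits over parameters, and models\<close>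

definition fixing :: "'a set \<Rightarrow> ('a \<Rightarrow> 'a) set" where
  "fixing A = {g \<in> \<Gamma>. \<forall>x\<in>A. g x = x}"

lemma fixingD: "g \<in> fixing A \<Longrightarrow> g \<in> \<Gamma>" "g \<in> fixing A \<Longrightarrow> x \<in> A \<Longrightarrow> g x = x"
  by (auto simp: fixing_def)

lemma fixing_mono: "A \<subseteq> B \<Longrightarrow> fixing B \<subseteq> fixing A"
  by (auto simp: fixing_def)

lemma fixing_id: "(\<lambda>x. x) \<in> fixing A"
  by (auto simp: fixing_def id_in)

lemma fixing_comp: "f \<in> fixing A \<Longrightarrow> g \<in> fixing A \<Longrightarrow> (\<lambda>x. f (g x)) \<in> fixing A"
  by (simp add: fixing_def comp_in)

lemma fixing_inv:
  assumes "f \<in> fixing A" "A \<subseteq> U"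
  obtains g where "g \<in> fixing A" "\<And>x. x \<in> U \<Longrightarrow> g (f x) = x" "\<And>x. x \<in> U \<Longrightarrow> f (g x) = x"
proof -
  obtain g where g: "g \<in> \<Gamma>" "\<forall>x\<in>U. g (f x) = x \<and> f (g x) = x"
    using inv_ex[of f] fixingD[OF assms(1)] by blast
  then have "g \<in> fixing A"
    using assms unfolding fixing_def by force
  then show ?thesis using that g by blast
qed

lemma aut_inj: "f \<in> \<Gamma> \<Longrightarrow> inj_on f U"
  using inv_ex by (metis inj_on_inverseI)

lemma aut_mem_cl:
  assumes "f \<in> \<Gamma>" "X \<subseteq> U" "x \<in> U"
  shows "f x \<in> cl (f ` X) \<longleftrightarrow> x \<in> cl X"
  using aut_cl[OF assms(1,2)] inj_on_image_mem_iff[OF aut_inj[OF assms(1)] assms(3) cl_in_U] by metis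

lemma aut_image_U: "f \<in> \<Gamma> \<Longrightarrow> X \<subseteq> U \<Longrightarrow> f ` X \<subseteq> U"
  using aut_in_U by blast

lemma aut_set_map: "f \<in> \<Gamma> \<Longrightarrow> set s \<subseteq> U \<Longrightarrow> set (map f s) \<subseteq> U"
  using aut_in_U by auto

lemma fixing_image: "g \<in> fixing A \<Longrightarrow> B \<subseteq> A \<Longrightarrow> g ` B = B"
  by (force simp: fixing_def)

definition eqt :: "'a set \<Rightarrow> 'a list \<Rightarrow> 'a list \<Rightarrow> bool" where
  "eqt A s t \<longleftrightarrow> (\<exists>g\<in>fixing A. map g s = t)"

lemma eqtI: "g \<in> fixing A \<Longrightarrow> map g s = t \<Longrightarrow> eqt A s t"
  by (auto simp: eqt_def)

lemma eqt_trans: "eqt A s t \<Longrightarrow> eqt A t u \<Longrightarrow> eqt A s u"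
  unfolding eqt_def
proof (elim bexE)
  fix f g assume "f \<in> fixing A" "g \<in> fixing A" "map f s = t" "map g t = u"
  then show "\<exists>g\<in>fixing A. map g s = u" by (intro bexI[OF _ fixing_comp[of g A f]]) auto
qed

lemma eqt_sym: "eqt A s t \<Longrightarrow> A \<subseteq> U \<Longrightarrow> set s \<subseteq> U \<Longrightarrow> eqt A t s"
proof -
  assume a: "eqt A s t" "A \<subseteq> U" "set s \<subseteq> U"
  then obtain f where f: "f \<in> fixing A" "map f s = t" by (auto simp: eqt_def)
  obtain g where "g \<in> fixing A" "\<And>x. x \<in> U \<Longrightarrow> g (f x) = x"
    using fixing_inv[OF f(1) a(2)] by metis
  then show ?thesis using f(2) map_inverse[of U g f s] a(3) by (auto simp: eqt_def)
qed

text \<open>Infinite-dimensional closed sets play the role of models.\<close>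

definition model :: "'a set \<Rightarrow> bool" where
  "model H \<longleftrightarrow> H \<subseteq> U \<and> cl H = H \<and> (\<forall>F. finite F \<longrightarrow> F \<subseteq> H \<longrightarrow> \<not> H \<subseteq> cl F)"

text \<open>Here \<open>D\<close> need not lie in \<open>H\<close>. Exchange trades each of its
  points for a point of \<open>H\<close>, after which a finite spanning set would lie inside
  \<open>H\<close>. The set \<open>F\<close> in the induction collects the points already
  traded.\<close>

lemma model_not_in_cl:
  assumes "model H" "finite D"
  shows "\<not> H \<subseteq> cl D"
proof -
  have "\<not> H \<subseteq> cl (F \<union> D)" if "finite F" "F \<subseteq> H" for F
    using assms(2) that
  proof (induction D arbitrary: F rule: finite_induct)
    case empty
    then show ?case using assms(1) by (auto simp: model_def)
  next
    case (insert u D)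
    obtain x where x: "x \<in> H" "x \<notin> cl (F \<union> D)" using insert.IH[OF insert.prems] by blast
    show ?case
    proof
      assume H: "H \<subseteq> cl (F \<union> insert u D)"
      then have "x \<in> cl (insert u (F \<union> D))" using x(1) by auto
      then have "u \<in> cl (insert x (F \<union> D))" using x(2) by (rule cl_exchange)
      moreover have "(F \<union> D) \<inter> U \<subseteq> cl (insert x (F \<union> D))"
        by (auto intro: cl_extensive)
      ultimately have "insert u (F \<union> D) \<inter> U \<subseteq> cl (insert x (F \<union> D))" by auto
      then have "cl (F \<union> insert u D) \<subseteq> cl (insert x F \<union> D)"
        using cl_subset'[of "F \<union> insert u D" "insert x F \<union> D"] by simp
      then have "H \<subseteq> cl (insert x F \<union> D)" using H by blast
      moreover have "finite (insert x F)" "insert x F \<subseteq> H" using x insert.prems by auto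
      ultimately show False using insert.IH[of "insert x F"] by simp
    qed
  qed
  from this[of "{}"] show ?thesis by simp
qed

end

lemma finite_subset_mono_UN:
  assumes "mono (X :: nat \<Rightarrow> 'a set)" "finite D" "D \<subseteq> (\<Union>n. X n)"
  shows "\<exists>n. D \<subseteq> X n"
  using assms(2,3)
proof (induction D rule: finite_induct)
  case (insert e D)
  then obtain n m where "D \<subseteq> X n" "e \<in> X m" by auto
  moreover have "X n \<subseteq> X (max n m)" "X m \<subseteq> X (max n m)" using assms(1) by (auto simp: mono_def)
  ultimately have "insert e D \<subseteq> X (max n m)" by blast
  then show ?case by blast
qed auto

lemma map_eq_iff_zip:
  "length j = length k \<Longrightarrow> map f j = k \<longleftrightarrow> (\<forall>(x,y)\<in>set (zip j k). f x = y)"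
  by (induction j k rule: list_induct2) auto

context homogeneous_pregeometry
begin

text \<open>Together with \<open>ind_notin\<close> this is the symmetry of independence between a
  point and a sequence.\<close>

lemma ind_insert: "ind X es \<Longrightarrow> k \<notin> cl (X \<union> set es) \<Longrightarrow> ind (insert k X) es"
proof (induction es arbitrary: X)
  case (Cons e es)
  have "e \<notin> cl (insert k X)"
  proof
    assume "e \<in> cl (insert k X)"
    then have "k \<in> cl (insert e X)" using Cons.prems by (auto intro: cl_exchange)
    then show False using Cons.prems(2) cl_mono[of "insert e X" "X \<union> set (e # es)"] by auto
  qed
  then show ?case using Cons.prems Cons.IH[of "insert e X"] by (auto simp: insert_commute)
qed auto

lemma cl_UN_mono:
  assumes "mono (X :: nat \<Rightarrow> 'a set)" "x \<in> cl (\<Union>n. X n)"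
  obtains n where "x \<in> cl (X n)"
proof -
  obtain D where D: "finite D" "D \<subseteq> (\<Union>n. X n)" "x \<in> cl D"
    using cl_finitary[OF assms(2)] by blast
  obtain n where n: "D \<subseteq> X n" using finite_subset_mono_UN[OF assms(1) D(1,2)] by blast
  have "x \<in> cl (X n)" using cl_monoD[OF D(3) n] .
  then show ?thesis by (rule that)
qed

lemma ind_UN:
  "mono (X :: nat \<Rightarrow> 'a set) \<Longrightarrow> (\<And>n. ind (X n) es) \<Longrightarrow> ind (\<Union>n. X n) es"
proof (induction es arbitrary: X)
  case (Cons e es)
  have "e \<notin> cl (\<Union>n. X n)" 
  proof
    assume "e \<in> cl (\<Union>n. X n)"
    then obtain n where "e \<in> cl (X n)" by (rule cl_UN_mono[OF Cons.prems(1)])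
    then show False using Cons.prems(2)[of n] by simp
  qed
  moreover have "mono (\<lambda>n. insert e (X n))" using Cons.prems(1) by (auto simp: mono_def)
  then have "ind (\<Union>n. insert e (X n)) es" using Cons.prems(2) by (intro Cons.IH) auto
  moreover have "(\<Union>n. insert e (X n)) = insert e (\<Union>n. X n)" by auto
  ultimately show ?case using Cons.prems(2) by auto
qed auto

lemma ind_cl: "X \<subseteq> U \<Longrightarrow> ind X es \<Longrightarrow> ind (cl X) es"
  by (rule ind_cl_mono[of X]) (auto simp: cl_idem dest: cl_U)

text \<open>Points are added forever, each outside the closure of what is there together with
  \<open>es\<close>. By symmetry \<open>es\<close> stays independent, and the added points prevent
  \<open>H\<close> from being spanned by a finite set.\<close>

lemma model_independent:
  assumes "finite D" "D \<subseteq> U" "ind D es"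
  obtains H where "countable H" "model H" "D \<subseteq> H" "ind H es"
proof -
  obtain fr where fr: "\<And>D. finite D \<Longrightarrow> fr D \<in> U \<and> fr D \<notin> cl D" using fresh by metis
  define X where "X = rec_nat D (\<lambda>_ X. insert (fr (X \<union> set es)) X)"
  have X0: "X 0 = D" and XS: "\<And>n. X (Suc n) = insert (fr (X n \<union> set es)) (X n)"
    by (auto simp: X_def)
  have fin: "finite (X n)" for n by (induction n) (auto simp: X0 XS assms)
  have XU: "X n \<subseteq> U" for n by (induction n) (use X0 XS assms fr fin in auto)
  have indX: "ind (X n) es" for n
    by (induction n) (use X0 XS assms fr fin in \<open>auto intro: ind_insert\<close>)
  have mono: "mono X" by (rule mono_iff_le_Suc[THEN iffD2]) (auto simp: XS)
  define H where "H = cl (\<Union>n. X n)"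
  have UU: "(\<Union>n. X n) \<subseteq> U" using XU by blast
  show ?thesis
  proof
    show "countable H" unfolding H_def using fin by (intro countable_cl) (auto intro: countable_finite)
    show "D \<subseteq> H" using cl_ext[OF UU] X0 by (auto simp: H_def)
    show "ind H es" unfolding H_def by (intro ind_cl UU ind_UN mono indX)
    show "model H" unfolding model_def
    proof (intro conjI allI impI)
      show "H \<subseteq> U" "cl H = H" by (auto simp: H_def cl_idem dest: cl_U)
      fix E assume E: "finite E" "E \<subseteq> H"
      then have "\<exists>n. E \<subseteq> cl (X n)"
      proof (induction E rule: finite_induct)
        case (insert e E)
        obtain n where n: "E \<subseteq> cl (X n)" using insert by auto
        obtain m where m: "e \<in> cl (X m)" using cl_UN_mono[OF mono] insert.prems by (auto simp: H_def)
        have "X n \<subseteq> X (max n m)" "X m \<subseteq> X (max n m)" using mono by (auto simp: mono_def)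
        then have "insert e E \<subseteq> cl (X (max n m))" using n m by (meson cl_monoD insert_subset subset_iff)
        then show ?case by blast
      qed auto
      then obtain n where "E \<subseteq> cl (X n)" by blast
      then have "cl E \<subseteq> cl (X n)" by (rule cl_subset)
      moreover have "fr (X n \<union> set es) \<in> X (Suc n)" by (simp add: XS)
      then have "fr (X n \<union> set es) \<in> H" using cl_ext[OF UU] by (auto simp: H_def)
      moreover have "fr (X n \<union> set es) \<notin> cl (X n)"
        using fr[of "X n \<union> set es"] fin cl_mono[of "X n" "X n \<union> set es"] by auto
      ultimately show "\<not> H \<subseteq> cl E" by blast
    qed
  qed
qed

section \<open>Nonsplitting over finite sets and stationarity\<close>

definition nsplit :: "'a set \<Rightarrow> 'a set \<Rightarrow> 'a list \<Rightarrow> bool" where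
  "nsplit A H d \<longleftrightarrow> (\<forall>k\<in>lists H. \<forall>k'\<in>lists H. eqt A k k' \<longrightarrow> eqt A (d @ k) (d @ k'))"

text \<open>If every finite set failed, one could build an elementary permutation of \<open>H\<close> over \<open>A1\<close> such that no
  extension of it has a value \<open>d\<close> at a tuple of \<open>cl (A1 \<union> set es)\<close>. But its extension fixing \<open>es\<close> has one.\<close>

lemma finite_nonsplitting_base:
  assumes H: "countable H" "model H" and es: "ind H es"
    and A1: "finite A1" "A1 \<subseteq> H" and d: "set d \<subseteq> cl (A1 \<union> set es)"
  obtains A0 where "finite A0" "A1 \<subseteq> A0" "A0 \<subseteq> H" "nsplit A0 H d"
proof (rule ccontr)
  assume "\<not> thesis"
  then have no: "\<not> nsplit A0 H d" if "finite A0" "A1 \<subseteq> A0" "A0 \<subseteq> H" for A0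
    using that \<open>\<And>A0. \<lbrakk>finite A0; A1 \<subseteq> A0; A0 \<subseteq> H; nsplit A0 H d\<rbrakk> \<Longrightarrow> thesis\<close> by blast
  have HU: "H \<subseteq> U" and clH: "cl H = H" using H by (auto simp: model_def)
  have A1U: "A1 \<subseteq> U" and esU: "set es \<subseteq> U" using A1 HU ind_in_U[OF es] by auto
  show False
  proof (cases es)
    \<comment> \<open>Without a generic point \<open>d\<close> lies in \<open>H\<close>, and adding
      its entries to the parameters gives a base.\<close>
    case Nil
    then have "set d \<subseteq> H" using d cl_mono[OF A1(2)] clH by auto
    moreover have "nsplit (A1 \<union> set d) H d"
      unfolding nsplit_def eqt_def by (auto simp: fixing_def map_idI intro!: bexI)
    ultimately show ?thesis using no[of "A1 \<union> set d"] A1 by auto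
  next
    case (Cons e es')
    \<comment> \<open>A condition is a finite part of the permutation of \<open>H\<close>, realised
      by an automorphism over \<open>A1\<close>. \<open>K v p\<close> says that \<open>p\<close>
      already excludes every automorphism over \<open>A1\<close> that extends it and takes
      \<open>v\<close> to \<open>d\<close>.\<close>
    define Q where "Q p \<longleftrightarrow> finite p \<and> p \<subseteq> H \<times> H \<and> (\<exists>g\<in>fixing A1. \<forall>(x,y)\<in>p. g x = y)" for p
    define V where "V = lists (cl (A1 \<union> set es))"
    define K where "K v p \<longleftrightarrow> (\<forall>f\<in>fixing A1. (\<forall>(x,y)\<in>p. f x = y) \<longrightarrow> map f v \<noteq> d)" for v p
    define \<D> where "\<D> = (\<lambda>a p. a \<in> fst ` p) ` H \<union> (\<lambda>a p. a \<in> snd ` p) ` H \<union> K ` V"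
    have Qfin: "Q p \<Longrightarrow> finite (A1 \<union> fst ` p) \<and> A1 \<union> fst ` p \<subseteq> H \<and> finite (A1 \<union> snd ` p) \<and> A1 \<union> snd ` p \<subseteq> H" for p
      using A1 by (auto simp: Q_def)
    have im: "g ` (A1 \<union> fst ` p) = A1 \<union> snd ` p" if "g \<in> fixing A1" "\<forall>(x,y)\<in>p. g x = y" for g p
      using that by (force simp: fixing_def)
    have Q_insert: "Q (insert (a,a') p)" if "Q p" "g \<in> \<Gamma>" "\<forall>x\<in>A1. g x = x" "\<forall>(x,y)\<in>p. g x = y"
      "g a = a'" "a \<in> H" "a' \<in> H" for p g a a'
      using that by (auto simp: Q_def fixing_def)
    have forth: "\<exists>a'. Q (insert (a,a') p)" if Q: "Q p" and a: "a \<in> H" for a p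
    proof -
      obtain g where g: "g \<in> fixing A1" "\<forall>(x,y)\<in>p. g x = y" using Q by (auto simp: Q_def)
      have gG: "g \<in> \<Gamma>" by (rule fixingD(1)[OF g(1)])
      have dU: "A1 \<union> fst ` p \<subseteq> U" using Qfin[OF Q] HU by blast
      show ?thesis
      proof (cases "a \<in> cl (A1 \<union> fst ` p)")
        case True
        have "g a \<in> cl (g ` (A1 \<union> fst ` p))"
          using aut_mem_cl[OF gG dU, of a] True a HU by blast
        then have "g a \<in> cl H" unfolding im[OF g] by (rule cl_monoD) (use Qfin[OF Q] in blast)
        then have gaH: "g a \<in> H" using clH by simp
        have "\<forall>x\<in>A1. g x = x" using g(1) by (simp add: fixing_def)
        from Q_insert[OF Q gG this g(2) refl a gaH] show ?thesis by (rule exI[of _ "g a"])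
      next
        case False
        obtain a' where a': "a' \<in> H" "a' \<notin> cl (A1 \<union> snd ` p)"
          using model_not_in_cl[OF H(2), of "A1 \<union> snd ` p"] Qfin[OF Q] by auto
        obtain g' where g': "g' \<in> \<Gamma>" "\<forall>x\<in>cl (A1 \<union> fst ` p). g' x = g x" "g' a = a'"
          using extend_one[OF gG _ dU _ False, of a'] Qfin[OF Q] a a' HU
          unfolding im[OF g] by (meson countable_finite subsetD)
        have sub: "A1 \<union> fst ` p \<subseteq> cl (A1 \<union> fst ` p)" by (rule cl_ext[OF dU])
        have 1: "\<forall>x\<in>A1. g' x = x"
          using g(1) g'(2) sub by (auto simp: fixing_def)
        have 2: "\<forall>(x,y)\<in>p. g' x = y"
        proof (intro ballI, clarify)
          fix x y assume xy: "(x,y) \<in> p"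
          then have "x \<in> cl (A1 \<union> fst ` p)" using sub by force
          then show "g' x = y" using g'(2) g(2) xy by auto
        qed
        from Q_insert[OF Q g'(1) 1 2 g'(3) a a'(1)] show ?thesis by (rule exI[of _ a'])
      qed
    qed
    have Qconv: "Q (converse p)" if Qp: "Q p" for p
    proof -
      obtain g where g: "g \<in> fixing A1" "\<forall>(x,y)\<in>p. g x = y" using Qp unfolding Q_def by blast
      obtain f where f: "f \<in> fixing A1" "\<And>x. x \<in> U \<Longrightarrow> f (g x) = x"
        using fixing_inv[OF g(1) A1U] by metis
      have p: "finite p" "p \<subseteq> H \<times> H" using Qp by (auto simp: Q_def)
      have "f y = x" if "(x,y) \<in> p" for x y
      proof -
        have "x \<in> U" "g x = y" using that p g(2) HU by auto
        then show ?thesis using f(2)[of x] by simp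
      qed
      then have "\<forall>(x,y)\<in>converse p. f x = y" by auto
      moreover have "finite (converse p)" "converse p \<subseteq> H \<times> H" using p by auto
      ultimately show ?thesis using f(1) unfolding Q_def by blast
    qed
    have bwd: "\<exists>a. Q (insert (a,a') p)" if Q: "Q p" and a: "a' \<in> H" for a' p
    proof -
      obtain a where "Q (insert (a',a) (converse p))" using forth[OF Qconv[OF Q] a] by blast
      then have "Q (converse (insert (a',a) (converse p)))" by (rule Qconv)
      moreover have "converse (insert (a',a) (converse p)) = insert (a,a') p" by auto
      ultimately show ?thesis by auto
    qed
    have back_list: "\<exists>j. length j = length k \<and> set j \<subseteq> H \<and> Q (p \<union> set (zip j k))"
      if "Q p" "k \<in> lists H" for p k
      using that(2,1)
    proof (induction k arbitrary: p rule: lists.induct)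
      case Nil
      then show ?case by simp
    next
      case (Cons a k)
      obtain j where j: "length j = length k" "set j \<subseteq> H" "Q (p \<union> set (zip j k))" using Cons by blast
      obtain b where b: "Q (insert (b,a) (p \<union> set (zip j k)))" using bwd[OF j(3) Cons.hyps(1)] by blast
      then have "b \<in> H" by (auto simp: Q_def)
      then show ?case using j b by (intro exI[of _ "b # j"]) auto
    qed
    \<comment> \<open>A pair \<open>k\<close>, \<open>k'\<close> that witnesses splitting over the
      range of \<open>p\<close> offers two prolongations of \<open>p\<close>, by
      \<open>j \<mapsto> k\<close> and by \<open>j \<mapsto> k'\<close>. If both had extensions
      taking \<open>v\<close> to \<open>d\<close>, the quotient of these would fix \<open>d\<close>
      and the range of \<open>p\<close> and move \<open>k\<close> to \<open>k'\<close>, against the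
      choice of the pair. So one of the two excludes \<open>v\<close>.\<close>
    have kill: "\<exists>q. p \<subseteq> q \<and> Q q \<and> K v q" if Q: "Q p" and v: "v \<in> V" for p v
    proof -
      let ?A0 = "A1 \<union> snd ` p"
      have A0U: "?A0 \<subseteq> U" using Qfin[OF Q] HU by blast
      have "\<not> nsplit ?A0 H d" using Qfin[OF Q] by (intro no) auto
      then obtain k k' where k: "k \<in> lists H" "k' \<in> lists H" "eqt ?A0 k k'"
          "\<not> eqt ?A0 (d @ k) (d @ k')"
        by (auto simp: nsplit_def)
      obtain \<tau> where \<tau>: "\<tau> \<in> fixing ?A0" "map \<tau> k = k'" using k(3) by (auto simp: eqt_def)
      obtain j where j: "length j = length k" "set j \<subseteq> H" "Q (p \<union> set (zip j k))"
        using back_list[OF Q k(1)] by blast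
      show ?thesis
      proof (cases "K v (p \<union> set (zip j k))")
        case True
        then show ?thesis using j by blast
      next
        case False
        then obtain f where f: "f \<in> fixing A1" "\<forall>(x,y)\<in>p \<union> set (zip j k). f x = y" "map f v = d"
          by (auto simp: K_def)
        have fj: "map f j = k" using f(2) unfolding map_eq_iff_zip[OF j(1)] ball_Un by simp
        obtain f' where f': "f' \<in> fixing A1" "\<And>x. x \<in> U \<Longrightarrow> f' (f x) = x" "\<And>x. x \<in> U \<Longrightarrow> f (f' x) = x"
          using fixing_inv[OF f(1) A1U] by metis
        have len: "length k' = length j" using \<tau>(2) j(1) by auto
        have g1: "(\<lambda>x. \<tau> (f x)) \<in> fixing A1"
          by (rule fixing_comp[OF subsetD[OF fixing_mono \<tau>(1)] f(1)]) simp
        have g2: "\<forall>(x,y)\<in>p \<union> set (zip j k'). \<tau> (f x) = y"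
        proof -
          have "\<tau> (f x) = y" if "(x,y) \<in> p" for x y
          proof -
            have "f x = y" using bspec[OF f(2), of "(x,y)"] that by simp
            moreover have "y \<in> ?A0" using that by force
            ultimately show ?thesis using fixingD(2)[OF \<tau>(1)] by simp
          qed
          moreover have "map (\<lambda>x. \<tau> (f x)) j = k'" using fj \<tau>(2) by auto
          then have "\<forall>(x,y)\<in>set (zip j k'). \<tau> (f x) = y"
            by (rule map_eq_iff_zip[OF len[symmetric], THEN iffD1])
          ultimately show ?thesis by (auto simp: ball_Un)
        qed
        have g3: "finite (p \<union> set (zip j k'))" "p \<union> set (zip j k') \<subseteq> H \<times> H"
          using Q j(2) k(2) by (auto simp: Q_def dest: set_zip_leftD set_zip_rightD)
        have Q': "Q (p \<union> set (zip j k'))"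
          unfolding Q_def by (intro conjI g3 bexI[OF _ g1] g2)
        have "K v (p \<union> set (zip j k'))" unfolding K_def
        proof (intro ballI impI notI)
          fix h assume h: "h \<in> fixing A1" "\<forall>(x,y)\<in>p \<union> set (zip j k'). h x = y" "map h v = d"
          have hj: "map h j = k'" using h(2) unfolding map_eq_iff_zip[OF len[symmetric]] ball_Un by simp
          have f'k: "map f' k = j" using map_inverse[of U f' f j, OF f'(2)] fj j(2) HU by blast
          have f'd: "map f' d = v" 
          proof -
            have "set v \<subseteq> U" using v cl_in_U by (auto simp: V_def)
            then show ?thesis using map_inverse[of U f' f v, OF f'(2)] f(3) by blast
          qed
          have "(\<lambda>x. h (f' x)) \<in> fixing ?A0"
          proof -
            have "h (f' y) = y" if "(x,y) \<in> p" for x y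

            proof -
              have "x \<in> U" using that Q HU by (auto simp: Q_def)
              moreover have "f x = y" "h x = y" using that bspec[OF f(2), of "(x,y)"] bspec[OF h(2), of "(x,y)"] by simp_all
              ultimately show ?thesis using f'(2)[of x] by simp
            qed
            then have "\<forall>y\<in>snd ` p. h (f' y) = y" by auto
            then show ?thesis using fixing_comp[OF h(1) f'(1)] by (auto simp: fixing_def)
          qed
          moreover have "map (\<lambda>x. h (f' x)) (d @ k) = d @ k'"

          proof -
            have "map h (map f' (d @ k)) = d @ k'" unfolding map_append f'd f'k h(3) hj ..
            then show ?thesis by (simp add: comp_def)
          qed
          ultimately show False using k(4) by (metis eqtI)
        qed
        then show ?thesis using Q' by blast
      qed
    qed
    have Q0: "Q {}" using fixing_id by (auto simp: Q_def)
    have cD: "countable \<D>"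
    proof -
      have "countable V" unfolding V_def
        by (intro countable_lists countable_cl_finite) (simp add: A1)
      then show ?thesis unfolding \<D>_def by (intro countable_Un countable_image H(1))
    qed
    have dense: "\<exists>q. p \<subseteq> q \<and> Q q \<and> D q" if D: "D \<in> \<D>" and p: "Q p" for D p
    proof -
      consider a where "D = (\<lambda>p. a \<in> fst ` p)" "a \<in> H" | a where "D = (\<lambda>p. a \<in> snd ` p)" "a \<in> H"
        | v where "D = K v" "v \<in> V"
        using D by (auto simp: \<D>_def)
      then show ?thesis
      proof cases
        case (1 a)
        then obtain a' where "Q (insert (a,a') p)" using forth[OF p] by blast
        then show ?thesis unfolding 1(1) by (intro exI[of _ "insert (a,a') p"]) auto
      next
        case (2 a')
        then obtain a where "Q (insert (a,a') p)" using bwd[OF p] by blast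
        then show ?thesis unfolding 2(1) by (intro exI[of _ "insert (a,a') p"]) auto
      next
        case 3
        then show ?thesis using kill[OF p] by simp
      qed
    qed
    obtain S :: "nat \<Rightarrow> ('a \<times> 'a) set" where S: "mono S" "\<And>n. Q (S n)" "\<And>D. D \<in> \<D> \<Longrightarrow> \<exists>n. D (S n)"
    proof (rule generic_chain[of Q "{}" \<D>, OF Q0 cD])
      show "\<exists>q. p \<subseteq> q \<and> Q q \<and> D q" if "D \<in> \<D>" "Q p" for D p using dense[OF that] .
    next
      fix S :: "nat \<Rightarrow> ('a \<times> 'a) set"
      assume "incseq S" "\<And>n. Q (S n)" "\<And>D. D \<in> \<D> \<Longrightarrow> \<exists>n. D (S n)"
      then show thesis by (rule that[of S])
    qed
    define R where "R = (\<Union>n. S n)"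
    have Rfin: "\<exists>n. X \<subseteq> S n" if "finite X" "X \<subseteq> R" for X
      using finite_subset_mono_UN[OF S(1) that(1)] that(2) by (simp add: R_def)
    have RH: "R \<subseteq> H \<times> H" using S(2) by (auto simp: R_def Q_def)
    have dom: "\<exists>y. (x,y) \<in> R" if "x \<in> H" for x
    proof -
      have "(\<lambda>p. x \<in> fst ` p) \<in> \<D>" using that by (auto simp: \<D>_def)
      then obtain n where "x \<in> fst ` S n" using S(3) by blast
      then obtain y where "(x,y) \<in> S n" by auto
      then show ?thesis unfolding R_def by blast
    qed
    have ran: "\<exists>x. (x,y) \<in> R" if "y \<in> H" for y
    proof -
      have "(\<lambda>p. y \<in> snd ` p) \<in> \<D>" using that by (auto simp: \<D>_def)
      then obtain n where "y \<in> snd ` S n" using S(3) by blast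
      then obtain x where "(x,y) \<in> S n" by auto
      then show ?thesis unfolding R_def by blast
    qed
    have QS: "\<exists>g\<in>fixing A1. \<forall>(x,y)\<in>S n. g x = y" for n using S(2)[of n] by (simp add: Q_def)
    have fn: "y = y'" if xy: "(x,y) \<in> R" "(x,y') \<in> R" for x y y'
    proof -
      obtain n where n: "(x,y) \<in> S n" "(x,y') \<in> S n" using Rfin[of "{(x,y),(x,y')}"] xy by auto
      obtain g where g: "\<forall>(x,y)\<in>S n. g x = y" using QS[of n] by auto
      show ?thesis using bspec[OF g n(1)] bspec[OF g n(2)] by simp
    qed
    define \<phi> where "\<phi> x = (THE y. (x,y) \<in> R)" for x
    have \<phi>: "\<phi> x = y" if "(x,y) \<in> R" for x y
      unfolding \<phi>_def using that fn[OF _ that] by (rule the_equality)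
    have \<phi>R: "(x, \<phi> x) \<in> R" if "x \<in> H" for x using dom[OF that] \<phi> by auto
    have \<phi>H: "\<phi> ` H = H"
    proof
      show "\<phi> ` H \<subseteq> H" using \<phi>R RH by auto
      show "H \<subseteq> \<phi> ` H"
      proof
        fix y assume "y \<in> H"
        then obtain x where x: "(x,y) \<in> R" using ran by blast
        then show "y \<in> \<phi> ` H" using \<phi>[OF x] RH by auto
      qed
    qed
    have elem: "\<exists>g\<in>fixing A1. \<forall>x\<in>X. g x = \<phi> x" if "finite X" "X \<subseteq> H" for X
    proof -
      have "finite ((\<lambda>x. (x, \<phi> x)) ` X)" "(\<lambda>x. (x, \<phi> x)) ` X \<subseteq> R" using that \<phi>R by auto
      then obtain n where n: "(\<lambda>x. (x, \<phi> x)) ` X \<subseteq> S n" using Rfin by meson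
      obtain g where g: "g \<in> fixing A1" "\<forall>(x,y)\<in>S n. g x = y" using QS[of n] by auto
      have "\<forall>x\<in>X. g x = \<phi> x" using g(2) n by auto
      then show ?thesis using g(1) by (intro bexI)
    qed
    have elem': "\<exists>g\<in>\<Gamma>. \<forall>x\<in>X. g x = \<phi> x" if "finite X" "X \<subseteq> H" for X
    proof -
      obtain g where g: "g \<in> fixing A1" "\<forall>x\<in>X. g x = \<phi> x" using elem[OF \<open>finite X\<close> \<open>X \<subseteq> H\<close>] by auto
      then show ?thesis using fixingD(1)[OF g(1)] by (intro bexI)
    qed
    have e: "e \<in> U" "e \<notin> H" "ind (insert e H) es'" using es Cons clH by auto
    have "cl (\<phi> ` H) = \<phi> ` H" "e \<notin> \<phi> ` H" using \<phi>H clH e by simp_all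
    from hom[OF H(1) HU clH this(1) elem' e(1,2) e(1) this(2)]
    obtain g where g: "g \<in> \<Gamma>" "\<forall>x\<in>H. g x = \<phi> x" "g e = e" by auto
    have gim: "g ` insert e H = insert e H" using g \<phi>H by force
    have "countable (insert e H)" "insert e H \<subseteq> U" "ind (g ` insert e H) es'"
      using H(1) e HU gim by auto
    from extend_list[OF g(1) this(1,2) e(3) this(3) refl]
    obtain h where h: "h \<in> \<Gamma>" "\<forall>x\<in>cl (insert e H). h x = g x" "map h es' = es'" by auto
    have "insert e H \<subseteq> cl (insert e H)" using e HU by (intro cl_ext) auto
    then have hH: "\<forall>x\<in>H. h x = \<phi> x" "h e = e" using h g by auto
    have "\<phi> x = x" if "x \<in> A1" for x using elem[of "{x}"] that A1 by (auto simp: fixing_def)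
    then have "\<forall>x\<in>A1. h x = x" using hH A1 by auto
    moreover have "\<forall>x\<in>set es'. h x = x" using h(3) by (metis map_idI map_eq_conv list.map_ident)
    ultimately have hfix: "h \<in> fixing (A1 \<union> set es)" using h(1) hH(2) Cons
      by (auto simp: fixing_def)
    have AU: "A1 \<union> set es \<subseteq> U" using A1U esU by simp
    obtain h' where h': "h' \<in> fixing (A1 \<union> set es)" "\<And>x. x \<in> U \<Longrightarrow> h (h' x) = x"
      by (rule fixing_inv[OF hfix AU]) blast
    \<comment> \<open>As \<open>h\<close> fixes \<open>A1\<close> and \<open>es\<close>, it permutes
      \<open>cl (A1 \<union> set es)\<close>. The preimage of \<open>d\<close> under
      \<open>h\<close> is therefore one of the countably many tuples that were excluded.\<close>
    define v where "v = map h' d"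
    have "h' ` cl (A1 \<union> set es) = cl (A1 \<union> set es)"
      using aut_cl[OF fixingD(1)[OF h'(1)] AU] fixing_image[OF h'(1) subset_refl] by simp
    then have "h' x \<in> cl (A1 \<union> set es)" if "x \<in> set d" for x using that d by blast
    then have "v \<in> V" by (auto simp: v_def V_def)
    then have "K v \<in> \<D>" by (simp add: \<D>_def)
    then obtain n where "K v (S n)" using S(3) by blast
    moreover have "h \<in> fixing A1" using hfix by (auto simp: fixing_def)
    moreover have "\<forall>(x,y)\<in>S n. h x = y"
    proof (intro ballI, clarify)
      fix x y assume "(x,y) \<in> S n"
      then have "(x,y) \<in> R" by (auto simp: R_def)
      then show "h x = y" using \<phi> hH RH by auto
    qed
    moreover have "map h v = d" unfolding v_def
      by (rule map_inverse[of U h h', OF h'(2)]) (use d cl_in_U in blast)+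
    ultimately show False by (auto simp: K_def)
  qed
qed

lemma eqt_append_fixed:
  assumes "g \<in> fixing A" "\<forall>x\<in>set d. g x = x"
  shows "eqt A (d @ k) (d @ map g k)"
  using assms by (intro eqtI[of g]) (auto simp: map_idI)

text \<open>Induction on \<open>k\<close> from the right. A point algebraic over its predecessors
  lands in \<open>H\<close> by itself. A generic one is generic even after adding \<open>es\<close>,
  by \<open>ind_notin\<close>, and so may be sent to a point of \<open>H\<close> that is generic
  over the images. Since the closure of \<open>A \<union> set es\<close> stays fixed, so does every
  tuple algebraic over it.\<close>

lemma move_into_model:
  assumes H: "model H" and A: "finite A" "A \<subseteq> H" and es: "ind H es"
    and k: "set k \<subseteq> U" "ind (A \<union> set k) es"
  shows "\<exists>\<sigma>\<in>fixing (cl (A \<union> set es)). set (map \<sigma> k) \<subseteq> H"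
  using k
proof (induction k rule: rev_induct)
  case Nil
  then show ?case using fixing_id by auto
next
  case (snoc u k)
  have HU: "H \<subseteq> U" and clH: "cl H = H" using H by (auto simp: model_def)
  have esU: "set es \<subseteq> U" using ind_in_U[OF es] .
  have "ind (A \<union> set k) es" by (rule ind_mono[OF snoc.prems(2)]) auto
  then obtain \<sigma> where \<sigma>: "\<sigma> \<in> fixing (cl (A \<union> set es))" "set (map \<sigma> k) \<subseteq> H"
    using snoc by auto
  have \<sigma>G: "\<sigma> \<in> \<Gamma>" using fixingD(1)[OF \<sigma>(1)] .
  have AesU: "A \<union> set es \<subseteq> U" using A HU esU by blast
  have fx: "\<sigma> x = x" if "x \<in> A \<union> set es" for x
    using fixingD(2)[OF \<sigma>(1)] cl_ext[OF AesU] that by blast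
  have AkU: "A \<union> set k \<subseteq> U" using A HU snoc.prems(1) by auto
  have imk: "\<sigma> ` (A \<union> set k) = A \<union> \<sigma> ` set k" using fx by force
  have sub: "A \<union> \<sigma> ` set k \<subseteq> H" using \<sigma>(2) A by auto
  show ?case
  proof (cases "u \<in> cl (A \<union> set k)")
    case True
    then have "\<sigma> u \<in> cl (\<sigma> ` (A \<union> set k))"
      using aut_mem_cl[OF \<sigma>G AkU, of u] snoc.prems(1) by simp
    then have "\<sigma> u \<in> cl H" unfolding imk by (rule cl_monoD[OF _ sub])
    then show ?thesis using \<sigma> clH by (intro bexI[OF _ \<sigma>(1)]) simp
  next
    case False
    have "finite (A \<union> \<sigma> ` set k)" using A by simp
    from model_not_in_cl[OF H this] obtain h where h: "h \<in> H" "h \<notin> cl (A \<union> \<sigma> ` set k)" by blast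
    let ?D = "(A \<union> set k) \<union> set es"
    have "ind (insert u (A \<union> set k)) es" using snoc.prems(2) by simp
    from ind_notin[OF this False] have u: "u \<notin> cl ?D" .
    have "ind (insert h (A \<union> \<sigma> ` set k)) es" by (rule ind_mono[OF es]) (use h sub in auto)
    from ind_notin[OF this h(2)] have h': "h \<notin> cl ((A \<union> \<sigma> ` set k) \<union> set es)" .
    have imD: "\<sigma> ` ?D = (A \<union> \<sigma> ` set k) \<union> set es" using fx by force
    have DU: "?D \<subseteq> U" using AkU esU by simp
    have "countable ?D" using A by (simp add: countable_finite)
    from extend_one[OF \<sigma>G this DU _ u, of h]
    obtain g where g: "g \<in> \<Gamma>" "\<forall>x\<in>cl ?D. g x = \<sigma> x" "g u = h"
      using snoc.prems(1) h HU h' unfolding imD by auto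
    have "cl (A \<union> set es) \<subseteq> cl ?D" by (intro cl_mono) auto
    then have "g \<in> fixing (cl (A \<union> set es))" using g \<sigma>(1) by (auto simp: fixing_def)
    moreover have "set k \<subseteq> cl ?D" using cl_ext[OF DU] by blast
    then have "map g k = map \<sigma> k" using g(2) by auto
    ultimately show ?thesis using g(3) \<sigma>(2) h(1) by (intro bexI[of _ g]) auto
  qed
qed

text \<open>Parameters from \<open>C\<close> can be moved into \<open>H\<close> without moving
  \<open>d\<close>, and there nonsplitting is known.\<close>

lemma nsplit_up:
  assumes ns: "nsplit A H d" and H: "model H" and A: "finite A" "A \<subseteq> H" and es: "ind H es"
    and d: "set d \<subseteq> cl (A \<union> set es)" and C: "ind C es" "A \<subseteq> C" "C \<subseteq> U"
  shows "nsplit A C d"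
  unfolding nsplit_def
proof (intro ballI impI)
  fix k k' assume k: "k \<in> lists C" "k' \<in> lists C" and kk: "eqt A k k'"
  have AU: "A \<subseteq> U" using C by blast
  have mv: "\<exists>j\<in>lists H. eqt A k j \<and> eqt A (d @ k) (d @ j)" if k: "k \<in> lists C" for k
  proof -
    have "set k \<subseteq> U" "ind (A \<union> set k) es" using C k by (auto intro!: ind_mono[OF C(1)])
    from move_into_model[OF H A es this]
    obtain \<sigma> where \<sigma>: "\<sigma> \<in> fixing (cl (A \<union> set es))" "set (map \<sigma> k) \<subseteq> H" by blast
    have "A \<subseteq> cl (A \<union> set es)" using cl_extensive AU by blast
    then have \<sigma>A: "\<sigma> \<in> fixing A" using fixing_mono \<sigma>(1) by blast
    have "\<forall>x\<in>set d. \<sigma> x = x" using \<sigma>(1) d by (auto simp: fixing_def)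
    then have "eqt A (d @ k) (d @ map \<sigma> k)" by (rule eqt_append_fixed[OF \<sigma>A])
    moreover have "eqt A k (map \<sigma> k)" by (rule eqtI[OF \<sigma>A refl])
    moreover have "map \<sigma> k \<in> lists H" using \<sigma>(2) by auto
    ultimately show ?thesis by blast
  qed
  obtain j where j: "j \<in> lists H" "eqt A k j" "eqt A (d @ k) (d @ j)" using mv[OF k(1)] by blast
  obtain j' where j': "j' \<in> lists H" "eqt A k' j'" "eqt A (d @ k') (d @ j')" using mv[OF k(2)] by blast
  have U: "set k \<subseteq> U" "set (d @ k') \<subseteq> U" using k C d cl_in_U by (auto dest: cl_U)
  have "eqt A j j'" using eqt_trans[OF eqt_trans[OF eqt_sym[OF j(2) AU U(1)] kk] j'(2)] .
  then have "eqt A (d @ j) (d @ j')" using ns j(1) j'(1) by (simp add: nsplit_def)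
  then show "eqt A (d @ k) (d @ k')"
    using eqt_trans[OF eqt_trans[OF j(3)] eqt_sym[OF j'(3) AU U(2)]] by blast
qed

text \<open>Prefixing the tuples of parameters with an enumeration of \<open>A'\<close> turns
  conjugacy over \<open>A\<close> into conjugacy over \<open>A'\<close>.\<close>

lemma nsplit_mono:
  assumes ns: "nsplit A H d" and A: "A \<subseteq> A'" "finite A'" "A' \<subseteq> H"
  shows "nsplit A' H d"
  unfolding nsplit_def
proof (intro ballI impI)
  fix k k' assume k: "k \<in> lists H" "k' \<in> lists H" and "eqt A' k k'"
  then obtain g where g: "g \<in> fixing A'" "map g k = k'" by (auto simp: eqt_def)
  obtain c where c: "set c = A'" using A(2) finite_list by blast
  have "map g c = c" using g(1) c by (intro map_idI) (auto simp: fixing_def)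
  then have "map g (c @ k) = c @ k'" using g(2) by simp
  then have "eqt A (c @ k) (c @ k')" using fixing_mono[OF A(1)] g(1) by (auto intro: eqtI)
  moreover have "c @ k \<in> lists H" "c @ k' \<in> lists H" using k c A(3) by auto
  ultimately have "eqt A (d @ (c @ k)) (d @ (c @ k'))" using ns by (simp only: nsplit_def)
  then obtain h where h: "h \<in> fixing A" "map h (d @ (c @ k)) = d @ (c @ k')" unfolding eqt_def by blast
  then have "map h d = d" "map h c = c" "map h k = k'" by auto
  then have "\<forall>x\<in>A'. h x = x" using c by (metis map_eq_conv list.map_ident)
  then have "h \<in> fixing A'" using h(1) by (auto simp: fixing_def)
  then show "eqt A' (d @ k) (d @ k')" by (rule eqtI) (simp add: \<open>map h d = d\<close> \<open>map h k = k'\<close>)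
qed

text \<open>An automorphism over \<open>A\<close> from \<open>d\<close> to \<open>d1\<close> turns
  the comparison of \<open>d\<close> with \<open>d1\<close> over \<open>C\<close> into the
  comparison of \<open>C\<close> with its preimage over \<open>d\<close>. As \<open>hd d\<close> is
  generic over both, both can be moved into \<open>H\<close> without moving \<open>d\<close>, and
  nonsplitting applies there.\<close>

lemma nsplit_stationary:
  assumes ns: "nsplit A H d" and H: "model H" and A: "finite A" "A \<subseteq> H"
    and d: "d \<noteq> []" "set d \<subseteq> cl (insert (hd d) A)" "hd d \<in> U" "hd d \<notin> H"
    and d1: "eqt A d d1" and C: "finite C" "C \<subseteq> U" "hd d \<notin> cl (A \<union> C)" "hd d1 \<notin> cl (A \<union> C)"
  shows "eqt (A \<union> C) d d1"
proof -
  have HU: "H \<subseteq> U" and clH: "cl H = H" using H by (auto simp: model_def)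
  have AU: "A \<subseteq> U" using A HU by blast
  have es: "ind H [hd d]" using d clH by simp
  obtain k where k: "set k = C" using C(1) finite_list by blast
  obtain \<theta> where \<theta>: "\<theta> \<in> fixing A" "map \<theta> d = d1" using d1 by (auto simp: eqt_def)
  obtain \<theta>' where \<theta>': "\<theta>' \<in> fixing A" "\<And>x. x \<in> U \<Longrightarrow> \<theta>' (\<theta> x) = x" "\<And>x. x \<in> U \<Longrightarrow> \<theta> (\<theta>' x) = x"
    using fixing_inv[OF \<theta>(1) AU] by metis
  have \<theta>k: "map \<theta> (map \<theta>' k) = k" by (rule map_inverse[of U \<theta> \<theta>', OF \<theta>'(3)]) (use k C in auto)
  have \<theta>G: "\<theta> \<in> \<Gamma>" "\<theta>' \<in> \<Gamma>" using \<theta> \<theta>' fixingD(1) by auto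
  have k'U: "set (map \<theta>' k) \<subseteq> U" using aut_set_map[OF \<theta>G(2)] k C by auto
  have "\<theta> (hd d) = hd d1" using \<theta>(2) d(1) by (simp add: hd_map[symmetric])
  moreover have "\<theta> ` (A \<union> set (map \<theta>' k)) = A \<union> C"
  proof -
    have "\<theta> ` A = A" by (rule fixing_image[OF \<theta>(1) subset_refl])
    moreover have "\<theta> ` set (map \<theta>' k) = C" using \<theta>k k by (metis list.set_map)
    ultimately show ?thesis by (simp only: image_Un)
  qed
  ultimately have "hd d \<notin> cl (A \<union> set (map \<theta>' k))"
    using aut_mem_cl[OF \<theta>G(1), of "A \<union> set (map \<theta>' k)" "hd d"] k'U AU d(3) C(4) by simp
  then have i': "ind (A \<union> set (map \<theta>' k)) [hd d]" using d(3) by simp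
  have i: "ind (A \<union> set k) [hd d]" using d(3) C k by simp
  have kU: "set k \<subseteq> U" using k C by simp
  obtain \<sigma> where \<sigma>: "\<sigma> \<in> fixing (cl (A \<union> set [hd d]))" "set (map \<sigma> k) \<subseteq> H"
    using move_into_model[OF H A es kU i] by blast
  obtain \<sigma>' where \<sigma>': "\<sigma>' \<in> fixing (cl (A \<union> set [hd d]))" "set (map \<sigma>' (map \<theta>' k)) \<subseteq> H"
    using move_into_model[OF H A es k'U i'] by blast
  have sub: "A \<subseteq> cl (A \<union> set [hd d])" using cl_extensive AU by blast
  have \<sigma>A: "\<sigma> \<in> fixing A" "\<sigma>' \<in> fixing A" using subsetD[OF fixing_mono[OF sub]] \<sigma>(1) \<sigma>'(1) by auto
  have \<sigma>d: "\<forall>x\<in>set d. \<sigma> x = x" "\<forall>x\<in>set d. \<sigma>' x = x" using \<sigma>(1) \<sigma>'(1) d(2) by (auto simp: fixing_def)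
  define j where "j = map \<sigma> k"
  define j' where "j' = map \<sigma>' (map \<theta>' k)"
  have "eqt A k j" unfolding j_def by (rule eqtI[OF \<sigma>A(1) refl])
  moreover have "eqt A k j'" unfolding j'_def
    by (rule eqt_trans[OF eqtI[OF \<theta>'(1) refl] eqtI[OF \<sigma>A(2) refl]])
  ultimately have "eqt A j j'" using eqt_sym[OF _ AU kU] eqt_trans by blast
  moreover have "j \<in> lists H" "j' \<in> lists H" using \<sigma>(2) \<sigma>'(2) by (auto simp: j_def j'_def)
  ultimately have 2: "eqt A (d @ j) (d @ j')" using ns by (simp add: nsplit_def)
  have 1: "eqt A (d @ k) (d @ j)" unfolding j_def by (rule eqt_append_fixed[OF \<sigma>A(1) \<sigma>d(1)])
  have 3: "eqt A (d @ map \<theta>' k) (d @ j')" unfolding j'_def by (rule eqt_append_fixed[OF \<sigma>A(2) \<sigma>d(2)])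
  have dU: "set d \<subseteq> U" using d(2) cl_in_U by blast
  have 3: "eqt A (d @ j') (d @ map \<theta>' k)" by (rule eqt_sym[OF 3 AU]) (use dU k'U in auto)
  have 4: "eqt A (d @ map \<theta>' k) (d1 @ k)" by (rule eqtI[OF \<theta>(1)]) (simp only: map_append \<theta>(2) \<theta>k)
  have "eqt A (d @ k) (d1 @ k)" by (rule eqt_trans[OF eqt_trans[OF eqt_trans[OF 1 2] 3] 4])
  then obtain h where h: "h \<in> fixing A" "map h (d @ k) = d1 @ k" by (auto simp: eqt_def)
  have "length d = length d1" using \<theta>(2) by auto
  then have "map h d = d1" "map h k = k" using h(2) by auto
  moreover from this(2) have "h \<in> fixing (A \<union> C)" using h(1) k
    by (auto simp: fixing_def) (metis list.map_ident map_eq_conv)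
  ultimately show ?thesis by (intro eqtI)
qed

end

section \<open>The group of germs\<close>

text \<open>The heads carry the rank: each tuple is algebraic over its head and \<open>A\<close>.
  The other entries are auxiliary points from which the value of \<open>Y\<close> is read off.
  \<open>Y\<close> has an abstract result type because only equality of its values matters.\<close>

locale germ_family = homogeneous_pregeometry +
  fixes A :: "'a set" and bb zz :: "'a list" and Y :: "'a list \<Rightarrow> 'a list \<Rightarrow> 'o"
  assumes A: "finite A" "A \<subseteq> U"
    and bb: "bb \<noteq> []" "set bb \<subseteq> cl (insert (hd bb) A)" "hd bb \<in> U" "hd bb \<notin> cl A"
    and zz: "zz \<noteq> []" "set zz \<subseteq> cl (insert (hd zz) A)" "hd zz \<in> U" "hd zz \<notin> cl (A \<union> set bb)"
    and stat_b: "eqt A bb s \<Longrightarrow> eqt A bb s' \<Longrightarrow> finite C \<Longrightarrow> C \<subseteq> U \<Longrightarrow> hd s \<notin> cl (A \<union> C) \<Longrightarrow>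
      hd s' \<notin> cl (A \<union> C) \<Longrightarrow> eqt (A \<union> C) s s'"
    and stat_z: "eqt A zz s \<Longrightarrow> eqt A zz s' \<Longrightarrow> finite C \<Longrightarrow> C \<subseteq> U \<Longrightarrow> hd s \<notin> cl (A \<union> C) \<Longrightarrow>
      hd s' \<notin> cl (A \<union> C) \<Longrightarrow> eqt (A \<union> C) s s'"
begin

definition q :: "'a list set" where "q = {s. eqt A bb s}"

definition zt :: "'a list set" where "zt = {s. eqt A zz s}"

definition R :: "'a list \<Rightarrow> 'a list \<Rightarrow> bool" where
  "R s t \<longleftrightarrow> (\<exists>g\<in>fixing A. map g bb = s \<and> map g zz = t)"

definition act :: "'a list \<times> 'a list \<Rightarrow> 'a list \<Rightarrow> 'a list \<Rightarrow> bool" where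
  "act p t t' \<longleftrightarrow> R (fst p) t \<and> R (snd p) t' \<and> Y (fst p) t = Y (snd p) t'"

definition supp :: "'a list \<times> 'a list \<Rightarrow> 'a set" where
  "supp p = set (fst p) \<union> set (snd p)"

text \<open>Equality of germs. One generic point of agreement suffices, since by
  \<open>stat_z\<close> all points of \<open>zt\<close> that are generic over the two supports are
  conjugate over them; see \<open>sim_act\<close>.\<close>

definition sim :: "'a list \<times> 'a list \<Rightarrow> 'a list \<times> 'a list \<Rightarrow> bool" where
  "sim p p' \<longleftrightarrow> (\<exists>t t'. hd t \<notin> cl (A \<union> (supp p \<union> supp p')) \<and> act p t t' \<and> act p' t t')"

end

text \<open>\<open>Y s t\<close> stands for \<open>y\<close> when \<open>s\<close> is in place of
  \<open>b\<close> and \<open>t\<close> in place of \<open>z\<close>. \<open>Y_bounded\<close> makes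
  \<open>t'\<close> algebraic over \<open>t\<close> but not equal to it, which is why points are
  compared by \<open>zeq\<close> below. \<open>Y_pairs\<close> is the heart of the configuration: an
  independent pair has the same germ as a pair each of whose components is generic over the first
  pair and \<open>C\<close>.\<close>

locale group_configuration = germ_family +
  assumes Y_aut: "g \<in> fixing A \<Longrightarrow> R s t \<Longrightarrow> R s' t' \<Longrightarrow> Y s t = Y s' t' \<Longrightarrow>
      Y (map g s) (map g t) = Y (map g s') (map g t')"
    and Y_bounded: "R s t \<Longrightarrow> R s t' \<Longrightarrow> Y s t = Y s t' \<Longrightarrow> hd t' \<in> cl (A \<union> set t)"
    and Y_extend: "s' \<in> q \<Longrightarrow> R s t \<Longrightarrow> hd t \<notin> cl (A \<union> (set s \<union> set s')) \<Longrightarrow>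
      \<exists>t'. R s' t' \<and> Y s t = Y s' t'"
    and Y_determines: "R s t \<Longrightarrow> R s' t' \<Longrightarrow> Y s t = Y s' t' \<Longrightarrow>
      hd t' \<in> cl (A \<union> (set s \<union> set s' \<union> set t))"
    and Y_nontrivial: "R s t \<Longrightarrow> R s' t \<Longrightarrow> hd s' \<notin> cl (A \<union> (set s \<union> set t)) \<Longrightarrow> Y s t \<noteq> Y s' t"
    and Y_pairs: "s \<in> q \<Longrightarrow> s' \<in> q \<Longrightarrow> hd s' \<notin> cl (A \<union> set s) \<Longrightarrow> finite C \<Longrightarrow> C \<subseteq> U \<Longrightarrow>
      \<exists>r\<in>q. \<exists>r'\<in>q. hd r \<notin> cl (A \<union> (set s \<union> set s' \<union> C)) \<and>
        hd r' \<notin> cl (A \<union> (set s \<union> set s' \<union> C)) \<and> sim (s, s') (r, r')"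

context germ_family
begin

lemma list_orbit:
  assumes d: "d \<noteq> []" "set d \<subseteq> cl (insert (hd d) A)" "hd d \<in> U" "hd d \<notin> cl A" and s: "eqt A d s"
  shows "s \<noteq> []" "set s \<subseteq> U" "set s \<subseteq> cl (insert (hd s) A)" "hd s \<in> U" "hd s \<notin> cl A" "hd s \<in> set s"
proof -
  obtain g where g: "g \<in> fixing A" "map g d = s" using s by (auto simp: eqt_def)
  have gG: "g \<in> \<Gamma>" using fixingD(1)[OF g(1)] .
  have dU: "insert (hd d) A \<subseteq> U" using d A by auto
  have hd: "hd s = g (hd d)" using g(2) d(1) by (auto simp: hd_map)
  have gA: "g ` A = A" by (rule fixing_image[OF g(1) subset_refl])
  have im: "g ` insert (hd d) A = insert (hd s) A" using hd gA by auto
  show 1: "s \<noteq> []" using g(2) d(1) by auto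
  show 2: "set s \<subseteq> cl (insert (hd s) A)"
  proof -
    have "g ` set d \<subseteq> g ` cl (insert (hd d) A)" using d(2) by (rule image_mono)
    then show ?thesis using aut_cl[OF gG dU] g(2) im by auto
  qed
  show "set s \<subseteq> U" using 2 cl_in_U by blast
  show "hd s \<in> U" using hd aut_in_U[OF gG d(3)] by simp
  show "hd s \<notin> cl A" using aut_mem_cl[OF gG A(2) d(3)] hd gA d(4) by simp
  show "hd s \<in> set s" using 1 by simp
qed

lemma zz': "hd zz \<notin> cl A"
  using zz(4) cl_mono[of A "A \<union> set bb"] by auto

lemmas qD = list_orbit[OF bb, folded mem_Collect_eq[of _ "eqt A bb"], folded q_def]
lemmas ztD = list_orbit[OF zz(1-3) zz', folded mem_Collect_eq[of _ "eqt A zz"], folded zt_def]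

lemma eqt_refl: "eqt B s s"
  by (rule eqtI[OF fixing_id]) simp

lemma bb_q: "bb \<in> q" and zz_zt: "zz \<in> zt"
  by (auto simp: q_def zt_def eqt_refl)

lemma q_aut: "s \<in> q \<Longrightarrow> g \<in> fixing A \<Longrightarrow> map g s \<in> q"
  unfolding q_def mem_Collect_eq by (erule eqt_trans, rule eqtI, assumption, rule refl)

lemma cl_head: "set s \<subseteq> cl (insert (hd s) A) \<Longrightarrow> cl (A \<union> (set s \<union> C)) \<subseteq> cl (insert (hd s) (A \<union> C))"
proof (rule cl_subset')
  assume s: "set s \<subseteq> cl (insert (hd s) A)"
  then have "set s \<subseteq> cl (insert (hd s) (A \<union> C))"
    using cl_mono[of "insert (hd s) A" "insert (hd s) (A \<union> C)"] by blast
  moreover have "(A \<union> C) \<inter> U \<subseteq> cl (insert (hd s) (A \<union> C))" by (auto intro: cl_extensive)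
  ultimately show "(A \<union> (set s \<union> C)) \<inter> U \<subseteq> cl (insert (hd s) (A \<union> C))" by blast
qed

text \<open>Symmetry of independence, for tuples that are algebraic over their heads.\<close>

lemma gen_exchange:
  assumes "hd u \<notin> cl (A \<union> C)" "hd v \<notin> cl (A \<union> (set u \<union> C))" "hd u \<in> set u"
    "set v \<subseteq> cl (insert (hd v) A)"
  shows "hd u \<notin> cl (A \<union> (set v \<union> C))"
proof
  assume "hd u \<in> cl (A \<union> (set v \<union> C))"
  then have "hd u \<in> cl (insert (hd v) (A \<union> C))" using cl_head[OF assms(4)] by blast
  then have "hd v \<in> cl (insert (hd u) (A \<union> C))" using assms(1) by (rule cl_exchange)
  then have "hd v \<in> cl (A \<union> (set u \<union> C))" by (rule cl_monoD) (use assms(3) in auto)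
  then show False using assms(2) by simp
qed

lemma gen_mono: "hd t \<notin> cl (A \<union> D) \<Longrightarrow> C \<subseteq> D \<Longrightarrow> hd t \<notin> cl (A \<union> C)"
  using cl_mono[of "A \<union> C" "A \<union> D"] by blast

lemma exists_generic:
  assumes d: "d \<noteq> []" "hd d \<in> U" "hd d \<notin> cl A" and C: "finite C"
  shows "\<exists>s. eqt A d s \<and> hd s \<notin> cl (A \<union> C)"
proof -
  obtain u where u: "u \<in> U" "u \<notin> cl (A \<union> C)" using fresh[of "A \<union> C"] A C by auto
  have "u \<notin> cl A" using u cl_mono[of A "A \<union> C"] by auto
  then obtain g where g: "g \<in> \<Gamma>" "\<forall>x\<in>cl A. g x = x" "g (hd d) = u"
    using extend_one[OF id_in _ A(2) d(2,3) u(1)] A by (auto simp: countable_finite)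
  have "g \<in> fixing A" using g cl_ext[OF A(2)] by (auto simp: fixing_def)
  moreover have "hd (map g d) = u" using g d by (simp add: hd_map)
  ultimately show ?thesis using u by (intro exI[of _ "map g d"]) (auto intro: eqtI)
qed

lemma q_generic: "finite C \<Longrightarrow> \<exists>s\<in>q. hd s \<notin> cl (A \<union> C)"
  using exists_generic[OF bb(1,3,4)] by (auto simp: q_def)

lemma zt_generic: "finite C \<Longrightarrow> \<exists>s\<in>zt. hd s \<notin> cl (A \<union> C)"
  using exists_generic[OF zz(1,3) zz'] by (auto simp: zt_def)

lemma R_D: "R s t \<Longrightarrow> s \<in> q" "R s t \<Longrightarrow> t \<in> zt"
  by (auto simp: R_def q_def zt_def intro: eqtI)

lemma R_aut: "R s t \<Longrightarrow> g \<in> fixing A \<Longrightarrow> R (map g s) (map g t)"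
proof -
  assume "R s t" "g \<in> fixing A"
  then obtain h where h: "h \<in> fixing A" "map h bb = s" "map h zz = t" by (auto simp: R_def)
  then show ?thesis using fixing_comp[OF \<open>g \<in> fixing A\<close> h(1)]
    unfolding R_def by (intro bexI[of _ "\<lambda>x. g (h x)"]) auto
qed

lemma R_gen_z:
  assumes "R s t"
  shows "hd t \<notin> cl (A \<union> set s)"
proof -
  obtain h where h: "h \<in> fixing A" "map h bb = s" "map h zz = t" using assms by (auto simp: R_def)
  have hG: "h \<in> \<Gamma>" using fixingD(1)[OF h(1)] .
  have im: "h ` (A \<union> set bb) = A \<union> set s" using fixing_image[OF h(1) subset_refl] h(2) by auto
  have "A \<union> set bb \<subseteq> U" using A bb_q qD(2) by auto
  from aut_mem_cl[OF hG this zz(3)] show ?thesis unfolding im using zz(4) zz(1) h(3) by (auto simp: hd_map)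
qed

lemma R_gen_q:
  assumes "R s t"
  shows "hd s \<notin> cl (A \<union> set t)"
  using gen_exchange[of s "{}" t] R_gen_z[OF assms] qD(5,6)[OF R_D(1)[OF assms]]
    ztD(3)[OF R_D(2)[OF assms]] by simp

text \<open>The image of \<open>zz\<close> under an automorphism taking \<open>bb\<close> to
  \<open>s\<close> is one point related to \<open>s\<close>, and by \<open>stat_z\<close> every
  point of \<open>zt\<close> that is generic over \<open>s\<close> is conjugate to it over
  \<open>s\<close>. So \<open>R\<close> means independence.\<close>

lemma R_I:
  assumes s: "s \<in> q" and t: "t \<in> zt" and gen: "hd t \<notin> cl (A \<union> set s)"
  shows "R s t"
proof -
  obtain g where g: "g \<in> fixing A" "map g bb = s" using s by (auto simp: q_def eqt_def)
  define t0 where "t0 = map g zz"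
  have R0: "R s t0" using g by (auto simp: R_def t0_def)
  have "eqt (A \<union> set s) t0 t"
    using R_D(2)[OF R0] t gen R_gen_z[OF R0] qD(2)[OF s] by (intro stat_z) (auto simp: zt_def)
  then obtain h where h: "h \<in> fixing (A \<union> set s)" "map h t0 = t" by (auto simp: eqt_def)
  have "map h s = s" using h(1) by (intro map_idI) (auto simp: fixing_def)
  moreover have "h \<in> fixing A" using h(1) by (auto simp: fixing_def)
  ultimately show ?thesis using R_aut[OF R0] h(2) by metis
qed

end

section \<open>The action of pairs on generic points, and equality of germs\<close>

context group_configuration
begin

text \<open>The value of \<open>Y\<close> at \<open>s\<close> determines \<open>t\<close> only up to
  this relation, so a pair acts on its classes.\<close>

definition zeq :: "'a list \<Rightarrow> 'a list \<Rightarrow> bool" where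
  "zeq t t' \<longleftrightarrow> (\<exists>s. R s t \<and> R s t' \<and> Y s t = Y s t')"

text \<open>Stationarity makes this relation independent of the element \<open>s\<close> used to define it.\<close>

lemma zeqD:
  assumes "zeq t t'" "R s' t"
  shows "R s' t'" "Y s' t = Y s' t'"
proof -
  obtain s where s: "R s t" "R s t'" "Y s t = Y s t'" using assms by (auto simp: zeq_def)
  have tU: "set t \<subseteq> U" "set t' \<subseteq> U" using ztD(2) R_D(2) s by auto
  have "set t' \<subseteq> cl (insert (hd t') A)" using ztD(3) R_D(2) s by auto
  moreover have "hd t' \<in> cl (A \<union> set t)" by (rule Y_bounded[OF s])
  then have "insert (hd t') A \<subseteq> cl (A \<union> set t)" using A(2) by (auto intro: cl_extensive)
  ultimately have "set t' \<subseteq> cl (A \<union> set t)" using cl_subset by blast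
  then have "A \<union> (set t \<union> set t') \<subseteq> cl (A \<union> set t)" using A(2) tU by (auto intro: cl_extensive)
  then have sub: "cl (A \<union> (set t \<union> set t')) \<subseteq> cl (A \<union> set t)" by (rule cl_subset)
  have "eqt (A \<union> (set t \<union> set t')) s s'"
  proof (rule stat_b)
    show "eqt A bb s" "eqt A bb s'" using R_D(1) s assms(2) by (auto simp: q_def)
    show "hd s \<notin> cl (A \<union> (set t \<union> set t'))" "hd s' \<notin> cl (A \<union> (set t \<union> set t'))"
      using R_gen_q[OF s(1)] R_gen_q[OF assms(2)] sub by auto
  qed (use tU in auto)
  then obtain g where g: "g \<in> fixing (A \<union> (set t \<union> set t'))" "map g s = s'" by (auto simp: eqt_def)
  have gA: "g \<in> fixing A" using g(1) by (auto simp: fixing_def)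
  have "map g t = t" "map g t' = t'" using g(1) by (auto simp: fixing_def intro!: map_idI)
  then show "R s' t'" "Y s' t = Y s' t'"
    using R_aut[OF s(2) gA] Y_aut[OF gA s] g(2) by simp_all
qed

lemma act_zeq_right: "act p t t' \<Longrightarrow> zeq t' u \<Longrightarrow> act p t u"
  using zeqD by (auto simp: act_def)

lemma act_zeq_left: "act p t t' \<Longrightarrow> zeq t u \<Longrightarrow> act p u t'"
  using zeqD by (auto simp: act_def)

lemma act_unique: "act p t t' \<Longrightarrow> act p t u \<Longrightarrow> zeq t' u"
  by (auto simp: act_def zeq_def)

lemma act_swap: "act (s, s') t t' \<longleftrightarrow> act (s', s) t' t"
  by (auto simp: act_def)

lemma act_chain: "act (s, s') t t' \<Longrightarrow> act (s', s'') t' u \<Longrightarrow> act (s, s'') t u"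
  by (auto simp: act_def)

lemma act_q: "act p t t' \<Longrightarrow> p \<in> q \<times> q" and act_zt: "act p t t' \<Longrightarrow> t \<in> zt" "act p t t' \<Longrightarrow> t' \<in> zt"
  using R_D by (auto simp: act_def mem_Times_iff)

lemma act_aut: "act p t t' \<Longrightarrow> g \<in> fixing A \<Longrightarrow> act (map_prod (map g) (map g) p) (map g t) (map g t')"
  using R_aut Y_aut by (auto simp: act_def)

lemma supp_aut: "supp (map_prod (map g) (map g) p) = g ` supp p"
  by (auto simp: supp_def)

lemma supp_finite: "finite (supp p)"
  by (simp add: supp_def)

lemma supp_U: "p \<in> q \<times> q \<Longrightarrow> supp p \<subseteq> U"
  using qD(2) by (auto simp: supp_def mem_Times_iff)

text \<open>By \<open>Y_determines\<close> the point \<open>t\<close> depends on \<open>t'\<close>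
  and the support of \<open>p\<close>, so a loss of genericity at \<open>t'\<close> would be one at
  \<open>t\<close>.\<close>

lemma act_gen:
  assumes "act p t t'" "hd t \<notin> cl (A \<union> C)" "supp p \<subseteq> C"
  shows "hd t' \<notin> cl (A \<union> C)"
proof
  assume h: "hd t' \<in> cl (A \<union> C)"
  have t': "t' \<in> zt" using act_zt(2)[OF assms(1)] .
  have "insert (hd t') A \<subseteq> cl (A \<union> C)" using h A(2) by (auto intro: cl_extensive)
  then have "set t' \<subseteq> cl (A \<union> C)" using ztD(3)[OF t'] cl_subset by blast
  then have "(A \<union> (set (snd p) \<union> set (fst p) \<union> set t')) \<inter> U \<subseteq> cl (A \<union> C)"
    using assms(3) by (auto simp: supp_def intro: cl_extensive)
  then have "cl (A \<union> (set (snd p) \<union> set (fst p) \<union> set t')) \<subseteq> cl (A \<union> C)" by (rule cl_subset')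
  moreover have "hd t \<in> cl (A \<union> (set (snd p) \<union> set (fst p) \<union> set t'))"
    using assms(1) by (intro Y_determines) (auto simp: act_def)
  ultimately show False using assms(2) by blast
qed

lemma act_ex:
  assumes "p \<in> q \<times> q" "t \<in> zt" "hd t \<notin> cl (A \<union> supp p)"
  shows "\<exists>t'. act p t t'"
proof -
  have "hd t \<notin> cl (A \<union> set (fst p))" using gen_mono[OF assms(3)] by (auto simp: supp_def)
  then have "R (fst p) t" using assms by (intro R_I) auto
  then show ?thesis using Y_extend[of "snd p" "fst p" t] assms by (auto simp: act_def supp_def)
qed

text \<open>Stationarity moves the point where the germs agree to \<open>t\<close>, over both
  supports. The common image moves along, and by \<open>act_unique\<close> it is \<open>t'\<close>
  up to \<open>zeq\<close>.\<close>

lemma sim_act: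
  assumes "sim p p'" "hd t \<notin> cl (A \<union> C)" "supp p \<union> supp p' \<subseteq> C" "act p t t'"
  shows "act p' t t'"
proof -
  let ?C = "supp p \<union> supp p'"
  obtain u u' where u: "hd u \<notin> cl (A \<union> ?C)" "act p u u'" "act p' u u'"
    using assms(1) by (auto simp: sim_def)
  have U: "?C \<subseteq> U" using supp_U act_q u by blast
  have "hd t \<notin> cl (A \<union> ?C)" using gen_mono[OF assms(2,3)] .
  moreover have "eqt A zz u" "eqt A zz t" using act_zt u(2) assms(4) by (auto simp: zt_def)
  ultimately have "eqt (A \<union> ?C) u t"
    using u(1) U by (intro stat_z) (auto simp: supp_finite)
  then obtain g where g: "g \<in> fixing (A \<union> ?C)" "map g u = t" by (auto simp: eqt_def)
  have gA: "g \<in> fixing A" using g(1) by (auto simp: fixing_def)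
  have fx: "map_prod (map g) (map g) r = r" if "supp r \<subseteq> ?C" for r
    using g(1) that by (cases r) (auto simp: fixing_def supp_def intro!: map_idI)
  have "act p t (map g u')" "act p' t (map g u')"
    using act_aut[OF u(2) gA] act_aut[OF u(3) gA] fx g(2) by auto
  then show ?thesis using act_unique[OF _ assms(4)] act_zeq_right by blast
qed

lemma simI: "act p t t' \<Longrightarrow> act p' t t' \<Longrightarrow> hd t \<notin> cl (A \<union> C) \<Longrightarrow> supp p \<union> supp p' \<subseteq> C \<Longrightarrow> sim p p'"
  unfolding sim_def using gen_mono by blast

lemma sim_sym: "sim p p' \<Longrightarrow> sim p' p"
  unfolding sim_def by (auto simp: Un_commute)

lemma sim_q: "sim p p' \<Longrightarrow> p \<in> q \<times> q" "sim p p' \<Longrightarrow> p' \<in> q \<times> q"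
  using act_q unfolding sim_def by blast+

lemma sim_refl: "p \<in> q \<times> q \<Longrightarrow> sim p p"
proof -
  assume p: "p \<in> q \<times> q"
  obtain t where t: "t \<in> zt" "hd t \<notin> cl (A \<union> supp p)" using zt_generic[OF supp_finite] by blast
  then obtain t' where "act p t t'" using act_ex[OF p] by blast
  then show ?thesis by (intro simI[OF _ _ t(2)]) auto
qed

lemma sim_trans: "sim p p' \<Longrightarrow> sim p' p'' \<Longrightarrow> sim p p''"
proof -
  assume s: "sim p p'" "sim p' p''"
  let ?C = "supp p \<union> supp p' \<union> supp p''"
  have "finite ?C" by (simp add: supp_finite)
  from zt_generic[OF this] obtain t where t: "t \<in> zt" "hd t \<notin> cl (A \<union> ?C)" by blast
  have "hd t \<notin> cl (A \<union> supp p)" by (rule gen_mono[OF t(2)]) auto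
  then obtain t' where t': "act p t t'" using act_ex[OF sim_q(1)[OF s(1)] t(1)] by blast
  have "act p' t t'" by (rule sim_act[OF s(1) t(2) _ t']) auto
  then have "act p'' t t'" by (rule sim_act[OF s(2) t(2), rotated]) auto
  then show ?thesis by (intro simI[OF t' _ t(2)]) auto
qed

lemma supp_swap: "supp (s, s') = supp (s', s)"
  by (auto simp: supp_def)

lemma sim_swap: "sim (s, s') (r, r') \<Longrightarrow> sim (s', s) (r', r)"
proof -
  assume "sim (s, s') (r, r')"
  then obtain t t' where t: "hd t \<notin> cl (A \<union> (supp (s, s') \<union> supp (r, r')))"
      "act (s, s') t t'" "act (r, r') t t'"
    by (auto simp: sim_def)
  have "hd t' \<notin> cl (A \<union> (supp (s, s') \<union> supp (r, r')))" by (rule act_gen[OF t(2,1)]) auto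
  then show ?thesis using t act_swap by (intro simI) (auto simp: supp_swap)
qed

lemma sim_aut: "sim p p' \<Longrightarrow> g \<in> fixing A \<Longrightarrow>
  sim (map_prod (map g) (map g) p) (map_prod (map g) (map g) p')"
proof -
  assume s: "sim p p'" and g: "g \<in> fixing A"
  let ?C = "supp p \<union> supp p'"
  obtain t t' where t: "hd t \<notin> cl (A \<union> ?C)" "act p t t'" "act p' t t'"
    using s by (auto simp: sim_def)
  have gG: "g \<in> \<Gamma>" using fixingD(1)[OF g] .
  have zt: "t \<in> zt" using act_zt t by blast
  have CU: "A \<union> ?C \<subseteq> U" using supp_U act_q t A by blast
  have im: "g ` (A \<union> ?C) = A \<union> (g ` supp p \<union> g ` supp p')"
    using fixing_image[OF g subset_refl] by (simp add: image_Un)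
  have "hd (map g t) \<notin> cl (g ` (A \<union> ?C))"
    using aut_mem_cl[OF gG CU ztD(4)[OF zt]] t(1) ztD(1)[OF zt] by (simp add: hd_map)
  then show ?thesis using act_aut[OF _ g] t unfolding im
    by (intro simI[of _ "map g t" "map g t'"]) (auto simp: supp_aut)
qed

text \<open>\<open>Y_pairs\<close> yields some generic pair \<open>(r, r')\<close>. Stationarity
  over \<open>s\<close>, \<open>s'\<close> and \<open>C\<close> takes \<open>r\<close> to the
  prescribed \<open>e\<close> without moving \<open>s\<close> and \<open>s'\<close>.\<close>

lemma pairs_through_generic:
  assumes s: "s \<in> q" "s' \<in> q" "hd s' \<notin> cl (A \<union> set s)" and C: "finite C" "C \<subseteq> U"
    and e: "e \<in> q" "hd e \<notin> cl (A \<union> (set s \<union> set s' \<union> C))"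
  shows "\<exists>e'\<in>q. hd e' \<notin> cl (A \<union> (set s \<union> set s' \<union> C)) \<and> sim (s, s') (e, e')"
proof -
  let ?D = "set s \<union> set s' \<union> C"
  obtain r r' where r: "r \<in> q" "r' \<in> q" "hd r \<notin> cl (A \<union> ?D)" "hd r' \<notin> cl (A \<union> ?D)"
      "sim (s, s') (r, r')"
    using Y_pairs[OF s C] by blast
  have DU: "?D \<subseteq> U" using s qD(2) C by auto
  have "eqt (A \<union> ?D) r e"
    using r(1) e(1) C DU r(3) e(2) by (intro stat_b) (auto simp: q_def)
  then obtain g where g: "g \<in> fixing (A \<union> ?D)" "map g r = e" by (auto simp: eqt_def)
  have gA: "g \<in> fixing A" using g(1) by (auto simp: fixing_def)
  have "map g s = s" "map g s' = s'" using g(1) by (auto simp: fixing_def intro!: map_idI)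
  then have "sim (s, s') (e, map g r')" using sim_aut[OF r(5) gA] g(2) by simp
  moreover have "g ` (A \<union> ?D) = A \<union> ?D" by (rule fixing_image[OF g(1) subset_refl])
  then have "hd (map g r') \<notin> cl (A \<union> ?D)"
    using aut_mem_cl[OF fixingD(1)[OF g(1)], of "A \<union> ?D" "hd r'"] DU A r(4) qD(1,4)[OF r(2)]
    by (simp add: hd_map)
  moreover have "map g r' \<in> q" using q_aut[OF r(2) gA] .
  ultimately show ?thesis by blast
qed

text \<open>An arbitrary pair is composed of two independent ones.\<close>

lemma sim_generic_left:
  assumes s: "s \<in> q" "s' \<in> q" and e: "e \<in> q" "hd e \<notin> cl (A \<union> (set s \<union> set s'))"
  shows "\<exists>f\<in>q. sim (s, s') (e, f)"
proof -
  \<comment> \<open>With \<open>t\<close> generic over everything, \<open>(s, t)\<close> and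
    \<open>(t, s')\<close> are independent pairs. Replacing the first by \<open>(e, e')\<close> and
    the second by \<open>(e', f)\<close>, the inner components cancel in the composite.\<close>
  obtain t where t: "t \<in> q" "hd t \<notin> cl (A \<union> (set e \<union> (set s \<union> set s')))"
    using q_generic[of "set e \<union> (set s \<union> set s')"] by auto
  have e2: "hd e \<notin> cl (A \<union> (set t \<union> (set s \<union> set s')))"
    by (rule gen_exchange[OF e(2) t(2) qD(6)[OF e(1)] qD(3)[OF t(1)]])
  have "hd t \<notin> cl (A \<union> set s)" by (rule gen_mono[OF t(2)]) auto
  moreover have "hd e \<notin> cl (A \<union> (set s \<union> set t \<union> set s'))" by (rule gen_mono[OF e2]) auto
  ultimately obtain e' where e': "e' \<in> q" "hd e' \<notin> cl (A \<union> (set s \<union> set t \<union> set s'))"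
      "sim (s, t) (e, e')"
    using pairs_through_generic[OF s(1) t(1) _ _ qD(2)[OF s(2)] e(1)] by auto
  have ts: "hd t \<notin> cl (A \<union> (set s' \<union> {}))" by (rule gen_mono[OF t(2)]) auto
  have "hd s' \<notin> cl (A \<union> (set t \<union> {}))"
    using gen_exchange[of s' "{}" t] qD(5,6)[OF s(2)] qD(3)[OF t(1)] ts by simp
  moreover have "hd e' \<notin> cl (A \<union> (set t \<union> set s' \<union> {}))" by (rule gen_mono[OF e'(2)]) auto
  ultimately obtain f where f: "f \<in> q" "sim (t, s') (e', f)"
    using pairs_through_generic[OF t(1) s(2) _ _ _ e'(1), of "{}"] by auto
  let ?C = "set s \<union> set s' \<union> set t \<union> set e \<union> set e' \<union> set f"
  obtain z where z: "z \<in> zt" "hd z \<notin> cl (A \<union> ?C)" using zt_generic[of ?C] by auto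
  have "hd z \<notin> cl (A \<union> supp (s, t))" by (rule gen_mono[OF z(2)]) (auto simp: supp_def)
  then obtain z2 where z2: "act (s, t) z z2" using act_ex[of "(s, t)" z] s t z by auto
  have g2: "hd z2 \<notin> cl (A \<union> ?C)" by (rule act_gen[OF z2 z(2)]) (auto simp: supp_def)
  have "hd z2 \<notin> cl (A \<union> supp (t, s'))" by (rule gen_mono[OF g2]) (auto simp: supp_def)
  then obtain z3 where z3: "act (t, s') z2 z3" using act_ex[of "(t, s')" z2] s t act_zt(2)[OF z2] by auto
  have "act (e, e') z z2" by (rule sim_act[OF e'(3) z(2) _ z2]) (auto simp: supp_def)
  moreover have "act (e', f) z2 z3" by (rule sim_act[OF f(2) g2 _ z3]) (auto simp: supp_def)
  ultimately have "act (e, f) z z3" by (rule act_chain)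
  then have "sim (s, s') (e, f)"
    using act_chain[OF z2 z3] z(2) by (intro simI) (auto simp: supp_def)
  then show ?thesis using f(1) by blast
qed

section \<open>Composition of germs and the group\<close>

definition cmp :: "'a list \<times> 'a list \<Rightarrow> 'a list \<times> 'a list \<Rightarrow> 'a list \<times> 'a list \<Rightarrow> bool" where
  "cmp p p' r \<longleftrightarrow> (\<exists>t u v. hd t \<notin> cl (A \<union> (supp p \<union> supp p' \<union> supp r)) \<and>
     act p t u \<and> act p' u v \<and> act r t v)"

lemma cmp_q: "cmp p p' r \<Longrightarrow> p \<in> q \<times> q \<and> p' \<in> q \<times> q \<and> r \<in> q \<times> q"
  using act_q unfolding cmp_def by blast

lemma cmp_act:
  assumes "cmp p p' r" "hd t \<notin> cl (A \<union> C)" "supp p \<union> supp p' \<union> supp r \<subseteq> C"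
    "act p t u" "act p' u v"
  shows "act r t v"
proof -
  let ?C = "supp p \<union> supp p' \<union> supp r"
  obtain x y w where x: "hd x \<notin> cl (A \<union> ?C)" "act p x y" "act p' y w" "act r x w"
    using assms(1) by (auto simp: cmp_def)
  have U: "?C \<subseteq> U" using supp_U act_q x by blast
  have "hd t \<notin> cl (A \<union> ?C)" using gen_mono[OF assms(2,3)] .
  moreover have "eqt A zz x" "eqt A zz t" using act_zt x(2) assms(4) by (auto simp: zt_def)
  ultimately have "eqt (A \<union> ?C) x t"
    using x(1) U by (intro stat_z) (auto simp: supp_finite)
  then obtain g where g: "g \<in> fixing (A \<union> ?C)" "map g x = t" by (auto simp: eqt_def)
  have gA: "g \<in> fixing A" using g(1) by (auto simp: fixing_def)
  have fx: "map_prod (map g) (map g) r = r" if "supp r \<subseteq> ?C" for r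
    using g(1) that by (cases r) (auto simp: fixing_def supp_def intro!: map_idI)
  have f: "map_prod (map g) (map g) p = p" "map_prod (map g) (map g) p' = p'"
    "map_prod (map g) (map g) r = r"
    by (rule fx, blast)+
  have a: "act p t (map g y)" "act p' (map g y) (map g w)" "act r t (map g w)"
    using act_aut[OF x(2) gA] act_aut[OF x(3) gA] act_aut[OF x(4) gA] unfolding f g(2) .
  have "act p' u (map g w)" by (rule act_zeq_left[OF a(2) act_unique[OF a(1) assms(4)]])
  then show ?thesis using act_zeq_right[OF a(3)] act_unique[OF _ assms(5)] by blast
qed

lemma cmpI: "act p t u \<Longrightarrow> act p' u v \<Longrightarrow> act r t v \<Longrightarrow> hd t \<notin> cl (A \<union> C) \<Longrightarrow>
    supp p \<union> supp p' \<union> supp r \<subseteq> C \<Longrightarrow> cmp p p' r"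
  unfolding cmp_def using gen_mono by blast

lemma generic_path:
  assumes "finite C" "p \<in> q \<times> q" "p' \<in> q \<times> q" "supp p \<union> supp p' \<subseteq> C"
  obtains t u v where "hd t \<notin> cl (A \<union> C)" "act p t u" "act p' u v" "hd u \<notin> cl (A \<union> C)" "hd v \<notin> cl (A \<union> C)"
proof -
  obtain t where t: "t \<in> zt" "hd t \<notin> cl (A \<union> C)" using zt_generic[OF assms(1)] by auto
  have "hd t \<notin> cl (A \<union> supp p)" by (rule gen_mono[OF t(2)]) (use assms(4) in auto)
  then obtain u where u: "act p t u" using act_ex[OF assms(2) t(1)] by blast
  have gu: "hd u \<notin> cl (A \<union> C)" by (rule act_gen[OF u t(2)]) (use assms(4) in auto)
  have "hd u \<notin> cl (A \<union> supp p')" by (rule gen_mono[OF gu]) (use assms(4) in auto)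
  then obtain v where v: "act p' u v" using act_ex[OF assms(3) act_zt(2)[OF u]] by blast
  have "hd v \<notin> cl (A \<union> C)" by (rule act_gen[OF v gu]) (use assms(4) in auto)
  then show ?thesis using that t(2) u v gu by blast
qed

text \<open>Both pairs can be rewritten through one common generic \<open>e\<close>, as
  \<open>(s5, e)\<close> and \<open>(e, s6)\<close>, and then \<open>(s5, s6)\<close> is a
  composite. The choice of \<open>e\<close> and of the representatives is arbitrary, so composition
  is kept as a relation until germs are formed.\<close>

lemma cmp_ex:
  assumes "p \<in> q \<times> q" "p' \<in> q \<times> q"
  shows "\<exists>r. cmp p p' r"
proof -
  obtain s1 s2 s3 s4 where p: "p = (s1, s2)" "p' = (s3, s4)" by fastforce
  have s: "s1 \<in> q" "s2 \<in> q" "s3 \<in> q" "s4 \<in> q" using assms p by auto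
  have "finite (supp p \<union> supp p')" by (simp add: supp_finite)
  from q_generic[OF this] obtain e where e: "e \<in> q" "hd e \<notin> cl (A \<union> (supp p \<union> supp p'))" by blast
  have "hd e \<notin> cl (A \<union> (set s2 \<union> set s1))" "hd e \<notin> cl (A \<union> (set s3 \<union> set s4))"
    by (rule gen_mono[OF e(2)]; auto simp: p supp_def)+
  then obtain s5 s6 where s56: "s5 \<in> q" "sim (s2, s1) (e, s5)" "s6 \<in> q" "sim (s3, s4) (e, s6)"
    using sim_generic_left s e(1) by metis
  have s5: "sim (s1, s2) (s5, e)" by (rule sim_swap[OF s56(2)])
  let ?C = "supp p \<union> supp p' \<union> supp (s5, e) \<union> supp (e, s6)"
  have "finite ?C" by (simp add: supp_finite)
  then obtain t u v where t: "hd t \<notin> cl (A \<union> ?C)" "act p t u" "act p' u v" "hd u \<notin> cl (A \<union> ?C)"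
    by (rule generic_path[OF _ assms]) auto
  have "act (s5, e) t u" by (rule sim_act[OF s5 t(1)]) (use t p in auto)
  moreover have "act (e, s6) u v" by (rule sim_act[OF s56(4) t(4)]) (use t p in auto)
  ultimately have "act (s5, s6) t v" by (rule act_chain)
  then have "cmp p p' (s5, s6)" by (intro cmpI[OF t(2,3) _ t(1)]) (auto simp: supp_def)
  then show ?thesis by blast
qed

text \<open>All the actions can be compared along a single path that starts at a point generic over
  all the supports; \<open>act_gen\<close> keeps its later points generic.\<close>

lemma cmp_cong:
  assumes "cmp p p' r" "sim p p1" "sim p' p1'" "r1 \<in> q \<times> q"
  shows "cmp p1 p1' r1 \<longleftrightarrow> sim r r1"
proof -
  let ?C = "supp p \<union> supp p' \<union> supp r \<union> supp p1 \<union> supp p1' \<union> supp r1"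
  have "finite ?C" by (simp add: supp_finite)
  then obtain t u v where t: "hd t \<notin> cl (A \<union> ?C)" "act p t u" "act p' u v" "hd u \<notin> cl (A \<union> ?C)"
    by (rule generic_path[of _ p p']) (use cmp_q[OF assms(1)] in auto)
  have r: "act r t v" by (rule cmp_act[OF assms(1) t(1) _ t(2,3)]) auto
  have p1: "act p1 t u" by (rule sim_act[OF assms(2) t(1) _ t(2)]) auto
  have p1': "act p1' u v" by (rule sim_act[OF assms(3) t(4) _ t(3)]) auto
  show ?thesis
  proof
    assume "cmp p1 p1' r1"
    then have "act r1 t v" by (rule cmp_act[OF _ t(1) _ p1 p1']) auto
    then show "sim r r1" by (intro simI[OF r _ t(1)]) auto
  next
    assume "sim r r1"
    then have "act r1 t v" by (rule sim_act[OF _ t(1) _ r]) auto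
    then show "cmp p1 p1' r1" by (intro cmpI[OF p1 p1' _ t(1)]) auto
  qed
qed

lemma cmp_assoc:
  assumes "cmp p p' r" "cmp r p'' x" "cmp p' p'' r'" "cmp p r' y"
  shows "sim x y"
proof -
  let ?C = "supp p \<union> supp p' \<union> supp p'' \<union> supp r \<union> supp r' \<union> supp x \<union> supp y"
  have "finite ?C" by (simp add: supp_finite)
  then obtain t u v where t: "hd t \<notin> cl (A \<union> ?C)" "act p t u" "act p' u v"
      "hd u \<notin> cl (A \<union> ?C)" "hd v \<notin> cl (A \<union> ?C)"
    by (rule generic_path[of _ p p']) (use cmp_q[OF assms(1)] in auto)
  have "hd v \<notin> cl (A \<union> supp p'')" by (rule gen_mono[OF t(5)]) auto
  then obtain w where w: "act p'' v w" using act_ex act_zt(2)[OF t(3)] cmp_q[OF assms(2)] by blast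
  have "act r t v" by (rule cmp_act[OF assms(1) t(1) _ t(2,3)]) auto
  then have x: "act x t w" by (rule cmp_act[OF assms(2) t(1) _ _ w, rotated]) auto
  have "act r' u w" by (rule cmp_act[OF assms(3) t(4) _ t(3) w]) auto
  then have "act y t w" by (rule cmp_act[OF assms(4) t(1) _ t(2), rotated]) auto
  then show ?thesis by (intro simI[OF x _ t(1)]) auto
qed

lemma cmp_unit:
  assumes "p \<in> q \<times> q" "s \<in> q"
  shows "cmp (s, s) p p"
proof -
  let ?C = "supp p \<union> set s"
  have "finite ?C" by (simp add: supp_finite)
  from zt_generic[OF this] obtain t where t: "t \<in> zt" "hd t \<notin> cl (A \<union> ?C)" by blast
  have "hd t \<notin> cl (A \<union> supp p)" "hd t \<notin> cl (A \<union> set s)" by (rule gen_mono[OF t(2)]; auto)+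
  then obtain u where "act p t u" "act (s, s) t t"
    using act_ex[OF assms(1) t(1)] R_I[OF assms(2) t(1)] by (auto simp: act_def)
  then show ?thesis by (intro cmpI[OF _ _ _ t(2)]) (auto simp: supp_def)
qed

lemma cmp_inverse:
  assumes "s \<in> q" "s' \<in> q" "b \<in> q"
  shows "cmp (s', s) (s, s') (b, b)"
proof -
  let ?C = "supp (s', s) \<union> supp (s, s') \<union> set b"
  have "finite ?C" by (simp add: supp_finite)
  then obtain t u v where t: "hd t \<notin> cl (A \<union> ?C)" "act (s', s) t u"
    by (rule generic_path[of _ "(s', s)" "(s, s')"]) (use assms in auto)
  have "hd t \<notin> cl (A \<union> set b)" by (rule gen_mono[OF t(1)]) auto
  then have "act (b, b) t t" using R_I[OF assms(3) act_zt(1)[OF t(2)]] by (auto simp: act_def)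
  then show ?thesis using t act_swap by (intro cmpI[OF t(2) _ _ t(1)]) (auto simp: supp_def)
qed

text \<open>The description is proper if \<open>\<gamma> p = \<gamma> p'\<close> holds exactly for pairs with the same germ.\<close>

definition germ_group :: "('a list \<times> 'a list \<Rightarrow> 'g) \<Rightarrow> 'g monoid" where
  "germ_group \<gamma> = \<lparr>carrier = \<gamma> ` (q \<times> q),
     mult = (\<lambda>x y. THE z. \<exists>p p' r. x = \<gamma> p \<and> y = \<gamma> p' \<and> cmp p p' r \<and> z = \<gamma> r), one = \<gamma> (bb, bb)\<rparr>"

lemma germ_group_mult:
  assumes \<gamma>: "\<And>p p'. p \<in> q \<times> q \<Longrightarrow> p' \<in> q \<times> q \<Longrightarrow> \<gamma> p = \<gamma> p' \<longleftrightarrow> sim p p'"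
    and c: "cmp p p' r"
  shows "\<gamma> p \<otimes>\<^bsub>germ_group \<gamma>\<^esub> \<gamma> p' = \<gamma> r"
proof -
  have "(THE z. \<exists>x x' y. \<gamma> p = \<gamma> x \<and> \<gamma> p' = \<gamma> x' \<and> cmp x x' y \<and> z = \<gamma> y) = \<gamma> r"
  proof (rule the_equality)
    show "\<exists>x x' y. \<gamma> p = \<gamma> x \<and> \<gamma> p' = \<gamma> x' \<and> cmp x x' y \<and> \<gamma> r = \<gamma> y" using c by metis
    fix z assume "\<exists>x x' y. \<gamma> p = \<gamma> x \<and> \<gamma> p' = \<gamma> x' \<and> cmp x x' y \<and> z = \<gamma> y"
    then obtain x x' y where x: "\<gamma> p = \<gamma> x" "\<gamma> p' = \<gamma> x'" "cmp x x' y" "z = \<gamma> y" by blast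
    note pq = cmp_q[OF c] and xq = cmp_q[OF x(3)]
    have "sim p x" "sim p' x'" using \<gamma> x(1,2) pq xq by blast+
    then have "sim r y" using cmp_cong[OF c] xq x(3) by blast
    then have "\<gamma> r = \<gamma> y" using \<gamma>[of r y] pq xq by simp
    then show "z = \<gamma> r" using x(4) by simp
  qed
  then show ?thesis by (simp add: germ_group_def)
qed

lemma germ_group:
  assumes \<gamma>: "\<And>p p'. p \<in> q \<times> q \<Longrightarrow> p' \<in> q \<times> q \<Longrightarrow> \<gamma> p = \<gamma> p' \<longleftrightarrow> sim p p'"
  shows "group (germ_group \<gamma>)"
proof (rule groupI)
  let ?G = "germ_group \<gamma>"
  have carr: "\<exists>p\<in>q \<times> q. x = \<gamma> p" if "x \<in> carrier ?G" for x
    using that by (auto simp: germ_group_def)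
  have ml: "\<gamma> p \<otimes>\<^bsub>?G\<^esub> \<gamma> p' = \<gamma> r" if "cmp p p' r" for p p' r
    by (rule germ_group_mult[OF \<gamma> that])
  have ex: "\<exists>r. r \<in> q \<times> q \<and> cmp p p' r \<and> \<gamma> p \<otimes>\<^bsub>?G\<^esub> \<gamma> p' = \<gamma> r"
    if pq: "p \<in> q \<times> q" "p' \<in> q \<times> q" for p p'
  proof -
    obtain r where "cmp p p' r" using cmp_ex[OF pq] by blast
    then show ?thesis using cmp_q ml by (intro exI[of _ r]) simp
  qed
  fix x y z
  assume x: "x \<in> carrier ?G"
  obtain p where p: "p \<in> q \<times> q" "x = \<gamma> p" using carr[OF x] by blast
  show "\<one>\<^bsub>?G\<^esub> \<otimes>\<^bsub>?G\<^esub> x = x"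
    using ml[OF cmp_unit[OF p(1) bb_q]] p(2) by (simp add: germ_group_def)
  show "\<exists>y\<in>carrier ?G. y \<otimes>\<^bsub>?G\<^esub> x = \<one>\<^bsub>?G\<^esub>"
  proof -
    obtain s s' where s: "p = (s, s')" "s \<in> q" "s' \<in> q" using p by auto
    have "\<gamma> (s', s) \<in> carrier ?G" using s by (auto simp: germ_group_def)
    moreover have "\<gamma> (s', s) \<otimes>\<^bsub>?G\<^esub> x = \<one>\<^bsub>?G\<^esub>"
      using ml[OF cmp_inverse[OF s(2,3) bb_q]] p(2) s(1) by (simp add: germ_group_def)
    ultimately show ?thesis by blast
  qed
  assume y: "y \<in> carrier ?G"
  obtain p' where p': "p' \<in> q \<times> q" "y = \<gamma> p'" using carr[OF y] by blast
  obtain r where r: "r \<in> q \<times> q" "cmp p p' r" "x \<otimes>\<^bsub>?G\<^esub> y = \<gamma> r" using ex[OF p(1) p'(1)] p p' by auto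
  show "x \<otimes>\<^bsub>?G\<^esub> y \<in> carrier ?G" using r by (auto simp: germ_group_def)
  assume z: "z \<in> carrier ?G"
  obtain p'' where p'': "p'' \<in> q \<times> q" "z = \<gamma> p''" using carr[OF z] by blast
  obtain r' where r': "r' \<in> q \<times> q" "cmp p' p'' r'" "y \<otimes>\<^bsub>?G\<^esub> z = \<gamma> r'"
    using ex[OF p'(1) p''(1)] p' p'' by auto
  obtain v where v: "v \<in> q \<times> q" "cmp r p'' v" "\<gamma> r \<otimes>\<^bsub>?G\<^esub> z = \<gamma> v" using ex[OF r(1) p''(1)] p'' by auto
  obtain w where w: "w \<in> q \<times> q" "cmp p r' w" "x \<otimes>\<^bsub>?G\<^esub> \<gamma> r' = \<gamma> w" using ex[OF p(1) r'(1)] p by auto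
  show "x \<otimes>\<^bsub>?G\<^esub> y \<otimes>\<^bsub>?G\<^esub> z = x \<otimes>\<^bsub>?G\<^esub> (y \<otimes>\<^bsub>?G\<^esub> z)"
    using cmp_assoc[OF r(2) v(2) r'(2) w(2)] r(3) v(3) r'(3) w(3) \<gamma>[OF v(1) w(1)] by simp
next
  show "\<one>\<^bsub>germ_group \<gamma>\<^esub> \<in> carrier (germ_group \<gamma>)" using bb_q by (auto simp: germ_group_def)
qed

lemma cmp_aut:
  assumes "cmp p p' r" "g \<in> fixing A"
  shows "cmp (map_prod (map g) (map g) p) (map_prod (map g) (map g) p') (map_prod (map g) (map g) r)"
proof -
  let ?C = "supp p \<union> supp p' \<union> supp r"
  obtain t u v where t: "hd t \<notin> cl (A \<union> ?C)" "act p t u" "act p' u v" "act r t v"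
    using assms(1) by (auto simp: cmp_def)
  have gG: "g \<in> \<Gamma>" using fixingD(1)[OF assms(2)] .
  have zt: "t \<in> zt" using act_zt t by blast
  have CU: "A \<union> ?C \<subseteq> U" using supp_U act_q t A by blast
  have im: "g ` (A \<union> ?C) = A \<union> (g ` supp p \<union> g ` supp p' \<union> g ` supp r)"
    using fixing_image[OF assms(2) subset_refl] by (simp add: image_Un)
  have "hd (map g t) \<notin> cl (g ` (A \<union> ?C))"
    using aut_mem_cl[OF gG CU ztD(4)[OF zt]] t(1) ztD(1)[OF zt] by (simp add: hd_map)
  then show ?thesis using act_aut[OF _ assms(2)] t unfolding im
    by (intro cmpI[of _ "map g t" "map g u" _ "map g v"]) (auto simp: supp_aut)
qed

text \<open>Equal germs would give \<open>Y f u = Y f' u\<close> at a point \<open>u\<close> generic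
  over \<open>f\<close> and \<open>f'\<close>, against \<open>Y_nontrivial\<close>. So a germ varies
  with its second component, which later bounds the rank from below.\<close>

lemma sim_nontrivial:
  assumes "e \<in> q" "f \<in> q" "f' \<in> q" "hd f' \<notin> cl (A \<union> set f)"
  shows "\<not> sim (e, f) (e, f')"
proof
  assume s: "sim (e, f) (e, f')"
  let ?C = "set e \<union> set f \<union> set f'"
  obtain t u where t: "hd t \<notin> cl (A \<union> (supp (e, f) \<union> supp (e, f')))" "act (e, f) t u" "act (e, f') t u"
    using s by (auto simp: sim_def)
  have "hd u \<notin> cl (A \<union> (supp (e, f) \<union> supp (e, f')))" by (rule act_gen[OF t(2,1)]) auto
  then have gu: "hd u \<notin> cl (A \<union> (set f' \<union> set f))" by (rule gen_mono) (auto simp: supp_def)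
  have "hd f' \<notin> cl (A \<union> (set u \<union> set f))"
    by (rule gen_exchange[OF assms(4) gu qD(6)[OF assms(3)] ztD(3)[OF act_zt(2)[OF t(2)]]])
  then have "hd f' \<notin> cl (A \<union> (set f \<union> set u))" by (simp add: Un_commute)
  from Y_nontrivial[OF _ _ this] show False using t by (auto simp: act_def)
qed

end

section \<open>Quadrangles\<close>

context homogeneous_pregeometry
begin

definition line :: "'a set \<Rightarrow> 'a \<Rightarrow> 'a \<Rightarrow> 'a \<Rightarrow> bool" where
  "line A p r s \<longleftrightarrow> p \<in> cl (insert r (insert s A)) \<and> r \<in> cl (insert p (insert s A)) \<and> s \<in> cl (insert p (insert r A))"

lemma cl_closed: "p \<in> cl S \<Longrightarrow> (\<And>v. v \<in> S \<Longrightarrow> v \<in> U \<Longrightarrow> v \<in> cl X) \<Longrightarrow> p \<in> cl X"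
  using cl_subset'[of S X] by blast

lemma cl_closed2:
  "p \<in> cl (insert r (insert s A)) \<Longrightarrow> r \<in> cl X \<Longrightarrow> s \<in> cl X \<Longrightarrow> A \<subseteq> X \<Longrightarrow> p \<in> cl X"
  by (erule cl_closed) (auto intro: cl_extensive)

lemma cl_closed1:
  "p \<in> cl (insert r A) \<Longrightarrow> r \<in> cl X \<Longrightarrow> A \<subseteq> X \<Longrightarrow> p \<in> cl X"
  by (erule cl_closed) (auto intro: cl_extensive)

lemma fixing_cl2:
  assumes g: "g \<in> fixing A" "A \<subseteq> U" and p: "p \<in> cl (insert r (insert s A))" "r \<in> U" "s \<in> U"
  shows "g p \<in> cl (insert (g r) (insert (g s) A))"
proof -
  have "g ` insert r (insert s A) = insert (g r) (insert (g s) A)"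
    using fixing_image[OF g(1) subset_refl] by simp
  then show ?thesis
    using aut_mem_cl[OF fixingD(1)[OF g(1)], of "insert r (insert s A)" p] p g(2) cl_U[OF p(1)] by simp
qed

lemma fixing_cl1:
  assumes "g \<in> fixing A" "A \<subseteq> U" "p \<in> cl (insert r A)" "r \<in> U"
  shows "g p \<in> cl (insert (g r) A)"
  using fixing_cl2[OF assms(1,2) _ assms(4,4)] assms(3) by simp

lemma line_U: "line A p r s \<Longrightarrow> p \<in> U" "line A p r s \<Longrightarrow> r \<in> U" "line A p r s \<Longrightarrow> s \<in> U"
  by (auto simp: line_def dest: cl_U)

lemma line_aut:
  assumes "g \<in> fixing A" "A \<subseteq> U" and l: "line A p r s"
  shows "line A (g p) (g r) (g s)"
  using fixing_cl2[OF assms(1,2)] line_U[OF l] l by (simp add: line_def)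

lemma line_closed:
  assumes "line A p r s" "A \<subseteq> X"
  shows "r \<in> cl X \<Longrightarrow> s \<in> cl X \<Longrightarrow> p \<in> cl X" "p \<in> cl X \<Longrightarrow> s \<in> cl X \<Longrightarrow> r \<in> cl X"
    "p \<in> cl X \<Longrightarrow> r \<in> cl X \<Longrightarrow> s \<in> cl X"
  using assms(1)[unfolded line_def] by (metis cl_closed2[OF _ _ _ assms(2)])+

text \<open>Two closed sets of dimension 2 through \<open>p\<close> meet only in the closure of
  \<open>p\<close>: a further common point \<open>u\<close> would, by exchange, span
  \<open>r\<close> together with \<open>p\<close> and so bring it into the second set.\<close>

lemma line_intersection:
  assumes "u \<in> cl (insert r (insert p A))" "u \<in> cl (insert s (insert p A))" "r \<notin> cl (insert s (insert p A))"
    "A \<subseteq> U" "p \<in> U"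
  shows "u \<in> cl (insert p A)"
proof (rule ccontr)
  assume "u \<notin> cl (insert p A)"
  then have "r \<in> cl (insert u (insert p A))" by (rule cl_exchange[OF assms(1)])
  then have "r \<in> cl (insert s (insert p A))"
    by (rule cl_closed2[OF _ assms(2)]) (use assms in \<open>auto intro: cl_extensive\<close>)
  then show False using assms(3) by simp
qed

lemma image_cl_Int:
  assumes "g \<in> \<Gamma>" "S \<subseteq> U" "T \<subseteq> U"
  shows "g ` (cl S \<inter> cl T) = cl (g ` S) \<inter> cl (g ` T)"
  using inj_on_image_Int[OF aut_inj[OF assms(1)] cl_in_U cl_in_U] aut_cl assms by simp

end

text \<open>Besides \<open>(a, b, c, x, y, z)\<close> there are three quadrangles \<open>(a1, b, c', x1, y, z)\<close>,
  \<open>(a', b, c3, x3, y, z)\<close> and \<open>(a23, b', c3, x3, y2, z)\<close> with \<open>a', b', c'\<close> in \<open>A\<close>. They recover \<open>y\<close> from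
  \<open>(b, a1)\<close> and \<open>(z, x1)\<close>, \<open>x3\<close> from \<open>(c3, a23)\<close> and \<open>(z, y2)\<close>, and \<open>z\<close> from \<open>(b, c3)\<close> and \<open>(y, x3)\<close>.\<close>

locale quadrangle_frame = homogeneous_pregeometry +
  fixes A0 A :: "'a set" and a b c x y z a1 c3 a23 x1 y2 x3 :: 'a
  assumes A0: "A0 \<subseteq> A" "finite A" "A \<subseteq> U"
    and lines: "line A0 a b c" "line A0 a x y" "line A0 b y z" "line A0 c x z"
    and ind_aby: "ind A [a, b, y]"
    and over_b: "a1 \<in> cl (insert b A)" "c3 \<in> cl (insert b A)" "a23 \<in> cl (insert b A)"
    and over_z: "x1 \<in> cl (insert z A)" "y2 \<in> cl (insert z A)"
    and over_y: "x3 \<in> cl (insert y A)"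
    and y_cl: "cl (insert b (insert z A0)) \<inter> cl (insert a1 (insert x1 A0)) = cl (insert y A0)"
    and x_cl: "cl (insert c3 (insert z A0)) \<inter> cl (insert a23 (insert y2 A0)) = cl (insert x3 A0)"
    and z_cl: "cl (insert b (insert y A0)) \<inter> cl (insert c3 (insert x3 A0)) = cl (insert z A0)"
    and stat_bl: "eqt A [b,a1,c3,a23] s \<Longrightarrow> eqt A [b,a1,c3,a23] s' \<Longrightarrow> finite C \<Longrightarrow> C \<subseteq> U \<Longrightarrow>
      hd s \<notin> cl (A \<union> C) \<Longrightarrow> hd s' \<notin> cl (A \<union> C) \<Longrightarrow> eqt (A \<union> C) s s'"
    and stat_zl: "eqt A [z,x1,y2] s \<Longrightarrow> eqt A [z,x1,y2] s' \<Longrightarrow> finite C \<Longrightarrow> C \<subseteq> U \<Longrightarrow>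
      hd s \<notin> cl (A \<union> C) \<Longrightarrow> hd s' \<notin> cl (A \<union> C) \<Longrightarrow> eqt (A \<union> C) s s'"
begin

lemma A0U: "A0 \<subseteq> U" using A0 by simp

lemma in_U: "a \<in> U" "b \<in> U" "c \<in> U" "x \<in> U" "y \<in> U" "z \<in> U" "a1 \<in> U" "c3 \<in> U" "a23 \<in> U"
  "x1 \<in> U" "y2 \<in> U" "x3 \<in> U"
  using line_U lines over_b over_z over_y cl_U by blast+

lemma gen: "a \<notin> cl A" "b \<notin> cl (insert a A)" "y \<notin> cl (insert b (insert a A))"
  using ind_aby by auto

definition bbl :: "'a list" where "bbl = [b,a1,c3,a23]"

definition zzl :: "'a list" where "zzl = [z,x1,y2]"

text \<open>At \<open>(bbl, zzl)\<close> the components are the closures of \<open>y\<close> and of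
  \<open>x3\<close> over \<open>A0\<close>. They are computed from \<open>s\<close> and
  \<open>t\<close> by closures alone, so automorphisms over \<open>A\<close> carry values along.
  Working over \<open>A0\<close> is essential: in the frame built later, the two closures in each
  intersection would coincide over \<open>A\<close>.\<close>

definition YY :: "'a list \<Rightarrow> 'a list \<Rightarrow> 'a set \<times> 'a set" where
  "YY s t = (cl (insert (s!0) (insert (t!0) A0)) \<inter> cl (insert (s!1) (insert (t!1) A0)),
     cl (insert (s!2) (insert (t!0) A0)) \<inter> cl (insert (s!3) (insert (t!2) A0)))"

lemma b_notin: "b \<notin> cl A" using gen(2) cl_mono[of A "insert a A"] by auto

lemma bbl_cl: "set bbl \<subseteq> cl (insert b A)"
  using over_b in_U by (auto simp: bbl_def intro: cl_extensive)

lemma zzl_cl: "set zzl \<subseteq> cl (insert z A)"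
  using over_z in_U by (auto simp: zzl_def intro: cl_extensive)

lemma z_notin: "z \<notin> cl (A \<union> set bbl)"
proof
  assume "z \<in> cl (A \<union> set bbl)"
  moreover have "A \<subseteq> cl (insert b A)" using A0 by (auto intro: cl_extensive)
  then have "A \<union> set bbl \<subseteq> cl (insert b A)" using bbl_cl by simp
  ultimately have "z \<in> cl (insert b A)" by (rule cl_trans)
  moreover have "b \<in> cl (insert b A)" using in_U by (auto intro: cl_extensive)
  ultimately have "y \<in> cl (insert b A)" using line_closed(2)[OF lines(3), of "insert b A"] A0 by auto
  then show False using gen(3) cl_mono[of "insert b A" "insert b (insert a A)"] by auto
qed

sublocale germ_family U cl \<Gamma> A bbl zzl YY
proof unfold_locales
  show "set bbl \<subseteq> cl (insert (hd bbl) A)" using bbl_cl by (simp add: bbl_def)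
  show "set zzl \<subseteq> cl (insert (hd zzl) A)" using zzl_cl by (simp add: zzl_def)
  show "hd zzl \<notin> cl (A \<union> set bbl)" using z_notin by (simp add: zzl_def)
qed (use A0 b_notin in_U stat_bl stat_zl in \<open>auto simp: bbl_def zzl_def\<close>)

lemma YY_map:
  assumes g: "g \<in> fixing A0" and s: "length s = 4" "set s \<subseteq> U" and t: "length t = 3" "set t \<subseteq> U"
  shows "YY (map g s) (map g t) = map_prod ((`) g) ((`) g) (YY s t)"
proof -
  have gG: "g \<in> \<Gamma>" using fixingD(1)[OF g] .
  have im: "g ` insert u (insert v A0) = insert (g u) (insert (g v) A0)" for u v
    using fixing_image[OF g subset_refl] by simp
  have sU: "s ! i \<in> U" if "i < 4" for i using s that nth_mem[of i s] by auto
  have tU: "t ! i \<in> U" if "i < 3" for i using t that nth_mem[of i t] by auto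
  have "g ` (cl (insert (s!i) (insert (t!j) A0)) \<inter> cl (insert (s!k) (insert (t!l) A0))) =
      cl (insert (g (s!i)) (insert (g (t!j)) A0)) \<inter> cl (insert (g (s!k)) (insert (g (t!l)) A0))"
    if "i < 4" "k < 4" "j < 3" "l < 3" for i j k l
    using image_cl_Int[OF gG, of "insert (s!i) (insert (t!j) A0)" "insert (s!k) (insert (t!l) A0)"]
      sU tU that A0U unfolding im by auto
  then show ?thesis using s(1) t(1) by (simp add: YY_def)
qed

lemma fixing_A0: "g \<in> fixing A \<Longrightarrow> g \<in> fixing A0"
  using fixing_mono[OF A0(1)] by blast

lemma R_cases:
  assumes "R s t"
  obtains g where "g \<in> fixing A" "s = map g bbl" "t = map g zzl"
  using assms by (auto simp: R_def)

lemma YY_value: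
  assumes g: "g \<in> fixing A"
  shows "YY (map g bbl) (map g zzl) = (cl (insert (g y) A0), cl (insert (g x3) A0))"
proof -
  have g0: "g \<in> fixing A0" using fixing_A0[OF g] .
  have "YY (map g bbl) (map g zzl) = map_prod ((`) g) ((`) g) (YY bbl zzl)"
    using in_U by (intro YY_map[OF g0]) (auto simp: bbl_def zzl_def)
  moreover have "YY bbl zzl = (cl (insert y A0), cl (insert x3 A0))"
    using y_cl x_cl by (simp add: YY_def bbl_def zzl_def)
  moreover have "g ` cl (insert v A0) = cl (insert (g v) A0)" if "v \<in> U" for v
    using aut_cl[OF fixingD(1)[OF g], of "insert v A0"] that A0U fixing_image[OF g0 subset_refl] by simp
  ultimately show ?thesis using in_U by simp
qed

lemma lines_aut:
  assumes "g \<in> fixing A"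
  shows "line A0 (g a) (g b) (g c)" "line A0 (g a) (g x) (g y)" "line A0 (g b) (g y) (g z)" "line A0 (g c) (g x) (g z)"
  using line_aut[OF fixing_A0[OF assms] A0U] lines by blast+

lemma hd_map_lists: "hd (map g bbl) = g b" "hd (map g zzl) = g z"
  by (simp_all add: bbl_def zzl_def)

lemma R_line:
  assumes "R s t"
  obtains u where "u \<in> U" "line A0 (hd s) u (hd t)" "fst (YY s t) = cl (insert u A0)"
proof -
  obtain g where g: "g \<in> fixing A" "s = map g bbl" "t = map g zzl" using R_cases[OF assms] .
  show ?thesis using that[of "g y"] lines_aut(3)[OF g(1)] YY_value[OF g(1)] g
      aut_in_U[OF fixingD(1)[OF g(1)] in_U(5)] by (simp add: hd_map_lists)
qed

text \<open>The closures of \<open>b, y\<close> and of \<open>c3, x3\<close> meet in that of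
  \<open>z\<close>. Hence points with the same value at the same \<open>s\<close> have heads with
  the same closure over \<open>A0\<close>; this gives \<open>Y_bounded\<close> and is the purpose of
  the second component of \<open>YY\<close>.\<close>

lemma z_from_Y:
  assumes "R s t"
  shows "cl (insert (hd t) A0) =
    cl (insert (s!0) (fst (YY s t))) \<inter> cl (insert (s!2) (snd (YY s t)))"
proof -
  obtain g where g: "g \<in> fixing A" "s = map g bbl" "t = map g zzl" using R_cases[OF assms] .
  have g0: "g \<in> fixing A0" using fixing_A0[OF g(1)] .
  have gG: "g \<in> \<Gamma>" using fixingD(1)[OF g0] .
  have ins: "cl (insert v (cl (insert w A0))) = cl (insert v (insert w A0))" if "w \<in> U" for v w
  proof
    show "cl (insert v (cl (insert w A0))) \<subseteq> cl (insert v (insert w A0))"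
      using cl_mono[of "insert w A0" "insert v (insert w A0)"] by (intro cl_subset') (auto intro: cl_extensive)
    show "cl (insert v (insert w A0)) \<subseteq> cl (insert v (cl (insert w A0)))"
      using that A0U by (intro cl_mono) (auto intro: cl_extensive)
  qed
  have im: "g ` insert u (insert v A0) = insert (g u) (insert (g v) A0)" "g ` insert u A0 = insert (g u) A0" for u v
    using fixing_image[OF g0 subset_refl] by simp_all
  have "cl (insert (g z) A0) = g ` cl (insert z A0)"
    using aut_cl[OF gG, of "insert z A0"] in_U A0U im by simp
  also have "\<dots> = cl (insert (g b) (insert (g y) A0)) \<inter> cl (insert (g c3) (insert (g x3) A0))"
    unfolding z_cl[symmetric] using image_cl_Int[OF gG, of "insert b (insert y A0)" "insert c3 (insert x3 A0)"]
      in_U A0U im by simp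
  finally show ?thesis
    using g(2,3) YY_value[OF g(1)] ins aut_in_U[OF gG] in_U by (simp add: bbl_def zzl_def)
qed

text \<open>The value is carried by the points \<open>g y\<close> and \<open>g x3\<close>. As
  \<open>t\<close> is generic, \<open>g y\<close> is generic over \<open>s\<close> and
  \<open>s'\<close>, so both \<open>s\<close> and \<open>s'\<close> are generic over
  \<open>g y\<close> and \<open>g x3\<close>. Stationarity gives an automorphism over these points
  from \<open>s\<close> to \<open>s'\<close>, and it takes \<open>t\<close> to the point
  sought.\<close>

lemma R_extend:
  assumes s': "s' \<in> q" and R: "R s t" and gen: "hd t \<notin> cl (A \<union> (set s \<union> set s'))"
  shows "\<exists>t'. R s' t' \<and> YY s t = YY s' t'"
proof -
  obtain g where g: "g \<in> fixing A" "s = map g bbl" "t = map g zzl" using R_cases[OF R] .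
  have gU: "g v \<in> U" if "v \<in> U" for v using aut_in_U[OF fixingD(1)[OF g(1)] that] .
  have s: "s \<in> q" using R_D(1)[OF R] .
  let ?X = "A \<union> (set s \<union> set s')"
  have hs: "hd s = g b" "hd t = g z" using g(2,3) by (simp_all add: hd_map_lists)
  have "g b \<in> cl ?X" using qD(4,6)[OF s] hs by (auto intro!: cl_extensive)
  then have gy: "g y \<notin> cl ?X"
    using line_closed(3)[OF lines_aut(3)[OF g(1)], of ?X] gen hs A0(1) by auto
  have gx: "g x3 \<in> cl (insert (g y) A)" using fixing_cl1[OF g(1) A0(3) over_y in_U(5)] .
  have sub: "cl (A \<union> {g y, g x3}) \<subseteq> cl (insert (g y) A)"
    using gx by (intro cl_subset') (auto intro: cl_extensive)
  have gs: "hd s1 \<notin> cl (A \<union> {g y, g x3})" if s1: "s1 \<in> q" "set s1 \<subseteq> ?X" for s1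
  proof
    assume "hd s1 \<in> cl (A \<union> {g y, g x3})"
    then have "hd s1 \<in> cl (insert (g y) A)" using sub by blast
    then have "g y \<in> cl (insert (hd s1) A)" using qD(5)[OF s1(1)] by (rule cl_exchange)
    then have "g y \<in> cl ?X" by (rule cl_monoD) (use s1(2) qD(6)[OF s1(1)] in auto)
    then show False using gy by simp
  qed
  have "eqt (A \<union> {g y, g x3}) s s'"
    using s s' gU[OF in_U(5)] gU[OF in_U(12)] gs[OF s] gs[OF s']
    by (intro stat_b) (auto simp: q_def)
  then obtain h where h: "h \<in> fixing (A \<union> {g y, g x3})" "map h s = s'" by (auto simp: eqt_def)
  have hA: "h \<in> fixing A" using h(1) by (auto simp: fixing_def)
  have hg: "(\<lambda>v. h (g v)) \<in> fixing A" using fixing_comp[OF hA g(1)] .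
  have "s' = map (\<lambda>v. h (g v)) bbl" using h(2)[symmetric] g(2) by (simp add: comp_def)
  moreover have "h (g y) = g y" "h (g x3) = g x3" using h(1) by (auto simp: fixing_def)
  ultimately have "YY s' (map (\<lambda>v. h (g v)) zzl) = YY s t"
    using YY_value[OF hg] YY_value[OF g(1)] g by simp
  moreover have "map (\<lambda>v. h (g v)) zzl = map h t" using g(3) by (simp add: comp_def)
  moreover have "R s' (map h t)" using R_aut[OF R hA] h(2) by simp
  ultimately show ?thesis by (intro exI[of _ "map h t"]) simp
qed

text \<open>Complete \<open>s\<close> and \<open>s'\<close> to quadrangles that share
  \<open>a\<close>, \<open>x\<close>, \<open>y\<close>: the common \<open>y\<close> makes
  \<open>(s, s')\<close> take the \<open>z\<close> of one to the \<open>z\<close> of the other. Now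
  move \<open>a\<close>, keeping \<open>x\<close> and the two points in place of \<open>c\<close>.
  Both points \<open>z\<close> stay, since each lies on a line with \<open>x\<close> and its
  \<open>c\<close>, while both points in place of \<open>b\<close> become generic. The moved pair
  still takes one \<open>z\<close> to the other, hence has the same germ.\<close>

lemma R_pairs:
  assumes s: "s \<in> q" "s' \<in> q" "hd s' \<notin> cl (A \<union> set s)" and C: "finite C" "C \<subseteq> U"
  shows "\<exists>r\<in>q. \<exists>r'\<in>q. hd r \<notin> cl (A \<union> (set s \<union> set s' \<union> C)) \<and>
    hd r' \<notin> cl (A \<union> (set s \<union> set s' \<union> C)) \<and> sim (s, s') (r, r')"
proof -
  let ?X = "A \<union> (set s \<union> set s' \<union> C)"
  have finX: "finite ?X" using A0 C by simp
  have XU: "?X \<subseteq> U" using A0 C qD(2)[OF s(1)] qD(2)[OF s(2)] by auto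
  \<comment> \<open>\<open>u\<close> and \<open>v\<close> will be the common \<open>a\<close> and
    \<open>y\<close>; \<open>w\<close> is where \<open>a\<close> will be moved to.\<close>
  obtain u where u: "u \<in> U" "u \<notin> cl ?X" using fresh[OF finX] by blast
  obtain v where v: "v \<in> U" "v \<notin> cl (insert u ?X)" using fresh[of "insert u ?X"] finX by auto
  obtain w where w: "w \<in> U" "w \<notin> cl (insert v (insert u ?X))"
    using fresh[of "insert v (insert u ?X)"] finX by auto
  have iX: "ind ?X [u, v]" using u v by simp
  have iA: "ind A [u, v]" by (rule ind_mono[OF iX]) auto
  have ay: "ind A [a, y]"
    using gen in_U cl_mono[of "insert a A" "insert b (insert a A)"] by auto
  have "ind ((\<lambda>x. x) ` A) [u, v]" using iA by simp
  from extend_list[OF id_in countable_finite[OF A0(2)] A0(3) ay this]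
  obtain \<sigma> where \<sigma>: "\<sigma> \<in> \<Gamma>" "\<forall>k\<in>cl A. \<sigma> k = k" "map \<sigma> [a, y] = [u, v]" by auto
  have \<sigma>A: "\<sigma> \<in> fixing A" using \<sigma>(1,2) cl_ext[OF A0(3)] by (auto simp: fixing_def)
  have \<sigma>a: "\<sigma> a = u" "\<sigma> y = v" using \<sigma>(3) by auto
  let ?D = "{u, v, \<sigma> x, \<sigma> x3}"
  have xs: "\<sigma> x \<in> cl (insert v (insert u A))" "\<sigma> x3 \<in> cl (insert v (insert u A))"
  proof -
    have uv: "u \<in> cl (insert v (insert u A))" "v \<in> cl (insert v (insert u A))"
      using u v by (auto intro: cl_extensive)
    show "\<sigma> x \<in> cl (insert v (insert u A))"
      using line_closed(2)[OF lines_aut(2)[OF \<sigma>A], of "insert v (insert u A)"] uv \<sigma>a A0(1) by auto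
    have "\<sigma> x3 \<in> cl (insert v A)" using fixing_cl1[OF \<sigma>A A0(3) over_y in_U(5)] \<sigma>a by simp
    then show "\<sigma> x3 \<in> cl (insert v (insert u A))" by (rule cl_monoD) auto
  qed
  have subD: "cl (A \<union> ?D) \<subseteq> cl (A \<union> set [u, v])"
    using xs A0 by (intro cl_subset') (auto intro: cl_extensive simp: insert_commute)
  have gs: "hd r \<notin> cl (A \<union> set [u, v])" if r: "r \<in> q" "set r \<subseteq> ?X" for r
  proof (rule ind_notin)
    show "ind (insert (hd r) A) [u, v]" by (rule ind_mono[OF iX]) (use qD(6)[OF r(1)] r(2) in auto)
    show "hd r \<notin> cl A" using qD(5)[OF r(1)] .
  qed
  have \<sigma>b: "map \<sigma> bbl \<in> q" using q_aut[OF bb_q \<sigma>A] .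
  have "b \<notin> cl (insert y (insert a A))"
    using cl_exchange[of b y "insert a A"] gen by auto
  then have "\<sigma> b \<notin> cl (\<sigma> ` insert y (insert a A))"
    using aut_mem_cl[OF \<sigma>(1), of "insert y (insert a A)" b] in_U A0 by auto
  moreover have "\<sigma> ` insert y (insert a A) = insert v (insert u A)"
    using fixing_image[OF \<sigma>A subset_refl] \<sigma>a by simp
  ultimately have "hd (map \<sigma> bbl) \<notin> cl (A \<union> set [u, v])"
    by (simp add: hd_map_lists insert_commute)
  then have gb: "hd (map \<sigma> bbl) \<notin> cl (A \<union> ?D)" using subD by blast
  have DU: "?D \<subseteq> U" using u v xs cl_U by blast
  \<comment> \<open>A realisation of \<open>q\<close> among the old parameters is generic over the
    copies of \<open>a\<close>, \<open>y\<close>, \<open>x\<close> and \<open>x3\<close>. So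
    stationarity adjusts the copied quadrangle to have it in place of \<open>b\<close>, keeping
    these four points.\<close>
  have copy: "\<exists>g\<in>fixing A. map g bbl = r \<and> g a = u \<and> g y = v \<and> g x = \<sigma> x \<and> g x3 = \<sigma> x3"
    if r: "r \<in> q" "set r \<subseteq> ?X" for r
  proof -
    have "hd r \<notin> cl (A \<union> ?D)" using gs[OF r] subD by blast
    then have "eqt (A \<union> ?D) (map \<sigma> bbl) r"
      using \<sigma>b r(1) gb DU by (intro stat_b) (auto simp: q_def)
    then obtain h where h: "h \<in> fixing (A \<union> ?D)" "map h (map \<sigma> bbl) = r" by (auto simp: eqt_def)
    have "h \<in> fixing A" using h(1) by (auto simp: fixing_def)
    from fixing_comp[OF this \<sigma>A] show ?thesis
      using h \<sigma>a by (intro bexI[of _ "\<lambda>k. h (\<sigma> k)"]) (auto simp: fixing_def)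
  qed
  obtain g where g: "g \<in> fixing A" "map g bbl = s" "g a = u" "g y = v" "g x = \<sigma> x" "g x3 = \<sigma> x3"
    using copy[OF s(1)] by auto
  obtain g' where g': "g' \<in> fixing A" "map g' bbl = s'" "g' a = u" "g' y = v" "g' x = \<sigma> x" "g' x3 = \<sigma> x3"
    using copy[OF s(2)] by auto
  have hs: "hd s = g b" "hd s' = g' b" using g(2) g'(2) by (auto simp: hd_map_lists)
  define t where "t = map g zzl"
  define t' where "t' = map g' zzl"
  have ht: "hd t = g z" "hd t' = g' z" by (simp_all add: t_def t'_def hd_map_lists)
  have Rt: "R s t" "R s' t'" using g g' by (auto simp: R_def t_def t'_def)
  have Yt: "YY s t = YY s' t'" using YY_value[OF g(1)] YY_value[OF g'(1)] g g' by (simp add: t_def t'_def)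
  note l = lines_aut[OF g(1)] and l' = lines_aut[OF g'(1)]
  have bX: "g b \<in> ?X" "g' b \<in> ?X" using qD(6)[OF s(1)] qD(6)[OF s(2)] hs by auto
  have A0X: "A0 \<subseteq> ?X" using A0(1) by blast
  let ?W = "insert (g x) (insert (g' c) (insert (g c) A))"
  \<comment> \<open>The point \<open>a\<close> can be moved only if it is not algebraic over
    \<open>x\<close> and the two points in place of \<open>c\<close>. From such a dependence
    \<open>x\<close> is removed because \<open>y\<close> is generic over \<open>a\<close> and both
    points in place of \<open>b\<close>, then \<open>c'\<close> because \<open>s'\<close> is generic
    over \<open>s\<close>, and finally \<open>c\<close> because \<open>b\<close> is generic over
    \<open>a\<close>.\<close>
  have uW: "u \<notin> cl ?W"
  proof
    assume u1: "u \<in> cl ?W"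
    let ?V = "insert u ?X"
    have uV: "u \<in> cl ?V" "g b \<in> cl ?V" "g' b \<in> cl ?V"
      using u bX XU by (auto intro!: cl_extensive)
    have cV: "g c \<in> cl ?V" "g' c \<in> cl ?V"
      using line_closed(3)[OF l(1), of ?V] line_closed(3)[OF l'(1), of ?V] uV g g' A0X by auto
    have u2: "u \<in> cl (insert (g' c) (insert (g c) A))"
    proof (rule ccontr)
      assume "u \<notin> cl (insert (g' c) (insert (g c) A))"
      then have "g x \<in> cl (insert u (insert (g' c) (insert (g c) A)))" by (rule cl_exchange[OF u1])
      then have "g x \<in> cl ?V" by (rule cl_closed) (use uV cV in \<open>auto intro: cl_extensive\<close>)
      then have "v \<in> cl ?V" using line_closed(3)[OF l(2), of ?V] uV g A0X by auto
      then show False using v by simp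
    qed
    have u3: "u \<in> cl (insert (g c) A)"
    proof (rule ccontr)
      assume "u \<notin> cl (insert (g c) A)"
      then have c': "g' c \<in> cl (insert u (insert (g c) A))" by (rule cl_exchange[OF u2])
      let ?T = "(A \<union> set s) \<union> set [u]"
      have uT: "u \<in> cl ?T" "g b \<in> cl ?T" using u bX(1) qD(2,6)[OF s(1)] hs by (auto intro!: cl_extensive)
      then have "g c \<in> cl ?T" using line_closed(3)[OF l(1), of ?T] g A0(1) by auto
      then have "g' c \<in> cl ?T" by (intro cl_closed2[OF c']) (use uT in auto)
      then have "g' b \<in> cl ?T" using line_closed(2)[OF l'(1), of ?T] uT g' A0(1) by auto
      moreover have "g' b \<notin> cl ?T"
      proof (rule ind_notin)
        show "ind (insert (g' b) (A \<union> set s)) [u]"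
          by (rule ind_mono[of ?X]) (use u bX in auto)
        show "g' b \<notin> cl (A \<union> set s)" using s(3) hs by simp
      qed
      ultimately show False by simp
    qed
    have "u \<notin> cl A" using u(2) cl_mono[of A ?X] by auto
    then have "g c \<in> cl (insert u A)" using cl_exchange[OF u3] by simp
    then have "g b \<in> cl (insert u A)"
      using line_closed(2)[OF l(1), of "insert u A"] u g A0(1) by (auto intro: cl_extensive)
    moreover have "g b \<notin> cl (A \<union> set [u, v])" using gs[OF s(1)] hs by auto
    ultimately show False using cl_mono[of "insert u A" "A \<union> set [u, v]"] by auto
  qed
  let ?Z = "insert v (insert u ?X)"
  have inZ: "u \<in> cl ?Z" "v \<in> cl ?Z" "g b \<in> cl ?Z" "g' b \<in> cl ?Z"
    using u v bX XU by (auto intro!: cl_extensive)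
  have A0Z: "A0 \<subseteq> ?Z" using A0X by blast
  have cZ: "g c \<in> cl ?Z" "g' c \<in> cl ?Z" "g x \<in> cl ?Z"
    using line_closed(3)[OF l(1), of ?Z] line_closed(3)[OF l'(1), of ?Z] line_closed(2)[OF l(2), of ?Z]
      inZ g g' A0Z by auto
  have "cl ?W \<subseteq> cl ?Z" using cZ by (intro cl_subset') (auto intro: cl_extensive)
  then have wW: "w \<notin> cl ?W" using w by blast
  have WU: "?W \<subseteq> U" using cZ cl_U A0 by blast
  have "countable ?W" using A0 by (simp add: countable_finite)
  from extend_one[OF id_in this WU u(1) uW w(1)] wW
  obtain \<tau> where \<tau>: "\<tau> \<in> \<Gamma>" "\<forall>k\<in>cl ?W. \<tau> k = k" "\<tau> u = w" by auto
  have \<tau>W: "\<tau> k = k" if "k \<in> ?W" for k using \<tau>(2) cl_ext[OF WU] that by blast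
  have \<tau>A: "\<tau> \<in> fixing A" using \<tau>(1) \<tau>W by (auto simp: fixing_def)
  have zW: "g z \<in> cl ?W" "g' z \<in> cl ?W"
    using line_closed(3)[OF l(4), of ?W] line_closed(3)[OF l'(4), of ?W] WU g g' A0(1)
    by (auto intro: cl_extensive)
  have tW: "\<tau> k = k" if k: "r \<in> zt" "hd r \<in> cl ?W" "k \<in> set r" for k r
  proof -
    have "k \<in> cl (insert (hd r) A)" using ztD(3)[OF k(1)] k(3) by blast
    then have "k \<in> cl ?W" by (rule cl_closed1[OF _ k(2)]) auto
    then show ?thesis using \<tau>(2) by simp
  qed
  have "map \<tau> t = t" "map \<tau> t' = t'"
    using tW[of t] tW[of t'] R_D(2) Rt zW ht by (auto intro!: map_idI)
  then have R': "R (map \<tau> s) t" "R (map \<tau> s') t'" using R_aut[OF _ \<tau>A] Rt by metis+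
  have \<tau>g: "(\<lambda>k. \<tau> (g k)) \<in> fixing A" "(\<lambda>k. \<tau> (g' k)) \<in> fixing A"
    using fixing_comp \<tau>A g(1) g'(1) by blast+
  have "YY (map \<tau> s) (map \<tau> t) = YY (map \<tau> s') (map \<tau> t')"
    using YY_value[OF \<tau>g(1)] YY_value[OF \<tau>g(2)] g g' by (auto simp: t_def t'_def comp_def)
  then have Y': "YY (map \<tau> s) t = YY (map \<tau> s') t'"
    using \<open>map \<tau> t = t\<close> \<open>map \<tau> t' = t'\<close> by simp
  note m = lines_aut[OF \<tau>g(1)] and m' = lines_aut[OF \<tau>g(2)]
  have \<tau>c: "\<tau> (g c) = g c" "\<tau> (g' c) = g' c" using \<tau>W by auto
  let ?B = "insert u ?X"
  have inB: "u \<in> cl ?B" "g b \<in> cl ?B" "g' b \<in> cl ?B"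
    using u bX XU by (auto intro!: cl_extensive)
  have A0B: "A0 \<subseteq> ?B" using A0X by blast
  have cB: "g c \<in> cl ?B" "g' c \<in> cl ?B"
    using line_closed(3)[OF l(1) A0B] line_closed(3)[OF l'(1) A0B] inB g(3) g'(3) by simp_all
  have wB: "w \<notin> cl ?B" using w cl_mono[of ?B ?Z] by auto
  have hr: "hd (map \<tau> s) = \<tau> (g b)" "hd (map \<tau> s') = \<tau> (g' b)" using g(2) g'(2) by (auto simp: hd_map_lists)
  have XB: "cl ?X \<subseteq> cl ?B" by (intro cl_mono) auto
  have r1: "hd (map \<tau> s) \<notin> cl ?X"
  proof
    assume "hd (map \<tau> s) \<in> cl ?X"
    then have "\<tau> (g b) \<in> cl ?B" using hr XB by auto
    then have "w \<in> cl ?B" using line_closed(1)[OF m(1) A0B] cB \<tau>c g(3) \<tau>(3) by simp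
    then show False using wB by simp
  qed
  have r2: "hd (map \<tau> s') \<notin> cl ?X"
  proof
    assume "hd (map \<tau> s') \<in> cl ?X"
    then have "\<tau> (g' b) \<in> cl ?B" using hr XB by auto
    then have "w \<in> cl ?B" using line_closed(1)[OF m'(1) A0B] cB \<tau>c g'(3) \<tau>(3) by simp
    then show False using wB by simp
  qed
  have rq: "map \<tau> s \<in> q" "map \<tau> s' \<in> q" using q_aut[OF _ \<tau>A] s by auto
  \<comment> \<open>Both pairs lie in the closure of \<open>w\<close>, \<open>u\<close> and the old
    parameters. If \<open>hd t\<close> did too, then so would \<open>v\<close>, and exchange would
    make \<open>w\<close> depend on \<open>v\<close>, \<open>u\<close> and the old
    parameters.\<close>
  have "hd t \<notin> cl (A \<union> (supp (s, s') \<union> supp (map \<tau> s, map \<tau> s')))"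
  proof
    assume tt: "hd t \<in> cl (A \<union> (supp (s, s') \<union> supp (map \<tau> s, map \<tau> s')))"
    let ?E = "insert w (insert u ?X)"
    have inE: "w \<in> cl ?E" "u \<in> cl ?E" "g b \<in> cl ?E" "g c \<in> cl ?E" "g' c \<in> cl ?E"
      using w(1) inB cB cl_mono[of ?B ?E] by (auto intro!: cl_extensive[of w])
    have A0E: "A0 \<subseteq> ?E" using A0X by blast
    have bE: "\<tau> (g b) \<in> cl ?E" "\<tau> (g' b) \<in> cl ?E"
      using line_closed(2)[OF m(1) A0E] line_closed(2)[OF m'(1) A0E] inE \<tau>c g(3) g'(3) \<tau>(3) by simp_all
    have rE: "set r \<subseteq> cl ?E" if r: "r \<in> q" "hd r \<in> cl ?E" for r
    proof
      fix k assume "k \<in> set r"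
      then have "k \<in> cl (insert (hd r) A)" using qD(3)[OF r(1)] by blast
      then show "k \<in> cl ?E" by (rule cl_closed1[OF _ r(2)]) auto
    qed
    have "set (map \<tau> s) \<subseteq> cl ?E" "set (map \<tau> s') \<subseteq> cl ?E"
      using rE[OF rq(1)] rE[OF rq(2)] bE hr by simp_all
    then have "hd t \<in> cl ?E"
      by (intro cl_closed[OF tt]) (auto simp: supp_def intro: cl_extensive)
    then have "v \<in> cl ?E" using line_closed(2)[OF l(3) A0E] inE ht tt g(4) \<open>hd t \<in> cl ?E\<close> by simp
    then have "w \<in> cl (insert v (insert u ?X))" using v(2) by (rule cl_exchange)
    then show False using w by simp
  qed
  moreover have "act (s, s') t t'" "act (map \<tau> s, map \<tau> s') t t'"
    using Rt Yt R' Y' by (simp_all add: act_def)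
  ultimately have "sim (s, s') (map \<tau> s, map \<tau> s')" by (auto simp: sim_def)
  then show ?thesis using rq r1 r2 by blast
qed

sublocale group_configuration U cl \<Gamma> A bbl zzl YY
proof unfold_locales
  fix g s t s' t' assume g: "g \<in> fixing A" and R: "R s t" "R s' t'" and Y: "YY s t = YY s' t'"
  have len: "length s = 4 \<and> length t = 3 \<and> set s \<subseteq> U \<and> set t \<subseteq> U" if R: "R s t" for s t
  proof -
    obtain h where "s = map h bbl" "t = map h zzl" by (rule R_cases[OF R])
    then show ?thesis using qD(2)[OF R_D(1)[OF R]] ztD(2)[OF R_D(2)[OF R]]
      by (simp add: bbl_def zzl_def)
  qed
  show "YY (map g s) (map g t) = YY (map g s') (map g t')"
    using YY_map[OF fixing_A0[OF g]] len[OF R(1)] len[OF R(2)] Y by simp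
next
  fix s t t' assume R: "R s t" "R s t'" and Y: "YY s t = YY s t'"
  have "cl (insert (hd t) A0) = cl (insert (hd t') A0)" using z_from_Y[OF R(1)] z_from_Y[OF R(2)] Y by simp
  moreover have "hd t' \<in> cl (insert (hd t') A0)" using ztD(4)[OF R_D(2)[OF R(2)]] by (auto intro: cl_extensive)
  ultimately have "hd t' \<in> cl (insert (hd t) A0)" by simp
  then show "hd t' \<in> cl (A \<union> set t)"
    by (rule cl_monoD) (use A0(1) ztD(6)[OF R_D(2)[OF R(1)]] in auto)
next
  fix s t s' t' assume R: "R s t" "R s' t'" and Y: "YY s t = YY s' t'"
  obtain u where u: "u \<in> U" "line A0 (hd s) u (hd t)" "fst (YY s t) = cl (insert u A0)" using R_line[OF R(1)] .
  obtain u' where u': "u' \<in> U" "line A0 (hd s') u' (hd t')" "fst (YY s' t') = cl (insert u' A0)" using R_line[OF R(2)] .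
  let ?X = "A \<union> (set s \<union> set s' \<union> set t)"
  have h: "hd s \<in> cl ?X" "hd s' \<in> cl ?X" "hd t \<in> cl ?X"
    using qD(4,6)[OF R_D(1)[OF R(1)]] qD(4,6)[OF R_D(1)[OF R(2)]] ztD(4,6)[OF R_D(2)[OF R(1)]]
    by (auto intro: cl_extensive)
  have A0X: "A0 \<subseteq> ?X" using A0(1) by blast
  have "u \<in> cl ?X" using line_closed(2)[OF u(2) A0X] h by simp
  moreover have "u' \<in> cl (insert u A0)" using u(3) u'(1,3) Y by (auto intro: cl_extensive)
  ultimately have "u' \<in> cl ?X" using cl_closed1 A0X by blast
  then show "hd t' \<in> cl ?X" using line_closed(3)[OF u'(2) A0X] h by simp
next
  \<comment> \<open>Equal values share the point in place of \<open>y\<close> up to closure. As this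
    point is not algebraic over \<open>t\<close>, exchange makes \<open>hd s'\<close> algebraic over
    it and \<open>t\<close>, hence over \<open>s\<close> and \<open>t\<close>.\<close>
  fix s t s' assume R: "R s t" "R s' t" and gen: "hd s' \<notin> cl (A \<union> (set s \<union> set t))"
  show "YY s t \<noteq> YY s' t"
  proof
    assume Y: "YY s t = YY s' t"
    obtain u where u: "u \<in> U" "line A0 (hd s) u (hd t)" "fst (YY s t) = cl (insert u A0)" using R_line[OF R(1)] .
    obtain u' where u': "u' \<in> U" "line A0 (hd s') u' (hd t)" "fst (YY s' t) = cl (insert u' A0)" using R_line[OF R(2)] .
    have t: "hd t \<in> U" "hd t \<in> set t" using ztD(4,6)[OF R_D(2)[OF R(1)]] by auto
    have s: "hd s \<in> U" "hd s \<in> set s" "hd s' \<in> U" using qD(4,6)[OF R_D(1)] R by auto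
    have "u \<in> cl (insert u' A0)" using u(1,3) u'(3) Y by (metis cl_extensive insertI1)
    moreover have "u' \<in> cl (insert (hd s') (A \<union> set t))"
      using line_closed(2)[OF u'(2), of "insert (hd s') (A \<union> set t)"] A0(1) t s by (auto intro: cl_extensive)
    ultimately have u2: "u \<in> cl (insert (hd s') (A \<union> set t))"
      by (rule cl_closed1) (use A0(1) in auto)
    have "u \<notin> cl (A \<union> set t)"
    proof
      assume "u \<in> cl (A \<union> set t)"
      then have "hd s \<in> cl (A \<union> set t)"
        using line_closed(1)[OF u(2), of "A \<union> set t"] A0(1) t by (auto intro: cl_extensive)
      then show False using R_gen_q[OF R(1)] by simp
    qed
    then have s': "hd s' \<in> cl (insert u (A \<union> set t))" by (rule cl_exchange[OF u2])
    have "u \<in> cl (A \<union> (set s \<union> set t))"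
      using line_closed(2)[OF u(2), of "A \<union> (set s \<union> set t)"] A0(1) t s by (auto intro: cl_extensive)
    then have "hd s' \<in> cl (A \<union> (set s \<union> set t))"
      using cl_closed1[OF s'] by blast
    then show False using gen by simp
  qed
next
  show "\<exists>t'. R s' t' \<and> YY s t = YY s' t'"
    if "s' \<in> q" "R s t" "hd t \<notin> cl (A \<union> (set s \<union> set s'))" for s s' t
    by (rule R_extend[OF that])
next
  show "\<exists>r\<in>q. \<exists>r'\<in>q. hd r \<notin> cl (A \<union> (set s \<union> set s' \<union> C)) \<and>
    hd r' \<notin> cl (A \<union> (set s \<union> set s' \<union> C)) \<and> sim (s, s') (r, r')"
    if "s \<in> q" "s' \<in> q" "hd s' \<notin> cl (A \<union> set s)" "finite C" "C \<subseteq> U" for s s' C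
    by (rule R_pairs[OF that])
qed

end

section \<open>Construction of the auxiliary quadrangles\<close>

context homogeneous_pregeometry
begin

text \<open>Conjugation by an automorphism taking \<open>d\<close> to \<open>s\<close> reduces this
  to \<open>nsplit_stationary\<close>, where one of the two realisations is \<open>d\<close>
  itself.\<close>

lemma nsplit_stationary_pair:
  assumes ns: "nsplit A H d" and H: "model H" and A: "finite A" "A \<subseteq> H"
    and d: "d \<noteq> []" "set d \<subseteq> cl (insert (hd d) A)" "hd d \<in> U" "hd d \<notin> H"
    and s: "eqt A d s" "eqt A d s'"
    and C: "finite C" "C \<subseteq> U" "hd s \<notin> cl (A \<union> C)" "hd s' \<notin> cl (A \<union> C)"
  shows "eqt (A \<union> C) s s'"
proof -
  have AU: "A \<subseteq> U" using A H by (auto simp: model_def)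
  have dU: "set d \<subseteq> U" using d(2) cl_in_U by blast
  obtain \<theta> where \<theta>: "\<theta> \<in> fixing A" "map \<theta> d = s" using s(1) by (auto simp: eqt_def)
  obtain \<theta>' where \<theta>': "\<theta>' \<in> fixing A" "\<And>x. x \<in> U \<Longrightarrow> \<theta>' (\<theta> x) = x" "\<And>x. x \<in> U \<Longrightarrow> \<theta> (\<theta>' x) = x"
    using fixing_inv[OF \<theta>(1) AU] by metis
  have G: "\<theta> \<in> \<Gamma>" "\<theta>' \<in> \<Gamma>" using fixingD(1) \<theta>(1) \<theta>'(1) by auto
  have sU: "set s \<subseteq> U" "set s' \<subseteq> U" using s dU aut_set_map fixingD(1) unfolding eqt_def by blast+
  have ne: "s \<noteq> []" "s' \<noteq> []" using s d(1) by (auto simp: eqt_def)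
  have hU: "hd s \<in> U" "hd s' \<in> U" using sU ne by auto
  have bk: "map \<theta>' s = d" using map_inverse[of U \<theta>' \<theta>, OF \<theta>'(2) dU] \<theta>(2) by simp
  let ?C = "\<theta>' ` C"
  have im: "\<theta>' ` (A \<union> C) = A \<union> ?C" using fixing_image[OF \<theta>'(1) subset_refl] by (simp add: image_Un)
  have ACU: "A \<union> C \<subseteq> U" using AU C by simp
  have "hd d \<notin> cl (A \<union> ?C)"
    using aut_mem_cl[OF G(2) ACU hU(1)] C(3) bk ne unfolding im by (auto simp: hd_map)
  moreover have "hd (map \<theta>' s') \<notin> cl (A \<union> ?C)"
    using aut_mem_cl[OF G(2) ACU hU(2)] C(4) ne unfolding im by (auto simp: hd_map)
  moreover have "eqt A d (map \<theta>' s')" by (rule eqt_trans[OF s(2) eqtI[OF \<theta>'(1) refl]])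
  moreover have "?C \<subseteq> U" using C(2) aut_image_U[OF G(2)] by blast
  ultimately have "eqt (A \<union> ?C) d (map \<theta>' s')"
    using C(1) by (intro nsplit_stationary[OF ns H A d]) auto
  then obtain g where g: "g \<in> fixing (A \<union> ?C)" "map g d = map \<theta>' s'" by (auto simp: eqt_def)
  have gA: "g \<in> fixing A" using g(1) by (auto simp: fixing_def)
  have "(\<lambda>x. \<theta> (g (\<theta>' x))) \<in> fixing A" using fixing_comp[OF \<theta>(1) fixing_comp[OF gA \<theta>'(1)]] .
  moreover have "\<theta> (g (\<theta>' x)) = x" if "x \<in> C" for x
    using that g(1) \<theta>'(3)[of x] C(2) by (auto simp: fixing_def)
  ultimately have "(\<lambda>x. \<theta> (g (\<theta>' x))) \<in> fixing (A \<union> C)" by (auto simp: fixing_def)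
  moreover have "map (\<lambda>x. \<theta> (g (\<theta>' x))) s = s'"
  proof -
    have "map \<theta> (map g (map \<theta>' s)) = s'"
      unfolding bk g(2) by (rule map_inverse[of U \<theta> \<theta>', OF \<theta>'(3) sU(2)])
    then show ?thesis by (simp add: comp_def)
  qed
  ultimately show ?thesis by (rule eqtI)
qed

text \<open>The copies are images of the given quadrangle under \<open>\<sigma>1\<close>, under
  \<open>\<sigma>2\<close>, and under \<open>\<sigma>2\<close> followed by \<open>\<sigma>3\<close>.
  The first two maps fix \<open>b\<close>, \<open>y\<close>, \<open>z\<close> and send
  \<open>c\<close> to \<open>c'\<close> and \<open>a\<close> to \<open>a'\<close>; the third fixes
  \<open>c3\<close>, \<open>x3\<close>, \<open>z\<close> and sends \<open>b\<close> to
  \<open>b'\<close>. As \<open>a'\<close>, \<open>b'\<close>, \<open>c'\<close> are fresh, a model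
  contains them over which \<open>a\<close>, \<open>b\<close>, \<open>y\<close> are still
  independent, and the parameters needed for stationarity are found in that model.\<close>

lemma quadrangle_frame_exists:
  assumes A0: "finite A0" "A0 \<subseteq> U"
    and lines: "line A0 a b c" "line A0 a x y" "line A0 b y z" "line A0 c x z"
    and i: "ind A0 [a, b, y]"
  shows "\<exists>A a1 c3 a23 x1 y2 x3. quadrangle_frame U cl \<Gamma> A0 A a b c x y z a1 c3 a23 x1 y2 x3"
proof -
  have in_U: "a \<in> U" "b \<in> U" "c \<in> U" "x \<in> U" "y \<in> U" "z \<in> U"
    using line_U[OF lines(1)] line_U[OF lines(2)] line_U[OF lines(3)] by auto
  have gen: "a \<notin> cl A0" "b \<notin> cl (insert a A0)" "y \<notin> cl (insert b (insert a A0))" using i by auto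
  have b0: "b \<notin> cl A0" using gen(2) cl_mono[of A0 "insert a A0"] by auto
  have ab: "a \<notin> cl (insert b A0)" using cl_exchange[of a b A0] gen by auto
  have aby: "a \<notin> cl (insert y (insert b A0))"
    using cl_exchange[of a y "insert b A0"] ab gen(3) by (auto simp: insert_commute)
  have bya: "b \<notin> cl (insert a (insert y A0))"
    using cl_exchange[of b y "insert a A0"] gen by (auto simp: insert_commute)
  let ?X = "insert y (insert b (insert a A0))"
  have XU: "?X \<subseteq> U" using in_U A0 by auto
  have finX: "finite ?X" using A0 by simp
  have inX: "a \<in> cl ?X" "b \<in> cl ?X" "y \<in> cl ?X" using in_U by (auto intro!: cl_extensive)
  have A0X: "A0 \<subseteq> ?X" by auto
  have inX': "c \<in> cl ?X" "x \<in> cl ?X" "z \<in> cl ?X"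
    using line_closed(3)[OF lines(1) A0X] line_closed(2)[OF lines(2) A0X] line_closed(3)[OF lines(3) A0X] inX
    by simp_all
  obtain a' where a': "a' \<in> U" "a' \<notin> cl ?X" using fresh[OF finX] by blast
  let ?X1 = "insert a' ?X"
  obtain b' where b': "b' \<in> U" "b' \<notin> cl ?X1" using fresh[of ?X1] finX by auto
  let ?X2 = "insert b' ?X1"
  obtain c' where c': "c' \<in> U" "c' \<notin> cl ?X2" using fresh[of ?X2] finX by auto
  have X12: "cl ?X \<subseteq> cl ?X1" "cl ?X1 \<subseteq> cl ?X2" by (rule cl_mono, blast)+
  let ?bz = "insert b (insert z A0)"
  have bzU: "?bz \<subseteq> U" using in_U A0 by auto
  have bz_in: "b \<in> cl ?bz" "z \<in> cl ?bz" using in_U by (auto intro!: cl_extensive)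
  have A0bz: "A0 \<subseteq> ?bz" by auto
  have ybz: "y \<in> cl ?bz" using line_closed(2)[OF lines(3) A0bz] bz_in by simp
  have zby: "z \<in> cl (insert y (insert b A0))" using lines(3) by (simp add: line_def insert_commute)
  have "cl ?bz \<subseteq> cl (insert y (insert b A0))"
    using zby in_U by (intro cl_subset') (auto intro: cl_extensive)
  then have abz: "a \<notin> cl ?bz" using aby by blast
  have cbz: "c \<notin> cl ?bz" using line_closed(1)[OF lines(1) A0bz] bz_in abz by auto
  have bzX: "cl ?bz \<subseteq> cl ?X" using inX inX' by (intro cl_subset') (auto intro: cl_extensive)
  have cbz_count: "countable ?bz" using A0 by (simp add: countable_finite)
  have c'bz: "c' \<notin> cl ?bz" using c' bzX X12 by blast
  have a'bz: "a' \<notin> cl ?bz" using a' bzX by blast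
  obtain \<sigma>1 where \<sigma>1: "\<sigma>1 \<in> \<Gamma>" "\<forall>k\<in>cl ?bz. \<sigma>1 k = k" "\<sigma>1 c = c'"
    using extend_one[OF id_in cbz_count bzU in_U(3) cbz c'(1)] c'bz by auto
  obtain \<sigma>2 where \<sigma>2: "\<sigma>2 \<in> \<Gamma>" "\<forall>k\<in>cl ?bz. \<sigma>2 k = k" "\<sigma>2 a = a'"
    using extend_one[OF id_in cbz_count bzU in_U(1) abz a'(1)] a'bz by auto
  have f1: "\<sigma>1 b = b" "\<sigma>1 z = z" "\<sigma>1 y = y" using \<sigma>1(2) bz_in ybz by auto
  have f2: "\<sigma>2 b = b" "\<sigma>2 z = z" "\<sigma>2 y = y" using \<sigma>2(2) bz_in ybz by auto
  have A0clbz: "A0 \<subseteq> cl ?bz" using A0 by (auto intro: cl_extensive)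
  have F1: "\<sigma>1 \<in> fixing A0" and F2: "\<sigma>2 \<in> fixing A0"
    using \<sigma>1(1,2) \<sigma>2(1,2) A0clbz by (auto simp: fixing_def)
  define a1 where "a1 = \<sigma>1 a"
  define x1 where "x1 = \<sigma>1 x"
  define c3 where "c3 = \<sigma>2 c"
  define x3 where "x3 = \<sigma>2 x"
  have L1: "line A0 a1 b c'" "line A0 a1 x1 y" "line A0 c' x1 z"
    using line_aut[OF F1 A0(2) lines(1)] line_aut[OF F1 A0(2) lines(2)] line_aut[OF F1 A0(2) lines(4)]
    by (simp_all add: f1 \<sigma>1(3) a1_def x1_def)
  have L2: "line A0 a' b c3" "line A0 a' x3 y" "line A0 c3 x3 z"
    using line_aut[OF F2 A0(2) lines(1)] line_aut[OF F2 A0(2) lines(2)] line_aut[OF F2 A0(2) lines(4)]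
    by (simp_all add: f2 \<sigma>2(3) c3_def x3_def)
  have bz0: "b \<notin> cl (insert z A0)"
  proof
    assume "b \<in> cl (insert z A0)"
    then have "z \<in> cl (insert b A0)" using b0 by (rule cl_exchange)
    then have "y \<in> cl (insert b A0)"
      using line_closed(2)[OF lines(3), of "insert b A0"] in_U by (auto intro: cl_extensive)
    then show False using gen(3) cl_mono[of "insert b A0" "insert b (insert a A0)"] by auto
  qed
  have "b \<notin> cl (insert c (insert z A0))" using cl_exchange[of b c "insert z A0"] bz0 cbz by auto
  moreover have "\<sigma>2 ` insert c (insert z A0) = insert c3 (insert z A0)"
    using fixing_image[OF F2 subset_refl] f2 by (simp add: c3_def)
  ultimately have bc3: "b \<notin> cl (insert c3 (insert z A0))"
    using aut_mem_cl[OF \<sigma>2(1), of "insert c (insert z A0)" b] in_U A0 f2 by auto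
  let ?cz = "insert c3 (insert z A0)"
  have c3U: "c3 \<in> U" using L2 line_U by blast
  have czU: "?cz \<subseteq> U" using in_U A0 c3U by auto
  have cz_in: "c3 \<in> cl ?cz" "z \<in> cl ?cz" using in_U c3U by (auto intro!: cl_extensive)
  have A0cz: "A0 \<subseteq> ?cz" by auto
  have x3cz: "x3 \<in> cl ?cz" using line_closed(2)[OF L2(3) A0cz] cz_in by simp
  have A0X1: "A0 \<subseteq> ?X1" by auto
  have inX1: "a' \<in> cl ?X1" "b \<in> cl ?X1" "z \<in> cl ?X1" using a' inX inX' X12 by (auto intro!: cl_extensive[of a'])
  have "c3 \<in> cl ?X1" using line_closed(3)[OF L2(1) A0X1] inX1 by simp
  then have "cl ?cz \<subseteq> cl ?X1" using inX1 by (intro cl_subset') (auto intro: cl_extensive)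
  then have b'cz: "b' \<notin> cl ?cz" using b' by blast
  have cz_count: "countable ?cz" using A0 by (simp add: countable_finite)
  obtain \<sigma>3 where \<sigma>3: "\<sigma>3 \<in> \<Gamma>" "\<forall>k\<in>cl ?cz. \<sigma>3 k = k" "\<sigma>3 b = b'"
    using extend_one[OF id_in cz_count czU in_U(2) bc3 b'(1)] b'cz by auto
  have f3: "\<sigma>3 c3 = c3" "\<sigma>3 z = z" "\<sigma>3 x3 = x3" using \<sigma>3(2) cz_in x3cz by auto
  have A0clcz: "A0 \<subseteq> cl ?cz" using A0 by (auto intro: cl_extensive)
  have F3: "\<sigma>3 \<in> fixing A0" using \<sigma>3(1,2) A0clcz by (auto simp: fixing_def)
  define a23 where "a23 = \<sigma>3 a'"
  define y2 where "y2 = \<sigma>3 y"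
  have L3: "line A0 a23 b' c3" "line A0 a23 x3 y2" "line A0 b' y2 z"
    using line_aut[OF F3 A0(2) L2(1)] line_aut[OF F3 A0(2) L2(2)] line_aut[OF F3 A0(2) lines(3)]
    by (simp_all add: f3 \<sigma>3(3) a23_def y2_def)
  let ?A2 = "insert c' (insert b' (insert a' A0))"
  have A2: "finite ?A2" "?A2 \<subseteq> U" using A0 a' b' c' by auto
  have "ind (insert a' A0) [a, b, y]"
    by (rule ind_insert[OF i]) (use a' in \<open>simp add: insert_commute\<close>)
  then have "ind (insert b' (insert a' A0)) [a, b, y]"
    by (rule ind_insert) (use b' in \<open>simp add: insert_commute\<close>)
  then have "ind ?A2 [a, b, y]"
    by (rule ind_insert) (use c' in \<open>simp add: insert_commute\<close>)
  then obtain H where H: "countable H" "model H" "?A2 \<subseteq> H" "ind H [a, b, y]"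
    using model_independent[OF A2] by blast
  have HU: "H \<subseteq> U" and clH: "cl H = H" using H by (auto simp: model_def)
  have A0H: "A0 \<subseteq> insert b H" "A0 \<subseteq> ?A2" using H(3) by auto
  have bH: "b \<notin> H" using H(4) cl_mono[of H "insert a H"] clH by auto
  have zH: "z \<notin> H"
  proof
    assume "z \<in> H"
    then have "z \<in> cl (insert b H)" "b \<in> cl (insert b H)" using in_U by (auto intro: cl_extensive)
    then have "y \<in> cl (insert b H)" using line_closed(2)[OF lines(3) A0H(1)] by simp
    then show False using H(4) cl_mono[of "insert b H" "insert b (insert a H)"] by auto
  qed
  have over: "a1 \<in> cl (insert b ?A2)" "c3 \<in> cl (insert b ?A2)" "a23 \<in> cl (insert b ?A2)"
    "x1 \<in> cl (insert z ?A2)" "y2 \<in> cl (insert z ?A2)" "x3 \<in> cl (insert y ?A2)"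
  proof -
    have s: "A0 \<subseteq> insert v ?A2" for v by auto
    have e: "v \<in> cl (insert v ?A2)" if "v \<in> U" for v using that by (auto intro: cl_extensive)
    have e': "a' \<in> cl (insert v ?A2)" "b' \<in> cl (insert v ?A2)" "c' \<in> cl (insert v ?A2)" for v
      using a' b' c' by (auto intro: cl_extensive)
    show "a1 \<in> cl (insert b ?A2)" using line_closed(1)[OF L1(1) s] e in_U e' by blast
    show c3: "c3 \<in> cl (insert b ?A2)" using line_closed(3)[OF L2(1) s] e in_U e' by blast
    show "a23 \<in> cl (insert b ?A2)" using line_closed(1)[OF L3(1) s] c3 e' by blast
    show "x1 \<in> cl (insert z ?A2)" using line_closed(2)[OF L1(3) s] e in_U e' by blast
    show "y2 \<in> cl (insert z ?A2)" using line_closed(2)[OF L3(3) s] e in_U e' by blast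
    show "x3 \<in> cl (insert y ?A2)" using line_closed(2)[OF L2(2) s] e in_U e' by blast
  qed
  let ?bb = "[b, a1, c3, a23]" and ?zz = "[z, x1, y2]"
  have ib: "ind H [b]" and iz: "ind H [z]" using bH zH clH in_U by auto
  have sb: "set ?bb \<subseteq> cl (?A2 \<union> set [b])" using over in_U by (auto intro: cl_extensive)
  have sz: "set ?zz \<subseteq> cl (?A2 \<union> set [z])" using over in_U by (auto intro: cl_extensive)
  obtain B1 where B1: "finite B1" "?A2 \<subseteq> B1" "B1 \<subseteq> H" "nsplit B1 H ?bb"
    using finite_nonsplitting_base[OF H(1,2) ib A2(1) H(3) sb] by blast
  obtain B2 where B2: "finite B2" "?A2 \<subseteq> B2" "B2 \<subseteq> H" "nsplit B2 H ?zz"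
    using finite_nonsplitting_base[OF H(1,2) iz A2(1) H(3) sz] by blast
  \<comment> \<open>A base may be enlarged inside \<open>H\<close>, so the union serves both tuples
    and keeps \<open>a\<close>, \<open>b\<close>, \<open>y\<close> independent.\<close>
  define A where "A = B1 \<union> B2"
  have A: "finite A" "?A2 \<subseteq> A" "A \<subseteq> H" using B1 B2 by (auto simp: A_def)
  have ns: "nsplit A H ?bb" "nsplit A H ?zz"
    using nsplit_mono[OF B1(4) _ A(1,3)] nsplit_mono[OF B2(4) _ A(1,3)] by (auto simp: A_def)
  have up: "v \<in> cl (insert w A)" if "v \<in> cl (insert w ?A2)" for v w
    using that by (rule cl_monoD) (use A(2) in blast)
  have frame: "quadrangle_frame U cl \<Gamma> A0 A a b c x y z a1 c3 a23 x1 y2 x3"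
  proof unfold_locales
    show "A0 \<subseteq> A" "finite A" "A \<subseteq> U" using A HU by auto
    show "ind A [a, b, y]" by (rule ind_mono[OF H(4) A(3)])
    show "a1 \<in> cl (insert b A)" "c3 \<in> cl (insert b A)" "a23 \<in> cl (insert b A)"
      "x1 \<in> cl (insert z A)" "y2 \<in> cl (insert z A)" "x3 \<in> cl (insert y A)"
      using over up by blast+
    show "cl (insert b (insert z A0)) \<inter> cl (insert a1 (insert x1 A0)) = cl (insert y A0)"
    proof (intro equalityI subsetI IntI)
      fix u assume u: "u \<in> cl (insert y A0)"
      show "u \<in> cl (insert b (insert z A0))" by (rule cl_closed1[OF u ybz A0bz])
      show "u \<in> cl (insert a1 (insert x1 A0))"
        by (rule cl_closed1[OF u]) (use L1(2) in \<open>auto simp: line_def\<close>)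
    next
      fix u assume "u \<in> cl (insert b (insert z A0)) \<inter> cl (insert a1 (insert x1 A0))"
      then have u: "u \<in> cl (insert b (insert z A0))" "u \<in> cl (insert a1 (insert x1 A0))" by auto
      have a1U: "a1 \<in> U" using line_U L1 by blast
      show "u \<in> cl (insert y A0)"
      \<comment> \<open>Both closures contain \<open>y\<close> and are spanned by it together with
        \<open>b\<close> and with \<open>a1\<close>, respectively. That \<open>b\<close> is outside
        the closure of \<open>a1\<close> and \<open>y\<close> is the image under
        \<open>\<sigma>1\<close> of the same fact for \<open>a\<close> and \<open>y\<close>. The
        other two intersections are treated alike.\<close>
      proof (rule line_intersection[of _ b _ _ a1])
        show "u \<in> cl (insert b (insert y A0))"
          by (rule cl_closed2[OF u(1)]) (use lines(3) in_U in \<open>auto simp: line_def intro: cl_extensive\<close>)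
        show "u \<in> cl (insert a1 (insert y A0))"
          by (rule cl_closed2[OF u(2)]) (use L1(2) a1U in \<open>auto simp: line_def intro: cl_extensive\<close>)
        have "\<sigma>1 ` insert a (insert y A0) = insert a1 (insert y A0)"
          using fixing_image[OF F1 subset_refl] f1 by (simp add: a1_def)
        then show "b \<notin> cl (insert a1 (insert y A0))"
          using aut_mem_cl[OF \<sigma>1(1), of "insert a (insert y A0)" b] bya in_U A0 f1 by auto
      qed (use A0 in_U in auto)
    qed
    show "cl (insert c3 (insert z A0)) \<inter> cl (insert a23 (insert y2 A0)) = cl (insert x3 A0)"
    proof (intro equalityI subsetI IntI)
      fix u assume u: "u \<in> cl (insert x3 A0)"
      show "u \<in> cl (insert c3 (insert z A0))" by (rule cl_closed1[OF u x3cz A0cz])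
      show "u \<in> cl (insert a23 (insert y2 A0))"
        by (rule cl_closed1[OF u]) (use L3(2) in \<open>auto simp: line_def\<close>)
    next
      fix u assume "u \<in> cl (insert c3 (insert z A0)) \<inter> cl (insert a23 (insert y2 A0))"
      then have u: "u \<in> cl (insert c3 (insert z A0))" "u \<in> cl (insert a23 (insert y2 A0))" by auto
      have U3: "a23 \<in> U" "x3 \<in> U" using line_U[OF L3(2)] by auto
      show "u \<in> cl (insert x3 A0)"
      proof (rule line_intersection[of _ c3 _ _ a23])
        show "u \<in> cl (insert c3 (insert x3 A0))"
          by (rule cl_closed2[OF u(1)]) (use L2(3) c3U in \<open>auto simp: line_def intro: cl_extensive\<close>)
        show "u \<in> cl (insert a23 (insert x3 A0))"
          by (rule cl_closed2[OF u(2)]) (use L3(2) U3 in \<open>auto simp: line_def intro: cl_extensive\<close>)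
        have ax: "c \<notin> cl (insert a (insert x A0))"
        proof
          assume c: "c \<in> cl (insert a (insert x A0))"
          have "c \<in> cl (insert a (insert y A0))"
            by (rule cl_closed2[OF c]) (use lines(2) in_U in \<open>auto simp: line_def intro: cl_extensive\<close>)
          then have "b \<in> cl (insert a (insert y A0))"
            using line_closed(2)[OF lines(1), of "insert a (insert y A0)"] in_U by (auto intro: cl_extensive)
          then show False using bya by simp
        qed
        have F32: "(\<lambda>v. \<sigma>3 (\<sigma>2 v)) \<in> fixing A0" by (rule fixing_comp[OF F3 F2])
        have "(\<lambda>v. \<sigma>3 (\<sigma>2 v)) ` insert a (insert x A0) = insert a23 (insert x3 A0)"
          using fixing_image[OF F32 subset_refl] f3 \<sigma>2(3) by (simp add: a23_def x3_def)
        then show "c3 \<notin> cl (insert a23 (insert x3 A0))"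
          using aut_mem_cl[OF fixingD(1)[OF F32], of "insert a (insert x A0)" c] ax in_U A0 f3
          by (auto simp: c3_def)
      qed (use A0 U3 in auto)
    qed
    show "cl (insert b (insert y A0)) \<inter> cl (insert c3 (insert x3 A0)) = cl (insert z A0)"
    proof (intro equalityI subsetI IntI)
      fix u assume u: "u \<in> cl (insert z A0)"
      show "u \<in> cl (insert b (insert y A0))"
        by (rule cl_closed1[OF u]) (use lines(3) in \<open>auto simp: line_def\<close>)
      show "u \<in> cl (insert c3 (insert x3 A0))"
        by (rule cl_closed1[OF u]) (use L2(3) in \<open>auto simp: line_def\<close>)
    next
      fix u assume "u \<in> cl (insert b (insert y A0)) \<inter> cl (insert c3 (insert x3 A0))"
      then have u: "u \<in> cl (insert b (insert y A0))" "u \<in> cl (insert c3 (insert x3 A0))" by auto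
      show "u \<in> cl (insert z A0)"
      proof (rule line_intersection[of _ b _ _ c3])
        show "u \<in> cl (insert b (insert z A0))"
          by (rule cl_closed2[OF u(1)]) (use bz_in ybz in auto)
        show "u \<in> cl (insert c3 (insert z A0))"
          by (rule cl_closed2[OF u(2)]) (use cz_in x3cz in auto)
        show "b \<notin> cl (insert c3 (insert z A0))" using bc3 .
      qed (use A0 in_U in auto)
    qed
    show "line A0 a b c" "line A0 a x y" "line A0 b y z" "line A0 c x z" using lines .
  next
    fix s s' C
    assume "eqt A ?bb s" "eqt A ?bb s'" "finite C" "C \<subseteq> U" "hd s \<notin> cl (A \<union> C)" "hd s' \<notin> cl (A \<union> C)"
    then show "eqt (A \<union> C) s s'"
      using over up in_U bH
      by (intro nsplit_stationary_pair[OF ns(1) H(2) A(1,3)]) (auto intro: cl_extensive)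
  next
    fix s s' C
    assume "eqt A ?zz s" "eqt A ?zz s'" "finite C" "C \<subseteq> U" "hd s \<notin> cl (A \<union> C)" "hd s' \<notin> cl (A \<union> C)"
    then show "eqt (A \<union> C) s s'"
      using over up in_U zH
      by (intro nsplit_stationary_pair[OF ns(2) H(2) A(1,3)]) (auto intro: cl_extensive)
  qed
  then show ?thesis by blast
qed

end

section \<open>Quasiminimal classes\<close>

text \<open>Relations instead of maps make converses and composites available without choosing
  inverses. Assignments may repeat values, so \<open>S\<close> is forced to be functional and
  injective by the formula \<open>Eql\<close>; see \<open>pelem_eq\<close>. The variables have the
  type used in \<open>qf_type\<close>.\<close>

definition pelem :: "('f, 'r) lang \<Rightarrow> ('f, 'r, 'a, 'm) fo_struct_scheme \<Rightarrow>
    ('f, 'r, 'b, 'n) fo_struct_scheme \<Rightarrow> ('a \<times> 'b) set \<Rightarrow> bool" where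
  "pelem L N N' S \<longleftrightarrow> (\<forall>(p :: ('f, 'r, nat + nat) qff) s s'. wf_qff L p \<longrightarrow>
     (\<forall>v\<in>vars_qff p. (s v, s' v) \<in> S) \<longrightarrow> holds N s p = holds N' s' p)"

lemma pelemD:
  fixes p :: "('f, 'r, nat + nat) qff"
  shows "pelem L N N' S \<Longrightarrow> wf_qff L p \<Longrightarrow> (\<And>v. v \<in> vars_qff p \<Longrightarrow> (s v, s' v) \<in> S) \<Longrightarrow>
    holds N s p = holds N' s' p"
  unfolding pelem_def by blast

lemma pelem_subset: "pelem L N N' S \<Longrightarrow> T \<subseteq> S \<Longrightarrow> pelem L N N' T"
  unfolding pelem_def by blast

lemma pelem_converse: "pelem L N N' S \<Longrightarrow> pelem L N' N (converse S)"
  unfolding pelem_def by (metis converse_iff)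

lemma val_cong: "(\<And>v. v \<in> vars_trm t \<Longrightarrow> s v = s' v) \<Longrightarrow> val N s t = val N s' t"
proof (induction t)
  case (App f ts)
  then have "map (val N s) ts = map (val N s') ts" by (intro map_cong) auto
  then show ?case by (simp only: val.simps)
qed simp

lemma holds_cong: "(\<And>v. v \<in> vars_qff p \<Longrightarrow> s v = s' v) \<Longrightarrow> holds N s p = holds N s' p"
proof (induction p)
  case (Eql t u)
  then show ?case using val_cong[of t s s' N] val_cong[of u s s' N] by simp
next
  case (Rel r ts)
  have "map (val N s) ts = map (val N s') ts"
    using Rel by (intro map_cong refl val_cong) auto
  then show ?case by (simp only: holds.simps)
qed auto

lemma pelem_comp:
  assumes "pelem L N N' S" "pelem L N' N'' T"
  shows "pelem L N N'' (S O T)"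
  unfolding pelem_def
proof (intro allI impI)
  fix p :: "(_, _, nat + nat) qff" and s s''
  assume p: "wf_qff L p" and "\<forall>v\<in>vars_qff p. (s v, s'' v) \<in> S O T"
  then have "\<forall>v\<in>vars_qff p. \<exists>y. (s v, y) \<in> S \<and> (y, s'' v) \<in> T" by blast
  then obtain s' where s': "\<forall>v\<in>vars_qff p. (s v, s' v) \<in> S \<and> (s' v, s'' v) \<in> T"
    by (rule bchoice[THEN exE])
  show "holds N s p = holds N'' s'' p"
    using pelemD[OF assms(1) p, of s s'] pelemD[OF assms(2) p, of s' s''] s' by blast
qed

lemma pelem_eq:
  assumes "pelem L N N' S" "(x, y) \<in> S" "(x', y') \<in> S"
  shows "x = x' \<longleftrightarrow> y = y'"
proof -
  let ?p = "Eql (Var (Inl 0)) (Var (Inr 0)) :: (_, _, nat + nat) qff"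
  have "holds N (case_sum (\<lambda>_. x) (\<lambda>_. x')) ?p = holds N' (case_sum (\<lambda>_. y) (\<lambda>_. y')) ?p"
    by (rule pelemD[OF assms(1)]) (use assms in auto)
  then show ?thesis by simp
qed

text \<open>A formula has finitely many variables, so it tests only finitely many pairs of
  \<open>S\<close>.\<close>

lemma pelem_finite:
  assumes "\<And>T. finite T \<Longrightarrow> T \<subseteq> S \<Longrightarrow> pelem L N N' T"
  shows "pelem L N N' S"
  unfolding pelem_def
proof (intro allI impI)
  fix p :: "(_, _, nat + nat) qff" and s s'
  assume p: "wf_qff L p" and v: "\<forall>v\<in>vars_qff p. (s v, s' v) \<in> S"
  have "pelem L N N' ((\<lambda>v. (s v, s' v)) ` vars_qff p)"
    using v by (intro assms) auto
  then show "holds N s p = holds N' s' p" by (rule pelemD[OF _ p]) auto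
qed

lemma pelem_UN_mono:
  assumes "mono (S :: nat \<Rightarrow> _)" "\<And>n. pelem L N N' (S n)"
  shows "pelem L N N' (\<Union>n. S n)"
proof (rule pelem_finite)
  fix T assume "finite T" "T \<subseteq> (\<Union>n. S n)"
  then obtain n where "T \<subseteq> S n" using finite_subset_mono_UN[OF assms(1)] by blast
  then show "pelem L N N' T" by (rule pelem_subset[OF assms(2)])
qed

lemma embedding_val:
  assumes "is_struct L N" "fo_embedding L g N N'" "wf_trm L t" "\<And>v. v \<in> vars_trm t \<Longrightarrow> s v \<in> univ N"
  shows "val N s t \<in> univ N \<and> val N' (\<lambda>v. g (s v)) t = g (val N s t)"
  using assms(3,4)
proof (induction t)
  case (App f ts)
  have IH: "val N s u \<in> univ N \<and> val N' (\<lambda>v. g (s v)) u = g (val N s u)" if "u \<in> set ts" for u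
    using App that by auto
  have t: "map (val N s) ts \<in> tuples (univ N) (far L f)" "f \<in> fsyms L"
    using IH App.prems by (auto simp: tuples_def)
  have m: "map (val N' (\<lambda>v. g (s v))) ts = map g (map (val N s) ts)" using IH by simp
  have "val N s (App f ts) \<in> univ N" using assms(1) t by (simp add: is_struct_def)
  moreover have "val N' (\<lambda>v. g (s v)) (App f ts) = fint N' f (map g (map (val N s) ts))"
    unfolding val.simps m ..
  moreover have "fint N' f (map g (map (val N s) ts)) = g (fint N f (map (val N s) ts))"
    using assms(2) t unfolding fo_embedding_def by metis
  ultimately show ?case by simp
qed simp

lemma embedding_holds:
  assumes "is_struct L N" "fo_embedding L g N N'"
  shows "wf_qff L p \<Longrightarrow> (\<And>v. v \<in> vars_qff p \<Longrightarrow> s v \<in> univ N) \<Longrightarrow>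
    holds N' (\<lambda>v. g (s v)) p = holds N s p"
proof (induction p)
  case (Eql t u)
  have "inj_on g (univ N)" using assms(2) by (simp add: fo_embedding_def)
  then show ?case using embedding_val[OF assms, of t s] embedding_val[OF assms, of u s] Eql
    by (auto dest: inj_onD)
next
  case (Rel r ts)
  have IH: "val N s u \<in> univ N \<and> val N' (\<lambda>v. g (s v)) u = g (val N s u)" if "u \<in> set ts" for u
    using Rel that by (intro embedding_val[OF assms]) auto
  have t: "map (val N s) ts \<in> tuples (univ N) (rar L r)" "r \<in> rsyms L"
    using IH Rel.prems by (auto simp: tuples_def)
  have m: "map (val N' (\<lambda>v. g (s v))) ts = map g (map (val N s) ts)" using IH by simp
  have "map (val N s) ts \<in> rint N r \<longleftrightarrow> map g (map (val N s) ts) \<in> rint N' r"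
    using assms(2) t unfolding fo_embedding_def by blast
  then show ?case unfolding holds.simps m by simp
qed auto

lemma embedding_pelem:
  assumes "is_struct L N" "fo_embedding L g N N'"
  shows "pelem L N N' ((\<lambda>x. (x, g x)) ` univ N)"
  unfolding pelem_def
proof (intro allI impI)
  fix p :: "(_, _, nat + nat) qff" and s s'
  assume p: "wf_qff L p" and v: "\<forall>v\<in>vars_qff p. (s v, s' v) \<in> (\<lambda>x. (x, g x)) ` univ N"
  have "holds N' s' p = holds N' (\<lambda>v. g (s v)) p" using v by (intro holds_cong) auto
  also have "\<dots> = holds N s p" using v by (intro embedding_holds[OF assms p]) auto
  finally show "holds N s p = holds N' s' p" by simp
qed

definition vars_upto :: "nat \<Rightarrow> ('f, nat + nat) trm list" where
  "vars_upto n = map (\<lambda>i. Var (Inl i)) [0..<n]"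

lemma val_vars_upto: "length xs = n \<Longrightarrow> map (val N (case_sum ((!) xs) h)) (vars_upto n) = xs"
  by (auto simp: vars_upto_def comp_def map_nth)

lemma pelem_fint:
  assumes "pelem L N N' S" "f \<in> fsyms L" "length xs = far L f" "length ys = far L f"
    "set (zip xs ys) \<subseteq> S" "(x, y) \<in> S"
  shows "fint N f xs = x \<longleftrightarrow> fint N' f ys = y"
proof -
  let ?p = "Eql (App f (vars_upto (far L f))) (Var (Inr 0)) :: (_, _, nat + nat) qff"
  have "holds N (case_sum ((!) xs) (\<lambda>_. x)) ?p = holds N' (case_sum ((!) ys) (\<lambda>_. y)) ?p"
  proof (rule pelemD[OF assms(1)])
    show "wf_qff L ?p" using assms(2) by (simp add: vars_upto_def)
    fix v assume "v \<in> vars_qff ?p"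
    then consider i where "v = Inl i" "i < far L f" | "v = Inr 0" by (auto simp: vars_upto_def)
    then show "(case_sum ((!) xs) (\<lambda>_. x) v, case_sum ((!) ys) (\<lambda>_. y) v) \<in> S"
    proof cases
      case 1
      then have "(xs ! i, ys ! i) \<in> set (zip xs ys)" using assms(3,4) by (auto simp: set_zip)
      then show ?thesis using 1 assms(5) by auto
    qed (use assms(6) in simp)
  qed
  then show ?thesis using val_vars_upto assms(3,4) by (simp add: val_vars_upto)
qed

lemma pelem_rint:
  assumes "pelem L N N' S" "r \<in> rsyms L" "length xs = rar L r" "length ys = rar L r"
    "set (zip xs ys) \<subseteq> S"
  shows "xs \<in> rint N r \<longleftrightarrow> ys \<in> rint N' r"
proof -
  let ?p = "Rel r (vars_upto (rar L r)) :: (_, _, nat + nat) qff"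
  have "holds N (case_sum ((!) xs) (\<lambda>_. undefined)) ?p = holds N' (case_sum ((!) ys) (\<lambda>_. undefined)) ?p"
  proof (rule pelemD[OF assms(1)])
    show "wf_qff L ?p" using assms(2) by (simp add: vars_upto_def)
    fix v assume "v \<in> vars_qff ?p"
    then obtain i where i: "v = Inl i" "i < rar L r" by (auto simp: vars_upto_def)
    then have "(xs ! i, ys ! i) \<in> set (zip xs ys)" using assms(3,4) by (auto simp: set_zip)
    then show "(case_sum ((!) xs) (\<lambda>_. undefined) v, case_sum ((!) ys) (\<lambda>_. undefined) v) \<in> S"
      using i assms(5) by auto
  qed
  then show ?thesis using assms(3,4) by (simp add: val_vars_upto)
qed

lemma pelem_embedding:
  assumes "pelem L N N' ((\<lambda>x. (x, g x)) ` univ N)" "is_struct L N" "g ` univ N \<subseteq> univ N'"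
  shows "fo_embedding L g N N'"
  unfolding fo_embedding_def
proof (intro conjI ballI)
  show "inj_on g (univ N)"
    using pelem_eq[OF assms(1)] by (intro inj_onI) blast
  have z: "set (zip xs (map g xs)) \<subseteq> (\<lambda>x. (x, g x)) ` univ N" if "set xs \<subseteq> univ N" for xs
    using that by (auto simp: zip_map2 zip_same_conv_map)
  fix xs
  show "g (fint N f xs) = fint N' f (map g xs)" if "f \<in> fsyms L" "xs \<in> tuples (univ N) (far L f)" for f
  proof -
    have xs: "length xs = far L f" "set xs \<subseteq> univ N" using that by (auto simp: tuples_def)
    have "fint N f xs \<in> univ N" using assms(2) that by (simp add: is_struct_def)
    then have "(fint N f xs, g (fint N f xs)) \<in> (\<lambda>x. (x, g x)) ` univ N" by blast
    from pelem_fint[OF assms(1) that(1) xs(1) _ z[OF xs(2)] this] show ?thesis using xs(1) by simp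
  qed
  show "xs \<in> rint N r \<longleftrightarrow> map g xs \<in> rint N' r" if "r \<in> rsyms L" "xs \<in> tuples (univ N) (rar L r)" for r
    using pelem_rint[OF assms(1) that(1) _ _ z] that by (simp add: tuples_def)
qed (use assms in auto)

lemma val_map: "val N s (map_trm (\<lambda>x. x) \<rho> t) = val N (\<lambda>v. s (\<rho> v)) t"
proof (induction t)
  case (App f ts)
  then have "map (val N s) (map (map_trm (\<lambda>x. x) \<rho>) ts) = map (val N (\<lambda>v. s (\<rho> v))) ts" by simp
  then show ?case by (simp only: trm.map val.simps)
qed simp

lemma holds_map: "holds N s (map_qff (\<lambda>x. x) (\<lambda>x. x) \<rho> p) = holds N (\<lambda>v. s (\<rho> v)) p"
  by (induction p) (auto simp: val_map comp_def)

lemma wf_trm_map: "wf_trm L (map_trm (\<lambda>x. x) \<rho> t) = wf_trm L t"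
  by (induction t) auto

lemma wf_qff_map: "wf_qff L (map_qff (\<lambda>x. x) (\<lambda>x. x) \<rho> p) = wf_qff L p"
  by (induction p) (auto simp: wf_trm_map)

text \<open>An assignment into the related pairs factors through a renaming of variables to
  positions of the families. Renaming the formula accordingly brings it into the form in which
  \<open>qf_type\<close> decides it.\<close>

lemma qf_type_eq_iff_pelem:
  assumes "length b = length b'"
  shows "qf_type L N I h b = qf_type L N' I h' b' \<longleftrightarrow>
    pelem L N N' ((\<lambda>i. (h i, h' i)) ` I \<union> set (zip b b'))" (is "?l \<longleftrightarrow> pelem L N N' ?S")
proof
  let ?V = "Inl ` I \<union> Inr ` {..<length b}" and ?s = "case_sum h ((!) b)" and ?s' = "case_sum h' ((!) b')"
  have inS: "(?s v, ?s' v) \<in> ?S" if "v \<in> ?V" for v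
    using that assms by (auto simp: set_zip)
  {
    assume l: ?l
    show "pelem L N N' ?S" unfolding pelem_def
    proof (intro allI impI)
      fix p :: "(_, _, nat + nat) qff" and s s'
      assume p: "wf_qff L p" and v: "\<forall>v\<in>vars_qff p. (s v, s' v) \<in> ?S"
      have "\<exists>w\<in>?V. (s v, s' v) = (?s w, ?s' w)" if "v \<in> vars_qff p" for v
      proof -
        have "(s v, s' v) \<in> ?S" using v that by blast
        then consider i where "i \<in> I" "(s v, s' v) = (h i, h' i)"
          | i where "i < length b" "(s v, s' v) = (b ! i, b' ! i)"
          by (auto simp: set_zip)
        then show ?thesis
        proof cases
          case (1 i)
          then show ?thesis by (intro bexI[of _ "Inl i"]) auto
        next
          case (2 i)
          then show ?thesis by (intro bexI[of _ "Inr i"]) auto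
        qed
      qed
      then obtain \<rho> where \<rho>: "\<And>v. v \<in> vars_qff p \<Longrightarrow> \<rho> v \<in> ?V \<and> (s v, s' v) = (?s (\<rho> v), ?s' (\<rho> v))"
        by metis
      let ?p = "map_qff (\<lambda>x. x) (\<lambda>x. x) \<rho> p"
      have "vars_qff ?p \<subseteq> ?V" using \<rho> by (auto simp: qff.set_map)
      moreover have "wf_qff L ?p" using p by (simp add: wf_qff_map)
      ultimately have "holds N ?s ?p \<longleftrightarrow> ?p \<in> qf_type L N I h b" "holds N' ?s' ?p \<longleftrightarrow> ?p \<in> qf_type L N' I h' b'"
        using assms by (auto simp: qf_type_def)
      then have "holds N ?s ?p = holds N' ?s' ?p" using l by simp
      moreover have "holds N s p = holds N ?s ?p" unfolding holds_map using \<rho> by (intro holds_cong) auto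
      moreover have "holds N' s' p = holds N' ?s' ?p" unfolding holds_map using \<rho> by (intro holds_cong) auto
      ultimately show "holds N s p = holds N' s' p" by simp
    qed
  next
    assume r: "pelem L N N' ?S"
    have "holds N ?s p = holds N' ?s' p" if "wf_qff L p" "vars_qff p \<subseteq> ?V" for p
    proof (rule pelemD[OF r that(1)])
      fix v assume "v \<in> vars_qff p"
      then show "(?s v, ?s' v) \<in> ?S" using inS that(2) by blast
    qed
    then show ?l using assms by (auto simp: qf_type_def)
  }
qed

section \<open>Finitary closure on a fixed universe\<close>

lemma pregeometryD:
  assumes "pregeometry V c"
  shows "X \<subseteq> V \<Longrightarrow> X \<subseteq> c X" "X \<subseteq> V \<Longrightarrow> c X \<subseteq> V" "X \<subseteq> Y \<Longrightarrow> Y \<subseteq> V \<Longrightarrow> c X \<subseteq> c Y"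
    "X \<subseteq> V \<Longrightarrow> c (c X) = c X"
    "X \<subseteq> V \<Longrightarrow> c X = (\<Union>D\<in>{D. finite D \<and> D \<subseteq> X}. c D)"
    "X \<subseteq> V \<Longrightarrow> v \<in> V \<Longrightarrow> w \<in> V \<Longrightarrow> v \<in> c (insert w X) - c X \<Longrightarrow> w \<in> c (insert v X)"
proof -
  note p = assms[unfolded pregeometry_def]
  note p1 = p[THEN conjunct1, rule_format] and p2 = p[THEN conjunct2, THEN conjunct1, rule_format]
    and p3 = p[THEN conjunct2, THEN conjunct2, THEN conjunct1, rule_format]
    and p4 = p[THEN conjunct2, THEN conjunct2, THEN conjunct2, THEN conjunct1, rule_format]
    and p5 = p[THEN conjunct2, THEN conjunct2, THEN conjunct2, THEN conjunct2, rule_format]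
  show "X \<subseteq> V \<Longrightarrow> X \<subseteq> c X" by (rule p1[THEN conjunct1])
  show "X \<subseteq> V \<Longrightarrow> c X \<subseteq> V" by (rule p1[THEN conjunct2])
  show "X \<subseteq> Y \<Longrightarrow> Y \<subseteq> V \<Longrightarrow> c X \<subseteq> c Y" by (rule p2) (rule conjI)
  show "X \<subseteq> V \<Longrightarrow> c (c X) = c X" by (rule p3)
  show "X \<subseteq> V \<Longrightarrow> c X = (\<Union>D\<in>{D. finite D \<and> D \<subseteq> X}. c D)" by (rule p4)
  show "X \<subseteq> V \<Longrightarrow> v \<in> V \<Longrightarrow> w \<in> V \<Longrightarrow> v \<in> c (insert w X) - c X \<Longrightarrow> w \<in> c (insert v X)" by (rule p5)
qed

lemma pregeometry_finitary:
  assumes "pregeometry V c" "X \<subseteq> V" "v \<in> c X"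
  obtains D where "finite D" "D \<subseteq> X" "v \<in> c D"
proof -
  have "v \<in> (\<Union>D\<in>{D. finite D \<and> D \<subseteq> X}. c D)" using pregeometryD(5)[OF assms(1,2)] assms(3) by simp
  then show ?thesis using that by auto
qed

lemma pregeometry_closed_subset:
  assumes "pregeometry V c" "X \<subseteq> V" "c X = X"
  shows "pregeometry X c"
proof -
  note D = pregeometryD[OF assms(1)]
  have sub: "Y \<subseteq> V" if "Y \<subseteq> X" for Y using that assms(2) by (rule order_trans)
  show ?thesis
    unfolding pregeometry_def
  proof (intro conjI allI impI ballI)
    fix Y assume Y: "Y \<subseteq> X"
    show "Y \<subseteq> c Y" "c (c Y) = c Y" using D(1,4) sub[OF Y] by simp_all
    show "c Y \<subseteq> X" using D(3)[OF Y assms(2)] assms(3) by simp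
    show "c Y = (\<Union>F\<in>{F. finite F \<and> F \<subseteq> Y}. c F)" by (rule D(5)[OF sub[OF Y]])
    fix a b assume "a \<in> X" "b \<in> X" "a \<in> c (insert b Y) - c Y"
    then show "b \<in> c (insert a Y)" using D(6)[OF sub[OF Y]] assms(2) by (meson subsetD)
  next
    fix Y Z assume "Y \<subseteq> Z \<and> Z \<subseteq> X"
    then show "c Y \<subseteq> c Z" using D(3)[of Y Z] sub[of Z] by simp
  qed
qed

lemma countable_pairs_enum:
  assumes "countable S"
  obtains I :: "nat set" and h h' where "(\<lambda>i. (h i, h' i)) ` I = S"
proof (cases "S = {}")
  case True
  then show ?thesis using that[of _ _ "{}"] by simp
next
  case False
  have "(\<lambda>i. (fst (from_nat_into S i), snd (from_nat_into S i))) ` UNIV = S"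
    using range_from_nat_into[OF False assms] by simp
  then show ?thesis using that[of "\<lambda>i. fst (from_nat_into S i)" "\<lambda>i. snd (from_nat_into S i)" UNIV] by blast
qed

lemma pelem_closure_iff:
  assumes N: "pregeometry (univ N) (cl N)" and N': "pregeometry (univ N') (cl N')"
    and T: "T \<subseteq> univ N \<times> univ N'"
    and fin: "\<And>T0. finite T0 \<Longrightarrow> T0 \<subseteq> T \<Longrightarrow> a \<in> cl N (fst ` T0) \<longleftrightarrow> a' \<in> cl N' (snd ` T0)"
  shows "a \<in> cl N (fst ` T) \<longleftrightarrow> a' \<in> cl N' (snd ` T)"
proof
  have T1: "fst ` T \<subseteq> univ N" and T2: "snd ` T \<subseteq> univ N'" using T by auto
  {
    assume "a \<in> cl N (fst ` T)"
    then obtain D where D: "finite D" "D \<subseteq> fst ` T" "a \<in> cl N D"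
      using pregeometry_finitary[OF N T1] by metis
    obtain T0 where T0: "T0 \<subseteq> T" "finite T0" "D = fst ` T0" using finite_subset_image[OF D(1,2)] by auto
    have "a' \<in> cl N' (snd ` T0)" using fin[OF T0(2,1)] D(3) T0(3) by simp
    moreover have "cl N' (snd ` T0) \<subseteq> cl N' (snd ` T)"
      by (rule pregeometryD(3)[OF N' image_mono[OF T0(1)] T2])
    ultimately show "a' \<in> cl N' (snd ` T)" by blast
  next
    assume "a' \<in> cl N' (snd ` T)"
    then obtain D where D: "finite D" "D \<subseteq> snd ` T" "a' \<in> cl N' D"
      using pregeometry_finitary[OF N' T2] by metis
    obtain T0 where T0: "T0 \<subseteq> T" "finite T0" "D = snd ` T0" using finite_subset_image[OF D(1,2)] by auto
    have "a \<in> cl N (fst ` T0)" using fin[OF T0(2,1)] D(3) T0(3) by simp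
    moreover have "cl N (fst ` T0) \<subseteq> cl N (fst ` T)"
      by (rule pregeometryD(3)[OF N image_mono[OF T0(1)] T1])
    ultimately show "a \<in> cl N (fst ` T)" by blast
  }
qed

lemma pregeometry_countable_cl:
  assumes N: "pregeometry V c" and fin: "\<And>D. finite D \<Longrightarrow> D \<subseteq> V \<Longrightarrow> countable (c D)"
    and X: "countable X" "X \<subseteq> V"
  shows "countable (c X)"
proof -
  have "countable {D. finite D \<and> D \<subseteq> X}"
    using countable_Collect_finite_subset[OF X(1)] by (simp add: conj_commute)
  then have "countable (\<Union>D\<in>{D. finite D \<and> D \<subseteq> X}. c D)"
    by (rule countable_UN) (use fin X in auto)
  then show ?thesis using pregeometryD(5)[OF N X(2)] by simp
qed

lemma pregeometry_closed_UN:
  assumes N: "pregeometry V c" and C: "mono (C :: nat \<Rightarrow> _)" "\<And>n. C n \<subseteq> V" "\<And>n. c (C n) = C n"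
  shows "c (\<Union>n. C n) = (\<Union>n. C n)"
proof
  have U: "(\<Union>n. C n) \<subseteq> V" using C by blast
  show "(\<Union>n. C n) \<subseteq> c (\<Union>n. C n)" by (rule pregeometryD(1)[OF N U])
  show "c (\<Union>n. C n) \<subseteq> (\<Union>n. C n)"
  proof
    fix v assume "v \<in> c (\<Union>n. C n)"
    then obtain D where D: "finite D" "D \<subseteq> (\<Union>n. C n)" "v \<in> c D" using pregeometry_finitary[OF N U] by metis
    obtain n where n: "D \<subseteq> C n" using finite_subset_mono_UN[OF C(1) D(1,2)] by blast
    have "c D \<subseteq> c (C n)" by (rule pregeometryD(3)[OF N n C(2)])
    then show "v \<in> (\<Union>n. C n)" using D(3) C(3) by auto
  qed
qed

section \<open>Back and forth in the generating structure\<close>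

locale quasiminimal_structure =
  fixes L :: "('f, 'r) lang" and M :: "('f, 'r, 'u) pstruct"
  assumes qm: "quasiminimal L M"
begin

abbreviation "UM \<equiv> univ M"

lemma struct: "is_struct L M" and pg: "pregeometry UM (cl M)"
  using qm by (auto simp: quasiminimal_def weakly_quasiminimal_def is_pstruct_def)

lemma QM1_pairs:
  assumes "finite T" "T \<subseteq> UM \<times> UM" "a \<in> UM" "a' \<in> UM" "pelem L M M (insert (a, a') T)"
  shows "a \<in> cl M (fst ` T) \<longleftrightarrow> a' \<in> cl M (snd ` T)"
proof -
  obtain ts where ts: "set ts = T" using finite_list[OF assms(1)] by blast
  have z: "set (zip (a # map fst ts) (a' # map snd ts)) = insert (a, a') T"
    using ts by (simp add: zip_map_fst_snd)
  have "qf_type_fin L M (a # map fst ts) = qf_type_fin L M (a' # map snd ts)"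
    using qf_type_eq_iff_pelem[of "a # map fst ts" "a' # map snd ts" L M "{}" "\<lambda>_. undefined" M "\<lambda>_. undefined"]
      assms(5) z by simp
  moreover have "fst ` T \<subseteq> UM" "snd ` T \<subseteq> UM" using assms(2) by auto
  then have "map fst ts \<in> lists UM" "map snd ts \<in> lists UM" using ts by (simp_all add: lists_eq_set)
  moreover have "QM1 L M" using qm by (simp add: quasiminimal_def weakly_quasiminimal_def)
  note this[unfolded QM1_def, rule_format, of a a' "map fst ts" "map snd ts"]
  ultimately have "a \<in> cl M (set (map fst ts)) \<longleftrightarrow> a' \<in> cl M (set (map snd ts))"
    using assms(3,4) by simp
  then show ?thesis using ts by simp
qed

lemma QM1_rel:
  assumes "T \<subseteq> UM \<times> UM" "a \<in> UM" "a' \<in> UM" "pelem L M M (insert (a, a') T)"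
  shows "a \<in> cl M (fst ` T) \<longleftrightarrow> a' \<in> cl M (snd ` T)"
  by (rule pelem_closure_iff[OF pg pg assms(1)], rule QM1_pairs)
    (use assms in \<open>auto intro: pelem_subset[OF assms(4)]\<close>)

lemma QM4_pairs:
  assumes S: "countable S" "closed_in M (fst ` S)" "closed_in M (snd ` S)" "pelem L M M S"
    and a: "a \<in> UM - fst ` S" "a' \<in> UM - snd ` S"
  shows "pelem L M M (insert (a, a') S)"
proof -
  obtain I :: "nat set" and h h' where I: "(\<lambda>i. (h i, h' i)) ` I = S" using countable_pairs_enum[OF S(1)] .
  have im: "h ` I = fst ` S" "h' ` I = snd ` S" by (auto simp: I[symmetric] image_image)
  have "qf_type L M I h [] = qf_type L M I h' []"
    using qf_type_eq_iff_pelem[of "[]" "[]" L M I h M h'] S(4) I by simp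
  moreover have "QM4 L M" using qm by (simp add: quasiminimal_def weakly_quasiminimal_def)
  note this[unfolded QM4_def, rule_format, of h I h' a a']
  ultimately have "qf_type L M I h [a] = qf_type L M I h' [a']"
    using S(2,3) a im by simp
  then show ?thesis
    using qf_type_eq_iff_pelem[of "[a]" "[a']" L M I h M h'] I by simp
qed

lemma QM5_pairs:
  assumes S: "countable S" "closed_in M (fst ` S)" "closed_in M (snd ` S)"
    and T: "finite T" "T \<subseteq> UM \<times> UM" "pelem L M M (S \<union> T)" and a: "a \<in> cl M (fst ` (S \<union> T))"
  obtains a' where "a' \<in> UM" "pelem L M M (insert (a, a') (S \<union> T))"
proof -
  obtain I :: "nat set" and h h' where I: "(\<lambda>i. (h i, h' i)) ` I = S" using countable_pairs_enum[OF S(1)] .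
  have im: "h ` I = fst ` S" "h' ` I = snd ` S" by (auto simp: I[symmetric] image_image)
  obtain ts where ts: "set ts = T" using finite_list[OF T(1)] by blast
  let ?b = "map fst ts" and ?b' = "map snd ts"
  have z: "set (zip ?b ?b') = T" using ts by (simp add: zip_map_fst_snd)
  have "qf_type L M I h [] = qf_type L M I h' []"
    using qf_type_eq_iff_pelem[of "[]" "[]" L M I h M h'] I pelem_subset[OF T(3)] by simp
  moreover have "qf_type L M I h ?b = qf_type L M I h' ?b'"
    using qf_type_eq_iff_pelem[of ?b ?b' L M I h M h'] I z T(3) by simp
  moreover have "fst ` T \<subseteq> UM" "snd ` T \<subseteq> UM" using T(2) by auto
  then have "?b \<in> lists UM" "?b' \<in> lists UM" using ts by (simp_all add: lists_eq_set)
  moreover have "a \<in> cl M (h ` I \<union> set ?b)" using a ts im by (simp add: image_Un)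
  moreover have "QM5 L M" using qm by (simp add: quasiminimal_def weakly_quasiminimal_def)
  note this[unfolded QM5_def, rule_format, of h I h' ?b ?b' a]
  ultimately have "\<exists>a'\<in>UM. qf_type L M I h (?b @ [a]) = qf_type L M I h' (?b' @ [a'])"
    using S(2,3) im by simp
  then obtain a' where a': "a' \<in> UM" "qf_type L M I h (?b @ [a]) = qf_type L M I h' (?b' @ [a'])" ..
  have "set (zip (?b @ [a]) (?b' @ [a'])) = insert (a, a') T" using z by simp
  then have "pelem L M M (insert (a, a') (S \<union> T))"
    using qf_type_eq_iff_pelem[of "?b @ [a]" "?b' @ [a']" L M I h M h'] a'(2) I by simp
  then show ?thesis using that a'(1) by blast
qed

lemma countable_cl_M: "countable X \<Longrightarrow> X \<subseteq> UM \<Longrightarrow> countable (cl M X)"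
  by (rule pregeometry_countable_cl[OF pg])
    (use qm in \<open>auto simp: quasiminimal_def weakly_quasiminimal_def QM3_def\<close>)

lemma finite_not_spanning: "finite X \<Longrightarrow> X \<subseteq> UM \<Longrightarrow> \<exists>u\<in>UM. u \<notin> cl M X"
proof -
  assume X: "finite X" "X \<subseteq> UM"
  have "cl M X \<noteq> UM" using qm X unfolding quasiminimal_def QM2_def finite_dimensional_def by blast
  moreover have "cl M X \<subseteq> UM" by (rule pregeometryD(2)[OF pg X(2)])
  ultimately show ?thesis by blast
qed

text \<open>(QM5) supplies the partner \<open>a'\<close>, and (QM1), applied over \<open>S\<close>
  and the pair \<open>(u, u')\<close>, puts it into the right closed set. The backward step is this
  one for the converse relations.\<close>

lemma forth_step:
  assumes S: "countable S" "closed_in M (fst ` S)" "closed_in M (snd ` S)" "S \<subseteq> UM \<times> UM"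
    and T: "finite T" "(u, u') \<in> T" "pelem L M M (S \<union> T)" "u \<in> UM" "u' \<in> UM"
      "T \<subseteq> cl M (insert u (fst ` S)) \<times> cl M (insert u' (snd ` S))"
    and a: "a \<in> cl M (insert u (fst ` S))"
  shows "\<exists>a'\<in>cl M (insert u' (snd ` S)). pelem L M M (S \<union> insert (a, a') T)"
proof -
  have V: "insert u (fst ` S) \<subseteq> UM" "insert u' (snd ` S) \<subseteq> UM" using S(4) T(4,5) by auto
  have CU: "cl M (insert u (fst ` S)) \<subseteq> UM" "cl M (insert u' (snd ` S)) \<subseteq> UM"
    using pregeometryD(2)[OF pg] V by auto
  have TU: "T \<subseteq> UM \<times> UM" using T(6) CU by blast
  have "insert u (fst ` S) \<subseteq> fst ` (S \<union> T)" using T(2) by force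
  moreover have "fst ` (S \<union> T) \<subseteq> UM" using TU S(4) by auto
  ultimately have "a \<in> cl M (fst ` (S \<union> T))" using pregeometryD(3)[OF pg] a by blast
  then obtain a' where a': "a' \<in> UM" "pelem L M M (insert (a, a') (S \<union> T))"
    using QM5_pairs[OF S(1-3) T(1) TU T(3)] by blast
  have "pelem L M M (insert (a, a') (insert (u, u') S))"
    by (rule pelem_subset[OF a'(2)]) (use T(2) in blast)
  then have "a \<in> cl M (fst ` insert (u, u') S) \<longleftrightarrow> a' \<in> cl M (snd ` insert (u, u') S)"
    using S(4) T(4,5) a' a CU by (intro QM1_rel) auto
  then have "a' \<in> cl M (insert u' (snd ` S))" using a by simp
  moreover have "S \<union> insert (a, a') T = insert (a, a') (S \<union> T)" by simp
  ultimately show ?thesis using a'(2) by (intro bexI[of _ a']) simp_all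
qed

text \<open>Back and forth: (QM4) provides the first step, (QM5) the others.\<close>

lemma extend_closed:
  assumes S: "countable S" "closed_in M (fst ` S)" "closed_in M (snd ` S)" "S \<subseteq> UM \<times> UM" "pelem L M M S"
    and u: "u \<in> UM - fst ` S" "u' \<in> UM - snd ` S"
  obtains S' where "insert (u, u') S \<subseteq> S'" "pelem L M M S'" "fst ` S' = cl M (insert u (fst ` S))"
    "snd ` S' = cl M (insert u' (snd ` S))"
proof -
  let ?C = "cl M (insert u (fst ` S))" and ?C' = "cl M (insert u' (snd ` S))"
  have V: "insert u (fst ` S) \<subseteq> UM" "insert u' (snd ` S) \<subseteq> UM" using S(4) u by auto
  have inC: "insert u (fst ` S) \<subseteq> ?C" "insert u' (snd ` S) \<subseteq> ?C'"
    using pregeometryD(1)[OF pg V(1)] pregeometryD(1)[OF pg V(2)] .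
  have cnt: "countable ?C" "countable ?C'" using V S(1) by (auto intro!: countable_cl_M)
  define Q where "Q T \<longleftrightarrow> finite T \<and> (u, u') \<in> T \<and> T \<subseteq> ?C \<times> ?C' \<and> pelem L M M (S \<union> T)" for T
  define \<D> where "\<D> = (\<lambda>a T. a \<in> fst ` T) ` ?C \<union> (\<lambda>a T. a \<in> snd ` T) ` ?C'"
  have Q0: "Q {(u, u')}"
    using QM4_pairs[OF S(1-3,5) u] inC by (simp add: Q_def)
  have cD: "countable \<D>" unfolding \<D>_def by (intro countable_Un countable_image cnt)
  have dense: "\<exists>T'. T \<subseteq> T' \<and> Q T' \<and> D T'" if D: "D \<in> \<D>" and Q: "Q T" for D T
  proof -
    have T: "finite T" "(u, u') \<in> T" "T \<subseteq> ?C \<times> ?C'" "pelem L M M (S \<union> T)"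
      using Q by (simp_all add: Q_def)
    consider a where "D = (\<lambda>T. a \<in> fst ` T)" "a \<in> ?C" | a where "D = (\<lambda>T. a \<in> snd ` T)" "a \<in> ?C'"
      using D by (auto simp: \<D>_def)
    then show ?thesis
    proof cases
      case (1 a)
      obtain a' where a': "a' \<in> ?C'" "pelem L M M (S \<union> insert (a, a') T)"
        using forth_step[OF S(1-4) T(1,2,4) _ _ T(3) 1(2)] u by blast
      then have "Q (insert (a, a') T)" using T 1(2) by (simp add: Q_def)
      then show ?thesis unfolding 1(1) by (intro exI[of _ "insert (a, a') T"]) auto
    next
      case (2 a')
      have c: "fst ` (converse X) = snd ` X" "snd ` (converse X) = fst ` X" for X :: "('u \<times> 'u) set" by force+
      have "\<exists>a\<in>cl M (insert u (snd ` converse S)). pelem L M M (converse S \<union> insert (a', a) (converse T))"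
      proof (rule forth_step)
        show "countable (converse S)" 
        proof -
          have "converse S = (\<lambda>(x, y). (y, x)) ` S" by auto
          then show ?thesis using S(1) by simp
        qed
        show "pelem L M M (converse S \<union> converse T)"
          using pelem_converse[OF T(4)] by (simp add: converse_Un)
      qed (use S T u 2(2) in \<open>auto simp: c\<close>)
      then obtain a where a: "a \<in> ?C" "pelem L M M (converse S \<union> insert (a', a) (converse T))" by (auto simp: c)
      have "converse (converse S \<union> insert (a', a) (converse T)) = S \<union> insert (a, a') T" by auto
      then have "pelem L M M (S \<union> insert (a, a') T)" using pelem_converse[OF a(2)] by simp
      then have "Q (insert (a, a') T)" using T 2(2) a(1) by (simp add: Q_def)
      then show ?thesis unfolding 2(1) by (intro exI[of _ "insert (a, a') T"]) auto
    qed
  qed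
  obtain X :: "nat \<Rightarrow> ('u \<times> 'u) set" where X: "mono X" "\<And>n. Q (X n)" "\<And>D. D \<in> \<D> \<Longrightarrow> \<exists>n. D (X n)"
  proof (rule generic_chain[of Q "{(u, u')}" \<D>, OF Q0 cD])
    show "\<exists>T'. T \<subseteq> T' \<and> Q T' \<and> D T'" if "D \<in> \<D>" "Q T" for D T using dense[OF that] .
  next
    fix X :: "nat \<Rightarrow> ('u \<times> 'u) set"
    assume "incseq X" "\<And>n. Q (X n)" "\<And>D. D \<in> \<D> \<Longrightarrow> \<exists>n. D (X n)"
    then show thesis by (rule that[of X])
  qed
  define S' where "S' = (\<Union>n. S \<union> X n)"
  have "mono (\<lambda>n. S \<union> X n)" using X(1) by (auto simp: mono_def)
  then have 1: "pelem L M M S'" unfolding S'_def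
    by (rule pelem_UN_mono) (use X(2) in \<open>simp add: Q_def\<close>)
  have 2: "insert (u, u') S \<subseteq> S'" using X(2)[of 0] by (auto simp: S'_def Q_def)
  have XC: "X n \<subseteq> ?C \<times> ?C'" for n using X(2)[of n] by (simp add: Q_def)
  have SC: "S \<subseteq> ?C \<times> ?C'" using inC by force
  have sub: "S' \<subseteq> ?C \<times> ?C'" using XC SC unfolding S'_def by blast
  have f: "?C \<subseteq> fst ` S'"
  proof
    fix a assume "a \<in> ?C"
    then have "(\<lambda>T. a \<in> fst ` T) \<in> \<D>" by (auto simp: \<D>_def)
    from X(3)[OF this] obtain n where "a \<in> fst ` X n" by blast
    then show "a \<in> fst ` S'" by (auto simp: S'_def)
  qed
  have s: "?C' \<subseteq> snd ` S'"
  proof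
    fix a assume "a \<in> ?C'"
    then have "(\<lambda>T. a \<in> snd ` T) \<in> \<D>" by (auto simp: \<D>_def)
    from X(3)[OF this] obtain n where "a \<in> snd ` X n" by blast
    then show "a \<in> snd ` S'" by (auto simp: S'_def)
  qed
  have f': "fst ` S' \<subseteq> ?C" and s': "snd ` S' \<subseteq> ?C'" using sub by auto
  show ?thesis using that[OF 2 1] f s f' s' by blast
qed

text \<open>By the uniqueness of generic types a closed set is closed under the functions of the language:
  the value \<open>f xs\<close>, if generic, would be equal to every other generic element.\<close>

lemma fint_in_cl:
  assumes f: "f \<in> fsyms L" and xs: "xs \<in> tuples UM (far L f)"
  shows "fint M f xs \<in> cl M (set xs)"
proof (rule ccontr)
  assume n: "fint M f xs \<notin> cl M (set xs)"
  let ?H = "cl M (set xs)" and ?a = "fint M f xs"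
  have X: "set xs \<subseteq> UM" "length xs = far L f" using xs by (auto simp: tuples_def)
  have a: "?a \<in> UM" using struct f xs by (simp add: is_struct_def)
  \<comment> \<open>The closure includes the value itself, so that \<open>a'\<close> is generic over
    \<open>?H\<close> and also different from the value.\<close>
  obtain a' where a': "a' \<in> UM" "a' \<notin> cl M (insert ?a (set xs))"
    using finite_not_spanning[of "insert ?a (set xs)"] a X by auto
  have V: "insert ?a (set xs) \<subseteq> UM" using a X by simp
  have "?H \<subseteq> cl M (insert ?a (set xs))" by (rule pregeometryD(3)[OF pg _ V]) auto
  then have "a' \<notin> ?H" using a' by blast
  have "?a \<in> cl M (insert ?a (set xs))" using pregeometryD(1)[OF pg V] by simp
  then have ne: "?a \<noteq> a'" using a' by metis
  have H: "?H \<subseteq> UM" "cl M ?H = ?H" "set xs \<subseteq> ?H" using pregeometryD[OF pg] X by simp_all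
  have im: "fst ` (Id_on ?H) = ?H" "snd ` (Id_on ?H) = ?H" by (force simp: Id_on_def)+
  have cl: "closed_in M (fst ` Id_on ?H)" "closed_in M (snd ` Id_on ?H)"
    using H unfolding im closed_in_def by simp_all
  have "countable ?H" using X by (intro countable_cl_M) (auto simp: countable_finite)
  then have cnt: "countable (Id_on ?H)" by (simp add: Id_on_def)
  have pe: "pelem L M M (Id_on ?H)" unfolding pelem_def
  proof (intro allI impI)
    fix p :: "('f, 'r, nat + nat) qff" and s s'
    assume "\<forall>v\<in>vars_qff p. (s v, s' v) \<in> Id_on ?H"
    then show "holds M s p = holds M s' p" by (intro holds_cong) auto
  qed
  have "pelem L M M (insert (?a, a') (Id_on ?H))"
    by (rule QM4_pairs[OF cnt cl pe]) (use n a a' \<open>a' \<notin> ?H\<close> im in auto)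
  from pelem_fint[OF this f X(2) X(2), of ?a a'] have "?a = a'"
    using H(3) by (auto simp: zip_same_conv_map Id_on_def)
  then show False using ne by simp
qed

end

lemma closed_submodelD:
  assumes "closed_submodel L A N"
  shows "univ A \<subseteq> univ N" "X \<subseteq> univ A \<Longrightarrow> cl A X = cl N X" "cl N (univ A) = univ A" "is_pstruct L A" "is_pstruct L N"
  using assms by (auto simp: closed_submodel_def closed_embedding_def closed_in_def)

lemma is_pstructD: "is_pstruct L N \<Longrightarrow> is_struct L N" "is_pstruct L N \<Longrightarrow> pregeometry (univ N) (cl N)"
  by (simp_all add: is_pstruct_def)

lemma restrict_closed:
  fixes N :: "('f, 'r, 'a) pstruct"
  assumes N: "is_pstruct L N" and Z: "Z \<subseteq> univ N" "cl N Z = Z"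
    and f: "\<And>f xs. f \<in> fsyms L \<Longrightarrow> xs \<in> tuples Z (far L f) \<Longrightarrow> fint N f xs \<in> Z"
  shows "closed_submodel L (N\<lparr>univ := Z\<rparr>) N"
  unfolding closed_submodel_def closed_embedding_def
proof (intro conjI)
  show "is_pstruct L (N\<lparr>univ := Z\<rparr>)"
    using f pregeometry_closed_subset[OF is_pstructD(2)[OF N] Z] by (simp add: is_pstruct_def is_struct_def)
  show "is_pstruct L N" by (rule N)
  show "fo_embedding L (\<lambda>x. x) (N\<lparr>univ := Z\<rparr>) N" using Z by (simp add: fo_embedding_def)
  show "closed_in N ((\<lambda>x. x) ` univ (N\<lparr>univ := Z\<rparr>))" using Z by (simp add: closed_in_def)
qed simp

section \<open>Embedding members of the class into the generating structure\<close>

context quasiminimal_structure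
begin

text \<open>With \<open>Y = Z\<close> the last clause says that the image of \<open>Z\<close> is
  closed in \<open>M\<close>. Outside \<open>Z\<close> the map is arbitrary.\<close>

definition closed_emb :: "('f, 'r, 'u) pstruct \<Rightarrow> 'u set \<Rightarrow> ('u \<Rightarrow> 'u) \<Rightarrow> bool" where
  "closed_emb N Z e \<longleftrightarrow> Z \<subseteq> univ N \<and> cl N Z = Z \<and> e ` Z \<subseteq> UM \<and> pelem L N M ((\<lambda>x. (x, e x)) ` Z) \<and>
     (\<forall>Y\<subseteq>Z. e ` cl N Y = cl M (e ` Y))"

text \<open>This is the invariant that passes to unions of chains, because a finite subset of the
  union lies in one member. An embedding of all of \<open>N\<close> could not be the invariant, as
  unions may outgrow \<open>M\<close>.\<close>

definition locally_embeds :: "('f, 'r, 'u) pstruct \<Rightarrow> bool" where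
  "locally_embeds N \<longleftrightarrow> is_pstruct L N \<and> (\<forall>X. finite X \<longrightarrow> X \<subseteq> univ N \<longrightarrow> (\<exists>e. closed_emb N (cl N X) e))"

lemma closed_embD:
  assumes "closed_emb N Z e"
  shows "Z \<subseteq> univ N" "cl N Z = Z" "e ` Z \<subseteq> UM" "pelem L N M ((\<lambda>x. (x, e x)) ` Z)"
    "Y \<subseteq> Z \<Longrightarrow> e ` cl N Y = cl M (e ` Y)"
  using assms by (simp_all add: closed_emb_def)

lemma locally_embedsE:
  assumes "locally_embeds N" "finite X" "X \<subseteq> univ N"
  obtains e where "closed_emb N (cl N X) e"
  using assms unfolding locally_embeds_def by blast

lemma closed_emb_inj: "closed_emb N Z e \<Longrightarrow> inj_on e Z"
proof (rule inj_onI)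
  fix x y assume e: "closed_emb N Z e" and xy: "x \<in> Z" "y \<in> Z" "e x = e y"
  have "x = y \<longleftrightarrow> e x = e y" by (rule pelem_eq[OF closed_embD(4)[OF e]]) (use xy in auto)
  then show "x = y" using xy(3) by simp
qed

lemma closed_emb_of_embedding:
  assumes g: "closed_embedding L g N M" and X: "X \<subseteq> univ N"
  shows "closed_emb N (cl N X) g"
proof -
  have N: "is_pstruct L N" and gf: "fo_embedding L g N M" and c: "\<forall>X\<subseteq>univ N. g ` cl N X = cl M (g ` X)"
    using g by (simp_all add: closed_embedding_def)
  note p = pregeometryD[OF is_pstructD(2)[OF N]]
  have Z: "cl N X \<subseteq> univ N" using p(2)[OF X] .
  have im: "g ` univ N \<subseteq> UM" using gf by (simp add: fo_embedding_def)
  have "pelem L N M ((\<lambda>x. (x, g x)) ` cl N X)"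
    by (rule pelem_subset[OF embedding_pelem[OF is_pstructD(1)[OF N] gf]]) (use Z in blast)
  then show ?thesis using Z p(4)[OF X] im c unfolding closed_emb_def by (auto 0 3 dest: order_trans)
qed

lemma closed_emb_transfer:
  assumes e: "closed_emb N Z e" and g: "closed_embedding L g N N'"
  shows "closed_emb N' (g ` Z) (\<lambda>y. e (inv_into (univ N) g y))"
proof -
  have N: "is_pstruct L N" and N': "is_pstruct L N'" and gf: "fo_embedding L g N N'"
    and c: "\<And>X. X \<subseteq> univ N \<Longrightarrow> g ` cl N X = cl N' (g ` X)"
    using g by (simp_all add: closed_embedding_def)
  have gi: "inj_on g (univ N)" and gU: "g ` univ N \<subseteq> univ N'" using gf by (simp_all add: fo_embedding_def)
  note E = closed_embD[OF e]
  let ?i = "inv_into (univ N) g"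
  have ig: "?i (g x) = x" if "x \<in> Z" for x using that E(1) gi by (intro inv_into_f_f) auto
  show ?thesis unfolding closed_emb_def
  proof (intro conjI allI impI)
    show "g ` Z \<subseteq> univ N'" using E(1) gU by blast
    show "cl N' (g ` Z) = g ` Z" using c[OF E(1)] E(2) by simp
    show "(\<lambda>y. e (?i y)) ` g ` Z \<subseteq> UM" using E(3) ig by auto
    have "pelem L N' N (converse ((\<lambda>x. (x, g x)) ` univ N))"
      by (rule pelem_converse[OF embedding_pelem[OF is_pstructD(1)[OF N] gf]])
    from pelem_comp[OF this E(4)]
    show "pelem L N' M ((\<lambda>y. (y, e (?i y))) ` g ` Z)"
    proof (rule pelem_subset, intro subsetI)
      fix p assume "p \<in> (\<lambda>y. (y, e (?i y))) ` g ` Z"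
      then obtain x where x: "x \<in> Z" "p = (g x, e x)" using ig by auto
      moreover have "(g x, x) \<in> converse ((\<lambda>x. (x, g x)) ` univ N)" using x(1) E(1) by auto
      ultimately show "p \<in> converse ((\<lambda>x. (x, g x)) ` univ N) O (\<lambda>x. (x, e x)) ` Z" by blast
    qed
    fix Y assume "Y \<subseteq> g ` Z"
    then obtain Y0 where Y0: "Y0 \<subseteq> Z" "Y = g ` Y0" by (auto simp: subset_image_iff)
    have "cl N Y0 \<subseteq> cl N Z" by (rule pregeometryD(3)[OF is_pstructD(2)[OF N] Y0(1) E(1)])
    then have Yc: "cl N Y0 \<subseteq> Z" using E(2) by simp
    have im: "(\<lambda>y. e (?i y)) ` g ` W = e ` W" if "W \<subseteq> Z" for W
      using that ig by (force simp: image_iff)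
    have "Y0 \<subseteq> univ N" using Y0(1) E(1) by blast
    then have "cl N' Y = g ` cl N Y0" using c Y0(2) by simp
    then show "(\<lambda>y. e (?i y)) ` cl N' Y = cl M ((\<lambda>y. e (?i y)) ` Y)"
      using im[OF Yc] im[OF Y0(1)] E(5)[OF Y0(1)] Y0(2) by simp
  qed
qed

lemma locally_embeds_M: "locally_embeds M"
proof -
  have "closed_embedding L (\<lambda>x. x) M M"
    using struct pg pregeometryD(4)[OF pg] pregeometryD(1,2)[OF pg, of UM]
    by (auto simp: closed_embedding_def is_pstruct_def fo_embedding_def closed_in_def)
  then show ?thesis using struct pg closed_emb_of_embedding
    unfolding locally_embeds_def is_pstruct_def by blast
qed

lemma locally_embeds_iso:
  assumes "locally_embeds N" "pstruct_iso L g N N'"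
  shows "locally_embeds N'"
  unfolding locally_embeds_def
proof (intro conjI allI impI)
  have g: "closed_embedding L g N N'" "g ` univ N = univ N'" using assms(2) by (simp_all add: pstruct_iso_def)
  then show "is_pstruct L N'" by (simp add: closed_embedding_def)
  fix X assume X: "finite X" "X \<subseteq> univ N'"
  then obtain Y where Y: "Y \<subseteq> univ N" "finite Y" "X = g ` Y"
    using finite_subset_image[of X g "univ N"] g(2) by auto
  obtain e where e: "closed_emb N (cl N Y) e" using locally_embedsE[OF assms(1) Y(2,1)] by blast
  have "g ` cl N Y = cl N' X" using g(1) Y by (simp add: closed_embedding_def)
  then show "\<exists>e. closed_emb N' (cl N' X) e" using closed_emb_transfer[OF e g(1)] by auto
qed

lemma locally_embeds_union:
  assumes C: "\<And>A. A \<in> C \<Longrightarrow> locally_embeds A" "is_chain_union L C N"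
  shows "locally_embeds N"
  unfolding locally_embeds_def
proof (intro conjI allI impI)
  have ne: "C \<noteq> {}" and ch: "\<And>A B. A \<in> C \<Longrightarrow> B \<in> C \<Longrightarrow> closed_submodel L A B \<or> closed_submodel L B A"
    and N: "is_pstruct L N" and U: "univ N = (\<Union>A\<in>C. univ A)" and sub: "\<And>A. A \<in> C \<Longrightarrow> closed_submodel L A N"
    using C(2) by (simp_all add: is_chain_union_def)
  show "is_pstruct L N" by (rule N)
  fix X assume X: "finite X" "X \<subseteq> univ N"
  then have "\<exists>A\<in>C. X \<subseteq> univ A" unfolding U
  proof (induction X rule: finite_induct)
    case empty
    then show ?case using ne by auto
  next
    case (insert x X)
    then obtain A B where AB: "A \<in> C" "X \<subseteq> univ A" "B \<in> C" "x \<in> univ B" by auto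
    then have "univ A \<subseteq> univ B \<or> univ B \<subseteq> univ A" using ch closed_submodelD(1) by blast
    then show ?case using AB by blast
  qed
  then obtain A where A: "A \<in> C" "X \<subseteq> univ A" by blast
  have s: "closed_embedding L (\<lambda>x. x) A N" using sub[OF A(1)] by (simp add: closed_submodel_def)
  obtain e where e: "closed_emb A (cl A X) e" using locally_embedsE[OF C(1)[OF A(1)] X(1) A(2)] by blast
  have "(\<lambda>x. x) ` cl A X = cl N X" using closed_submodelD(2)[OF sub[OF A(1)] A(2)] by simp
  then show "\<exists>e. closed_emb N (cl N X) e" using closed_emb_transfer[OF e s] by auto
qed

lemma Kclass_locally_embeds: "N \<in> Kclass L M \<Longrightarrow> locally_embeds N"
proof (induction rule: Kclass.induct)
  case (minus N)
  then show ?case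
  proof (induction rule: Kminus.induct)
    case self
    show ?case by (rule locally_embeds_M)
  next
    case (closed N)
    then have "closed_embedding L (\<lambda>x. x) N M" by (simp add: closed_submodel_def)
    moreover from this have "is_pstruct L N" by (simp add: closed_embedding_def)
    ultimately show ?case using closed_emb_of_embedding unfolding locally_embeds_def by blast
  qed (rule locally_embeds_iso)
next
  case (union C N)
  then show ?case using locally_embeds_union by blast
qed (rule locally_embeds_iso)

text \<open>A local embedding of the closed set generated by \<open>a\<close> and the domain of
  \<open>T\<close> turns a relation between \<open>N\<close> and \<open>M\<close> into one inside
  \<open>M\<close>, where (QM1) is available.\<close>

lemma cross_QM1_finite:
  assumes N: "locally_embeds N" and T: "finite T" "T \<subseteq> univ N \<times> UM" "a \<in> univ N" "a' \<in> UM"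
    "pelem L N M (insert (a, a') T)"
  shows "a \<in> cl N (fst ` T) \<longleftrightarrow> a' \<in> cl M (snd ` T)"
proof -
  have Np: "pregeometry (univ N) (cl N)" using N by (simp add: locally_embeds_def is_pstruct_def)
  have sub: "insert a (fst ` T) \<subseteq> univ N" using T by auto
  let ?Z = "cl N (insert a (fst ` T))"
  obtain e where e: "closed_emb N ?Z e" using locally_embedsE[OF N _ sub] T(1) by blast
  note E = closed_embD[OF e]
  have inZ: "insert a (fst ` T) \<subseteq> ?Z" by (rule pregeometryD(1)[OF Np sub])
  define T' where "T' = (\<lambda>(x, y). (e x, y)) ` T"
  have im: "fst ` T' = e ` fst ` T" "snd ` T' = snd ` T" by (force simp: T'_def image_iff)+
  have "pelem L M M (converse ((\<lambda>x. (x, e x)) ` ?Z) O insert (a, a') T)"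
    by (rule pelem_comp[OF pelem_converse[OF E(4)] T(5)])
  then have "pelem L M M (insert (e a, a') T')"
    by (rule pelem_subset) (use inZ in \<open>force simp: T'_def relcomp_unfold\<close>)
  moreover have "T' \<subseteq> UM \<times> UM" "e a \<in> UM" using E(3) T(2) inZ by (force simp: T'_def)+
  moreover have "finite T'" using T(1) by (simp add: T'_def)
  ultimately have "e a \<in> cl M (e ` fst ` T) \<longleftrightarrow> a' \<in> cl M (snd ` T)"
    using QM1_pairs[of T' "e a" a'] T(4) im by simp
  moreover have fZ: "fst ` T \<subseteq> ?Z" using inZ by simp
  then have "cl M (e ` fst ` T) = e ` cl N (fst ` T)" using E(5) by simp
  moreover have "cl N (fst ` T) \<subseteq> ?Z" by (rule pregeometryD(3)[OF Np _ sub]) auto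
  then have "e a \<in> e ` cl N (fst ` T) \<longleftrightarrow> a \<in> cl N (fst ` T)"
    using inj_on_image_mem_iff[OF closed_emb_inj[OF e]] inZ by simp
  ultimately show ?thesis by simp
qed

lemma cross_QM1:
  assumes N: "locally_embeds N" and T: "T \<subseteq> univ N \<times> UM" "a \<in> univ N" "a' \<in> UM"
    "pelem L N M (insert (a, a') T)"
  shows "a \<in> cl N (fst ` T) \<longleftrightarrow> a' \<in> cl M (snd ` T)"
proof (rule pelem_closure_iff[OF _ pg T(1)])
  show "pregeometry (univ N) (cl N)" using N by (simp add: locally_embeds_def is_pstruct_def)
  fix T0 assume T0: "finite T0" "T0 \<subseteq> T"
  have "pelem L N M (insert (a, a') T0)" by (rule pelem_subset[OF T(4)]) (use T0 in auto)
  then show "a \<in> cl N (fst ` T0) \<longleftrightarrow> a' \<in> cl M (snd ` T0)"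
    using T0 T by (intro cross_QM1_finite[OF N]) auto
qed

lemma countable_cl_finite_N:
  assumes N: "locally_embeds N" "finite X" "X \<subseteq> univ N"
  shows "countable (cl N X)"
proof -
  obtain e where e: "closed_emb N (cl N X) e" using locally_embedsE[OF N] by blast
  have Np: "pregeometry (univ N) (cl N)" using N by (simp add: locally_embeds_def is_pstruct_def)
  have X: "X \<subseteq> cl N X" by (rule pregeometryD(1)[OF Np N(3)])
  have "e ` X \<subseteq> UM" using closed_embD(3)[OF e] X by blast
  then have "countable (cl M (e ` X))" using N(2) by (intro countable_cl_M) (auto simp: countable_finite)
  then have "countable (e ` cl N X)" using closed_embD(5)[OF e X] by simp
  then show ?thesis by (rule countable_image_inj_on[OF _ closed_emb_inj[OF e]])
qed

lemma countable_cl_N: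
  assumes N: "locally_embeds N" "countable X" "X \<subseteq> univ N"
  shows "countable (cl N X)"
  by (rule pregeometry_countable_cl[OF _ countable_cl_finite_N[OF N(1)] N(2,3)])
    (use N in \<open>auto simp: locally_embeds_def is_pstruct_def\<close>)

lemma pelem_functional: "pelem L N N' S \<Longrightarrow> (x, y) \<in> S \<Longrightarrow> (x, y') \<in> S \<Longrightarrow> y = y'"
  using pelem_eq[of L N N' S x y x y'] by simp

lemma pelem_inj_fst: "pelem L N N' S \<Longrightarrow> inj_on fst S"
  by (auto intro!: inj_onI dest: pelem_functional)

text \<open>The finite generating set \<open>D\<close> keeps the range finite-dimensional, so that
  \<open>M\<close> still has a generic point for the next step.\<close>

definition partial_emb :: "('f, 'r, 'u) pstruct \<Rightarrow> 'u set \<Rightarrow> ('u \<times> 'u) set \<Rightarrow> bool" where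
  "partial_emb N D S \<longleftrightarrow> finite D \<and> D \<subseteq> univ N \<and> fst ` S = cl N D \<and> snd ` S \<subseteq> UM \<and>
     cl M (snd ` S) = snd ` S \<and> pelem L N M S"

text \<open>There is an embedding \<open>e\<close> of the closure of \<open>D\<close> and
  \<open>x\<close>, but it need not extend \<open>S\<close>. The discrepancy between the two is the
  relation \<open>T\<close> inside \<open>M\<close>; \<open>extend_closed\<close> prolongs it to
  \<open>e x\<close>, and composing the result with \<open>e\<close> gives an extension of
  \<open>S\<close>.\<close>

lemma partial_emb_extend:
  assumes N: "locally_embeds N" and S: "partial_emb N D S" and x: "x \<in> univ N"
  shows "\<exists>S'. S \<subseteq> S' \<and> partial_emb N (insert x D) S'"
proof -
  have Np: "pregeometry (univ N) (cl N)" using N by (simp add: locally_embeds_def is_pstruct_def)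
  have D: "finite D" "D \<subseteq> univ N" and S': "fst ` S = cl N D" "snd ` S \<subseteq> UM" "cl M (snd ` S) = snd ` S" "pelem L N M S"
    using S by (simp_all add: partial_emb_def)
  have clD: "cl N D \<subseteq> univ N" "D \<subseteq> cl N D" "cl N (cl N D) = cl N D" using pregeometryD[OF Np] D by auto
  have xD: "insert x D \<subseteq> univ N" "finite (insert x D)" using D x by auto
  show ?thesis
  proof (cases "x \<in> cl N D")
    case True
    have "cl N (insert x D) \<subseteq> cl N (cl N D)" by (rule pregeometryD(3)[OF Np _ clD(1)]) (use True clD in auto)
    moreover have "cl N D \<subseteq> cl N (insert x D)" by (rule pregeometryD(3)[OF Np _ xD(1)]) auto
    ultimately have "cl N (insert x D) = cl N D" using clD by auto
    then show ?thesis using S xD by (intro exI[of _ S]) (simp add: partial_emb_def)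
  next
    case False
    let ?Z = "cl N (insert x D)"
    obtain e where e: "closed_emb N ?Z e" using locally_embedsE[OF N xD(2,1)] by blast
    note E = closed_embD[OF e]
    have inZ: "insert x D \<subseteq> ?Z" by (rule pregeometryD(1)[OF Np xD(1)])
    have DZ: "cl N D \<subseteq> ?Z" by (rule pregeometryD(3)[OF Np _ xD(1)]) auto
    define T where "T = (\<lambda>(z, y). (e z, y)) ` S"
    have im: "fst ` T = e ` cl N D" "snd ` T = snd ` S" using S'(1) by (force simp: T_def image_iff)+
    have "pelem L M M (converse ((\<lambda>x. (x, e x)) ` ?Z) O S)"
      by (rule pelem_comp[OF pelem_converse[OF E(4)] S'(4)])
    moreover have "T \<subseteq> converse ((\<lambda>x. (x, e x)) ` ?Z) O S"
    proof
      fix p assume "p \<in> T"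
      then obtain z y where zy: "p = (e z, y)" "(z, y) \<in> S" by (auto simp: T_def)
      then have "z \<in> ?Z" using S'(1) DZ by force
      then show "p \<in> converse ((\<lambda>x. (x, e x)) ` ?Z) O S" using zy by auto
    qed
    ultimately have pT: "pelem L M M T" by (rule pelem_subset)
    have "countable (fst ` S)" using countable_cl_finite_N[OF N D] S'(1) by simp
    then have "countable S" by (rule countable_image_inj_on[OF _ pelem_inj_fst[OF S'(4)]])
    then have cT: "countable T" by (simp add: T_def)
    have ecl: "e ` cl N D = cl M (e ` D)" using E(5)[of D] inZ by simp
    have eD: "e ` D \<subseteq> UM" "e ` cl N D \<subseteq> UM" using E(3) inZ DZ by blast+
    have clT: "closed_in M (fst ` T)" "closed_in M (snd ` T)"
      using pregeometryD(2,4)[OF pg eD(1)] S'(2,3) ecl unfolding im closed_in_def by simp_all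
    have TU: "T \<subseteq> UM \<times> UM"
    proof
      fix p assume "p \<in> T"
      then have "fst p \<in> fst ` T" "snd p \<in> snd ` T" by auto
      then show "p \<in> UM \<times> UM" using im eD S'(2) by (cases p) auto
    qed
    have ex: "e x \<in> UM - fst ` T"
      using E(3) inZ False inj_on_image_mem_iff[OF closed_emb_inj[OF e], of x "cl N D"] DZ im by auto
    \<comment> \<open>The part of \<open>S\<close> over \<open>D\<close> is finite and, by (QM1)
      across the two structures, its range spans that of \<open>S\<close>. So a point outside the
      range of \<open>S\<close> exists.\<close>
    define T0 where "T0 = {p \<in> S. fst p \<in> D}"
    have T0: "fst ` T0 = D" using clD(2) S'(1) by (force simp: T0_def)
    have "inj_on fst T0" by (rule inj_on_subset[OF pelem_inj_fst[OF S'(4)]]) (auto simp: T0_def)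
    then have "finite T0" by (rule finite_imageD[rotated]) (simp add: T0 D)
    moreover have T0U: "T0 \<subseteq> univ N \<times> UM" using S'(1,2) clD(1) by (force simp: T0_def)
    then have "snd ` T0 \<subseteq> UM" by auto
    ultimately obtain u' where u': "u' \<in> UM" "u' \<notin> cl M (snd ` T0)"
      using finite_not_spanning[of "snd ` T0"] by auto
    have "snd ` S \<subseteq> cl M (snd ` T0)"
    proof
      fix y assume "y \<in> snd ` S"
      then obtain z where z: "(z, y) \<in> S" by auto
      then have zD: "z \<in> cl N (fst ` T0)" "z \<in> univ N" "y \<in> UM" using S'(1,2) T0 clD(1) by force+
      have "pelem L N M (insert (z, y) T0)" by (rule pelem_subset[OF S'(4)]) (use z in \<open>auto simp: T0_def\<close>)
      from cross_QM1[OF N T0U zD(2,3) this] show "y \<in> cl M (snd ` T0)" using zD by simp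
    qed
    then have u'S: "u' \<in> UM - snd ` T" using u' im by auto
    obtain S1 where S1: "insert (e x, u') T \<subseteq> S1" "pelem L M M S1"
        "fst ` S1 = cl M (insert (e x) (fst ` T))" "snd ` S1 = cl M (insert u' (snd ` T))"
      by (rule extend_closed[OF cT clT TU pT ex u'S])
    define S2 where "S2 = {(z, t). z \<in> ?Z \<and> (e z, t) \<in> S1}"
    have 1: "S \<subseteq> S2"
    proof
      fix p assume p: "p \<in> S"
      then have "fst p \<in> ?Z" using S'(1) DZ by force
      moreover have "(e (fst p), snd p) \<in> T" using p by (force simp: T_def)
      ultimately show "p \<in> S2" using S1(1) by (auto simp: S2_def case_prod_unfold)
    qed
    have V: "insert (e x) (fst ` T) \<subseteq> UM" "insert u' (snd ` T) \<subseteq> UM" using TU ex u'S by auto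
    have f1: "fst ` S1 \<subseteq> e ` ?Z"
    proof -
      have "insert (e x) (fst ` T) \<subseteq> e ` ?Z" using inZ DZ im by auto
      then have "fst ` S1 \<subseteq> cl M (e ` ?Z)" unfolding S1(3) by (rule pregeometryD(3)[OF pg _ E(3)])
      then show ?thesis using E(5)[OF subset_refl] E(2) by simp
    qed
    have f2: "e ` ?Z \<subseteq> fst ` S1"
    proof -
      have "e ` ?Z = cl M (e ` insert x D)" by (rule E(5)[OF inZ])
      also have "\<dots> \<subseteq> cl M (insert (e x) (fst ` T))"
        by (rule pregeometryD(3)[OF pg _ V(1)]) (use im clD in auto)
      finally show ?thesis using S1(3) by simp
    qed
    have "fst ` S2 = ?Z"
    proof
      show "fst ` S2 \<subseteq> ?Z" by (auto simp: S2_def)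
      show "?Z \<subseteq> fst ` S2"
      proof
        fix z assume z: "z \<in> ?Z"
        then have "e z \<in> fst ` S1" using f2 by blast
        then obtain t where "(e z, t) \<in> S1" by auto
        then have "(z, t) \<in> S2" using z by (simp add: S2_def)
        then show "z \<in> fst ` S2" by force
      qed
    qed
    moreover have "snd ` S2 = snd ` S1"
    proof
      show "snd ` S2 \<subseteq> snd ` S1" by (force simp: S2_def)
      show "snd ` S1 \<subseteq> snd ` S2"
      proof
        fix t assume "t \<in> snd ` S1"
        then obtain w where w: "(w, t) \<in> S1" by auto
        then have "w \<in> e ` ?Z" using f1 by force
        then obtain z where "z \<in> ?Z" "w = e z" by blast
        then have "(z, t) \<in> S2" using w by (simp add: S2_def)
        then show "t \<in> snd ` S2" by force
      qed
    qed
    moreover have "cl M (snd ` S1) = snd ` S1" "snd ` S1 \<subseteq> UM"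
      unfolding S1(4) using pregeometryD(2,4)[OF pg V(2)] by simp_all
    moreover have "pelem L N M ((\<lambda>x. (x, e x)) ` ?Z O S1)" by (rule pelem_comp[OF E(4) S1(2)])
    then have "pelem L N M S2" by (rule pelem_subset) (auto simp: S2_def relcomp_unfold)
    ultimately have "partial_emb N (insert x D) S2" using xD by (simp add: partial_emb_def)
    then show ?thesis using 1 by blast
  qed
qed

text \<open>Finitely generated closed sets embed separately; \<open>partial_emb_extend\<close> makes
  the embeddings cohere along an enumeration of \<open>X\<close>. The union has closed range and
  respects closure.\<close>

lemma countable_embeds:
  assumes N: "locally_embeds N" and X: "countable X" "X \<subseteq> univ N"
  obtains e where "closed_emb N (cl N X) e"
proof -
  have Np: "pregeometry (univ N) (cl N)" using N by (simp add: locally_embeds_def is_pstruct_def)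
  define Q where "Q S \<longleftrightarrow> (\<exists>D\<subseteq>X. partial_emb N D S)" for S
  define \<D> where "\<D> = (\<lambda>x (S :: ('u \<times> 'u) set). x \<in> fst ` S) ` X"
  have cD: "countable \<D>" unfolding \<D>_def by (intro countable_image X)
  obtain e0 where e0: "closed_emb N (cl N {}) e0" using locally_embedsE[OF N, of "{}"] by auto
  have "partial_emb N {} ((\<lambda>x. (x, e0 x)) ` cl N {})"
    using closed_embD[OF e0] closed_embD(5)[OF e0, of "{}"] pregeometryD(4)[OF pg, of "{}"]
    by (simp add: partial_emb_def image_image)
  then have Q0: "Q ((\<lambda>x. (x, e0 x)) ` cl N {})" unfolding Q_def by blast
  have dense: "\<exists>S'. S \<subseteq> S' \<and> Q S' \<and> R S'" if R: "R \<in> \<D>" and Q: "Q S" for R S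
  proof -
    obtain x where x: "x \<in> X" "R = (\<lambda>S. x \<in> fst ` S)" using R by (auto simp: \<D>_def)
    obtain D where D: "D \<subseteq> X" "partial_emb N D S" using Q by (auto simp: Q_def)
    obtain S' where S': "S \<subseteq> S'" "partial_emb N (insert x D) S'"
      using partial_emb_extend[OF N D(2)] x(1) X(2) by blast
    have "insert x D \<subseteq> cl N (insert x D)" using x(1) D(1) X(2) by (intro pregeometryD(1)[OF Np]) auto
    then have "x \<in> fst ` S'" using S'(2) by (simp add: partial_emb_def)
    moreover have "Q S'" unfolding Q_def using S'(2) x(1) D(1) by blast
    ultimately show ?thesis using S'(1) x(2) by blast
  qed
  obtain S :: "nat \<Rightarrow> ('u \<times> 'u) set" where S: "mono S" "\<And>n. Q (S n)" "\<And>D. D \<in> \<D> \<Longrightarrow> \<exists>n. D (S n)"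
  proof (rule generic_chain[of Q "(\<lambda>x. (x, e0 x)) ` cl N {}" \<D>, OF Q0 cD])
    show "\<exists>S'. S \<subseteq> S' \<and> Q S' \<and> R S'" if "R \<in> \<D>" "Q S" for R S using dense[OF that] .
  next
    fix S :: "nat \<Rightarrow> ('u \<times> 'u) set"
    assume "incseq S" "\<And>n. Q (S n)" "\<And>D. D \<in> \<D> \<Longrightarrow> \<exists>n. D (S n)"
    then show thesis by (rule that[of S])
  qed
  define T where "T = (\<Union>n. S n)"
  have p: "pelem L N M (S n)" "cl M (snd ` S n) = snd ` S n" "snd ` S n \<subseteq> UM" "fst ` S n \<subseteq> cl N X"
    "cl N (fst ` S n) = fst ` S n" for n
  proof -
    obtain D where D: "D \<subseteq> X" "partial_emb N D (S n)" using S(2)[of n] by (auto simp: Q_def)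
    then show "pelem L N M (S n)" "cl M (snd ` S n) = snd ` S n" "snd ` S n \<subseteq> UM"
      by (simp_all add: partial_emb_def)
    have "fst ` S n = cl N D" "D \<subseteq> univ N" using D(2) by (simp_all add: partial_emb_def)
    then show "fst ` S n \<subseteq> cl N X" "cl N (fst ` S n) = fst ` S n"
      using pregeometryD(3)[OF Np D(1) X(2)] pregeometryD(4)[OF Np] by auto
  qed
  have pT: "pelem L N M T" unfolding T_def by (rule pelem_UN_mono[OF S(1) p(1)])
  have mo: "mono (\<lambda>n. snd ` S n)" "mono (\<lambda>n. fst ` S n)" using S(1) by (auto simp: mono_def)
  have sT: "cl M (snd ` T) = snd ` T"
    unfolding T_def image_UN by (rule pregeometry_closed_UN[OF pg mo(1) p(3) p(2)])
  have clX: "cl N X \<subseteq> univ N" by (rule pregeometryD(2)[OF Np X(2)])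
  have fU: "fst ` S n \<subseteq> univ N" for n using p(4) clX by blast
  have fT: "cl N (fst ` T) = fst ` T"
    unfolding T_def image_UN by (rule pregeometry_closed_UN[OF Np mo(2) fU p(5)])
  have "X \<subseteq> fst ` T"
  proof
    fix x assume "x \<in> X"
    then have "(\<lambda>S. x \<in> fst ` S) \<in> \<D>" by (simp add: \<D>_def)
    from S(3)[OF this] obtain n where "x \<in> fst ` S n" by blast
    then show "x \<in> fst ` T" by (auto simp: T_def)
  qed
  moreover have fTX: "fst ` T \<subseteq> cl N X" using p(4) by (auto simp: T_def)
  then have fTU: "fst ` T \<subseteq> univ N" using clX by blast
  ultimately have fTe: "fst ` T = cl N X"
    using pregeometryD(3)[OF Np _ fTU, of X] fT fTX by (intro equalityI) simp_all
  have sTU: "snd ` T \<subseteq> UM" using p(3) by (auto simp: T_def)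
  define e where "e z = (THE t. (z, t) \<in> T)" for z
  have eT: "e z = t" if "(z, t) \<in> T" for z t
    unfolding e_def using that pelem_functional[OF pT _ that] by (rule the_equality)
  have Te: "(z, e z) \<in> T" if z: "z \<in> cl N X" for z
  proof -
    obtain t where "(z, t) \<in> T" using z fTe by force
    then show ?thesis using eT by simp
  qed
  have eU: "e ` cl N X \<subseteq> UM" using Te sTU by force
  then have eU': "\<And>y. y \<in> cl N X \<Longrightarrow> e y \<in> UM" by blast
  have emb: "pelem L N M ((\<lambda>x. (x, e x)) ` cl N X)" by (rule pelem_subset[OF pT]) (use Te in auto)
  have "closed_emb N (cl N X) e" unfolding closed_emb_def
  proof (intro conjI allI impI)
    show "cl N X \<subseteq> univ N" "cl N (cl N X) = cl N X" "e ` cl N X \<subseteq> UM"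
      using clX pregeometryD(4)[OF Np X(2)] eU by simp_all
    show "pelem L N M ((\<lambda>x. (x, e x)) ` cl N X)" by (rule emb)
    fix Y assume Y: "Y \<subseteq> cl N X"
    have YU: "Y \<subseteq> univ N" using Y clX by blast
    let ?T = "(\<lambda>x. (x, e x)) ` Y"
    have f: "fst ` ?T = Y" "snd ` ?T = e ` Y" by (auto simp: image_image)
    \<comment> \<open>The chain guarantees elementarity and closed range only; that the map commutes
      with closure is (QM1) between \<open>N\<close> and \<open>M\<close>.\<close>
    have iff: "z \<in> cl N Y \<longleftrightarrow> e z \<in> cl M (e ` Y)" if z: "z \<in> cl N X" for z
    proof -
      have "pelem L N M (insert (z, e z) ?T)" by (rule pelem_subset[OF emb]) (use Y z in auto)
      moreover have "?T \<subseteq> univ N \<times> UM" "z \<in> univ N" "e z \<in> UM" using Y YU z clX eU' by auto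
      ultimately show ?thesis using cross_QM1[OF N, of ?T z "e z"] f by simp
    qed
    have "cl N Y \<subseteq> cl N (cl N X)" by (rule pregeometryD(3)[OF Np Y clX])
    then have YX: "cl N Y \<subseteq> cl N X" using pregeometryD(4)[OF Np X(2)] by simp
    show "e ` cl N Y = cl M (e ` Y)"
    proof
      show "e ` cl N Y \<subseteq> cl M (e ` Y)" using iff YX by auto
      show "cl M (e ` Y) \<subseteq> e ` cl N Y"
      proof
        fix t assume t: "t \<in> cl M (e ` Y)"
        have "e ` Y \<subseteq> snd ` T" using Te Y by force
        then have "cl M (e ` Y) \<subseteq> snd ` T" using pregeometryD(3)[OF pg _ sTU] sT by blast
        then obtain z where z: "(z, t) \<in> T" using t by force
        then have "z \<in> cl N X" "e z = t" using fTe eT by force+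
        then show "t \<in> e ` cl N Y" using iff t by blast
      qed
    qed
  qed
  then show ?thesis by (rule that)
qed

end

lemma val_univ_update: "val (N\<lparr>univ := Z\<rparr>) s t = val N s t"
proof (induction t)
  case (App f ts)
  then have "map (val (N\<lparr>univ := Z\<rparr>) s) ts = map (val N s) ts" by simp
  then show ?case by (simp only: val.simps) simp
qed simp

lemma holds_univ_update: "holds (N\<lparr>univ := Z\<rparr>) s p = holds N s p"
proof (induction p)
  case (Rel r ts)
  have "map (val (N\<lparr>univ := Z\<rparr>) s) ts = map (val N s) ts" by (simp add: val_univ_update)
  then show ?case by (simp only: holds.simps) simp
qed (auto simp: val_univ_update)

lemma pelem_univ_update:
  "pelem L (N\<lparr>univ := Z\<rparr>) N' S = pelem L N N' S" "pelem L N (N'\<lparr>univ := Z'\<rparr>) S = pelem L N N' S"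
  by (simp_all add: pelem_def holds_univ_update)

section \<open>Transfer of the axioms to all members of the class\<close>

context quasiminimal_structure
begin

lemma locally_embedsD:
  assumes "locally_embeds N"
  shows "is_pstruct L N" "is_struct L N" "pregeometry (univ N) (cl N)"
  using assms by (simp_all add: locally_embeds_def is_pstruct_def)

lemma QM1_N:
  assumes N: "locally_embeds N" and T: "T \<subseteq> univ N \<times> univ N" "a \<in> univ N" "a' \<in> univ N"
    "pelem L N N (insert (a, a') T)"
  shows "a \<in> cl N (fst ` T) \<longleftrightarrow> a' \<in> cl N (snd ` T)"
proof (rule pelem_closure_iff[OF locally_embedsD(3)[OF N] locally_embedsD(3)[OF N] T(1)])
  note Np = locally_embedsD(3)[OF N]
  fix T0 assume T0: "finite T0" "T0 \<subseteq> T"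
  have sub: "insert a' (snd ` T0) \<subseteq> univ N" "finite (insert a' (snd ` T0))" using T T0 by auto
  let ?Z = "cl N (insert a' (snd ` T0))"
  obtain e where e: "closed_emb N ?Z e" using locally_embedsE[OF N sub(2,1)] by blast
  note E = closed_embD[OF e]
  have inZ: "insert a' (snd ` T0) \<subseteq> ?Z" by (rule pregeometryD(1)[OF Np sub(1)])
  define T1 where "T1 = (\<lambda>(x, y). (x, e y)) ` T0"
  have im: "fst ` T1 = fst ` T0" "snd ` T1 = e ` snd ` T0" by (force simp: T1_def image_iff)+
  have eU: "e y \<in> UM" if "y \<in> ?Z" for y using E(3) that by blast
  have "pelem L N N (insert (a, a') T0)" by (rule pelem_subset[OF T(4)]) (use T0 in auto)
  then have "pelem L N M (insert (a, a') T0 O (\<lambda>x. (x, e x)) ` ?Z)" by (rule pelem_comp[OF _ E(4)])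
  then have "pelem L N M (insert (a, e a') T1)"
  proof (rule pelem_subset, intro subsetI)
    fix p assume "p \<in> insert (a, e a') T1"
    then obtain x y where xy: "p = (x, e y)" "(x, y) \<in> insert (a, a') T0" by (auto simp: T1_def)
    then have "y \<in> ?Z" using inZ by force
    then show "p \<in> insert (a, a') T0 O (\<lambda>x. (x, e x)) ` ?Z" using xy by blast
  qed
  moreover have "T1 \<subseteq> univ N \<times> UM"
  proof
    fix p assume "p \<in> T1"
    then obtain x y where xy: "p = (x, e y)" "(x, y) \<in> T0" by (auto simp: T1_def)
    then have "y \<in> ?Z" using inZ by force
    then show "p \<in> univ N \<times> UM" using xy T0 T(1) eU by auto
  qed
  ultimately have "a \<in> cl N (fst ` T0) \<longleftrightarrow> e a' \<in> cl M (e ` snd ` T0)"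
    using cross_QM1[OF N, of T1 a "e a'"] T(2) eU inZ im by simp
  moreover have fZ: "snd ` T0 \<subseteq> ?Z" using inZ by simp
  then have "cl M (e ` snd ` T0) = e ` cl N (snd ` T0)" using E(5) by simp
  moreover have "cl N (snd ` T0) \<subseteq> ?Z" by (rule pregeometryD(3)[OF Np _ sub(1)]) auto
  then have "e a' \<in> e ` cl N (snd ` T0) \<longleftrightarrow> a' \<in> cl N (snd ` T0)"
    using inj_on_image_mem_iff[OF closed_emb_inj[OF e]] inZ by simp
  ultimately show "a \<in> cl N (fst ` T0) \<longleftrightarrow> a' \<in> cl N (snd ` T0)" by simp
qed

lemma fint_in_cl_N:
  assumes N: "locally_embeds N" and f: "f \<in> fsyms L" and xs: "xs \<in> tuples (univ N) (far L f)"
  shows "fint N f xs \<in> cl N (set xs)"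
proof -
  note Np = locally_embedsD(3)[OF N]
  let ?a = "fint N f xs"
  have X: "set xs \<subseteq> univ N" "length xs = far L f" using xs by (auto simp: tuples_def)
  have a: "?a \<in> univ N" using locally_embedsD(2)[OF N] f xs by (simp add: is_struct_def)
  have sub: "insert ?a (set xs) \<subseteq> univ N" "finite (insert ?a (set xs))" using a X by auto
  let ?Z = "cl N (insert ?a (set xs))"
  obtain e where e: "closed_emb N ?Z e" using locally_embedsE[OF N sub(2,1)] by blast
  note E = closed_embD[OF e]
  have inZ: "insert ?a (set xs) \<subseteq> ?Z" by (rule pregeometryD(1)[OF Np sub(1)])
  have "set (zip xs (map e xs)) \<subseteq> (\<lambda>x. (x, e x)) ` ?Z"
    using inZ by (auto simp: zip_map2 zip_same_conv_map)
  from pelem_fint[OF E(4) f X(2) _ this, of ?a "e ?a"] have "fint M f (map e xs) = e ?a"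
    using X(2) inZ by simp
  moreover have "set (map e xs) \<subseteq> UM" using E(3) inZ by auto
  then have "fint M f (map e xs) \<in> cl M (set (map e xs))"
    using X(2) by (intro fint_in_cl f) (simp add: tuples_def)
  ultimately have "e ?a \<in> e ` cl N (set xs)" using E(5)[of "set xs"] inZ by simp
  moreover have "cl N (set xs) \<subseteq> ?Z" by (rule pregeometryD(3)[OF Np _ sub(1)]) auto
  ultimately show ?thesis using inj_on_image_mem_iff[OF closed_emb_inj[OF e]] inZ by simp
qed

text \<open>The domain and range of \<open>S\<close> together with \<open>u\<close> and
  \<open>u'\<close> generate a countable closed set. It embeds into \<open>M\<close>, where
  \<open>extend_closed\<close> applies, and the result is pulled back.\<close>

lemma extend_closed_N:
  assumes N: "locally_embeds N" and S: "countable S" "closed_in N (fst ` S)" "closed_in N (snd ` S)"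
      "S \<subseteq> univ N \<times> univ N" "pelem L N N S"
    and u: "u \<in> univ N - fst ` S" "u' \<in> univ N - snd ` S"
  obtains S' where "insert (u, u') S \<subseteq> S'" "pelem L N N S'" "fst ` S' = cl N (insert u (fst ` S))"
    "snd ` S' = cl N (insert u' (snd ` S))"
proof -
  note Np = locally_embedsD(3)[OF N]
  let ?X = "insert u (insert u' (fst ` S \<union> snd ` S))"
  have X: "countable ?X" "?X \<subseteq> univ N" using S(1,4) u by auto
  let ?Z = "cl N ?X"
  obtain e where e: "closed_emb N ?Z e" using countable_embeds[OF N X] by blast
  note E = closed_embD[OF e]
  note ei = closed_emb_inj[OF e]
  have inZ: "?X \<subseteq> ?Z" by (rule pregeometryD(1)[OF Np X(2)])
  let ?G = "(\<lambda>x. (x, e x)) ` ?Z"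
  define T where "T = (\<lambda>(x, y). (e x, e y)) ` S"
  have SZ: "x \<in> ?Z" "y \<in> ?Z" if "(x, y) \<in> S" for x y using inZ that by force+
  have im: "fst ` T = e ` fst ` S" "snd ` T = e ` snd ` S" by (force simp: T_def image_iff)+
  have sub: "fst ` S \<subseteq> ?Z" "snd ` S \<subseteq> ?Z" using inZ by auto
  have eU: "e y \<in> UM" if "y \<in> ?Z" for y using E(3) that by blast
  have "pelem L M M (converse ?G O (S O ?G))"
    by (rule pelem_comp[OF pelem_converse[OF E(4)] pelem_comp[OF S(5) E(4)]])
  then have pT: "pelem L M M T"
  proof (rule pelem_subset, intro subsetI)
    fix p assume "p \<in> T"
    then obtain x y where "p = (e x, e y)" "(x, y) \<in> S" by (auto simp: T_def)
    then show "p \<in> converse ?G O (S O ?G)" using SZ by blast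
  qed
  have cT: "countable T" using S(1) by (simp add: T_def)
  have clT: "closed_in M (fst ` T)" "closed_in M (snd ` T)"
    using E(5)[OF sub(1)] E(5)[OF sub(2)] S(2,3) eU sub unfolding im closed_in_def by auto
  have TU: "T \<subseteq> UM \<times> UM" using SZ eU by (auto simp: T_def)
  have eu: "e u \<in> UM - fst ` T" "e u' \<in> UM - snd ` T"
    unfolding im using inj_on_image_mem_iff[OF ei _ sub(1), of u] inj_on_image_mem_iff[OF ei _ sub(2), of u']
      inZ eU u by auto
  obtain S1 where S1: "insert (e u, e u') T \<subseteq> S1" "pelem L M M S1"
      "fst ` S1 = cl M (insert (e u) (fst ` T))" "snd ` S1 = cl M (insert (e u') (snd ` T))"
    by (rule extend_closed[OF cT clT TU pT eu])
  let ?C = "cl N (insert u (fst ` S))" and ?C' = "cl N (insert u' (snd ` S))"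
  have C: "?C \<subseteq> ?Z" "?C' \<subseteq> ?Z" by (rule pregeometryD(3)[OF Np _ X(2)]; auto)+
  have s: "insert u (fst ` S) \<subseteq> ?Z" "insert u' (snd ` S) \<subseteq> ?Z" using inZ by auto
  have S1C: "fst ` S1 = e ` ?C" "snd ` S1 = e ` ?C'"
    using E(5)[OF s(1)] E(5)[OF s(2)] S1(3,4) im by simp_all
  define S' where "S' = {(x, y). x \<in> ?Z \<and> y \<in> ?Z \<and> (e x, e y) \<in> S1}"
  have "insert (u, u') S \<subseteq> S'"
  proof
    fix p assume "p \<in> insert (u, u') S"
    moreover obtain x y where "p = (x, y)" by (cases p)
    ultimately have p: "p = (x, y)" "(x, y) \<in> insert (u, u') S" by simp_all
    then have "x \<in> ?Z" "y \<in> ?Z" using SZ inZ by auto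
    moreover have "(e x, e y) \<in> insert (e u, e u') T" using p(2) by (force simp: T_def)
    ultimately show "p \<in> S'" using S1(1) p(1) by (auto simp: S'_def)
  qed
  moreover have "pelem L N N (?G O (S1 O converse ?G))"
    by (rule pelem_comp[OF E(4) pelem_comp[OF S1(2) pelem_converse[OF E(4)]]])
  then have "pelem L N N S'" by (rule pelem_subset) (auto simp: S'_def relcomp_unfold)
  moreover have "fst ` S' = ?C"
  proof
    show "fst ` S' \<subseteq> ?C"
    proof
      fix x assume "x \<in> fst ` S'"
      then obtain y where y: "x \<in> ?Z" "(e x, e y) \<in> S1" by (auto simp: S'_def)
      then have "e x \<in> e ` ?C" using S1C(1) by force
      then show "x \<in> ?C" using inj_on_image_mem_iff[OF ei y(1) C(1)] by simp
    qed
    show "?C \<subseteq> fst ` S'"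
    proof
      fix x assume x: "x \<in> ?C"
      then have "e x \<in> fst ` S1" using S1C(1) by blast
      then obtain t where t: "(e x, t) \<in> S1" by auto
      then have "t \<in> e ` ?C'" using S1C(2) by force
      then obtain y where "y \<in> ?C'" "t = e y" by blast
      then have "(x, y) \<in> S'" using t x C by (auto simp: S'_def)
      then show "x \<in> fst ` S'" by force
    qed
  qed
  moreover have "snd ` S' = ?C'"
  proof
    show "snd ` S' \<subseteq> ?C'"
    proof
      fix y assume "y \<in> snd ` S'"
      then obtain x where x: "y \<in> ?Z" "(e x, e y) \<in> S1" by (auto simp: S'_def)
      then have "e y \<in> e ` ?C'" using S1C(2) by force
      then show "y \<in> ?C'" using inj_on_image_mem_iff[OF ei x(1) C(2)] by simp
    qed
    show "?C' \<subseteq> snd ` S'"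
    proof
      fix y assume y: "y \<in> ?C'"
      then have "e y \<in> snd ` S1" using S1C(2) by blast
      then obtain t where t: "(t, e y) \<in> S1" by auto
      then have "t \<in> e ` ?C" using S1C(1) by force
      then obtain x where "x \<in> ?C" "t = e x" by blast
      then have "(x, y) \<in> S'" using t y C by (auto simp: S'_def)
      then show "y \<in> snd ` S'" by force
    qed
  qed
  ultimately show ?thesis by (rule that)
qed

lemma restrict_submodel:
  assumes N: "locally_embeds N" and Z: "Z \<subseteq> univ N" "cl N Z = Z"
  shows "closed_submodel L (N\<lparr>univ := Z\<rparr>) N"
proof (rule restrict_closed[OF locally_embedsD(1)[OF N] Z])
  fix f xs assume f: "f \<in> fsyms L" and xs: "xs \<in> tuples Z (far L f)"
  have "xs \<in> tuples (univ N) (far L f)" "set xs \<subseteq> Z" using xs Z(1) by (auto simp: tuples_def)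
  then show "fint N f xs \<in> Z"
    using fint_in_cl_N[OF N f] pregeometryD(3)[OF locally_embedsD(3)[OF N] _ Z(1), of "set xs"] Z(2) by auto
qed

text \<open>A countable closed set is isomorphic to a closed substructure of \<open>M\<close> by
  \<open>countable_embeds\<close>. This provides the small members of the class inside the monster
  model to which its homogeneity is applied.\<close>

lemma restrict_in_Kminus:
  assumes N: "locally_embeds N" and Z: "Z \<subseteq> univ N" "cl N Z = Z" "countable Z"
  shows "N\<lparr>univ := Z\<rparr> \<in> Kminus L M"
proof -
  obtain e where "closed_emb N (cl N Z) e" using countable_embeds[OF N Z(3,1)] .
  then have e: "closed_emb N Z e" using Z(2) by simp
  note E = closed_embD[OF e]
  note ei = closed_emb_inj[OF e]
  have eZ: "cl M (e ` Z) = e ` Z" using E(5)[OF subset_refl] Z(2) by simp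
  have sM: "closed_submodel L (M\<lparr>univ := e ` Z\<rparr>) M" by (rule restrict_submodel[OF locally_embeds_M E(3) eZ])
  have sN: "closed_submodel L (N\<lparr>univ := Z\<rparr>) N" by (rule restrict_submodel[OF N Z(1,2)])
  let ?g = "inv_into Z e"
  have ge: "?g (e x) = x" if "x \<in> Z" for x using that ei by simp
  have gZ: "?g ` e ` Z = Z" using ge by (force simp: image_iff)
  have gim: "?g ` e ` Y = Y" if "Y \<subseteq> Z" for Y using that ge by (force simp: image_iff)
  have "pelem L M N (converse ((\<lambda>x. (x, e x)) ` Z))" by (rule pelem_converse[OF E(4)])
  then have "pelem L M N ((\<lambda>x. (x, ?g x)) ` e ` Z)" by (rule pelem_subset) (use ge in auto)
  then have p: "pelem L (M\<lparr>univ := e ` Z\<rparr>) (N\<lparr>univ := Z\<rparr>) ((\<lambda>x. (x, ?g x)) ` univ (M\<lparr>univ := e ` Z\<rparr>))"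
    by (simp add: pelem_univ_update)
  have ps: "is_pstruct L (M\<lparr>univ := e ` Z\<rparr>)" "is_pstruct L (N\<lparr>univ := Z\<rparr>)"
    using closed_submodelD(4)[OF sM] closed_submodelD(4)[OF sN] .
  have "closed_embedding L ?g (M\<lparr>univ := e ` Z\<rparr>) (N\<lparr>univ := Z\<rparr>)" unfolding closed_embedding_def
  proof (intro conjI allI impI ps)
    show "fo_embedding L ?g (M\<lparr>univ := e ` Z\<rparr>) (N\<lparr>univ := Z\<rparr>)"
      by (rule pelem_embedding[OF p is_pstructD(1)[OF ps(1)]]) (use gZ in simp)
    show "closed_in (N\<lparr>univ := Z\<rparr>) (?g ` univ (M\<lparr>univ := e ` Z\<rparr>))"
      using gZ Z(2) by (simp add: closed_in_def)
    fix X assume "X \<subseteq> univ (M\<lparr>univ := e ` Z\<rparr>)"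
    then obtain Y where Y: "Y \<subseteq> Z" "X = e ` Y" by (auto simp: subset_image_iff)
    have YZ: "cl N Y \<subseteq> Z" using pregeometryD(3)[OF locally_embedsD(3)[OF N] Y(1) Z(1)] Z(2) by simp
    show "?g ` cl (M\<lparr>univ := e ` Z\<rparr>) X = cl (N\<lparr>univ := Z\<rparr>) (?g ` X)"
      using Y E(5)[OF Y(1), symmetric] gim[OF YZ] gim[OF Y(1)] by simp
  qed
  then have "pstruct_iso L ?g (M\<lparr>univ := e ` Z\<rparr>) (N\<lparr>univ := Z\<rparr>)" using gZ by (simp add: pstruct_iso_def)
  then show ?thesis by (rule Kminus.iso[OF Kminus.closed[OF sM]])
qed

end

section \<open>Homogeneity of the monster model\<close>

locale quasiminimal_monster = quasiminimal_structure L M for L :: "('f, 'r) lang" and M :: "('f, 'r, 'u) pstruct" +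
  fixes \<delta> :: "'u rel" and MO :: "('f, 'r, 'u) pstruct"
  assumes monster: "monster_model L {N \<in> Kclass L M. \<not> finite_dimensional N} \<delta> MO"
begin

abbreviation "KK \<equiv> {N \<in> Kclass L M. \<not> finite_dimensional N}"

abbreviation "UU \<equiv> univ MO"

lemma MO_loc: "locally_embeds MO"
  using monster Kclass_locally_embeds by (auto simp: monster_model_def)

lemmas MO_struct = locally_embedsD(2)[OF MO_loc] and MO_pg = locally_embedsD(3)[OF MO_loc]

lemma MO_not_spanned: "finite X \<Longrightarrow> X \<subseteq> UU \<Longrightarrow> \<exists>u\<in>UU. u \<notin> cl MO X"
proof -
  assume X: "finite X" "X \<subseteq> UU"
  have "\<not> finite_dimensional MO" using monster by (simp add: monster_model_def)
  then have "cl MO X \<noteq> UU" using X unfolding finite_dimensional_def by blast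
  moreover have "cl MO X \<subseteq> UU" by (rule pregeometryD(2)[OF MO_pg X(2)])
  ultimately show ?thesis by blast
qed

definition inf_dim_closed :: "'u set \<Rightarrow> bool" where
  "inf_dim_closed Z \<longleftrightarrow> Z \<subseteq> UU \<and> cl MO Z = Z \<and> (\<forall>D. finite D \<longrightarrow> D \<subseteq> Z \<longrightarrow> cl MO D \<noteq> Z)"

lemma inf_dim_closedI:
  "Z \<subseteq> UU \<Longrightarrow> cl MO Z = Z \<Longrightarrow> (\<And>D. finite D \<Longrightarrow> D \<subseteq> Z \<Longrightarrow> \<not> Z \<subseteq> cl MO D) \<Longrightarrow> inf_dim_closed Z"
  unfolding inf_dim_closed_def by auto

lemma countable_bounded: "countable Z \<Longrightarrow> |Z| <o \<delta>"
proof -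
  assume "countable Z"
  then obtain f where "inj_on (f :: _ \<Rightarrow> nat) Z" by (rule countableE)
  then have "|Z| \<le>o |UNIV :: nat set|" using card_of_ordLeq by blast
  then have "|Z| \<le>o natLeq" by (rule ordLeq_ordIso_trans[OF _ card_of_nat])
  moreover have "natLeq <o \<delta>" using monster by (simp add: monster_model_def large_cardinal_def)
  ultimately show ?thesis by (rule ordLeq_ordLess_trans)
qed

lemma restrict_in_KK:
  assumes "inf_dim_closed Z" "countable Z"
  shows "MO\<lparr>univ := Z\<rparr> \<in> KK" "closed_submodel L (MO\<lparr>univ := Z\<rparr>) MO"
proof -
  have Z: "Z \<subseteq> UU" "cl MO Z = Z" and D: "\<And>D. finite D \<Longrightarrow> D \<subseteq> Z \<Longrightarrow> cl MO D \<noteq> Z"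
    using assms by (auto simp: inf_dim_closed_def)
  show "closed_submodel L (MO\<lparr>univ := Z\<rparr>) MO" by (rule restrict_submodel[OF MO_loc Z])
  have "MO\<lparr>univ := Z\<rparr> \<in> Kclass L M" by (rule Kclass.minus[OF restrict_in_Kminus[OF MO_loc Z assms(2)]])
  moreover have "\<not> finite_dimensional (MO\<lparr>univ := Z\<rparr>)" using D by (auto simp: finite_dimensional_def)
  ultimately show "MO\<lparr>univ := Z\<rparr> \<in> KK" by simp
qed

text \<open>Infinite dimension is what makes the domain and the range members of the class, so that
  model homogeneity speaks about them.\<close>

lemma pelem_realized:
  assumes S: "countable S" "pelem L MO MO S" "inf_dim_closed (fst ` S)" "inf_dim_closed (snd ` S)"
  obtains f where "fo_iso L f MO MO" "\<And>x y. (x, y) \<in> S \<Longrightarrow> f x = y"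
proof -
  let ?A = "MO\<lparr>univ := fst ` S\<rparr>" and ?B = "MO\<lparr>univ := snd ` S\<rparr>"
  have c: "countable (fst ` S)" "countable (snd ` S)" using S(1) by auto
  note A = restrict_in_KK[OF S(3) c(1)] and B = restrict_in_KK[OF S(4) c(2)]
  define g where "g x = (THE y. (x, y) \<in> S)" for x
  have g: "g x = y" if "(x, y) \<in> S" for x y
    unfolding g_def using that pelem_functional[OF S(2) _ that] by (rule the_equality)
  have gS: "(\<lambda>x. (x, g x)) ` fst ` S = S" using g by force
  have p: "pelem L ?A ?B ((\<lambda>x. (x, g x)) ` univ ?A)" using S(2) gS by (simp add: pelem_univ_update)
  have im: "g ` fst ` S = snd ` S" using g by force
  have "fo_embedding L g ?A ?B"
    by (rule pelem_embedding[OF p is_pstructD(1)[OF closed_submodelD(4)[OF A(2)]]]) (use im in simp)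
  then have iso: "fo_iso L g ?A ?B" using im by (simp add: fo_iso_def)
  have "model_homogeneous L KK \<delta> MO" using monster by (simp add: monster_model_def)
  note this[unfolded model_homogeneous_def, rule_format, of ?A ?B g]
  then obtain f where f: "fo_iso L f MO MO" "\<forall>x\<in>fst ` S. f x = g x"
    using A B iso countable_bounded[OF c(1)] countable_bounded[OF c(2)] by auto
  have "f x = y" if "(x, y) \<in> S" for x y using f(2) g[OF that] that by force
  then show ?thesis using that f(1) by blast
qed

definition good_pair :: "('u \<times> 'u) set \<Rightarrow> bool" where
  "good_pair S \<longleftrightarrow> countable S \<and> S \<subseteq> UU \<times> UU \<and> pelem L MO MO S \<and> closed_in MO (fst ` S) \<and> closed_in MO (snd ` S)"

lemma good_pair_extend:
  assumes S: "good_pair S" and u: "u \<in> UU - fst ` S" "u' \<in> UU - snd ` S"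
  shows "\<exists>S'. insert (u, u') S \<subseteq> S' \<and> good_pair S'"
proof -
  have S': "countable S" "S \<subseteq> UU \<times> UU" "pelem L MO MO S" "closed_in MO (fst ` S)" "closed_in MO (snd ` S)"
    using S by (simp_all add: good_pair_def)
  obtain T where T: "insert (u, u') S \<subseteq> T" "pelem L MO MO T" "fst ` T = cl MO (insert u (fst ` S))"
      "snd ` T = cl MO (insert u' (snd ` S))"
    by (rule extend_closed_N[OF MO_loc S'(1,4,5,2,3) u])
  have V: "insert u (fst ` S) \<subseteq> UU" "insert u' (snd ` S) \<subseteq> UU" using S'(2) u by auto
  have "countable (fst ` T)" unfolding T(3) by (rule countable_cl_N[OF MO_loc _ V(1)]) (use S'(1) in simp)
  then have "countable T" by (rule countable_image_inj_on[OF _ pelem_inj_fst[OF T(2)]])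
  moreover have "closed_in MO (fst ` T)" "closed_in MO (snd ` T)"
    unfolding T(3,4) closed_in_def using pregeometryD(2,4)[OF MO_pg] V by auto
  moreover from this have "T \<subseteq> UU \<times> UU" unfolding closed_in_def by force
  ultimately show ?thesis using T(1,2) by (intro exI[of _ T]) (simp add: good_pair_def)
qed

text \<open>By (QM1) a set spanning the domain corresponds under \<open>S\<close> to a set spanning
  the range. Thus domain and range are finite-dimensional together.\<close>

lemma good_pair_spanned:
  assumes S: "good_pair S" and D: "finite D" "D \<subseteq> fst ` S" "fst ` S \<subseteq> cl MO D"
  shows "\<exists>D'. finite D' \<and> D' \<subseteq> snd ` S \<and> snd ` S \<subseteq> cl MO D'"
proof -
  have S': "S \<subseteq> UU \<times> UU" "pelem L MO MO S" using S by (simp_all add: good_pair_def)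
  obtain T where T: "T \<subseteq> S" "finite T" "D = fst ` T" using finite_subset_image[OF D(1,2)] by auto
  have "snd ` S \<subseteq> cl MO (snd ` T)"
  proof
    fix y assume "y \<in> snd ` S"
    then obtain x where x: "(x, y) \<in> S" by auto
    have "pelem L MO MO (insert (x, y) T)" by (rule pelem_subset[OF S'(2)]) (use x T in auto)
    moreover have "T \<subseteq> UU \<times> UU" "x \<in> UU" "y \<in> UU" using T(1) S'(1) x by auto
    ultimately have "x \<in> cl MO (fst ` T) \<longleftrightarrow> y \<in> cl MO (snd ` T)" by (intro QM1_N[OF MO_loc])
    moreover have "x \<in> cl MO (fst ` T)" using x D(3) T(3) by force
    ultimately show "y \<in> cl MO (snd ` T)" by simp
  qed
  then show ?thesis using T by (intro exI[of _ "snd ` T"]) auto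
qed

lemma good_pair_converse: "good_pair S \<Longrightarrow> good_pair (converse S)"
proof -
  assume S: "good_pair S"
  have c: "fst ` (converse S) = snd ` S" "snd ` (converse S) = fst ` S" by force+
  have "converse S = (\<lambda>(x, y). (y, x)) ` S" by auto
  then have "countable (converse S)" using S by (simp add: good_pair_def)
  then show ?thesis using S pelem_converse unfolding good_pair_def c by blast
qed

text \<open>The class omits finite-dimensional structures, so model homogeneity does not apply to a
  finite-dimensional \<open>S\<close> directly. Generic pairs are first added along a sequence until
  the domain and the range are infinite-dimensional.\<close>

lemma good_pair_realized:
  assumes S: "good_pair S"
  obtains f where "fo_iso L f MO MO" "\<And>x y. (x, y) \<in> S \<Longrightarrow> f x = y"
proof -
    have "\<exists>X. \<forall>n::nat. (good_pair (X n) \<and> (n = 0 \<longrightarrow> X n = S)) \<and> (X n \<subseteq> X (Suc n) \<and>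
        (UU - fst ` X n \<noteq> {} \<longrightarrow> UU - snd ` X n \<noteq> {} \<longrightarrow> fst ` X (Suc n) \<noteq> fst ` X n))"
    proof (rule dependent_nat_choice)
      show "\<exists>x. good_pair x \<and> ((0::nat) = 0 \<longrightarrow> x = S)" using S by blast
      fix T and n :: nat assume T: "good_pair T \<and> (n = 0 \<longrightarrow> T = S)"
      show "\<exists>T'. (good_pair T' \<and> (Suc n = 0 \<longrightarrow> T' = S)) \<and> (T \<subseteq> T' \<and>
          (UU - fst ` T \<noteq> {} \<longrightarrow> UU - snd ` T \<noteq> {} \<longrightarrow> fst ` T' \<noteq> fst ` T))"
      proof (cases "UU - fst ` T \<noteq> {} \<and> UU - snd ` T \<noteq> {}")
        case True
        then obtain u u' where u: "u \<in> UU - fst ` T" "u' \<in> UU - snd ` T" by blast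
        obtain T' where T': "insert (u, u') T \<subseteq> T'" "good_pair T'" using good_pair_extend[OF _ u] T by blast
        have "u \<in> fst ` T'" using T'(1) by force
        then have "fst ` T' \<noteq> fst ` T" using u by blast
        then show ?thesis using T' by (intro exI[of _ T']) blast
      next
        case False
        then show ?thesis using T by (intro exI[of _ T]) blast
      qed
    qed
  then obtain X :: "nat \<Rightarrow> ('u \<times> 'u) set" where X0: "\<And>n. (good_pair (X n) \<and> (n = 0 \<longrightarrow> X n = S)) \<and> (X n \<subseteq> X (Suc n) \<and>
        (UU - fst ` X n \<noteq> {} \<longrightarrow> UU - snd ` X n \<noteq> {} \<longrightarrow> fst ` X (Suc n) \<noteq> fst ` X n))"
    by blast
  have X: "\<And>n. good_pair (X n)" "X 0 = S" "\<And>n. X n \<subseteq> X (Suc n)"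
      "\<And>n. UU - fst ` X n \<noteq> {} \<Longrightarrow> UU - snd ` X n \<noteq> {} \<Longrightarrow> fst ` X (Suc n) \<noteq> fst ` X n"
    using X0 by simp_all
  have X': "countable (X n)" "X n \<subseteq> UU \<times> UU" "pelem L MO MO (X n)" "fst ` X n \<subseteq> UU" "snd ` X n \<subseteq> UU"
    "cl MO (fst ` X n) = fst ` X n" "cl MO (snd ` X n) = snd ` X n" for n
    using X(1)[of n] by (simp_all add: good_pair_def closed_in_def)
  have mono: "mono X" using X(3) by (simp add: mono_iff_le_Suc)
  have mo: "mono (\<lambda>n. fst ` X n)" "mono (\<lambda>n. snd ` X n)" using mono by (auto simp: mono_def)
  define T where "T = (\<Union>n. X n)"
  have im: "fst ` T = (\<Union>n. fst ` X n)" "snd ` T = (\<Union>n. snd ` X n)" by (auto simp: T_def)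
  have cT: "countable T" using X'(1) by (simp add: T_def)
  have pT: "pelem L MO MO T" unfolding T_def by (rule pelem_UN_mono[OF mono X'(3)])
  have clT: "cl MO (fst ` T) = fst ` T" "cl MO (snd ` T) = snd ` T"
    unfolding im by (rule pregeometry_closed_UN[OF MO_pg mo(1) X'(4,6)], rule pregeometry_closed_UN[OF MO_pg mo(2) X'(5,7)])
  have TU: "fst ` T \<subseteq> UU" "snd ` T \<subseteq> UU" unfolding im using X'(4,5) by blast+
  have gT: "good_pair T"
    using cT pT clT TU by (force simp: good_pair_def closed_in_def)
  \<comment> \<open>A finite spanning set would be contained in some stage, and the domain would
    stop growing there. But neither the domain nor the range of that stage is the whole universe,
    which is not spanned by a finite set, so the next stage is strictly larger.\<close>
  have notspan: "\<not> fst ` T \<subseteq> cl MO D" if D: "finite D" "D \<subseteq> fst ` T" for D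
  proof
    assume sp: "fst ` T \<subseteq> cl MO D"
    obtain n where n: "D \<subseteq> fst ` X n" using finite_subset_mono_UN[OF mo(1) D(1)] D(2) im by auto
    have "cl MO D \<subseteq> fst ` X n" using pregeometryD(3)[OF MO_pg n X'(4)] X'(6) by simp
    moreover have T: "fst ` X k \<subseteq> fst ` T" for k unfolding im by (rule UN_upper) simp
    ultimately have eq: "fst ` X n = fst ` T" "cl MO D = fst ` X n"
      using sp T[of n] by (meson equalityI order_trans)+
    have eq2: "fst ` X (Suc n) = fst ` X n"
      using T[of "Suc n"] eq(1) image_mono[OF X(3)[of n], of fst] by (intro equalityI) simp_all
    have "D \<subseteq> UU" using D(2) TU(1) by blast
    then have "UU - fst ` X n \<noteq> {}" using MO_not_spanned[OF D(1)] eq(2) by auto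
    moreover obtain D' where D': "finite D'" "D' \<subseteq> snd ` X n" "snd ` X n \<subseteq> cl MO D'"
      using good_pair_spanned[OF X(1) D(1) n] eq(2) by auto
    have "D' \<subseteq> UU" using D'(2) X'(5) by blast
    then have "UU - snd ` X n \<noteq> {}" using MO_not_spanned[OF D'(1)] D'(3) by blast
    ultimately show False using X(4)[of n] eq2 by simp
  qed
  have "inf_dim_closed (fst ` T)" by (rule inf_dim_closedI[OF TU(1) clT(1) notspan])
  moreover have "inf_dim_closed (snd ` T)"
  proof -
    have c: "fst ` (converse T) = snd ` T" "snd ` (converse T) = fst ` T" by force+
    have ns: "\<not> snd ` T \<subseteq> cl MO D" if D: "finite D" "D \<subseteq> snd ` T" for D
    proof
      assume "snd ` T \<subseteq> cl MO D"
      then obtain D' where "finite D'" "D' \<subseteq> fst ` T" "fst ` T \<subseteq> cl MO D'"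
        using good_pair_spanned[OF good_pair_converse[OF gT] D(1), unfolded c, OF D(2)] by meson
      then show False using notspan by simp
    qed
    show ?thesis by (rule inf_dim_closedI[OF TU(2) clT(2) ns])
  qed
  ultimately obtain f where f: "fo_iso L f MO MO" "\<And>x y. (x, y) \<in> T \<Longrightarrow> f x = y"
    using pelem_realized[OF cT pT] by blast
  have "S \<subseteq> T" using X(2) by (auto simp: T_def)
  then show ?thesis using that f by blast
qed

lemma iso_pelem: "fo_iso L f MO MO \<Longrightarrow> pelem L MO MO ((\<lambda>x. (x, f x)) ` UU)"
  by (rule embedding_pelem[OF MO_struct]) (simp add: fo_iso_def)

lemma iso_bij: "fo_iso L f MO MO \<Longrightarrow> inj_on f UU" "fo_iso L f MO MO \<Longrightarrow> f ` UU = UU"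
  by (simp_all add: fo_iso_def fo_embedding_def)

lemma iso_of_pelem:
  assumes "pelem L MO MO ((\<lambda>x. (x, f x)) ` UU)" "f ` UU = UU"
  shows "fo_iso L f MO MO"
  using pelem_embedding[OF assms(1) MO_struct] assms(2) by (simp add: fo_iso_def)

text \<open>Automorphisms are required to respect the language only; that they respect closure is
  (QM1) for the monster model.\<close>

lemma iso_cl:
  assumes f: "fo_iso L f MO MO" and X: "X \<subseteq> UU"
  shows "f ` cl MO X = cl MO (f ` X)"
proof -
  have fU: "f x \<in> UU" if "x \<in> UU" for x using iso_bij(2)[OF f] that by blast
  have iff: "x \<in> cl MO X \<longleftrightarrow> f x \<in> cl MO (f ` X)" if x: "x \<in> UU" for x
  proof -
    let ?T = "(\<lambda>x. (x, f x)) ` X"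
    have "pelem L MO MO (insert (x, f x) ?T)" by (rule pelem_subset[OF iso_pelem[OF f]]) (use X x in auto)
    moreover have "?T \<subseteq> UU \<times> UU" using X fU by auto
    moreover have "fst ` ?T = X" "snd ` ?T = f ` X" by (auto simp: image_image)
    ultimately show ?thesis using QM1_N[OF MO_loc, of ?T x "f x"] x fU by simp
  qed
  have fX: "f ` X \<subseteq> UU" using X fU by auto
  have c: "cl MO X \<subseteq> UU" "cl MO (f ` X) \<subseteq> UU"
    using pregeometryD(2)[OF MO_pg X] pregeometryD(2)[OF MO_pg fX] .
  show ?thesis
  proof
    show "f ` cl MO X \<subseteq> cl MO (f ` X)" using iff c by auto
    show "cl MO (f ` X) \<subseteq> f ` cl MO X"
    proof
      fix y assume y: "y \<in> cl MO (f ` X)"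
      then obtain x where "x \<in> UU" "y = f x" using c(2) iso_bij(2)[OF f] by blast
      then show "y \<in> f ` cl MO X" using iff y by auto
    qed
  qed
qed

text \<open>The operator \<open>cl MO\<close> is constrained on subsets of the universe only, hence
  the intersection. For \<open>hom\<close>, a map realised on finite sets is elementary as a whole,
  since a formula mentions finitely many points; back and forth adds the generic pair, and model
  homogeneity realises the outcome.\<close>

sublocale homogeneous_pregeometry UU "\<lambda>X. cl MO (X \<inter> UU)" "{f. fo_iso L f MO MO}"
proof
  note p = pregeometryD[OF MO_pg]
  have I: "X \<inter> UU \<subseteq> UU" for X by simp
  fix X Y :: "'u set" and a b x :: 'u
  show "cl MO (X \<inter> UU) \<subseteq> UU" by (rule p(2)[OF I])
  show "cl MO (X \<inter> UU \<inter> UU) = cl MO (X \<inter> UU)" by (simp add: Int_assoc)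
  show "x \<in> X \<Longrightarrow> x \<in> UU \<Longrightarrow> x \<in> cl MO (X \<inter> UU)" using p(1)[OF I] by blast
  show "X \<subseteq> Y \<Longrightarrow> cl MO (X \<inter> UU) \<subseteq> cl MO (Y \<inter> UU)" by (rule p(3)[OF _ I]) auto
  have c: "cl MO (X \<inter> UU) \<inter> UU = cl MO (X \<inter> UU)" using p(2)[OF I] by blast
  show "cl MO (cl MO (X \<inter> UU) \<inter> UU) = cl MO (X \<inter> UU)" unfolding c by (rule p(4)[OF I])
  show "\<exists>D. finite D \<and> D \<subseteq> X \<and> x \<in> cl MO (D \<inter> UU)" if x: "x \<in> cl MO (X \<inter> UU)"
  proof -
    obtain D where D: "finite D" "D \<subseteq> X \<inter> UU" "x \<in> cl MO D" using pregeometry_finitary[OF MO_pg I x] .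
    then have "D \<inter> UU = D" by blast
    then show ?thesis using D by (intro exI[of _ D]) auto
  qed
  show "b \<in> cl MO (insert a X \<inter> UU)" if ab: "a \<in> cl MO (insert b X \<inter> UU)" "a \<notin> cl MO (X \<inter> UU)"
  proof (cases "b \<in> UU")
    case True
    have aU: "a \<in> UU" using p(2)[OF I] ab(1) by blast
    have "b \<in> cl MO (insert a (X \<inter> UU))" using p(6)[OF I aU True, of X] ab True by simp
    then show ?thesis using aU by simp
  next
    case False
    then show ?thesis using ab by simp
  qed
  show "countable (cl MO (X \<inter> UU))" if "finite X"
    by (rule countable_cl_finite_N[OF MO_loc]) (use that in auto)
  show "\<not> UU \<subseteq> cl MO (X \<inter> UU)" if "finite X" using MO_not_spanned[of "X \<inter> UU"] that by auto
next
  have "pelem L MO MO ((\<lambda>x. (x, x)) ` UU)" unfolding pelem_def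
  proof (intro allI impI)
    fix p :: "('f, 'r, nat + nat) qff" and s s'
    assume "\<forall>v\<in>vars_qff p. (s v, s' v) \<in> (\<lambda>x. (x, x)) ` UU"
    then show "holds MO s p = holds MO s' p" by (intro holds_cong) auto
  qed
  then show "(\<lambda>x. x) \<in> {f. fo_iso L f MO MO}" by (auto intro: iso_of_pelem)
next
  fix f g assume "f \<in> {f. fo_iso L f MO MO}" "g \<in> {f. fo_iso L f MO MO}"
  then have f: "fo_iso L f MO MO" and g: "fo_iso L g MO MO" by auto
  have gU: "g x \<in> UU" if "x \<in> UU" for x using iso_bij(2)[OF g] that by blast
  have "pelem L MO MO ((\<lambda>x. (x, g x)) ` UU O (\<lambda>x. (x, f x)) ` UU)"
    by (rule pelem_comp[OF iso_pelem[OF g] iso_pelem[OF f]])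
  then have "pelem L MO MO ((\<lambda>x. (x, f (g x))) ` UU)" by (rule pelem_subset) (use gU in auto)
  moreover have "(\<lambda>x. f (g x)) ` UU = f ` g ` UU" by auto
  then have "(\<lambda>x. f (g x)) ` UU = UU" using iso_bij(2)[OF f] iso_bij(2)[OF g] by simp
  ultimately show "(\<lambda>x. f (g x)) \<in> {f. fo_iso L f MO MO}" by (auto intro: iso_of_pelem)
next
  fix f assume "f \<in> {f. fo_iso L f MO MO}"
  then have f: "fo_iso L f MO MO" by simp
  note b = iso_bij[OF f]
  let ?g = "inv_into UU f"
  have gf: "?g (f x) = x" if "x \<in> UU" for x using that b(1) by simp
  have fg: "f (?g x) = x" if "x \<in> UU" for x using that b(2) by (intro f_inv_into_f) simp
  have gU: "?g x \<in> UU" if "x \<in> UU" for x using that b(2) by (intro inv_into_into) simp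
  have "pelem L MO MO (converse ((\<lambda>x. (x, f x)) ` UU))" by (rule pelem_converse[OF iso_pelem[OF f]])
  then have "pelem L MO MO ((\<lambda>x. (x, ?g x)) ` UU)"
  proof (rule pelem_subset, intro subsetI)
    fix p assume "p \<in> (\<lambda>x. (x, ?g x)) ` UU"
    then obtain x where x: "x \<in> UU" "p = (x, ?g x)" by blast
    have "(?g x, f (?g x)) \<in> (\<lambda>x. (x, f x)) ` UU" by (rule imageI[OF gU[OF x(1)]])
    then have "(?g x, x) \<in> (\<lambda>x. (x, f x)) ` UU" using fg[OF x(1)] by simp
    then show "p \<in> converse ((\<lambda>x. (x, f x)) ` UU)" using x(2) by blast
  qed
  moreover have "?g ` UU = UU"
  proof
    show "?g ` UU \<subseteq> UU" using gU by blast
    show "UU \<subseteq> ?g ` UU"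
    proof
      fix x assume x: "x \<in> UU"
      then have "f x \<in> UU" using b(2) by blast
      then have "?g (f x) \<in> ?g ` UU" by (rule imageI)
      then show "x \<in> ?g ` UU" using gf[OF x] by simp
    qed
  qed
  ultimately have "?g \<in> {f. fo_iso L f MO MO}" by (auto intro: iso_of_pelem)
  then show "\<exists>g\<in>{f. fo_iso L f MO MO}. \<forall>x\<in>UU. g (f x) = x \<and> f (g x) = x" using gf fg by blast
  show "f x \<in> UU" if "x \<in> UU" for x using b(2) that by blast
  show "f ` cl MO (X \<inter> UU) = cl MO (f ` X \<inter> UU)" if X: "X \<subseteq> UU" for X
  proof -
    have "f ` X \<subseteq> UU" using X b(2) by blast
    then have "X \<inter> UU = X" "f ` X \<inter> UU = f ` X" using X by blast+
    then show ?thesis using iso_cl[OF f X] by simp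
  qed
next
  fix H \<phi> u u'
  assume H: "countable H" "H \<subseteq> UU" "cl MO (H \<inter> UU) = H" "cl MO (\<phi> ` H \<inter> UU) = \<phi> ` H"
    and el: "\<And>D. finite D \<Longrightarrow> D \<subseteq> H \<Longrightarrow> \<exists>g\<in>{f. fo_iso L f MO MO}. \<forall>x\<in>D. g x = \<phi> x"
    and u: "u \<in> UU" "u \<notin> H" "u' \<in> UU" "u' \<notin> \<phi> ` H"
  let ?S = "(\<lambda>x. (x, \<phi> x)) ` H"
  have im: "fst ` ?S = H" "snd ` ?S = \<phi> ` H" by (auto simp: image_image)
  have \<phi>U: "\<phi> x \<in> UU" if "x \<in> H" for x
    using el[of "{x}"] that H(2) iso_bij(2) by force
  have HU: "H \<inter> UU = H" "\<phi> ` H \<inter> UU = \<phi> ` H" using H(2) \<phi>U by blast+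
  have "pelem L MO MO ?S"
  proof (rule pelem_finite)
    fix T assume T: "finite T" "T \<subseteq> ?S"
    have "finite (fst ` T)" "fst ` T \<subseteq> H" using T by auto
    from el[OF this] obtain g where g: "fo_iso L g MO MO" "\<forall>x\<in>fst ` T. g x = \<phi> x" by blast
    have "T \<subseteq> (\<lambda>x. (x, g x)) ` UU"
    proof
      fix p assume p: "p \<in> T"
      then obtain x where x: "x \<in> H" "p = (x, \<phi> x)" using T(2) by blast
      moreover have "g x = \<phi> x" using g(2) p x(2) by force
      ultimately show "p \<in> (\<lambda>x. (x, g x)) ` UU" using H(2) by auto
    qed
    then show "pelem L MO MO T" by (rule pelem_subset[OF iso_pelem[OF g(1)]])
  qed
  then have "good_pair ?S"
    using H HU \<phi>U unfolding good_pair_def im closed_in_def by auto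
  then obtain S' where S': "insert (u, u') ?S \<subseteq> S'" "good_pair S'"
    using good_pair_extend[of ?S u u'] u im by auto
  obtain f where f: "fo_iso L f MO MO" "\<And>x y. (x, y) \<in> S' \<Longrightarrow> f x = y" by (rule good_pair_realized[OF S'(2)]) blast
  have "\<forall>x\<in>H. f x = \<phi> x" "f u = u'" using f(2) S'(1) by auto
  then show "\<exists>g\<in>{f. fo_iso L f MO MO}. (\<forall>x\<in>H. g x = \<phi> x) \<and> g u = u'" using f(1) by blast
qed

end

section \<open>Automorphisms of imaginaries\<close>

lemma fo_iso_id: "fo_iso L (\<lambda>x. x) N N"
  by (simp add: fo_iso_def fo_embedding_def)

lemma fo_iso_comp:
  assumes st: "is_struct L N" and f: "fo_iso L f N N" and g: "fo_iso L g N N"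
  shows "fo_iso L (\<lambda>x. f (g x)) N N"
proof -
  have gU: "g x \<in> univ N" if "x \<in> univ N" for x using g that by (auto simp: fo_iso_def)
  have e: "fo_embedding L g N N" "fo_embedding L f N N" using f g by (simp_all add: fo_iso_def)
  have "pelem L N N ((\<lambda>x. (x, g x)) ` univ N O (\<lambda>x. (x, f x)) ` univ N)"
    by (rule pelem_comp[OF embedding_pelem[OF st e(1)] embedding_pelem[OF st e(2)]])
  then have p: "pelem L N N ((\<lambda>x. (x, f (g x))) ` univ N)" by (rule pelem_subset) (use gU in auto)
  have "(\<lambda>x. f (g x)) ` univ N = f ` g ` univ N" by auto
  then have "(\<lambda>x. f (g x)) ` univ N = univ N" using f g by (simp add: fo_iso_def)
  then show ?thesis using pelem_embedding[OF p st] by (simp add: fo_iso_def)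
qed

lemma fo_iso_inverse:
  assumes st: "is_struct L N" and f: "fo_iso L f N N"
  obtains g where "fo_iso L g N N" "\<And>x. x \<in> univ N \<Longrightarrow> g (f x) = x" "\<And>x. x \<in> univ N \<Longrightarrow> f (g x) = x"
proof -
  have b: "inj_on f (univ N)" "f ` univ N = univ N" and e: "fo_embedding L f N N"
    using f by (simp_all add: fo_iso_def fo_embedding_def)
  let ?g = "inv_into (univ N) f"
  have gf: "?g (f x) = x" if "x \<in> univ N" for x using that b(1) by simp
  have fg: "f (?g x) = x" if "x \<in> univ N" for x using that b(2) by (intro f_inv_into_f) simp
  have gU: "?g x \<in> univ N" if "x \<in> univ N" for x using that b(2) by (intro inv_into_into) simp
  have "pelem L N N (converse ((\<lambda>x. (x, f x)) ` univ N))"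
    by (rule pelem_converse[OF embedding_pelem[OF st e]])
  then have p: "pelem L N N ((\<lambda>x. (x, ?g x)) ` univ N)"
  proof (rule pelem_subset, intro subsetI)
    fix p assume "p \<in> (\<lambda>x. (x, ?g x)) ` univ N"
    then obtain x where x: "x \<in> univ N" "p = (x, ?g x)" by blast
    have "(?g x, f (?g x)) \<in> (\<lambda>x. (x, f x)) ` univ N" by (rule imageI[OF gU[OF x(1)]])
    then show "p \<in> converse ((\<lambda>x. (x, f x)) ` univ N)" using x(2) fg[OF x(1)] by simp
  qed
  have im: "?g ` univ N = univ N"
  proof
    show "?g ` univ N \<subseteq> univ N" using gU by blast
    show "univ N \<subseteq> ?g ` univ N"
    proof
      fix x assume x: "x \<in> univ N"
      then have "f x \<in> univ N" using b(2) by blast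
      then have "?g (f x) \<in> ?g ` univ N" by (rule imageI)
      then show "x \<in> ?g ` univ N" using gf[OF x] by simp
    qed
  qed
  have "fo_iso L ?g N N" using pelem_embedding[OF p st] im by (simp add: fo_iso_def)
  then show ?thesis using that gf fg by blast
qed

locale structured_monster =
  fixes MM :: "('f, 'r, 'a, 'd) monster"
  assumes st: "is_struct (lng MM) (str MM)"
begin

lemma Aut_iff: "f \<in> Aut MM A \<longleftrightarrow> f \<in> Aut MM {} \<and> (\<forall>x\<in>A. f x = x)"
  by (auto simp: Aut_def)

lemma Aut_point: "f \<in> Aut MM A \<Longrightarrow> x \<in> points MM \<Longrightarrow> f x \<in> points MM"
  by (auto simp: Aut_def fo_iso_def)

lemma Aut_id: "(\<lambda>x. x) \<in> Aut MM A"
  by (auto simp: Aut_def fo_iso_id)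

lemma Aut_comp: "f \<in> Aut MM {} \<Longrightarrow> g \<in> Aut MM {} \<Longrightarrow> (\<lambda>x. f (g x)) \<in> Aut MM {}"
  using fo_iso_comp[OF st] by (simp add: Aut_def)

lemma Aut_inverse:
  assumes "f \<in> Aut MM {}"
  obtains g where "g \<in> Aut MM {}" "\<And>x. x \<in> points MM \<Longrightarrow> g (f x) = x" "\<And>x. x \<in> points MM \<Longrightarrow> f (g x) = x"
  using fo_iso_inverse[OF st, of f] assms by (auto simp: Aut_def)

lemma tuples_map: "f \<in> Aut MM {} \<Longrightarrow> a \<in> tuples (points MM) n \<Longrightarrow> map f a \<in> tuples (points MM) n"
  using Aut_point by (auto simp: tuples_def)

text \<open>An invariant relation is given by the Galois types of its elements.\<close>

lemma imag_relsI:
  assumes "countable \<E>" "eq_rel MM \<in> \<E>"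
    and E: "\<And>E. E \<in> \<E> \<Longrightarrow> \<exists>n>0. equiv (tuples (points MM) n) E \<and>
      (\<forall>f\<in>Aut MM {}. \<forall>a b. (a, b) \<in> E \<longrightarrow> (map f a, map f b) \<in> E) \<and>
      countable ((\<lambda>(a, b). galois_type MM {} (a @ b)) ` E)"
  shows "imag_rels MM \<E>"
  unfolding imag_rels_def
proof (intro conjI ballI assms(1,2))
  fix E assume "E \<in> \<E>"
  then obtain n where n: "n > 0" "equiv (tuples (points MM) n) E"
      "\<And>f a b. f \<in> Aut MM {} \<Longrightarrow> (a, b) \<in> E \<Longrightarrow> (map f a, map f b) \<in> E"
      "countable ((\<lambda>(a, b). galois_type MM {} (a @ b)) ` E)" (is "countable ?G")
    using E[OF \<open>E \<in> \<E>\<close>] by (elim exE conjE) (rule that, simp_all)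
  have sub: "E \<subseteq> tuples (points MM) n \<times> tuples (points MM) n" using n(2) by (simp add: equiv_def refl_on_def)
  have "?G \<subseteq> galois_type MM {} ` lists (points MM)"
  proof
    fix t assume "t \<in> ?G"
    then obtain a b where ab: "(a, b) \<in> E" "t = galois_type MM {} (a @ b)" by auto
    then have "a @ b \<in> lists (points MM)" using sub by (auto simp: tuples_def)
    then show "t \<in> galois_type MM {} ` lists (points MM)" using ab(2) by blast
  qed
  moreover have "E = {(a, b). a \<in> tuples (points MM) n \<and> b \<in> tuples (points MM) n \<and> galois_type MM {} (a @ b) \<in> ?G}"
  proof (intro equalityI subsetI)
    fix p assume "p \<in> E"
    then show "p \<in> {(a, b). a \<in> tuples (points MM) n \<and> b \<in> tuples (points MM) n \<and> galois_type MM {} (a @ b) \<in> ?G}"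
      using sub by auto
  next
    fix p assume p: "p \<in> {(a, b). a \<in> tuples (points MM) n \<and> b \<in> tuples (points MM) n \<and> galois_type MM {} (a @ b) \<in> ?G}"
    obtain a b where ab: "p = (a, b)" by (cases p)
    with p have t: "a \<in> tuples (points MM) n" "b \<in> tuples (points MM) n" "galois_type MM {} (a @ b) \<in> ?G" by auto
    then obtain c d where cd: "(c, d) \<in> E" "galois_type MM {} (a @ b) = galois_type MM {} (c @ d)" by auto
    have "map (\<lambda>x. x) (a @ b) \<in> galois_type MM {} (a @ b)"
      unfolding galois_type_def by (intro CollectI exI[of _ "\<lambda>x. x"] conjI refl Aut_id)
    then have "a @ b \<in> galois_type MM {} (c @ d)" using cd(2) by simp
    then obtain f where f: "f \<in> Aut MM {}" "map f (c @ d) = a @ b" by (auto simp: galois_type_def)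
    have "length c = length a" using sub cd(1) t by (auto simp: tuples_def)
    then have "map f c = a" "map f d = b" using f(2) by auto
    then show "p \<in> E" using n(3)[OF f(1) cd(1)] ab by simp
  qed
  ultimately show "\<exists>n>0. equiv (tuples (points MM) n) E \<and>
      (\<exists>\<G>. countable \<G> \<and> \<G> \<subseteq> galois_type MM {} ` lists (points MM) \<and>
        E = {(a, b). a \<in> tuples (points MM) n \<and> b \<in> tuples (points MM) n \<and> galois_type MM {} (a @ b) \<in> \<G>})"
    by (intro exI[of _ n] conjI n(1,2) exI[of _ ?G] n(4))
qed

lemma equiv_eq_rel: "equiv (tuples (points MM) 1) (eq_rel MM)"
  by (auto simp: eq_rel_def intro!: equivI refl_onI symI transI)

lemma eq_rel_invariant: "f \<in> Aut MM {} \<Longrightarrow> (a, b) \<in> eq_rel MM \<Longrightarrow> (map f a, map f b) \<in> eq_rel MM"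
  using tuples_map[of f a 1] by (auto simp: eq_rel_def)

lemma home_eq: "x \<in> points MM \<Longrightarrow> home MM x = Imag (eq_rel MM) {[x]}"
  by (auto simp: home_def quot_def eq_rel_def tuples_def)

lemma home_inj: "x \<in> points MM \<Longrightarrow> y \<in> points MM \<Longrightarrow> home MM x = home MM y \<longleftrightarrow> x = y"
  by (simp add: home_eq)

end

text \<open>The tag \<open>E\<close> is kept because the relations in question are invariant, so
  that the image of a class of \<open>E\<close> is again a class of \<open>E\<close>.\<close>

primrec imag_map :: "('a \<Rightarrow> 'a) \<Rightarrow> 'a imag \<Rightarrow> 'a imag" where
  "imag_map f (Imag E X) = Imag E (map f ` X)"

locale imaginaries = structured_monster MM for MM :: "('f, 'r, 'a, 'd) monster" +
  fixes \<E> :: "'a list rel set"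
  assumes eq_in: "eq_rel MM \<in> \<E>"
    and equivs: "E \<in> \<E> \<Longrightarrow> \<exists>n>0. equiv (tuples (points MM) n) E"
    and invariant: "E \<in> \<E> \<Longrightarrow> f \<in> Aut MM {} \<Longrightarrow> (a, b) \<in> E \<Longrightarrow> (map f a, map f b) \<in> E"
begin

abbreviation "MMeq \<equiv> eq_monster MM \<E>"

lemma eq_simps: "lng MMeq = eq_lang MM \<E>" "str MMeq = eq_struct MM \<E>" "points MMeq = eq_set \<E> (points MM)"
  "mods MMeq = eq_set \<E> ` mods MM" "bnd MMeq = bnd MM"
  by (simp_all add: eq_monster_def eq_struct_def)

sublocale eq: structured_monster MMeq
  by unfold_locales (simp add: is_struct_def eq_simps eq_lang_def)

lemma Domain_E:
  assumes "E \<in> \<E>"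
  obtains n where "n > 0" "equiv (tuples (points MM) n) E" "Domain E = tuples (points MM) n"
proof -
  obtain n where n: "n > 0" "equiv (tuples (points MM) n) E" using equivs[OF assms] by blast
  then have "Domain E = tuples (points MM) n" by (auto simp: equiv_def refl_on_def)
  then show ?thesis using that n by blast
qed

lemma quot_eq_iff:
  assumes "E \<in> \<E>" "a \<in> Domain E" "b \<in> Domain E"
  shows "quot E a = quot E' b \<longleftrightarrow> E = E' \<and> (a, b) \<in> E"
proof -
  obtain n where n: "n > 0" "equiv (tuples (points MM) n) E" "Domain E = tuples (points MM) n" using Domain_E[OF assms(1)] by blast
  then have "E `` {a} = E `` {b} \<longleftrightarrow> (a, b) \<in> E" using eq_equiv_class_iff[OF n(2), of a b] assms(2,3) by simp
  then show ?thesis by (auto simp: quot_def)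
qed

lemma in_pointsI: "E \<in> \<E> \<Longrightarrow> a \<in> Domain E \<Longrightarrow> quot E a \<in> points MMeq"
proof -
  assume E: "E \<in> \<E>" "a \<in> Domain E"
  then have "set a \<subseteq> points MM" by (elim Domain_E) (auto simp: tuples_def)
  then show "quot E a \<in> points MMeq" unfolding eq_simps(3) eq_set_def using E by blast
qed

lemma pointsE:
  assumes "e \<in> points MMeq"
  obtains E a where "E \<in> \<E>" "a \<in> Domain E" "set a \<subseteq> points MM" "e = quot E a"
  using assms unfolding eq_simps(3) eq_set_def by blast

lemma home_point: "x \<in> points MM \<Longrightarrow> home MM x \<in> points MMeq"
  unfolding home_def by (rule in_pointsI[OF eq_in]) (auto simp: eq_rel_def tuples_def)

lemma imag_map_quot:
  assumes f: "f \<in> Aut MM {}" and E: "E \<in> \<E>" "a \<in> Domain E"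
  shows "imag_map f (quot E a) = quot E (map f a)" "map f a \<in> Domain E"
proof -
  obtain n where n: "n > 0" "equiv (tuples (points MM) n) E" "Domain E = tuples (points MM) n" using Domain_E[OF E(1)] by blast
  show "map f a \<in> Domain E" using E(2) tuples_map[OF f] unfolding n(3) by blast
  obtain g where g: "g \<in> Aut MM {}" "\<And>x. x \<in> points MM \<Longrightarrow> g (f x) = x" "\<And>x. x \<in> points MM \<Longrightarrow> f (g x) = x"
    using Aut_inverse[OF f] by blast
  have sub: "E \<subseteq> tuples (points MM) n \<times> tuples (points MM) n" using n(2) by (simp add: equiv_def refl_on_def)
  have "map f ` (E `` {a}) = E `` {map f a}"
  proof (intro equalityI subsetI)
    fix b assume "b \<in> map f ` (E `` {a})"
    then show "b \<in> E `` {map f a}" using invariant[OF E(1) f] by auto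
  next
    fix b assume "b \<in> E `` {map f a}"
    then have b: "(map f a, b) \<in> E" by simp
    then have bU: "set b \<subseteq> points MM" using sub by (auto simp: tuples_def)
    have aU: "set a \<subseteq> points MM" using E(2) unfolding n(3) by (simp add: tuples_def)
    have "map g (map f a) = a" by (rule map_inverse[of "points MM" g f, OF g(2) aU])
    then have "(a, map g b) \<in> E" using invariant[OF E(1) g(1) b] by simp
    moreover have "map f (map g b) = b" by (rule map_inverse[of "points MM" f g, OF g(3) bU])
    ultimately show "b \<in> map f ` (E `` {a})" by (metis ImageI image_eqI singletonI)
  qed
  then show "imag_map f (quot E a) = quot E (map f a)" by (simp add: quot_def)
qed

lemma imag_map_home: "f \<in> Aut MM {} \<Longrightarrow> x \<in> points MM \<Longrightarrow> imag_map f (home MM x) = home MM (f x)"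
  using Aut_point[of f "{}" x] by (simp add: home_eq)

lemma imag_map_point: "f \<in> Aut MM {} \<Longrightarrow> e \<in> points MMeq \<Longrightarrow> imag_map f e \<in> points MMeq"
proof -
  assume f: "f \<in> Aut MM {}" and "e \<in> points MMeq"
  then obtain E a where E: "E \<in> \<E>" "a \<in> Domain E" "e = quot E a" using pointsE by metis
  then show ?thesis using imag_map_quot[OF f E(1,2)] in_pointsI[OF E(1)] by simp
qed

lemma imag_map_agree:
  assumes "f \<in> Aut MM {}" "g \<in> Aut MM {}" "E \<in> \<E>" "a \<in> Domain E" "\<And>x. x \<in> set a \<Longrightarrow> f x = g x"
  shows "imag_map f (quot E a) = imag_map g (quot E a)"
proof -
  have "map f a = map g a" using assms(5) by (rule map_cong[OF refl])
  then show ?thesis unfolding imag_map_quot(1)[OF assms(1,3,4)] imag_map_quot(1)[OF assms(2,3,4)] by (rule arg_cong)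
qed

lemma imag_map_comp:
  assumes "f \<in> Aut MM {}" "g \<in> Aut MM {}" "e \<in> points MMeq"
  shows "imag_map f (imag_map g e) = imag_map (\<lambda>x. f (g x)) e"
proof -
  obtain E a where E: "E \<in> \<E>" "a \<in> Domain E" "e = quot E a" using assms(3) pointsE by metis
  have fg: "(\<lambda>x. f (g x)) \<in> Aut MM {}" using Aut_comp[OF assms(1,2)] .
  show ?thesis unfolding E(3) imag_map_quot(1)[OF assms(2) E(1,2)] imag_map_quot(1)[OF fg E(1,2)]
    using imag_map_quot(1)[OF assms(1) E(1) imag_map_quot(2)[OF assms(2) E(1,2)]] by (simp add: comp_def)
qed

lemma imag_map_id: "e \<in> points MMeq \<Longrightarrow> (\<And>x. x \<in> points MM \<Longrightarrow> f x = x) \<Longrightarrow> f \<in> Aut MM {} \<Longrightarrow> imag_map f e = e"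
proof -
  assume e: "e \<in> points MMeq" and f: "\<And>x. x \<in> points MM \<Longrightarrow> f x = x" "f \<in> Aut MM {}"
  obtain E a where E: "E \<in> \<E>" "a \<in> Domain E" "set a \<subseteq> points MM" "e = quot E a" by (rule pointsE[OF e])
  have "map f a = a" using f(1) E(3) by (intro map_idI) auto
  then show ?thesis using imag_map_quot(1)[OF f(2) E(1,2)] E(4) by simp
qed

lemma imag_map_rint:
  assumes f: "f \<in> Aut MM {}" and r: "r \<in> rsyms (eq_lang MM \<E>)" and xs: "xs \<in> rint (eq_struct MM \<E>) r"
  shows "map (imag_map f) xs \<in> rint (eq_struct MM \<E>) r"
proof -
  have iso: "fo_embedding (lng MM) f (str MM) (str MM)" using f by (simp add: Aut_def fo_iso_def)
  have hm: "map (imag_map f) (map (home MM) a) = map (home MM) (map f a)" if "set a \<subseteq> points MM" for a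
    using that imag_map_home[OF f] by auto
  show ?thesis
  proof (cases r)
    case (Graph h)
    then have h: "h \<in> fsyms (lng MM)" using r by (auto simp: eq_lang_def)
    obtain a where a: "xs = map (home MM) (a @ [fint (str MM) h a])" "a \<in> tuples (points MM) (far (lng MM) h)"
      using xs Graph by (auto simp: eq_struct_def)
    have "fint (str MM) h a \<in> points MM" using st h a(2) by (simp add: is_struct_def)
    then have sub: "set (a @ [fint (str MM) h a]) \<subseteq> points MM" using a(2) by (auto simp: tuples_def)
    have "f (fint (str MM) h a) = fint (str MM) h (map f a)" using iso h a(2) unfolding fo_embedding_def by blast
    then have "map (imag_map f) xs = map (home MM) (map f a @ [fint (str MM) h (map f a)])"
      unfolding a(1) hm[OF sub] by simp
    moreover have "map f a \<in> tuples (points MM) (far (lng MM) h)" by (rule tuples_map[OF f a(2)])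
    moreover have "rint (eq_struct MM \<E>) r = {map (home MM) (a @ [fint (str MM) h a]) |a. a \<in> tuples (points MM) (far (lng MM) h)}"
      unfolding Graph by (simp add: eq_struct_def)
    ultimately show ?thesis by blast
  next
    case (Old s)
    then have s: "s \<in> rsyms (lng MM)" using r by (auto simp: eq_lang_def)
    obtain a where a: "xs = map (home MM) a" "a \<in> tuples (points MM) (rar (lng MM) s)" "a \<in> rint (str MM) s"
      using xs Old by (auto simp: eq_struct_def)
    have "map f a \<in> rint (str MM) s" using iso s a(2,3) unfolding fo_embedding_def by blast
    moreover have "map f a \<in> tuples (points MM) (rar (lng MM) s)" by (rule tuples_map[OF f a(2)])
    moreover have "map (imag_map f) xs = map (home MM) (map f a)" unfolding a(1) using a(2) by (intro hm) (simp add: tuples_def)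
    moreover have "rint (eq_struct MM \<E>) r = {map (home MM) a |a. a \<in> tuples (points MM) (rar (lng MM) s) \<and> a \<in> rint (str MM) s}"
      unfolding Old by (simp add: eq_struct_def)
    ultimately show ?thesis by blast
  next
    case (P E)
    then have E: "E \<in> \<E>" using r by (auto simp: eq_lang_def)
    obtain a where a: "xs = [quot E a]" "a \<in> Domain E" using xs P by (auto simp: eq_struct_def)
    then show ?thesis using imag_map_quot[OF f E a(2)] P by (auto simp: eq_struct_def)
  next
    case (F n E)
    then have E: "E \<in> \<E>" "equiv (tuples (points MM) n) E" using r by (auto simp: eq_lang_def)
    then have D: "Domain E = tuples (points MM) n" by (auto simp: equiv_def refl_on_def)
    obtain a where a: "xs = map (home MM) a @ [quot E a]" "a \<in> tuples (points MM) n" using xs F by (auto simp: eq_struct_def)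
    have "map (imag_map f) xs = map (home MM) (map f a) @ [quot E (map f a)]"
      using hm[of a] a imag_map_quot(1)[OF f E(1), of a] D by (simp add: tuples_def)
    moreover have "map f a \<in> tuples (points MM) n" by (rule tuples_map[OF f a(2)])
    moreover have "rint (eq_struct MM \<E>) r = {map (home MM) a @ [quot E a] |a. a \<in> tuples (points MM) n}"
      unfolding F by (simp add: eq_struct_def)
    ultimately show ?thesis by blast
  qed
qed

lemma imag_map_Aut:
  assumes f: "f \<in> Aut MM {}"
  shows "imag_map f \<in> Aut MMeq {}"
proof -
  obtain g where g: "g \<in> Aut MM {}" "\<And>x. x \<in> points MM \<Longrightarrow> g (f x) = x" "\<And>x. x \<in> points MM \<Longrightarrow> f (g x) = x"
    using Aut_inverse[OF f] by blast
  have gf: "imag_map g (imag_map f e) = e" if "e \<in> points MMeq" for e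
    using imag_map_comp[OF g(1) f that] imag_map_id[OF that, of "\<lambda>x. g (f x)"] g Aut_comp[OF g(1) f] by simp
  have fg: "imag_map f (imag_map g e) = e" if "e \<in> points MMeq" for e
    using imag_map_comp[OF f g(1) that] imag_map_id[OF that, of "\<lambda>x. f (g x)"] g Aut_comp[OF f g(1)] by simp
  have im: "imag_map f ` points MMeq = points MMeq"
  proof
    show "imag_map f ` points MMeq \<subseteq> points MMeq" using imag_map_point[OF f] by blast
    show "points MMeq \<subseteq> imag_map f ` points MMeq"
    proof
      fix e assume e: "e \<in> points MMeq"
      have "imag_map f (imag_map g e) \<in> imag_map f ` points MMeq" by (rule imageI[OF imag_map_point[OF g(1) e]])
      then show "e \<in> imag_map f ` points MMeq" using fg[OF e] by simp
    qed
  qed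
  have "fo_embedding (lng MMeq) (imag_map f) (str MMeq) (str MMeq)"
    unfolding fo_embedding_def
  proof (intro conjI ballI)
    show "inj_on (imag_map f) (points MMeq)" by (rule inj_on_inverseI[of "points MMeq" "imag_map g" "imag_map f", OF gf])
    show "imag_map f ` points MMeq \<subseteq> points MMeq" using im by simp
    show "imag_map f (fint (str MMeq) h xs) = fint (str MMeq) h (map (imag_map f) xs)" if "h \<in> fsyms (lng MMeq)" for h xs
      using that by (simp add: eq_simps eq_lang_def)
    fix r xs assume r: "r \<in> rsyms (lng MMeq)" and xs: "xs \<in> tuples (points MMeq) (rar (lng MMeq) r)"
    have r': "r \<in> rsyms (eq_lang MM \<E>)" using r by (simp add: eq_simps)
    have "map (imag_map g) (map (imag_map f) xs) = xs"
      by (rule map_inverse[of "points MMeq" "imag_map g" "imag_map f", OF gf]) (use xs in \<open>simp_all add: tuples_def\<close>)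
    then show "xs \<in> rint (str MMeq) r \<longleftrightarrow> map (imag_map f) xs \<in> rint (str MMeq) r"
      using imag_map_rint[OF f r', of xs] imag_map_rint[OF g(1) r', of "map (imag_map f) xs"]
      unfolding eq_simps(2) by auto
  qed
  then show ?thesis using im by (simp add: Aut_def fo_iso_def)
qed

text \<open>Conversely, an automorphism of the imaginaries is determined by its restriction to the copy
  of the original universe, which is marked by the predicate for equality.\<close>

lemma Aut_MMeq_imag_map:
  assumes "\<phi> \<in> Aut MMeq {}"
  obtains f where "f \<in> Aut MM {}" "\<And>e. e \<in> points MMeq \<Longrightarrow> \<phi> e = imag_map f e"
proof -
  let ?U = "points MM"
  have iso: "fo_embedding (lng MMeq) \<phi> (str MMeq) (str MMeq)" "\<phi> ` points MMeq = points MMeq"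
    using assms by (simp_all add: Aut_def fo_iso_def)
  have rel: "xs \<in> rint (eq_struct MM \<E>) r \<longleftrightarrow> map \<phi> xs \<in> rint (eq_struct MM \<E>) r"
    if "r \<in> rsyms (eq_lang MM \<E>)" "xs \<in> tuples (points MMeq) (rar (eq_lang MM \<E>) r)" for r xs
    using iso(1) that unfolding fo_embedding_def eq_simps(1,2) by blast
  have inj: "inj_on \<phi> (points MMeq)" using iso(1) by (simp add: fo_embedding_def)
  have DE: "Domain (eq_rel MM) = (\<lambda>x. [x]) ` ?U" by (auto simp: eq_rel_def tuples_def length_Suc_conv)
  have Pr: "rint (eq_struct MM \<E>) (P (eq_rel MM)) = (\<lambda>x. [home MM x]) ` ?U"
    unfolding eq_struct_def by (auto simp: DE home_def)
  have P_in: "P (eq_rel MM) \<in> rsyms (eq_lang MM \<E>)" using eq_in by (simp add: eq_lang_def)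
  have mem: "e \<in> home MM ` ?U \<longleftrightarrow> \<phi> e \<in> home MM ` ?U" if "e \<in> points MMeq" for e
    using rel[OF P_in, of "[e]"] that unfolding Pr by (auto simp: tuples_def eq_lang_def)
  have "\<exists>y\<in>?U. \<phi> (home MM x) = home MM y" if "x \<in> ?U" for x
    using mem[OF home_point[OF that]] that by blast
  then obtain f where f: "\<And>x. x \<in> ?U \<Longrightarrow> f x \<in> ?U \<and> \<phi> (home MM x) = home MM (f x)" by metis
  have mapf: "map \<phi> (map (home MM) a) = map (home MM) (map f a)" if "set a \<subseteq> ?U" for a
    using that f by auto
  have mapinj: "map (home MM) a = map (home MM) b \<longleftrightarrow> a = b" if "set a \<subseteq> ?U" "set b \<subseteq> ?U" for a b
  proof
    assume eq: "map (home MM) a = map (home MM) b"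
    have "inj_on (home MM) (set a \<union> set b)" using that home_inj by (intro inj_onI) blast
    with eq show "a = b" by (rule map_inj_on)
  qed simp
  have mapU: "set (map f a) \<subseteq> ?U" if "set a \<subseteq> ?U" for a using that f by auto
  have hpts: "set (map (home MM) a) \<subseteq> points MMeq" if "set a \<subseteq> ?U" for a using that home_point by auto
  have finj: "inj_on f ?U"
  proof (rule inj_onI)
    fix x y assume xy: "x \<in> ?U" "y \<in> ?U" "f x = f y"
    then have "\<phi> (home MM x) = \<phi> (home MM y)" using f by simp
    then have "home MM x = home MM y" using inj_onD[OF inj] home_point xy by blast
    then show "x = y" using home_inj xy by simp
  qed
  have fsurj: "f ` ?U = ?U"
  proof
    show "f ` ?U \<subseteq> ?U" using f by blast
    show "?U \<subseteq> f ` ?U"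
    proof
      fix y assume y: "y \<in> ?U"
      then obtain e where e: "e \<in> points MMeq" "\<phi> e = home MM y" using iso(2) home_point by (metis imageE)
      then obtain x where x: "x \<in> ?U" "e = home MM x" using mem[OF e(1)] y by auto
      then have "home MM (f x) = home MM y" using f e(2) by simp
      then have "f x = y" using home_inj f x(1) y by blast
      then show "y \<in> f ` ?U" using x(1) by blast
    qed
  qed
  have "fo_embedding (lng MM) f (str MM) (str MM)" unfolding fo_embedding_def
  proof (intro conjI ballI)
    show "inj_on f ?U" "f ` ?U \<subseteq> ?U" using finj fsurj by auto
  next
    fix h a assume h: "h \<in> fsyms (lng MM)" and a: "a \<in> tuples ?U (far (lng MM) h)"
    let ?y = "fint (str MM) h a"
    have y: "?y \<in> ?U" using st h a by (simp add: is_struct_def)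
    have aU: "set (a @ [?y]) \<subseteq> ?U" "length a = far (lng MM) h" using a y by (auto simp: tuples_def)
    have r: "Graph h \<in> rsyms (eq_lang MM \<E>)" using h by (simp add: eq_lang_def)
    have rr: "rint (eq_struct MM \<E>) (Graph h) = {map (home MM) (a @ [fint (str MM) h a]) |a. a \<in> tuples ?U (far (lng MM) h)}"
      by (simp add: eq_struct_def)
    have "map (home MM) (a @ [?y]) \<in> rint (eq_struct MM \<E>) (Graph h)" unfolding rr using a by blast
    moreover have "map (home MM) (a @ [?y]) \<in> tuples (points MMeq) (rar (eq_lang MM \<E>) (Graph h))"
      using hpts[OF aU(1)] aU(2) by (simp add: tuples_def eq_lang_def)
    ultimately have "map \<phi> (map (home MM) (a @ [?y])) \<in> rint (eq_struct MM \<E>) (Graph h)" using rel[OF r] by blast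
    then have "map (home MM) (map f (a @ [?y])) \<in> rint (eq_struct MM \<E>) (Graph h)" unfolding mapf[OF aU(1)] .
    then obtain c where c: "map (home MM) (map f (a @ [?y])) = map (home MM) (c @ [fint (str MM) h c])"
        "c \<in> tuples ?U (far (lng MM) h)" unfolding rr by blast
    have "fint (str MM) h c \<in> ?U" using st h c(2) by (simp add: is_struct_def)
    then have "set (c @ [fint (str MM) h c]) \<subseteq> ?U" using c(2) by (auto simp: tuples_def)
    then have "map f (a @ [?y]) = c @ [fint (str MM) h c]" using mapinj[OF mapU[OF aU(1)]] c(1) by blast
    then show "f ?y = fint (str MM) h (map f a)" by simp
  next
    fix s a assume s: "s \<in> rsyms (lng MM)" and a: "a \<in> tuples ?U (rar (lng MM) s)"
    have aU: "set a \<subseteq> ?U" "length a = rar (lng MM) s" using a by (auto simp: tuples_def)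
    have r: "Old s \<in> rsyms (eq_lang MM \<E>)" using s by (simp add: eq_lang_def)
    have rr: "map (home MM) b \<in> rint (eq_struct MM \<E>) (Old s) \<longleftrightarrow> b \<in> rint (str MM) s"
      if b: "set b \<subseteq> ?U" "length b = rar (lng MM) s" for b
    proof
      assume "map (home MM) b \<in> rint (eq_struct MM \<E>) (Old s)"
      then obtain c where "map (home MM) b = map (home MM) c" "c \<in> tuples ?U (rar (lng MM) s)" "c \<in> rint (str MM) s"
        by (auto simp: eq_struct_def)
      then show "b \<in> rint (str MM) s" using mapinj[OF b(1), of c] by (simp add: tuples_def)
    next
      assume "b \<in> rint (str MM) s"
      then show "map (home MM) b \<in> rint (eq_struct MM \<E>) (Old s)" using b by (auto simp: eq_struct_def tuples_def)
    qed
    have "map (home MM) a \<in> tuples (points MMeq) (rar (eq_lang MM \<E>) (Old s))"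
      using hpts[OF aU(1)] aU(2) by (simp add: tuples_def eq_lang_def)
    from rel[OF r this] show "a \<in> rint (str MM) s \<longleftrightarrow> map f a \<in> rint (str MM) s"
      unfolding mapf[OF aU(1)] rr[OF aU] using rr[OF mapU[OF aU(1)]] aU(2) by simp
  qed
  then have fA: "f \<in> Aut MM {}" using fsurj by (simp add: Aut_def fo_iso_def)
  have "\<phi> e = imag_map f e" if e: "e \<in> points MMeq" for e
  proof -
    obtain E a where E: "E \<in> \<E>" "a \<in> Domain E" "set a \<subseteq> ?U" "e = quot E a" by (rule pointsE[OF e])
    obtain n where n: "n > 0" "equiv (tuples ?U n) E" "Domain E = tuples ?U n" using Domain_E[OF E(1)] by blast
    \<comment> \<open>The graph of the quotient map of \<open>E\<close> belongs to the language, so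
      the image of \<open>quot E a\<close> is forced by the images of the entries of
      \<open>a\<close>.\<close>
    have r: "F n E \<in> rsyms (eq_lang MM \<E>)" using E(1) n(2) by (simp add: eq_lang_def)
    have rr: "rint (eq_struct MM \<E>) (F n E) = {map (home MM) a @ [quot E a] |a. a \<in> tuples ?U n}"
      by (simp add: eq_struct_def)
    have "map (home MM) a @ [e] \<in> rint (eq_struct MM \<E>) (F n E)" unfolding rr using E(2,4) n(3) by blast
    moreover have "map (home MM) a @ [e] \<in> tuples (points MMeq) (rar (eq_lang MM \<E>) (F n E))"
      using hpts[OF E(3)] e E(2) n(3) by (simp add: tuples_def eq_lang_def)
    ultimately have "map \<phi> (map (home MM) a @ [e]) \<in> rint (eq_struct MM \<E>) (F n E)" using rel[OF r] by blast
    then have "map (home MM) (map f a) @ [\<phi> e] \<in> rint (eq_struct MM \<E>) (F n E)"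
      unfolding map_append mapf[OF E(3)] by simp
    then obtain c where c: "map (home MM) (map f a) @ [\<phi> e] = map (home MM) c @ [quot E c]" "c \<in> tuples ?U n"
      unfolding rr by blast
    then have "map f a = c" "\<phi> e = quot E c" using mapinj[OF mapU[OF E(3)], of c] by (auto simp: tuples_def)
    then show ?thesis using imag_map_quot(1)[OF fA E(1,2)] E(4) by simp
  qed
  then show ?thesis using that fA by blast
qed

lemma eq_set_cong: "B \<subseteq> C \<Longrightarrow> eq_set \<E> B \<subseteq> eq_set \<E> C"
  by (auto simp: eq_set_def)

lemma home_in_eq_set:
  assumes "x \<in> points MM"
  shows "home MM x \<in> eq_set \<E> B \<longleftrightarrow> x \<in> B"
proof
  assume "home MM x \<in> eq_set \<E> B"
  then obtain E a where E: "home MM x = quot E a" "E \<in> \<E>" "a \<in> Domain E" "set a \<subseteq> B"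
    by (auto simp: eq_set_def)
  then have "E = eq_rel MM" by (simp add: home_def quot_def)
  then have "a \<in> Domain (eq_rel MM)" "eq_rel MM `` {[x]} = eq_rel MM `` {a}" using E by (auto simp: home_def quot_def)
  then have "a = [x]" using assms by (auto simp: eq_rel_def tuples_def)
  then show "x \<in> B" using E(4) by simp
next
  assume "x \<in> B"
  moreover have "[x] \<in> Domain (eq_rel MM)" using assms by (auto simp: eq_rel_def tuples_def)
  moreover have "home MM x = quot (eq_rel MM) [x]" by (simp add: home_def)
  ultimately show "home MM x \<in> eq_set \<E> B" unfolding eq_set_def using eq_in by (intro CollectI exI[of _ "eq_rel MM"] exI[of _ "[x]"]) simp
qed

end

section \<open>Galois types over finite sets and definability\<close>

context structured_monster
begin

lemma galois_type_map:
  assumes "f \<in> Aut MM {}" "set a \<subseteq> points MM"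
  shows "galois_type MM {} (map f a) = galois_type MM {} a"
proof -
  obtain g where g: "g \<in> Aut MM {}" "\<And>x. x \<in> points MM \<Longrightarrow> g (f x) = x" using Aut_inverse[OF assms(1)] by blast
  have a: "map g (map f a) = a" by (rule map_inverse[of "points MM" g f, OF g(2) assms(2)])
  have sub: "galois_type MM {} (map h b) \<subseteq> galois_type MM {} b" if "h \<in> Aut MM {}" for h b
  proof
    fix t assume "t \<in> galois_type MM {} (map h b)"
    then obtain k where k: "k \<in> Aut MM {}" "t = map k (map h b)" by (auto simp: galois_type_def)
    then have "t = map (\<lambda>x. k (h x)) b" by simp
    then show "t \<in> galois_type MM {} b" unfolding galois_type_def using Aut_comp[OF k(1) that] by blast
  qed
  show ?thesis using sub[OF assms(1), of a] sub[OF g(1), of "map f a"] unfolding a by blast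
qed

lemma same_type_finite: "finite B \<Longrightarrow> same_type MM B a b \<longleftrightarrow> (\<exists>f\<in>Aut MM B. map f a = b)"
proof
  show "finite B \<Longrightarrow> same_type MM B a b \<Longrightarrow> \<exists>f\<in>Aut MM B. map f a = b"
    by (simp add: same_type_def same_galois_type_def)
  assume "\<exists>f\<in>Aut MM B. map f a = b"
  then obtain f where f: "f \<in> Aut MM B" "map f a = b" by blast
  show "same_type MM B a b" unfolding same_type_def same_galois_type_def
  proof (intro allI impI)
    fix A0 assume "finite A0 \<and> A0 \<subseteq> B"
    then have "f \<in> Aut MM A0" using f(1) by (auto simp: Aut_def)
    then show "\<exists>f\<in>Aut MM A0. map f a = b" using f(2) by blast
  qed
qed

text \<open>One inclusion is enough, because it also holds for the inverse automorphism, which fixes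
  \<open>A\<close> as well.\<close>

lemma galois_definableI:
  assumes "A \<subseteq> points MM" "B \<subseteq> lists (points MM)" "\<And>f b. f \<in> Aut MM A \<Longrightarrow> b \<in> B \<Longrightarrow> map f b \<in> B"
  shows "galois_definable MM A B"
  unfolding galois_definable_def
proof (intro conjI ballI assms(2) equalityI subsetI)
  fix f b assume f: "f \<in> Aut MM A"
  { assume "b \<in> map f ` B" then show "b \<in> B" using assms(3)[OF f] by blast }
  assume b: "b \<in> B"
  have f0: "f \<in> Aut MM {}" "\<forall>x\<in>A. f x = x" using f Aut_iff by blast+
  obtain g where g: "g \<in> Aut MM {}" "\<And>x. x \<in> points MM \<Longrightarrow> g (f x) = x" "\<And>x. x \<in> points MM \<Longrightarrow> f (g x) = x"
    using Aut_inverse[OF f0(1)] by blast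
  have "g x = x" if "x \<in> A" for x using g(2)[of x] f0(2) that assms(1) by auto
  then have "g \<in> Aut MM A" using g(1) Aut_iff by blast
  then have "map g b \<in> B" using assms(3) b by blast
  moreover have "set b \<subseteq> points MM" using b assms(2) by auto
  then have "map f (map g b) = b" using map_inverse[of "points MM" f g, OF g(3)] by blast
  ultimately show "b \<in> map f ` B" by (metis image_eqI)
qed

end

text \<open>All strong submodels have to be models of the pregeometry, but conversely only countable
  models have to be strong submodels: these are always bounded, and they suffice as witnesses for
  lower bounds on rank.\<close>

locale geometric_monster = homogeneous_pregeometry U cl \<Gamma> + structured_monster MM
  for U :: "'a set" and cl \<Gamma> and MM :: "('f, 'r, 'a, 'd) monster" +
  assumes points: "points MM = U" and Aut: "Aut MM {} = \<Gamma>"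
    and mods_model: "B \<in> mods MM \<Longrightarrow> model B"
    and model_mods: "countable B \<Longrightarrow> model B \<Longrightarrow> B \<in> mods MM"
begin

lemma Aut_fixing: "Aut MM B = fixing B"
  using Aut_iff[of _ B] Aut by (auto simp: fixing_def)

text \<open>With no parameters to fix, \<open>move_into_model\<close> carries every finite tuple
  into one and the same model. So finite tuples realise only countably many Galois types over the
  empty set.\<close>

lemma countable_model:
  obtains N where "countable N" "model N" "\<And>k. set k \<subseteq> U \<Longrightarrow> \<exists>f\<in>Aut MM {}. set (map f k) \<subseteq> N"
proof -
  obtain N where N: "countable N" "model N" using model_independent[of "{}" "[]"] by auto
  show ?thesis
  proof (rule that[OF N])
    fix k assume "set k \<subseteq> U"
    then have "\<exists>\<sigma>\<in>fixing (cl ({} \<union> set [])). set (map \<sigma> k) \<subseteq> N" by (intro move_into_model[OF N(2)]) auto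
    then obtain f where f: "f \<in> fixing (cl ({} \<union> set []))" "set (map f k) \<subseteq> N" by blast
    have "f \<in> Aut MM {}" using fixingD(1)[OF f(1)] Aut by simp
    then show "\<exists>f\<in>Aut MM {}. set (map f k) \<subseteq> N" using f(2) by blast
  qed
qed

text \<open>As there are countably many Galois types of finite tuples, every invariant equivalence
  relation is given by a countable set of them. At the second stage only equality has to be
  described.\<close>

lemma imag_rels_countable:
  assumes im: "imaginaries MM \<E>" and c: "countable \<E>"
  shows "imag_rels MM \<E>" "imag_rels (eq_monster MM \<E>) {eq_rel (eq_monster MM \<E>)}"
proof -
  interpret im: imaginaries MM \<E> by (rule im)
  obtain N where N: "countable N" "model N" "\<And>k. set k \<subseteq> points MM \<Longrightarrow> \<exists>f\<in>Aut MM {}. set (map f k) \<subseteq> N"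
    using countable_model points by metis
  have ct: "countable (galois_type MM {} ` lists (points MM))"
  proof (rule countable_subset)
    show "galois_type MM {} ` lists (points MM) \<subseteq> galois_type MM {} ` lists N"
    proof
      fix t assume "t \<in> galois_type MM {} ` lists (points MM)"
      then obtain k where k: "set k \<subseteq> points MM" "t = galois_type MM {} k" by auto
      obtain f where f: "f \<in> Aut MM {}" "set (map f k) \<subseteq> N" using N(3)[OF k(1)] by blast
      have "map f k \<in> lists N" using f(2) by auto
      then show "t \<in> galois_type MM {} ` lists N" using galois_type_map[OF f(1) k(1)] k(2) by blast
    qed
    show "countable (galois_type MM {} ` lists N)" using N(1) by simp
  qed
  show "imag_rels MM \<E>"
  proof (rule imag_relsI[OF c im.eq_in])
    fix E assume E: "E \<in> \<E>"
    obtain n where n: "n > 0" "equiv (tuples (points MM) n) E" using im.equivs[OF E] by blast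
    have sub: "E \<subseteq> tuples (points MM) n \<times> tuples (points MM) n" using n(2) by (simp add: equiv_def refl_on_def)
    have "(\<lambda>(a, b). galois_type MM {} (a @ b)) ` E \<subseteq> galois_type MM {} ` lists (points MM)"
    proof
      fix t assume "t \<in> (\<lambda>(a, b). galois_type MM {} (a @ b)) ` E"
      then obtain a b where ab: "(a, b) \<in> E" "t = galois_type MM {} (a @ b)" by auto
      then have "a @ b \<in> lists (points MM)" using sub by (auto simp: tuples_def)
      then show "t \<in> galois_type MM {} ` lists (points MM)" using ab(2) by blast
    qed
    then have ce: "countable ((\<lambda>(a, b). galois_type MM {} (a @ b)) ` E)" using ct countable_subset by blast
    have inv: "\<forall>f\<in>Aut MM {}. \<forall>a b. (a, b) \<in> E \<longrightarrow> (map f a, map f b) \<in> E"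
      by (intro ballI allI impI) (rule im.invariant[OF E])
    show "\<exists>n>0. equiv (tuples (points MM) n) E \<and> (\<forall>f\<in>Aut MM {}. \<forall>a b. (a, b) \<in> E \<longrightarrow> (map f a, map f b) \<in> E) \<and>
      countable ((\<lambda>(a, b). galois_type MM {} (a @ b)) ` E)"
      by (intro exI[of _ n] conjI n inv ce)
  qed
  let ?Q = "eq_monster MM \<E>"
  have ce: "countable ((\<lambda>(a, b). galois_type ?Q {} (a @ b)) ` eq_rel ?Q)"
  proof (rule countable_subset)
    \<comment> \<open>Only diagonal pairs are related by equality, and every element of the first
      stage is conjugate to a class with a representative in \<open>N\<close>.\<close>
    let ?T = "(\<lambda>(E, a). galois_type ?Q {} [quot E a, quot E a]) ` (\<E> \<times> lists N)"
    show "(\<lambda>(a, b). galois_type ?Q {} (a @ b)) ` eq_rel ?Q \<subseteq> ?T"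
    proof
      fix t assume "t \<in> (\<lambda>(a, b). galois_type ?Q {} (a @ b)) ` eq_rel ?Q"
      then obtain a where "a \<in> tuples (points ?Q) 1" "t = galois_type ?Q {} (a @ a)" by (auto simp: eq_rel_def)
      then obtain e where e: "e \<in> points ?Q" "t = galois_type ?Q {} [e, e]" by (auto simp: tuples_def length_Suc_conv)
      obtain E d where E: "E \<in> \<E>" "d \<in> Domain E" "set d \<subseteq> points MM" "e = quot E d" by (rule im.pointsE[OF e(1)])
      obtain f where f: "f \<in> Aut MM {}" "set (map f d) \<subseteq> N" using N(3)[OF E(3)] by blast
      have "galois_type ?Q {} (map (imag_map f) [e, e]) = galois_type ?Q {} [e, e]"
        by (rule im.eq.galois_type_map[OF im.imag_map_Aut[OF f(1)]]) (simp add: e(1))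
      moreover have "imag_map f e = quot E (map f d)" unfolding E(4) by (rule im.imag_map_quot(1)[OF f(1) E(1,2)])
      ultimately have "t = (\<lambda>(E, a). galois_type ?Q {} [quot E a, quot E a]) (E, map f d)" using e(2) by simp
      moreover have "(E, map f d) \<in> \<E> \<times> lists N" using E(1) f(2) by auto
      ultimately show "t \<in> ?T" by blast
    qed
    show "countable ?T" using c N(1) by simp
  qed
  have inv: "\<forall>f\<in>Aut ?Q {}. \<forall>a b. (a, b) \<in> eq_rel ?Q \<longrightarrow> (map f a, map f b) \<in> eq_rel ?Q"
    by (intro ballI allI impI) (rule im.eq.eq_rel_invariant)
  show "imag_rels ?Q {eq_rel ?Q}"
  proof (rule im.eq.imag_relsI)
    fix E assume "E \<in> {eq_rel ?Q}"
    then have E: "E = eq_rel ?Q" by simp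
    show "\<exists>n>0. equiv (tuples (points ?Q) n) E \<and> (\<forall>f\<in>Aut ?Q {}. \<forall>a b. (a, b) \<in> E \<longrightarrow> (map f a, map f b) \<in> E) \<and>
      countable ((\<lambda>(a, b). galois_type ?Q {} (a @ b)) ` E)"
      unfolding E by (intro exI[of _ 1] conjI im.eq.equiv_eq_rel inv ce) simp
  qed auto
qed

lemma imaginaries_eq_rel: "imaginaries MM {eq_rel MM}"
proof
  fix E assume "E \<in> {eq_rel MM}"
  then show "\<exists>n>0. equiv (tuples (points MM) n) E" using equiv_eq_rel by (intro exI[of _ 1]) simp
next
  fix E f a b assume "E \<in> {eq_rel MM}" "f \<in> Aut MM {}" "(a, b) \<in> E"
  then show "(map f a, map f b) \<in> E" using eq_rel_invariant by simp
qed simp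

end


section \<open>The group in the imaginaries of imaginaries\<close>

locale monster_group = group_configuration U cl \<Gamma> A bb zz Y + geometric_monster U cl \<Gamma> MM
  for U :: "'a set" and cl \<Gamma> A bb zz and Y :: "'a list \<Rightarrow> 'a list \<Rightarrow> 'o"
    and MM :: "('f, 'r, 'a, 'd) monster"
begin

definition base :: "'a list" where "base = (SOME l. set l = A)"

lemma set_base: "set base = A"
  unfolding base_def by (rule someI_ex) (rule finite_list[OF A(1)])

definition code :: "'a list \<times> 'a list \<Rightarrow> 'a list" where
  "code p = base @ fst p @ snd p"

lemma q_length: "s \<in> q \<Longrightarrow> length s = length bb"
  by (auto simp: q_def eqt_def)

abbreviation "pmap f \<equiv> map_prod (map f) (map f)"

abbreviation "code_length \<equiv> length base + 2 * length bb"

lemma code_tuples: "p \<in> q \<times> q \<Longrightarrow> code p \<in> tuples U code_length"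
  using q_length A(2) qD(2) by (force simp: code_def tuples_def set_base)

lemma map_code_fixing: "g \<in> fixing A \<Longrightarrow> map g (code p) = code (pmap g p)"
proof -
  assume "g \<in> fixing A"
  then have "map g base = base" by (intro map_idI) (simp add: set_base fixingD(2))
  then show ?thesis by (simp add: code_def)
qed

lemma pmap_q: "g \<in> fixing A \<Longrightarrow> p \<in> q \<times> q \<Longrightarrow> pmap g p \<in> q \<times> q"
  using q_aut by (cases p) auto

text \<open>Prefixing the germs with the parameters makes the relation invariant under all automorphisms.\<close>

definition germ_rel :: "'a list rel" where
  "germ_rel = Id_on (tuples U code_length) \<union> {(map g (code p), map g (code p')) |g p p'. g \<in> \<Gamma> \<and> sim p p'}"

lemma map_tuples: "g \<in> \<Gamma> \<Longrightarrow> a \<in> tuples U n \<Longrightarrow> map g a \<in> tuples U n"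
  using tuples_map[of g a n] points Aut by simp

lemma germ_relI: "g \<in> \<Gamma> \<Longrightarrow> sim p p' \<Longrightarrow> (map g (code p), map g (code p')) \<in> germ_rel"
  unfolding germ_rel_def by blast

lemma germ_relE:
  assumes "(x, y) \<in> germ_rel"
  obtains "x = y" "x \<in> tuples U code_length"
  | g p p' where "g \<in> \<Gamma>" "sim p p'" "x = map g (code p)" "y = map g (code p')"
  using assms unfolding germ_rel_def by blast

text \<open>The two automorphisms presenting \<open>x\<close> and its partner may differ. But the
  codes contain an enumeration of \<open>A\<close>, so the quotient of the two fixes
  \<open>A\<close> and carries equality of germs along. Transitivity of \<open>germ_rel\<close>
  rests on this.\<close>

lemma germ_rel_code:
  assumes g: "g \<in> \<Gamma>" and p: "p \<in> q \<times> q" and r: "(map g (code p), x) \<in> germ_rel"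
  obtains p' where "sim p p'" "x = map g (code p')"
  using r
proof (cases rule: germ_relE)
  case 1
  then show ?thesis using that sim_refl[OF p] by blast
next
  case (2 h e e')
  obtain g' where g': "g' \<in> \<Gamma>" "\<And>x. x \<in> U \<Longrightarrow> g' (g x) = x" "\<And>x. x \<in> U \<Longrightarrow> g (g' x) = x" using inv_ex[OF g] by blast
  let ?k = "\<lambda>x. g' (h x)"
  have cp: "set (code p) \<subseteq> U" using code_tuples[OF p] by (simp add: tuples_def)
  have e: "e \<in> q \<times> q" "e' \<in> q \<times> q" using sim_q[OF 2(2)] by simp_all
  have "map g' (map g (code p)) = code p" by (rule map_inverse[of U g' g, OF g'(2) cp])
  then have k: "map ?k (code e) = code p" unfolding 2(3) by (simp add: comp_def)
  then have kb: "map ?k base = base" "map ?k (fst e) = fst p" "map ?k (snd e) = snd p"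
    using p e q_length by (auto simp: code_def)
  have "?k x = x" if "x \<in> A" for x using map_eq_conv[of ?k base "\<lambda>x. x"] kb(1) that set_base by simp
  then have kA: "?k \<in> fixing A" using comp_in[OF g'(1) 2(1)] by (simp add: fixing_def)
  have pe: "pmap ?k e = p" using kb(2,3) by (cases e, cases p) simp
  have s: "sim p (pmap ?k e')" using sim_aut[OF 2(2) kA] pe by simp
  have ce: "set (map h (code e')) \<subseteq> U" using map_tuples[OF 2(1) code_tuples[OF e(2)]] by (simp add: tuples_def)
  have "map g (code (pmap ?k e')) = map g (map g' (map h (code e')))"
    unfolding map_code_fixing[OF kA, symmetric] by (simp add: comp_def)
  also have "\<dots> = map h (code e')" using map_inverse[of U g g', OF g'(3) ce] by blast
  finally show ?thesis using that s 2(4) by simp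
qed

lemma equiv_germ_rel: "equiv (tuples U code_length) germ_rel"
proof (rule equivI)
  show "germ_rel \<subseteq> tuples U code_length \<times> tuples U code_length"
    using map_tuples code_tuples sim_q by (auto elim!: germ_relE)
  show "refl_on (tuples U code_length) germ_rel"
    by (rule refl_onI) (auto simp: germ_rel_def)
  show "sym germ_rel"
  proof (rule symI)
    fix x y assume xy: "(x, y) \<in> germ_rel"
    then show "(y, x) \<in> germ_rel"
    proof (cases rule: germ_relE)
      case 1 then show ?thesis using xy by simp
    next
      case (2 g p p') then show ?thesis using germ_relI[OF 2(1) sim_sym[OF 2(2)]] by simp
    qed
  qed
  show "trans germ_rel"
  proof (rule transI)
    fix x y z assume xy: "(x, y) \<in> germ_rel" and yz: "(y, z) \<in> germ_rel"
    show "(x, z) \<in> germ_rel" using xy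
    proof (cases rule: germ_relE)
      case 1 then show ?thesis using yz by simp
    next
      case (2 g p p')
      obtain p'' where p'': "sim p' p''" "z = map g (code p'')"
        using germ_rel_code[OF 2(1) sim_q(2)[OF 2(2)]] yz unfolding 2(4) by blast
      then show ?thesis using germ_relI[OF 2(1) sim_trans[OF 2(2) p''(1)]] 2(3) by simp
    qed
  qed
qed

lemma germ_rel_invariant: "f \<in> \<Gamma> \<Longrightarrow> (x, y) \<in> germ_rel \<Longrightarrow> (map f x, map f y) \<in> germ_rel"
proof -
  assume f: "f \<in> \<Gamma>" and xy: "(x, y) \<in> germ_rel"
  from xy show ?thesis
  proof (cases rule: germ_relE)
    case 1 then show ?thesis using map_tuples[OF f] by (auto simp: germ_rel_def)
  next
    case (2 g p p')
    then show ?thesis using germ_relI[OF comp_in[OF f 2(1)] 2(2)] by (simp add: comp_def)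
  qed
qed

lemma code_rel: "p \<in> q \<times> q \<Longrightarrow> p' \<in> q \<times> q \<Longrightarrow> (code p, code p') \<in> germ_rel \<longleftrightarrow> sim p p'"
proof
  assume p: "p \<in> q \<times> q" "p' \<in> q \<times> q"
  { assume "sim p p'" then show "(code p, code p') \<in> germ_rel" using germ_relI[OF id_in] by simp }
  assume "(code p, code p') \<in> germ_rel"
  then obtain p'' where p'': "sim p p''" "code p' = code p''"
    using germ_rel_code[OF id_in p(1), of "code p'"] by auto
  have "p' = p''" using p''(2) p sim_q(2)[OF p''(1)] q_length by (auto simp: code_def)
  then show "sim p p'" using p''(1) by simp
qed

abbreviation "rels1 \<equiv> {eq_rel MM, germ_rel}"

sublocale im: imaginaries MM rels1
proof
  fix E assume "E \<in> rels1"
  moreover have "code_length > 0" using bb(1) by simp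
  ultimately show "\<exists>n>0. equiv (tuples (points MM) n) E"
    using equiv_eq_rel equiv_germ_rel points by (metis insertE singletonD zero_less_one)
next
  fix E f a b assume "E \<in> rels1" "f \<in> Aut MM {}" "(a, b) \<in> E"
  then show "(map f a, map f b) \<in> E" using eq_rel_invariant germ_rel_invariant Aut by auto
qed simp

abbreviation "MQ \<equiv> eq_monster MM rels1"
abbreviation "rels2 \<equiv> {eq_rel MQ}"

sublocale im2: imaginaries MQ rels2
proof
  fix E assume "E \<in> rels2"
  then show "\<exists>n>0. equiv (tuples (points MQ) n) E" using im.eq.equiv_eq_rel by (intro exI[of _ 1]) simp
next
  fix E f a b assume "E \<in> rels2" "f \<in> Aut MQ {}" "(a, b) \<in> E"
  then show "(map f a, map f b) \<in> E" using im.eq.eq_rel_invariant by simp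
qed simp

abbreviation "MQQ \<equiv> eq_monster MQ rels2"

lemma imag_rels_germ: "imag_rels MM rels1" "imag_rels MQ rels2"
  by (rule imag_rels_countable[OF im.imaginaries_axioms], simp)+

definition lift :: "('a \<Rightarrow> 'a) \<Rightarrow> 'a imag imag \<Rightarrow> 'a imag imag" where
  "lift f = imag_map (imag_map f)"

definition hm :: "'a \<Rightarrow> 'a imag imag" where
  "hm x = home MQ (home MM x)"

definition germ :: "'a list \<times> 'a list \<Rightarrow> 'a imag imag" where
  "germ p = home MQ (quot germ_rel (code p))"

text \<open>For a strong submodel \<open>B\<close> this is the universe of the corresponding
  submodel of the second stage; see \<open>mods_hat\<close>.\<close>

definition hat :: "'a set \<Rightarrow> 'a imag imag set" where
  "hat B = eq_set rels2 (eq_set rels1 B)"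

lemma mods_hat: "mods MQQ = hat ` mods MM"
  by (simp add: im.eq_simps im2.eq_simps hat_def image_image)

lemma points_hat: "points MQQ = hat U"
  unfolding hat_def im2.eq_simps(3) im.eq_simps(3) points ..

lemma lift_Aut: "f \<in> \<Gamma> \<Longrightarrow> lift f \<in> Aut MQQ {}"
  unfolding lift_def using im2.imag_map_Aut[OF im.imag_map_Aut] Aut by simp

lemma lift_comp: "f \<in> \<Gamma> \<Longrightarrow> g \<in> \<Gamma> \<Longrightarrow> e \<in> points MQQ \<Longrightarrow> lift (\<lambda>x. f (g x)) e = lift f (lift g e)"
proof -
  assume fg: "f \<in> \<Gamma>" "g \<in> \<Gamma>" and e: "e \<in> points MQQ"
  have A: "f \<in> Aut MM {}" "g \<in> Aut MM {}" using fg Aut by simp_all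
  obtain E a where E: "E \<in> rels2" "a \<in> Domain E" "set a \<subseteq> points MQ" "e = quot E a" by (rule im2.pointsE[OF e])
  have "lift f (lift g e) = imag_map (\<lambda>x. imag_map f (imag_map g x)) e"
    unfolding lift_def by (rule im2.imag_map_comp[OF im.imag_map_Aut[OF A(1)] im.imag_map_Aut[OF A(2)] e])
  also have "\<dots> = imag_map (imag_map (\<lambda>x. f (g x))) e"
    unfolding E(4)
  proof (rule im2.imag_map_agree[OF _ _ E(1,2)])
    show "(\<lambda>x. imag_map f (imag_map g x)) \<in> Aut MQ {}"
      by (rule im.eq.Aut_comp[OF im.imag_map_Aut[OF A(1)] im.imag_map_Aut[OF A(2)]])
    show "imag_map (\<lambda>x. f (g x)) \<in> Aut MQ {}" by (rule im.imag_map_Aut[OF Aut_comp[OF A]])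
    fix x assume "x \<in> set a"
    then show "imag_map f (imag_map g x) = imag_map (\<lambda>x. f (g x)) x" using im.imag_map_comp[OF A] E(3) by blast
  qed
  finally show ?thesis by (simp add: lift_def)
qed

lemma lift_id: "e \<in> points MQQ \<Longrightarrow> lift (\<lambda>x. x) e = e"
  unfolding lift_def using im.imag_map_id Aut_id im.imag_map_Aut[OF Aut_id]
  by (intro im2.imag_map_id) auto

lemma Aut_lift:
  assumes "\<phi> \<in> Aut MQQ {}"
  obtains f where "f \<in> \<Gamma>" "\<And>e. e \<in> points MQQ \<Longrightarrow> \<phi> e = lift f e"
proof -
  obtain \<psi> where \<psi>: "\<psi> \<in> Aut MQ {}" "\<And>e. e \<in> points MQQ \<Longrightarrow> \<phi> e = imag_map \<psi> e"
    using im2.Aut_MMeq_imag_map[OF assms] by blast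
  obtain f where f: "f \<in> Aut MM {}" "\<And>e. e \<in> points MQ \<Longrightarrow> \<psi> e = imag_map f e"
    using im.Aut_MMeq_imag_map[OF \<psi>(1)] by blast
  show ?thesis
  proof (rule that)
    show "f \<in> \<Gamma>" using f(1) Aut by simp
    fix e assume e: "e \<in> points MQQ"
    obtain E a where E: "E \<in> rels2" "a \<in> Domain E" "set a \<subseteq> points MQ" "e = quot E a" by (rule im2.pointsE[OF e])
    have "imag_map \<psi> (quot E a) = imag_map (imag_map f) (quot E a)"
      by (rule im2.imag_map_agree[OF \<psi>(1) im.imag_map_Aut[OF f(1)] E(1,2)]) (use f(2) E(3) in blast)
    then show "\<phi> e = lift f e" using \<psi>(2)[OF e] E(4) by (simp add: lift_def)
  qed
qed

lemma hm_in_hat: "x \<in> U \<Longrightarrow> hm x \<in> hat B \<longleftrightarrow> x \<in> B"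
  unfolding hm_def hat_def using im.home_in_eq_set im2.home_in_eq_set im.home_point points by metis

lemma hat_mono: "B \<subseteq> C \<Longrightarrow> hat B \<subseteq> hat C"
  unfolding hat_def by (intro im2.eq_set_cong im.eq_set_cong)

lemma hat_subset: "B \<subseteq> U \<Longrightarrow> hat B \<subseteq> hat C \<longleftrightarrow> B \<subseteq> C"
  using hat_mono hm_in_hat by (metis subset_iff)

lemma hm_hat: "B \<subseteq> U \<Longrightarrow> hm ` B \<subseteq> hat C \<longleftrightarrow> B \<subseteq> C"
  using hm_in_hat by (auto simp: subset_iff)

lemma lift_hm: "f \<in> \<Gamma> \<Longrightarrow> x \<in> U \<Longrightarrow> lift f (hm x) = hm (f x)"
  unfolding lift_def hm_def
  using im2.imag_map_home[OF im.imag_map_Aut im.home_point] im.imag_map_home Aut points by simp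

lemma hm_inj: "x \<in> U \<Longrightarrow> y \<in> U \<Longrightarrow> hm x = hm y \<longleftrightarrow> x = y"
  unfolding hm_def using im.eq.home_inj im.home_point home_inj points by metis

lemma code_Domain: "p \<in> q \<times> q \<Longrightarrow> code p \<in> Domain germ_rel"
  using code_rel sim_refl by blast

lemma germ_quot_point: "p \<in> q \<times> q \<Longrightarrow> quot germ_rel (code p) \<in> points MQ"
  by (rule im.in_pointsI) (simp_all add: code_Domain)

lemma germ_eq: "p \<in> q \<times> q \<Longrightarrow> p' \<in> q \<times> q \<Longrightarrow> germ p = germ p' \<longleftrightarrow> sim p p'"
  unfolding germ_def im.eq.home_inj[OF germ_quot_point germ_quot_point]
  using im.quot_eq_iff[of germ_rel "code p" "code p'" germ_rel] code_Domain code_rel by simp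

lemma lift_germ: "f \<in> fixing A \<Longrightarrow> p \<in> q \<times> q \<Longrightarrow> lift f (germ p) = germ (pmap f p)"
proof -
  assume f: "f \<in> fixing A" and p: "p \<in> q \<times> q"
  have fA: "f \<in> Aut MM {}" using fixingD(1)[OF f] Aut by simp
  have "imag_map f (quot germ_rel (code p)) = quot germ_rel (code (pmap f p))"
    using im.imag_map_quot(1)[OF fA, of germ_rel "code p"] code_Domain[OF p] map_code_fixing[OF f] by simp
  then show ?thesis unfolding lift_def germ_def
    using im2.imag_map_home[OF im.imag_map_Aut[OF fA] germ_quot_point[OF p]] by simp
qed

lemma germ_in_hat: "p \<in> q \<times> q \<Longrightarrow> A \<union> supp p \<subseteq> B \<Longrightarrow> B \<subseteq> U \<Longrightarrow> germ p \<in> hat B"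
proof -
  assume p: "p \<in> q \<times> q" and B: "A \<union> supp p \<subseteq> B" "B \<subseteq> U"
  have "set (code p) \<subseteq> B" using B by (auto simp: code_def set_base supp_def)
  then have "quot germ_rel (code p) \<in> eq_set rels1 B" unfolding eq_set_def using code_Domain[OF p] by blast
  then show ?thesis unfolding hat_def germ_def using im2.home_in_eq_set[OF germ_quot_point[OF p]] by blast
qed

lemma germ_point: "p \<in> q \<times> q \<Longrightarrow> germ p \<in> points MQQ"
  unfolding points_hat by (rule germ_in_hat) (use A supp_U in auto)

text \<open>Stated for two automorphisms that agree on \<open>D\<close>, and not only for those
  fixing \<open>D\<close>, in order to compare images of elements that have been moved.\<close>

definition supports :: "'a set \<Rightarrow> 'a imag imag set \<Rightarrow> bool" where
  "supports D X \<longleftrightarrow> (\<forall>f\<in>\<Gamma>. \<forall>g\<in>\<Gamma>. (\<forall>x\<in>D. f x = g x) \<longrightarrow> (\<forall>e\<in>X. lift f e = lift g e))"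

lemma supportsD:
  assumes "supports D X" "f \<in> \<Gamma>" "g \<in> \<Gamma>" "\<And>x. x \<in> D \<Longrightarrow> f x = g x" "e \<in> X"
  shows "lift f e = lift g e"
proof -
  have "\<forall>x\<in>D. f x = g x" using assms(4) by (rule ballI)
  with bspec[OF bspec[OF assms(1)[unfolded supports_def] assms(2)] assms(3)] have "\<forall>e\<in>X. lift f e = lift g e" by (rule mp)
  then show ?thesis using assms(5) by (rule bspec)
qed

lemma hat_support:
  assumes B: "B \<subseteq> U" and e: "e \<in> hat B"
  shows "\<exists>D. finite D \<and> D \<subseteq> B \<and> supports D {e}"
proof -
  obtain E a where E: "E \<in> rels2" "a \<in> Domain E" "set a \<subseteq> eq_set rels1 B" "e = quot E a"
    using e unfolding hat_def eq_set_def[of rels2] by blast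
  obtain i where i: "a = [i]" using E(1,2) by (auto simp: eq_rel_def tuples_def length_Suc_conv)
  obtain E' d where E': "E' \<in> rels1" "d \<in> Domain E'" "set d \<subseteq> B" "i = quot E' d"
    using E(3) i unfolding eq_set_def by auto
  show ?thesis unfolding supports_def
  proof (intro exI conjI ballI impI)
    show "finite (set d)" "set d \<subseteq> B" using E' by auto
    fix f g e' assume fg: "f \<in> \<Gamma>" "g \<in> \<Gamma>" "\<forall>x\<in>set d. f x = g x" and e': "e' \<in> {e}"
    have fgA: "f \<in> Aut MM {}" "g \<in> Aut MM {}" using fg Aut by simp_all
    have "imag_map f i = imag_map g i" unfolding E'(4)
      by (rule im.imag_map_agree[OF fgA E'(1,2)]) (use fg(3) in blast)
    then have "imag_map f y = imag_map g y" if "y \<in> set a" for y using that i by simp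
    then have "lift f e = lift g e" unfolding lift_def E(4)
      by (rule im2.imag_map_agree[OF im.imag_map_Aut[OF fgA(1)] im.imag_map_Aut[OF fgA(2)] E(1,2)])
    then show "lift f e' = lift g e'" using e' by simp
  qed
qed

lemma hat_supports:
  assumes B: "B \<subseteq> U" and X: "finite X" "X \<subseteq> hat B"
  obtains D where "finite D" "D \<subseteq> B" "supports D X"
proof -
  have "\<forall>e\<in>X. \<exists>D. finite D \<and> D \<subseteq> B \<and> supports D {e}"
    using X(2) by (intro ballI) (rule hat_support[OF B], blast)
  from bchoice[OF this] obtain D where D: "\<forall>e\<in>X. finite (D e) \<and> D e \<subseteq> B \<and> supports (D e) {e}" by (elim exE)
  show ?thesis
  proof (rule that)
    show "finite (\<Union>e\<in>X. D e)" "(\<Union>e\<in>X. D e) \<subseteq> B" using X(1) D by auto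
    show "supports (\<Union>e\<in>X. D e) X" unfolding supports_def
    proof (intro ballI impI)
      fix f g e assume fg: "f \<in> \<Gamma>" "g \<in> \<Gamma>" "\<forall>x\<in>(\<Union>e\<in>X. D e). f x = g x" and e: "e \<in> X"
      have "supports (D e) {e}" using D e by simp
      then show "lift f e = lift g e" by (rule supportsD[OF _ fg(1,2)]) (use fg(3) e in auto)
    qed
  qed
qed

end

lemma (in homogeneous_pregeometry) model_cl_insert:
  assumes "model H" "finite D" "D \<subseteq> U"
  shows "model (cl (H \<union> D))"
proof -
  have H: "H \<subseteq> U" "cl H = H" using assms(1) by (simp_all add: model_def)
  have HD: "H \<subseteq> cl (H \<union> D)" using cl_ext[of "H \<union> D"] H(1) assms(3) by auto
  have "\<not> cl (H \<union> D) \<subseteq> cl F" if "finite F" for F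
    using model_not_in_cl[OF assms(1) that] HD by blast
  then show ?thesis by (simp add: model_def cl_in_U cl_idem)
qed

section \<open>Definability and rank of the group\<close>

context monster_group
begin

abbreviation "G \<equiv> germ_group germ"

lemma group_G: "group G"
  by (rule germ_group) (rule germ_eq)

lemma carrier_G: "carrier G = germ ` (q \<times> q)"
  by (simp add: germ_group_def)

lemma carrier_G_points: "carrier G \<subseteq> points MQQ"
  unfolding carrier_G by (rule image_subsetI) (rule germ_point)

lemma Aut_hm:
  assumes "\<phi> \<in> Aut MQQ (hm ` B)" "B \<subseteq> U"
  obtains f where "f \<in> fixing B" "\<And>e. e \<in> points MQQ \<Longrightarrow> \<phi> e = lift f e"
proof -
  have \<phi>: "\<phi> \<in> Aut MQQ {}" "\<And>x. x \<in> B \<Longrightarrow> \<phi> (hm x) = hm x"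
    using assms(1) im2.eq.Aut_iff[of \<phi> "hm ` B"] by auto
  obtain f where f: "f \<in> \<Gamma>" "\<And>e. e \<in> points MQQ \<Longrightarrow> \<phi> e = lift f e" using Aut_lift[OF \<phi>(1)] by blast
  have "f x = x" if x: "x \<in> B" for x
  proof -
    have xU: "x \<in> U" using x assms(2) by blast
    have "hm x \<in> points MQQ" using hm_in_hat[OF xU] xU by (simp only: points_hat)
    then have "lift f (hm x) = hm x" using f(2) \<phi>(2)[OF x] by simp
    then show ?thesis using lift_hm[OF f(1) xU] hm_inj[OF aut_in_U[OF f(1) xU] xU] by simp
  qed
  then have "f \<in> fixing B" using f(1) by (simp add: fixing_def)
  then show ?thesis using f(2) by (rule that)
qed

lemma lift_fixing: "f \<in> fixing B \<Longrightarrow> B \<subseteq> U \<Longrightarrow> lift f \<in> Aut MQQ (hm ` B)"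
  using lift_Aut[of f] lift_hm[of f] fixingD[of f B] im2.eq.Aut_iff[of "lift f" "hm ` B"] by auto

lemma hm_points: "B \<subseteq> U \<Longrightarrow> hm ` B \<subseteq> points MQQ"
  unfolding points_hat by (simp add: hm_hat)

text \<open>Automorphisms over the image of \<open>A\<close> come from automorphisms over
  \<open>A\<close>. These permute the pairs and preserve both germs and composition, by
  \<open>lift_germ\<close> and \<open>cmp_aut\<close>.\<close>

lemma definable_G: "galois_definable_group MQQ (hm ` A) G"
  unfolding galois_definable_group_def
proof (intro conjI group_G)
  show "galois_definable MQQ (hm ` A) {[g] |g. g \<in> carrier G}"
  proof (rule im2.eq.galois_definableI[OF hm_points[OF A(2)]])
    show "{[g] |g. g \<in> carrier G} \<subseteq> lists (points MQQ)"
      using carrier_G_points by auto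
    fix \<phi> b assume \<phi>: "\<phi> \<in> Aut MQQ (hm ` A)" and "b \<in> {[g] |g. g \<in> carrier G}"
    then obtain p where p: "p \<in> q \<times> q" "b = [germ p]" unfolding carrier_G by blast
    obtain f where f: "f \<in> fixing A" "\<And>e. e \<in> points MQQ \<Longrightarrow> \<phi> e = lift f e" using Aut_hm[OF \<phi> A(2)] by blast
    have "map \<phi> b = [germ (pmap f p)]" using p(2) f(2)[OF germ_point[OF p(1)]] lift_germ[OF f(1) p(1)] by simp
    moreover have "germ (pmap f p) \<in> carrier G" unfolding carrier_G by (rule imageI[OF pmap_q[OF f(1) p(1)]])
    ultimately show "map \<phi> b \<in> {[g] |g. g \<in> carrier G}" by simp
  qed
  show "galois_definable MQQ (hm ` A) {[g, h, g \<otimes>\<^bsub>G\<^esub> h] |g h. g \<in> carrier G \<and> h \<in> carrier G}"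
  proof (rule im2.eq.galois_definableI[OF hm_points[OF A(2)]])
    have "g \<otimes>\<^bsub>G\<^esub> h \<in> points MQQ" if "g \<in> carrier G" "h \<in> carrier G" for g h
      using monoid.m_closed[OF group.is_monoid[OF group_G] that] carrier_G_points by blast
    then show "{[g, h, g \<otimes>\<^bsub>G\<^esub> h] |g h. g \<in> carrier G \<and> h \<in> carrier G} \<subseteq> lists (points MQQ)" using carrier_G_points by auto
    fix \<phi> b assume \<phi>: "\<phi> \<in> Aut MQQ (hm ` A)" and "b \<in> {[g, h, g \<otimes>\<^bsub>G\<^esub> h] |g h. g \<in> carrier G \<and> h \<in> carrier G}"
    then obtain p p' where p: "p \<in> q \<times> q" "p' \<in> q \<times> q" "b = [germ p, germ p', germ p \<otimes>\<^bsub>G\<^esub> germ p']"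
      unfolding carrier_G by blast
    obtain r where r: "cmp p p' r" using cmp_ex[OF p(1,2)] by blast
    obtain f where f: "f \<in> fixing A" "\<And>e. e \<in> points MQQ \<Longrightarrow> \<phi> e = lift f e" using Aut_hm[OF \<phi> A(2)] by blast
    have im: "\<phi> (germ e) = germ (pmap f e)" if "e \<in> q \<times> q" for e
      using f(2)[OF germ_point[OF that]] lift_germ[OF f(1) that] by simp
    have ml: "germ x \<otimes>\<^bsub>G\<^esub> germ x' = germ y" if "cmp x x' y" for x x' y
      by (rule germ_group_mult[OF germ_eq that])
    have rq: "r \<in> q \<times> q" using cmp_q[OF r] by simp
    have "map \<phi> b = [germ (pmap f p), germ (pmap f p'), germ (pmap f p) \<otimes>\<^bsub>G\<^esub> germ (pmap f p')]"
      unfolding p(3) ml[OF r] ml[OF cmp_aut[OF r f(1)]] using im[OF p(1)] im[OF p(2)] im[OF rq] by simp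
    moreover have "germ (pmap f p) \<in> carrier G" "germ (pmap f p') \<in> carrier G"
      unfolding carrier_G by (rule imageI[OF pmap_q[OF f(1) p(1)]], rule imageI[OF pmap_q[OF f(1) p(2)]])
    ultimately show "map \<phi> b \<in> {[g, h, g \<otimes>\<^bsub>G\<^esub> h] |g h. g \<in> carrier G \<and> h \<in> carrier G}" by simp
  qed
qed

text \<open>This supplies, inside a given model, the generic first component through which a germ is
  then represented.\<close>

lemma q_in_model:
  assumes B: "model B" "A \<subseteq> B" and D: "finite D"
  obtains s where "s \<in> q" "set s \<subseteq> B" "hd s \<notin> cl (A \<union> D)"
proof -
  have "\<not> B \<subseteq> cl (A \<union> D)" using model_not_in_cl[OF B(1)] A(1) D by blast
  then obtain u where u: "u \<in> B" "u \<notin> cl (A \<union> D)" by blast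
  have BU: "B \<subseteq> U" "cl B = B" using B(1) by (simp_all add: model_def)
  have "u \<notin> cl A" using u(2) cl_mono[of A "A \<union> D"] by blast
  then obtain g where g: "g \<in> \<Gamma>" "\<forall>x\<in>cl A. g x = x" "g (hd bb) = u"
    using extend_one[OF id_in _ A(2) bb(3,4), of u] u(1) BU(1) A(1) by (auto simp: countable_finite)
  have "g \<in> fixing A" using g cl_ext[OF A(2)] by (auto simp: fixing_def)
  then have s: "map g bb \<in> q" using q_aut[OF bb_q] by blast
  have hd: "hd (map g bb) = u" using g(3) bb(1) by (simp add: hd_map)
  have "set (map g bb) \<subseteq> cl (insert u A)" using qD(3)[OF s] hd by simp
  also have "\<dots> \<subseteq> B" using cl_mono[of "insert u A" B] u(1) B(2) BU(2) by simp
  finally show ?thesis using that[OF s] u(2) hd by simp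
qed

text \<open>Given an automorphism over \<open>A \<union> set s\<close> that moves \<open>k\<close> to \<open>k'\<close>, both with parameters in \<open>C\<close>, it is
  corrected by stationarity to fix \<open>s'\<close> as well.\<close>

lemma germ_independent:
  assumes C: "model C" "A \<subseteq> C" and B: "B \<subseteq> C" and s: "s \<in> q" "set s \<subseteq> B" "s' \<in> q" "hd s' \<notin> C" and AB: "A \<subseteq> B"
  shows "ns_indep MQQ [germ (s, s')] (hat B) (hat C)"
proof -
  let ?A = "A \<union> set s" and ?g = "germ (s, s')"
  have CU: "C \<subseteq> U" "cl C = C" using C(1) by (simp_all add: model_def)
  have AU: "?A \<subseteq> U" "finite ?A" "?A \<subseteq> C" using AB B s(2) CU A(1) by auto
  have ss: "(s, s') \<in> q \<times> q" using s by simp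
  have fin: "finite (hm ` ?A)" using AU(2) by simp
  have "\<not> splits MQQ [?g] (hat B \<union> hat C) (hm ` ?A)"
    unfolding splits_def
  proof (intro notI, elim bexE conjE)
    fix k k' assume k: "k \<in> lists (hat B \<union> hat C)" "k' \<in> lists (hat B \<union> hat C)"
      and eq: "same_type MQQ (hm ` ?A) k k'" and neq: "\<not> same_type MQQ (hm ` ?A) ([?g] @ k) ([?g] @ k')"
    have hBC: "hat B \<union> hat C = hat C" using hat_mono[OF B] by blast
    have kC: "set k \<subseteq> hat C" "set k' \<subseteq> hat C" using k hBC by auto
    have kp: "set k \<subseteq> points MQQ" "set k' \<subseteq> points MQQ" using kC hat_mono[OF CU(1)] unfolding points_hat by auto
    obtain \<phi> where \<phi>: "\<phi> \<in> Aut MQQ (hm ` ?A)" "map \<phi> k = k'" using eq im2.eq.same_type_finite[OF fin] by blast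
    obtain \<sigma> where \<sigma>: "\<sigma> \<in> fixing ?A" "\<And>e. e \<in> points MQQ \<Longrightarrow> \<phi> e = lift \<sigma> e" using Aut_hm[OF \<phi>(1) AU(1)] by blast
    have \<sigma>k: "map (lift \<sigma>) k = k'" unfolding \<phi>(2)[symmetric] using \<sigma>(2) kp(1) by (intro map_cong) auto
    obtain D where D: "finite D" "D \<subseteq> C" "supports D (set k)"
      by (rule hat_supports[OF CU(1) finite_set kC(1)])
    obtain D' where D': "finite D'" "D' \<subseteq> C" "supports D' (set k')"
      by (rule hat_supports[OF CU(1) finite_set kC(2)])
    have \<sigma>G: "\<sigma> \<in> \<Gamma>" using fixingD(1)[OF \<sigma>(1)] .
    let ?E = "?A \<union> D'" and ?S = "\<sigma> ` D"
    have EU: "?E \<subseteq> U" "finite ?E" "?E \<subseteq> C" using AU D' CU by auto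
    have DU: "D \<subseteq> U" using D(2) CU(1) by blast
    have SU: "?S \<subseteq> U" "finite ?S" using DU aut_in_U[OF \<sigma>G] D(1) by auto
    have hs: "hd s' \<in> U" "hd s' \<in> set s'" using qD(4,6)[OF s(3)] by simp_all
    have hsE: "hd s' \<notin> cl ?E" using s(4) cl_mono[OF EU(3)] CU(2) by blast
    \<comment> \<open>The map \<open>\<sigma>\<close> may carry the support of \<open>k\<close> to a
      set over which \<open>s'\<close> is no longer generic. It is therefore followed by
      \<open>g\<close>, which fixes the support of \<open>k'\<close> and moves the image of the
      support of \<open>k\<close> so that \<open>s'\<close> is generic over it.\<close>
    obtain u where u: "u \<in> U" "u \<notin> cl (?E \<union> ?S)" using fresh[of "?E \<union> ?S"] EU SU by auto
    have uE: "u \<notin> cl ?E" using u(2) cl_mono[of ?E "?E \<union> ?S"] by blast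
    obtain g where g: "g \<in> \<Gamma>" "\<forall>x\<in>cl ?E. g x = x" "g u = hd s'"
      using extend_one[OF id_in _ EU(1) u(1) uE hs(1)] EU(2) hsE by (auto simp: countable_finite)
    have gE: "g x = x" if "x \<in> ?E" for x using g(2) cl_ext[OF EU(1)] that by blast
    let ?\<sigma>1 = "\<lambda>x. g (\<sigma> x)"
    have gA: "g \<in> fixing ?A" unfolding fixing_def using g(1) gE by blast
    have \<sigma>1: "?\<sigma>1 \<in> fixing ?A" by (rule fixing_comp[OF gA \<sigma>(1)])
    let ?T = "?\<sigma>1 ` D"
    have TU: "?T \<subseteq> U" "finite ?T" using DU aut_in_U[OF fixingD(1)[OF \<sigma>1]] D(1) by auto
    have gen1: "hd s' \<notin> cl (?A \<union> ?T)"
    proof -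
      have "g u \<notin> cl (g ` (?E \<union> ?S))" using aut_mem_cl[OF g(1), of "?E \<union> ?S" u] EU(1) SU(1) u by auto
      moreover have "?A \<union> ?T \<subseteq> g ` (?E \<union> ?S)"
      proof -
        have "x = g x" if "x \<in> ?A" for x by (rule sym[OF gE]) (use that in blast)
        then have "?A \<subseteq> g ` ?E" by blast
        moreover have "?T \<subseteq> g ` ?S" by blast
        ultimately show ?thesis by blast
      qed
      ultimately show ?thesis using cl_mono[of "?A \<union> ?T" "g ` (?E \<union> ?S)"] g(3) by auto
    qed
    let ?r = "map ?\<sigma>1 s'"
    have \<sigma>1A: "?\<sigma>1 \<in> fixing A" using \<sigma>1 fixing_mono[of A ?A] by blast
    have rq: "?r \<in> q" by (rule q_aut[OF s(3) \<sigma>1A])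
    have hr: "hd ?r = ?\<sigma>1 (hd s')" using qD(1)[OF s(3)] by (simp add: hd_map)
    have gen2: "hd ?r \<notin> cl (?A \<union> ?T)"
    proof -
      have "hd s' \<notin> cl (?A \<union> D)" using s(4) cl_mono[of "?A \<union> D" C] AU(3) D(2) CU(2) by blast
      then have "?\<sigma>1 (hd s') \<notin> cl (?\<sigma>1 ` (?A \<union> D))"
        using aut_mem_cl[OF fixingD(1)[OF \<sigma>1], of "?A \<union> D" "hd s'"] AU(1) DU hs(1) by auto
      moreover have "?\<sigma>1 ` (?A \<union> D) = ?A \<union> ?T"
        using fixing_image[OF \<sigma>1 subset_refl] unfolding image_Un[of ?\<sigma>1 ?A D] by simp
      ultimately show ?thesis using hr by simp
    qed
    \<comment> \<open>Now \<open>s'\<close> and its image \<open>?r\<close> are both generic over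
      the image of the support of \<open>k\<close>. The map \<open>\<tau>\<close> takes
      \<open>?r\<close> back to \<open>s'\<close> over that image, so the image of \<open>k\<close>
      is not disturbed.\<close>
    have "eqt (A \<union> (set s \<union> ?T)) ?r s'"
      by (rule stat_b) (use rq s(3) gen1 gen2 TU AU in \<open>auto simp: q_def Un_assoc\<close>)
    then obtain \<tau> where \<tau>: "\<tau> \<in> fixing (A \<union> (set s \<union> ?T))" "map \<tau> ?r = s'" unfolding eqt_def by blast
    have \<tau>A: "\<tau> \<in> fixing ?A" "\<tau> \<in> fixing ?T" "\<tau> \<in> \<Gamma>"
      using \<tau>(1) fixing_mono[of ?A "A \<union> (set s \<union> ?T)"] fixing_mono[of ?T "A \<union> (set s \<union> ?T)"] fixingD(1) by blast+
    let ?\<rho> = "\<lambda>x. \<tau> (?\<sigma>1 x)"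
    have \<rho>: "?\<rho> \<in> fixing ?A" by (rule fixing_comp[OF \<tau>A(1) \<sigma>1])
    have \<rho>A: "?\<rho> \<in> fixing A" using \<rho> fixing_mono[of A ?A] by blast
    have "map ?\<rho> s' = s'" using \<tau>(2) by (simp add: comp_def)
    moreover have "map ?\<rho> s = s" by (intro map_idI) (use fixingD(2)[OF \<rho>] in blast)
    ultimately have "pmap ?\<rho> (s, s') = (s, s')" by simp
    then have lg: "lift ?\<rho> ?g = ?g" using lift_germ[OF \<rho>A ss] by simp
    have \<sigma>1G: "?\<sigma>1 \<in> \<Gamma>" and \<rho>G: "?\<rho> \<in> \<Gamma>" using fixingD(1) \<sigma>1 \<rho> by blast+
    have lk: "lift ?\<rho> e = lift \<sigma> e" if e: "e \<in> set k" for e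
    proof -
      have "lift ?\<rho> e = lift ?\<sigma>1 e"
        by (rule supportsD[OF D(3) \<rho>G \<sigma>1G _ e]) (rule fixingD(2)[OF \<tau>A(2)], blast)
      also have "\<dots> = lift g (lift \<sigma> e)"
      proof -
        have "lift (\<lambda>x. g (\<sigma> x)) e = lift g (lift \<sigma> e)" by (rule lift_comp) (use g(1) \<sigma>G e kp(1) in auto)
        then show ?thesis .
      qed
      also have "\<dots> = lift (\<lambda>x. x) (lift \<sigma> e)"
      proof (rule supportsD[OF D'(3) g(1) id_in])
        show "g x = x" if "x \<in> D'" for x using gE that by simp
        show "lift \<sigma> e \<in> set k'" using e \<sigma>k by force
      qed
      also have "\<dots> = lift \<sigma> e"
        by (rule lift_id) (use e \<sigma>k kp(2) in force)
      finally show ?thesis .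
    qed
    then have "map (lift ?\<rho>) k = k'" unfolding \<sigma>k[symmetric] by simp
    then have "map (lift ?\<rho>) ([?g] @ k) = [?g] @ k'" using lg by simp
    then have "same_type MQQ (hm ` ?A) ([?g] @ k) ([?g] @ k')"
      using im2.eq.same_type_finite[OF fin] lift_fixing[OF \<rho> AU(1)] by blast
    then show False using neq by simp
  qed
  moreover have "hm ` ?A \<subseteq> hat B" using hm_hat[OF AU(1), of B] AB s(2) by simp
  ultimately show ?thesis unfolding ns_indep_def using fin by blast
qed

text \<open>An element of \<open>X\<close> is by itself a base over which its type does not
  split.\<close>

lemma member_independent:
  assumes "g \<in> X"
  shows "ns_indep MQQ [g] X Z"
proof -
  have "\<not> splits MQQ [g] (X \<union> Z) {g}" unfolding splits_def
  proof (intro notI, elim bexE conjE)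
    fix k k' assume "same_type MQQ {g} k k'" and neq: "\<not> same_type MQQ {g} ([g] @ k) ([g] @ k')"
    then obtain \<phi> where \<phi>: "\<phi> \<in> Aut MQQ {g}" "map \<phi> k = k'" using im2.eq.same_type_finite[of "{g}"] by auto
    then have "map \<phi> ([g] @ k) = [g] @ k'" by (simp add: Aut_def)
    then show False using neq im2.eq.same_type_finite[of "{g}" "[g] @ k" "[g] @ k'"] \<phi>(1) by blast
  qed
  then show ?thesis unfolding ns_indep_def using assms by (intro exI[of _ "{g}"]) simp
qed

text \<open>Represent the germ as that of \<open>(e, f)\<close> with \<open>e\<close> in the model
  \<open>B\<close>. By \<open>germ_independent\<close>, dependence on a larger model
  \<open>C\<close> forces the head of \<open>f\<close> into \<open>C\<close>. Then the germ lies in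
  \<open>hat C\<close>, and by \<open>member_independent\<close> no further drop is
  possible.\<close>

lemma germ_rank_le:
  assumes p: "p \<in> q \<times> q"
  shows "U_rank MQQ [germ p] (hm ` A) \<le> 1"
proof -
  have ge: "\<not> U_ge MQQ [germ p] (Suc (Suc n)) (hat B)" if B: "B \<in> mods MM" "A \<subseteq> B" for n B
  proof
    assume "U_ge MQQ [germ p] (Suc (Suc n)) (hat B)"
    then obtain X Z where X: "X \<in> mods MQQ" "hat B \<subseteq> X" "\<not> ns_indep MQQ [germ p] (hat B) X"
        and Z: "\<not> ns_indep MQQ [germ p] X Z" by auto
    obtain C where C: "C \<in> mods MM" "X = hat C" using X(1) unfolding mods_hat by blast
    have mB: "model B" and mC: "model C" using mods_model B(1) C(1) by blast+
    have U: "B \<subseteq> U" "C \<subseteq> U" "cl C = C" using mB mC by (simp_all add: model_def)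
    have BC: "B \<subseteq> C" using X(2) hat_subset[OF U(1)] C(2) by simp
    obtain s s' where ss: "p = (s, s')" "s \<in> q" "s' \<in> q" using p by auto
    obtain e where e: "e \<in> q" "set e \<subseteq> B" "hd e \<notin> cl (A \<union> (set s \<union> set s'))"
      using q_in_model[OF mB B(2), of "set s \<union> set s'"] by auto
    obtain f where f: "f \<in> q" "sim (s, s') (e, f)" using sim_generic_left[OF ss(2,3) e(1,3)] by blast
    have eq: "germ p = germ (e, f)" using germ_eq[OF p, of "(e, f)"] e(1) f ss(1) by simp
    show False
    proof (cases "hd f \<in> C")
      case False
      have "ns_indep MQQ [germ p] (hat B) (hat C)" unfolding eq
        by (rule germ_independent[OF mC _ BC e(1,2) f(1) False B(2)]) (use B(2) BC in blast)
      then show ?thesis using X(3) C(2) by simp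
    next
      case True
      have "set f \<subseteq> cl C" using qD(3)[OF f(1)] cl_mono[of "insert (hd f) A" C] True B(2) BC by auto
      then have "germ (e, f) \<in> hat C" using e f(1) B(2) BC U by (intro germ_in_hat) (auto simp: supp_def)
      then show ?thesis using member_independent[of "germ p" X Z] Z eq C(2) by simp
    qed
  qed
  have "n \<le> 1" if "U_ge MQQ [germ p] n (hat B)" "B \<in> mods MM" "A \<subseteq> B" for n B
  proof (rule ccontr)
    assume "\<not> n \<le> 1"
    then obtain m where "n = Suc (Suc m)" by (metis One_nat_def le_0_eq le_SucI not0_implies_Suc not_less_eq_eq order_refl)
    then show False using ge[OF that(2,3)] that(1) by blast
  qed
  then have "U_model MQQ [germ p] X \<le> 1" if "X \<in> mods MQQ" "hm ` A \<subseteq> X" for X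
    using that hm_hat[OF A(2)] unfolding mods_hat U_model_def
    by (auto intro!: Sup_least simp: one_enat_def)
  then show ?thesis unfolding U_rank_def by (intro Sup_least) blast
qed

text \<open>The germs of \<open>(e, f)\<close> and \<open>(e, f')\<close>, with \<open>e\<close> in
  a model \<open>H\<close> and \<open>f\<close>, \<open>f'\<close> generic and independent, are
  distinct. Over a finite part of \<open>hat H\<close> they are nevertheless conjugate, so comparing
  the first germ with itself and with the second exhibits splitting.\<close>

lemma germ_rank_one:
  obtains p where "p \<in> q \<times> q" "U_rank MQQ [germ p] (hm ` A) \<ge> 1"
proof -
  obtain u where u: "u \<in> U" "u \<notin> cl A" using fresh[OF A(1)] by blast
  obtain v where v: "v \<in> U" "v \<notin> cl (insert u A)" using fresh[of "insert u A"] A(1) by auto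
  have "ind A [u, v]" using u v by simp
  then obtain H where H: "countable H" "model H" "A \<subseteq> H" "ind H [u, v]" by (rule model_independent[OF A])
  have HU: "H \<subseteq> U" "cl H = H" using H(2) by (simp_all add: model_def)
  have real: "\<exists>s\<in>q. hd s = w" if w: "w \<in> U" "w \<notin> cl A" for w
  proof -
    obtain g where g: "g \<in> \<Gamma>" "\<forall>x\<in>cl A. g x = x" "g (hd bb) = w"
      using extend_one[OF id_in _ A(2) bb(3,4), of w] w A(1) by (auto simp: countable_finite)
    have "g \<in> fixing A" using g cl_ext[OF A(2)] by (auto simp: fixing_def)
    then have "map g bb \<in> q" using q_aut[OF bb_q] by blast
    moreover have "hd (map g bb) = w" using g(3) bb(1) by (simp add: hd_map)
    ultimately show ?thesis by blast
  qed
  have vA: "v \<notin> cl A" using v(2) cl_mono[of A "insert u A"] by blast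
  obtain f where f: "f \<in> q" "hd f = u" using real[OF u] by blast
  obtain f' where f': "f' \<in> q" "hd f' = v" using real[OF v(1) vA] by blast
  obtain e where e: "e \<in> q" "set e \<subseteq> H" by (rule q_in_model[OF H(2,3) finite.emptyI])
  let ?D = "cl (H \<union> {u, v})" and ?g = "germ (e, f)" and ?g' = "germ (e, f')"
  have D: "model ?D" "countable ?D" using model_cl_insert[OF H(2), of "{u, v}"] u v H(1) by (auto intro: countable_cl)
  have HD: "insert u (insert v H) \<subseteq> ?D" using cl_ext[of "H \<union> {u, v}"] HU(1) u(1) v(1) by auto
  have ef: "(e, f) \<in> q \<times> q" "(e, f') \<in> q \<times> q" using e f f' by simp_all
  have fD: "set f \<subseteq> ?D" "set f' \<subseteq> ?D"
    using qD(3)[OF f(1)] qD(3)[OF f'(1)] cl_mono[of "insert u A" "H \<union> {u, v}"] cl_mono[of "insert v A" "H \<union> {u, v}"] H(3)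
    unfolding f(2) f'(2) by auto
  have sD: "A \<union> supp (e, f) \<subseteq> ?D" "A \<union> supp (e, f') \<subseteq> ?D" using fD e(2) H(3) HD unfolding supp_def by auto
  have gD: "?g \<in> hat ?D" "?g' \<in> hat ?D"
    by (rule germ_in_hat[OF ef(1) sD(1) cl_in_U], rule germ_in_hat[OF ef(2) sD(2) cl_in_U])
  have uv: "u \<notin> cl H" "v \<notin> cl (insert u H)" using H(4) by simp_all
  have vH: "v \<notin> cl H" using uv(2) cl_mono[of H "insert u H"] by blast
  have neq: "?g \<noteq> ?g'"
  proof -
    have "set f \<subseteq> cl (insert u A)" using qD(3)[OF f(1)] f(2) by simp
    then have "cl (A \<union> set f) \<subseteq> cl (insert u A)"
      using A(2) cl_extensive by (intro cl_subset') auto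
    then have "hd f' \<notin> cl (A \<union> set f)" using v(2) f'(2) by blast
    then show ?thesis using sim_nontrivial[OF e(1) f(1) f'(1)] germ_eq[OF ef] by blast
  qed
  \<comment> \<open>The finite set \<open>X\<close> of imaginaries is supported by finitely many
    points of \<open>H\<close>. Stationarity over these points and \<open>e\<close> gives the
    automorphism that takes \<open>f\<close> to \<open>f'\<close>.\<close>
  have spl: "splits MQQ [?g] (hat H \<union> hat ?D) X" if X: "finite X" "X \<subseteq> hat H" for X
    unfolding splits_def
  proof (rule bexI[of _ "[?g]"], rule bexI[of _ "[?g']"], intro conjI notI)
    show "[?g] \<in> lists (hat H \<union> hat ?D)" "[?g'] \<in> lists (hat H \<union> hat ?D)" using gD by simp_all
    obtain D0 where D0: "finite D0" "D0 \<subseteq> H" "supports D0 X" by (rule hat_supports[OF HU(1) X])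
    let ?C = "set e \<union> D0"
    have C: "finite ?C" "?C \<subseteq> U" "A \<union> ?C \<subseteq> H" using D0 e(2) HU H(3) by auto
    have "hd f \<notin> cl (A \<union> ?C)" "hd f' \<notin> cl (A \<union> ?C)" using f(2) f'(2) uv(1) vH cl_mono[OF C(3)] by blast+
    then have "eqt (A \<union> ?C) f f'" using f(1) f'(1) C by (intro stat_b) (auto simp: q_def)
    then obtain \<sigma> where \<sigma>: "\<sigma> \<in> fixing (A \<union> ?C)" "map \<sigma> f = f'" unfolding eqt_def by blast
    have \<sigma>A: "\<sigma> \<in> fixing A" "\<sigma> \<in> \<Gamma>" using \<sigma>(1) fixing_mono[of A "A \<union> ?C"] fixingD(1) by blast+
    have "map \<sigma> e = e" by (intro map_idI) (use fixingD(2)[OF \<sigma>(1)] in blast)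
    then have lg: "lift \<sigma> ?g = ?g'" using lift_germ[OF \<sigma>A(1) ef(1)] \<sigma>(2) by simp
    have "lift \<sigma> x = x" if x: "x \<in> X" for x
    proof -
      have "lift \<sigma> x = lift (\<lambda>x. x) x"
        by (rule supportsD[OF D0(3) \<sigma>A(2) id_in _ x]) (use fixingD(2)[OF \<sigma>(1)] in blast)
      also have "\<dots> = x" using lift_id[of x] x X(2) hat_mono[OF HU(1)] unfolding points_hat by blast
      finally show ?thesis .
    qed
    then have "lift \<sigma> \<in> Aut MQQ X" using lift_Aut[OF \<sigma>A(2)] im2.eq.Aut_iff[of "lift \<sigma>" X] by blast
    then show "same_type MQQ X [?g] [?g']" using im2.eq.same_type_finite[OF X(1)] lg by auto
    assume "same_type MQQ X ([?g] @ [?g]) ([?g] @ [?g'])"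
    then obtain \<phi> where "\<phi> ?g = ?g" "\<phi> ?g = ?g'" using im2.eq.same_type_finite[OF X(1)] by auto
    then show False using neq by simp
  qed
  have "\<not> ns_indep MQQ [?g] (hat H) (hat ?D)" unfolding ns_indep_def using spl by blast
  moreover have "hat ?D \<in> mods MQQ" unfolding mods_hat by (intro imageI model_mods D)
  moreover have "hat H \<subseteq> hat ?D" using HD by (intro hat_mono) auto
  ultimately have "U_ge MQQ [?g] 1 (hat H)" unfolding One_nat_def U_ge.simps by blast
  then have "enat 1 \<le> U_model MQQ [?g] (hat H)" unfolding U_model_def by (intro Sup_upper) blast
  also have "hat H \<in> mods MQQ" unfolding mods_hat by (intro imageI model_mods H)
  then have "U_model MQQ [?g] (hat H) \<le> U_rank MQQ [?g] (hm ` A)"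
    unfolding U_rank_def using hm_hat[OF A(2)] H(3) by (intro Sup_upper) blast
  finally show ?thesis using that[OF ef(1)] by (simp add: one_enat_def)
qed

lemma group_exists:
  "\<exists>G. galois_definable_group MQQ (hm ` A) G \<and>
    (\<exists>g. generic MQQ (hm ` A) {[g] |g. g \<in> carrier G} g) \<and>
    (\<forall>g. generic MQQ (hm ` A) {[g] |g. g \<in> carrier G} g \<longrightarrow> U_rank MQQ g (hm ` A) = 1)"
proof (intro exI[of _ G] conjI allI impI definable_G)
  let ?GG = "{[g] |g. g \<in> carrier G}"
  have le: "U_rank MQQ g (hm ` A) \<le> 1" if "g \<in> ?GG" for g
    using that germ_rank_le unfolding carrier_G by auto
  obtain p where p: "p \<in> q \<times> q" "U_rank MQQ [germ p] (hm ` A) \<ge> 1" using germ_rank_one by blast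
  have pG: "[germ p] \<in> ?GG" using p(1) unfolding carrier_G by blast
  have "generic MQQ (hm ` A) ?GG [germ p]" unfolding generic_def
  proof (intro conjI ballI pG)
    fix h assume "h \<in> ?GG"
    then show "U_rank MQQ h (hm ` A) \<le> U_rank MQQ [germ p] (hm ` A)" using le p(2) order_trans by blast
  qed
  then show "\<exists>g. generic MQQ (hm ` A) ?GG g" by blast
  fix g assume "generic MQQ (hm ` A) ?GG g"
  then have g: "g \<in> ?GG" "\<forall>h\<in>?GG. U_rank MQQ h (hm ` A) \<le> U_rank MQQ g (hm ` A)" unfolding generic_def by blast+
  have "1 \<le> U_rank MQQ g (hm ` A)" using p(2) bspec[OF g(2) pG] by (rule order_trans)
  then show "U_rank MQQ g (hm ` A) = 1" using le[OF g(1)] by (rule antisym[rotated])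
qed

end

section \<open>U-rank as dimension\<close>

context homogeneous_pregeometry
begin

lemma ind_append: "ind X (es @ es') \<longleftrightarrow> ind X es \<and> ind (X \<union> set es) es'"
  by (induction es arbitrary: X) auto

text \<open>The last conjunct separates the two cases of the rank computation: either
  \<open>es\<close> is itself independent over \<open>X\<close>, or a strictly shorter sequence
  spans the same.\<close>

lemma basis:
  assumes "set es \<subseteq> U"
  shows "\<exists>es'. ind X es' \<and> set es' \<subseteq> set es \<and> set es \<subseteq> cl (X \<union> set es') \<and> length es' \<le> length es \<and>
    (length es' = length es \<longrightarrow> es' = es)"
  using assms
proof (induction es rule: rev_induct)
  case Nil
  show ?case by (intro exI[of _ "[]"]) simp
next
  case (snoc f es)
  then obtain es' where es': "ind X es'" "set es' \<subseteq> set es" "set es \<subseteq> cl (X \<union> set es')" "length es' \<le> length es"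
      "length es' = length es \<longrightarrow> es' = es" by auto
  show ?case
  proof (cases "f \<in> cl (X \<union> set es')")
    case True
    then show ?thesis using es' by (intro exI[of _ es']) auto
  next
    case False
    have f: "f \<in> U" using snoc.prems by simp
    have "cl (X \<union> set es') \<subseteq> cl (X \<union> set (es' @ [f]))" by (rule cl_mono) auto
    then have "set es \<subseteq> cl (X \<union> set (es' @ [f]))" using es'(3) by (rule order_trans[rotated])
    moreover have "f \<in> cl (X \<union> set (es' @ [f]))" using f by (intro cl_extensive) auto
    ultimately show ?thesis using es' False f by (intro exI[of _ "es' @ [f]"]) (auto simp: ind_append)
  qed
qed

text \<open>The models in the definition of rank may be uncountable, whereas
  \<open>finite_nonsplitting_base\<close> works over a countable one. Points of \<open>B\<close>
  outside the closure so far are added countably often.\<close>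

lemma countable_submodel:
  assumes B: "model B" and D: "finite D" "D \<subseteq> B"
  obtains H where "countable H" "model H" "D \<subseteq> H" "H \<subseteq> B"
proof -
  have BU: "B \<subseteq> U" "cl B = B" using B by (simp_all add: model_def)
  have "\<exists>S. \<forall>n. (finite (S n) \<and> D \<subseteq> S n \<and> S n \<subseteq> B) \<and> (S n \<subseteq> S (Suc n) \<and> \<not> S (Suc n) \<subseteq> cl (S n))"
  proof (rule dependent_nat_choice)
    show "\<exists>X. finite X \<and> D \<subseteq> X \<and> X \<subseteq> B" using D by blast
    fix X and n :: nat assume X: "finite X \<and> D \<subseteq> X \<and> X \<subseteq> B"
    then obtain u where "u \<in> B" "u \<notin> cl X" using model_not_in_cl[OF B, of X] by blast
    then show "\<exists>X'. (finite X' \<and> D \<subseteq> X' \<and> X' \<subseteq> B) \<and> X \<subseteq> X' \<and> \<not> X' \<subseteq> cl X"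
      using X by (intro exI[of _ "insert u X"]) auto
  qed
  then obtain S :: "nat \<Rightarrow> 'a set" where S: "\<And>n. finite (S n)" "\<And>n. D \<subseteq> S n" "\<And>n. S n \<subseteq> B"
      "\<And>n. S n \<subseteq> S (Suc n)" "\<And>n. \<not> S (Suc n) \<subseteq> cl (S n)" by blast
  have mono: "mono S" using S(4) by (simp add: mono_iff_le_Suc)
  let ?X = "\<Union>n. S n"
  have X: "?X \<subseteq> B" "?X \<subseteq> U" "D \<subseteq> ?X" using S(2,3) BU(1) by blast+
  have "\<not> cl ?X \<subseteq> cl F" if F: "finite F" "F \<subseteq> cl ?X" for F
  proof
    assume sub: "cl ?X \<subseteq> cl F"
    have "mono (\<lambda>n. cl (S n))" using mono cl_mono by (auto simp: mono_def)
    moreover have "F \<subseteq> (\<Union>n. cl (S n))"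
    proof
      fix v assume "v \<in> F"
      then have v: "v \<in> cl ?X" using F(2) by blast
      obtain n where "v \<in> cl (S n)" by (rule cl_UN_mono[OF mono v])
      then show "v \<in> (\<Union>n. cl (S n))" by blast
    qed
    ultimately obtain n where "F \<subseteq> cl (S n)" using finite_subset_mono_UN[of "\<lambda>n. cl (S n)" F] F(1) by blast
    then have "cl ?X \<subseteq> cl (S n)" using sub cl_subset by blast
    moreover have "S (Suc n) \<subseteq> cl ?X" using cl_ext[OF X(2)] by blast
    ultimately show False using S(5) by blast
  qed
  then have "model (cl ?X)" by (simp add: model_def cl_in_U cl_idem)
  moreover have "countable (cl ?X)" using S(1) by (intro countable_cl) (simp add: countable_finite)
  moreover have "D \<subseteq> cl ?X" using X cl_ext[OF X(2)] by blast
  moreover have "cl ?X \<subseteq> B" using cl_mono[OF X(1)] BU(2) by simp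
  ultimately show ?thesis using that by blast
qed

lemma finite_support:
  assumes "finite S" "S \<subseteq> cl (X \<union> E)"
  obtains D where "finite D" "D \<subseteq> X" "S \<subseteq> cl (D \<union> E)"
proof -
  have "\<forall>s\<in>S. \<exists>D. finite D \<and> D \<subseteq> X \<and> s \<in> cl (D \<union> E)"
  proof
    fix s assume "s \<in> S"
    then obtain F where F: "finite F" "F \<subseteq> X \<union> E" "s \<in> cl F" using assms(2) cl_finitary[of s "X \<union> E"] by blast
    have "s \<in> cl ((F \<inter> X) \<union> E)" by (rule cl_monoD[OF F(3)]) (use F(2) in blast)
    then show "\<exists>D. finite D \<and> D \<subseteq> X \<and> s \<in> cl (D \<union> E)" using F(1) by (intro exI[of _ "F \<inter> X"]) simp
  qed
  from bchoice[OF this] obtain D where D: "\<forall>s\<in>S. finite (D s) \<and> D s \<subseteq> X \<and> s \<in> cl (D s \<union> E)" by (elim exE)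
  show ?thesis
  proof (rule that)
    show "finite (\<Union>s\<in>S. D s)" "(\<Union>s\<in>S. D s) \<subseteq> X" using D assms(1) by auto
    show "S \<subseteq> cl ((\<Union>s\<in>S. D s) \<union> E)"
    proof
      fix s assume s: "s \<in> S"
      then have "s \<in> cl (D s \<union> E)" using D by blast
      then show "s \<in> cl ((\<Union>s\<in>S. D s) \<union> E)" by (rule cl_monoD) (use s in blast)
    qed
  qed
qed

end

section \<open>Rank over finite sets, and the elements of a quadrangle\<close>

context geometric_monster
begin

lemma same_type_eqt: "finite B \<Longrightarrow> same_type MM B s t \<longleftrightarrow> eqt B s t"
  by (simp add: same_type_finite eqt_def Aut_fixing)

lemma splits_iff: "finite B \<Longrightarrow> splits MM d C B \<longleftrightarrow> \<not> nsplit B C d"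
  unfolding splits_def nsplit_def by (simp only: same_type_eqt) blast

lemma ns_indep_iff: "B \<subseteq> C \<Longrightarrow> ns_indep MM d B C \<longleftrightarrow> (\<exists>D. finite D \<and> D \<subseteq> B \<and> nsplit D C d)"
  using splits_iff by (auto simp: ns_indep_def Un_absorb1)

text \<open>If \<open>es\<close> is still independent over \<open>C\<close>, then \<open>d\<close>
  has a finite nonsplitting base in a countable submodel of \<open>B\<close>, and by
  \<open>nsplit_up\<close> it is one for \<open>C\<close> too. So every step in the definition of
  rank uses up at least one element of the spanning sequence.\<close>

lemma U_ge_le:
  "U_ge MM d n B \<Longrightarrow> B \<in> mods MM \<Longrightarrow> set es \<subseteq> U \<Longrightarrow> set d \<subseteq> cl (B \<union> set es) \<Longrightarrow> n \<le> length es"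
proof (induction n arbitrary: B es)
  case (Suc n)
  obtain C where C: "C \<in> mods MM" "B \<subseteq> C" "\<not> ns_indep MM d B C" "U_ge MM d n C" using Suc.prems(1) by auto
  have mB: "model B" and mC: "model C" using mods_model Suc.prems(2) C(1) by blast+
  have CU: "C \<subseteq> U" using mC by (simp add: model_def)
  obtain es' where es': "ind C es'" "set es' \<subseteq> set es" "set es \<subseteq> cl (C \<union> set es')" "length es' \<le> length es"
      "length es' = length es \<longrightarrow> es' = es" using basis[OF Suc.prems(3), of C] by blast
  have "set d \<subseteq> cl (C \<union> set es')"
  proof -
    have "C \<subseteq> cl (C \<union> set es')" using CU cl_extensive by blast
    then have "B \<union> set es \<subseteq> cl (C \<union> set es')" using C(2) es'(3) by blast
    then show ?thesis using Suc.prems(4) cl_subset by blast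
  qed
  then have n: "n \<le> length es'" using Suc.IH[OF C(4,1)] es'(2) Suc.prems(3) by blast
  have "es' \<noteq> es"
  proof
    assume "es' = es"
    then have ind: "ind C es" using es'(1) by simp
    obtain A1 where A1: "finite A1" "A1 \<subseteq> B" "set d \<subseteq> cl (A1 \<union> set es)"
      using finite_support[OF finite_set Suc.prems(4)] by blast
    obtain H where H: "countable H" "model H" "A1 \<subseteq> H" "H \<subseteq> B" using countable_submodel[OF mB A1(1,2)] by blast
    have indH: "ind H es" by (rule ind_mono[OF ind]) (use H(4) C(2) in blast)
    obtain A0 where A0: "finite A0" "A1 \<subseteq> A0" "A0 \<subseteq> H" "nsplit A0 H d"
      by (rule finite_nonsplitting_base[OF H(1,2) indH A1(1) H(3) A1(3)])
    have "set d \<subseteq> cl (A0 \<union> set es)" using A1(3) cl_mono[of "A1 \<union> set es" "A0 \<union> set es"] A0(2) by blast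
    then have "nsplit A0 C d"
      by (rule nsplit_up[OF A0(4) H(2) A0(1,3) indH _ ind _ CU]) (use A0(3) H(4) C(2) in blast)
    then show False using C(3) ns_indep_iff[OF C(2)] A0(1,3) H(4) by blast
  qed
  then have "length es' < length es" using es'(4,5) by linarith
  then show ?case using n by linarith
qed simp

text \<open>An entry \<open>e\<close> of \<open>d\<close> outside \<open>H\<close> is conjugate,
  over any finite \<open>D \<subseteq> H\<close>, to some point \<open>v\<close> of
  \<open>H\<close>, but not over \<open>d\<close>, of which it is an entry. So \<open>d\<close>
  splits once \<open>e\<close> has been added to the model.\<close>

lemma U_ge_ind:
  "countable H \<Longrightarrow> model H \<Longrightarrow> ind H es \<Longrightarrow> set es \<subseteq> set d \<Longrightarrow> U_ge MM d (length es) H"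
proof (induction es arbitrary: H)
  case (Cons e es)
  have HU: "H \<subseteq> U" "cl H = H" using Cons.prems(2) by (simp_all add: model_def)
  have e: "e \<in> U" "e \<notin> H" "ind (insert e H) es" using Cons.prems(3) HU(2) by simp_all
  let ?C = "cl (H \<union> {e})"
  have C: "model ?C" "countable ?C" using model_cl_insert[OF Cons.prems(2), of "{e}"] e(1) Cons.prems(1) by (auto intro: countable_cl)
  have sub: "insert e H \<subseteq> ?C" using cl_ext[of "H \<union> {e}"] HU(1) e(1) by simp
  have "ind ?C es" using ind_cl[of "insert e H" es] e HU(1) by simp
  then have 1: "U_ge MM d (length es) ?C" using Cons.IH[OF C(2,1)] Cons.prems(4) by simp
  have "\<not> nsplit D ?C d" if D: "finite D" "D \<subseteq> H" for D
  proof
    assume ns: "nsplit D ?C d"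
    have DU: "D \<subseteq> U" using D(2) HU(1) by blast
    obtain v where v: "v \<in> H" "v \<notin> cl D" using model_not_in_cl[OF Cons.prems(2) D(1)] by blast
    have "e \<notin> cl D" using e(2) cl_mono[OF D(2)] HU(2) by blast
    then obtain g where g: "g \<in> \<Gamma>" "\<forall>x\<in>cl D. g x = x" "g e = v"
      using extend_one[OF id_in _ DU e(1), of v] v HU(1) D(1) by (auto simp: countable_finite)
    have "g \<in> fixing D" using g cl_ext[OF DU] by (auto simp: fixing_def)
    then have "eqt D [e] [v]" by (rule eqtI) (simp add: g(3))
    moreover have "[e] \<in> lists ?C" "[v] \<in> lists ?C" using sub v(1) by auto
    ultimately have "eqt D (d @ [e]) (d @ [v])" using ns unfolding nsplit_def by blast
    then obtain h where "map h d = d" "h e = v" by (auto simp: eqt_def)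
    then have "e = v" using Cons.prems(4) map_eq_conv[of h d "\<lambda>x. x"] by auto
    then show False using v(1) e(2) by simp
  qed
  then have 2: "\<not> ns_indep MM d H ?C" using ns_indep_iff[of H ?C d] sub by blast
  have "?C \<in> mods MM" by (rule model_mods[OF C(2,1)])
  then show ?case using 1 2 sub by (auto intro!: bexI[of _ ?C])
qed simp

lemma U_rank_le:
  assumes "set es \<subseteq> U" "set d \<subseteq> cl (A \<union> set es)"
  shows "U_rank MM d A \<le> enat (length es)"
  unfolding U_rank_def U_model_def
proof (intro Sup_least, elim CollectE exE conjE)
  fix r B assume "r = Sup {enat n |n. U_ge MM d n B}" and B: "B \<in> mods MM" "A \<subseteq> B"
  moreover have "set d \<subseteq> cl (B \<union> set es)" using assms(2) cl_mono[of "A \<union> set es" "B \<union> set es"] B(2) by blast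
  then have "Sup {enat n |n. U_ge MM d n B} \<le> enat (length es)"
    using U_ge_le[OF _ B(1) assms(1)] by (intro Sup_least) auto
  ultimately show "r \<le> enat (length es)" by simp
qed

lemma U_rank_ge:
  assumes "finite A" "A \<subseteq> U" "ind A es" "set es \<subseteq> set d"
  shows "enat (length es) \<le> U_rank MM d A"
proof -
  obtain H where H: "countable H" "model H" "A \<subseteq> H" "ind H es" by (rule model_independent[OF assms(1-3)])
  have "enat (length es) \<le> U_model MM d H"
    unfolding U_model_def using U_ge_ind[OF H(1,2,4) assms(4)] by (intro Sup_upper) blast
  also have "\<dots> \<le> U_rank MM d A"
    unfolding U_rank_def using model_mods[OF H(1,2)] H(3) by (intro Sup_upper) blast
  finally show ?thesis .
qed

lemma rank_one:
  assumes A: "finite A" "A \<subseteq> U" and d: "set d \<subseteq> U" "U_rank MM d A = 1"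
  shows "\<exists>e. e \<in> set d \<and> set d \<subseteq> cl (insert e A)"
proof -
  obtain es where es: "ind A es" "set es \<subseteq> set d" "set d \<subseteq> cl (A \<union> set es)" using basis[OF d(1), of A] by blast
  have "set es \<subseteq> U" using es(2) d(1) by blast
  then have "U_rank MM d A = enat (length es)"
    using U_rank_le[OF _ es(3)] U_rank_ge[OF A es(1,2)] by (intro antisym)
  then have "length es = 1" using d(2) by (simp add: one_enat_def)
  then obtain e where "es = [e]" by (auto simp: length_Suc_conv)
  then show ?thesis using es by auto
qed

lemma rank_three:
  assumes "set [u, v, w] \<subseteq> U" "set d \<subseteq> cl (A \<union> set [u, v, w])" "U_rank MM d A = 3"
  shows "ind A [u, v, w]"
proof -
  obtain es where es: "ind A es" "set es \<subseteq> set [u, v, w]" "set [u, v, w] \<subseteq> cl (A \<union> set es)"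
      "length es = length [u, v, w] \<longrightarrow> es = [u, v, w]" "length es \<le> length [u, v, w]" using basis[OF assms(1), of A] by blast
  have "set es \<subseteq> U" using es(2) assms(1) by blast
  moreover have "set d \<subseteq> cl (A \<union> set es)"
  proof -
    have "cl (A \<union> set [u, v, w]) \<subseteq> cl (A \<union> set es)"
      using es(3) by (intro cl_subset') (auto intro: cl_extensive)
    then show ?thesis using assms(2) by blast
  qed
  ultimately have "U_rank MM d A \<le> enat (length es)" by (rule U_rank_le)
  then have "3 \<le> length es" using assms(3) by (simp add: numeral_eq_enat)
  then show ?thesis using es(1,4,5) by simp
qed

text \<open>Rank 2 excludes independence and gives one dependence; the three generic pairs turn it,
  by exchange, into all three memberships of \<open>line\<close>.\<close>

lemma rank_two_line:
  assumes A: "finite A" "A \<subseteq> U" and U: "u \<in> U" "v \<in> U" "w \<in> U" and d: "{u, v, w} \<subseteq> set d" "U_rank MM d A = 2"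
    and gen: "u \<notin> cl A" "v \<notin> cl (insert u A)" "w \<notin> cl (insert u A)" "w \<notin> cl (insert v A)"
  shows "line A u v w"
proof -
  have "\<not> ind A [u, v, w]"
  proof
    assume "ind A [u, v, w]"
    then have "enat 3 \<le> U_rank MM d A" using U_rank_ge[OF A, of "[u, v, w]" d] d(1) by (simp add: numeral_3_eq_3)
    then show False using d(2) by (simp add: numeral_eq_enat)
  qed
  then have w: "w \<in> cl (insert v (insert u A))" using U gen(1,2) by simp
  have "v \<in> cl (insert w (insert u A))" by (rule cl_exchange[OF w gen(3)])
  moreover have "u \<in> cl (insert w (insert v A))" by (rule cl_exchange[OF _ gen(4)]) (use w in \<open>simp add: insert_commute\<close>)
  ultimately show ?thesis using w by (simp add: line_def insert_commute)
qed

lemma quadrangle_elements: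
  assumes A: "finite A" "A \<subseteq> points MM" and Q: "strict_bounded_partial_quadrangle MM A a b c x y z"
  obtains a' b' c' x' y' z' where "line A a' b' c'" "line A a' x' y'" "line A b' y' z'" "line A c' x' z'" "ind A [a', b', y']"
proof -
  let ?p = "\<lambda>i. [a, b, c, x, y, z] ! i"
  have AU: "A \<subseteq> U" using A(2) points by simp
  have Q1: "?p i \<in> lists (points MM)" "U_rank MM (?p i) A = 1" if "i < 6" for i
    using Q that unfolding strict_bounded_partial_quadrangle_def Let_def by blast+
  have Q3: "U_rank MM (?p i @ ?p j @ ?p k) A = 3" if "i < j" "j < k" "k < 6" "{i, j, k} \<notin> quadrangle_lines" for i j k
    using Q that unfolding strict_bounded_partial_quadrangle_def Let_def by blast
  have Q2: "U_rank MM (?p i @ ?p j @ ?p k) A = 2" if "i < j" "j < k" "k < 6" "{i, j, k} \<in> quadrangle_lines" for i j k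
    using Q that unfolding strict_bounded_partial_quadrangle_def Let_def by blast
  have pU: "set (?p i) \<subseteq> U" if "i < 6" for i using Q1(1)[OF that] points by auto
  have "\<forall>i\<in>{..<6}. \<exists>e. e \<in> set (?p i) \<and> set (?p i) \<subseteq> cl (insert e A)"
    using rank_one[OF A(1) AU pU Q1(2)] by blast
  from bchoice[OF this] obtain e where "\<forall>i\<in>{..<6}. e i \<in> set (?p i) \<and> set (?p i) \<subseteq> cl (insert (e i) A)" by (elim exE)
  then have e: "e i \<in> set (?p i)" "set (?p i) \<subseteq> cl (insert (e i) A)" if "i < 6" for i using that by blast+
  have eU: "e i \<in> U" if "i < 6" for i using e(1)[OF that] pU[OF that] by blast
  have I: "ind A [e i, e j, e k]" if i: "i < j" "j < k" "k < 6" "{i, j, k} \<notin> quadrangle_lines" for i j k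
  proof (rule rank_three[OF _ _ Q3[OF i]])
    have lt: "i < 6" "j < 6" "k < 6" using i by auto
    show "set [e i, e j, e k] \<subseteq> U" using eU lt by simp
    have "cl (insert (e l) A) \<subseteq> cl (A \<union> set [e i, e j, e k])" if "l \<in> {i, j, k}" for l
      by (rule cl_mono) (use that in auto)
    then have "set (?p l) \<subseteq> cl (A \<union> set [e i, e j, e k])" if "l \<in> {i, j, k}" for l
      using e(2)[of l] lt that by blast
    then show "set (?p i @ ?p j @ ?p k) \<subseteq> cl (A \<union> set [e i, e j, e k])" by simp
  qed
  have N: "e j \<notin> cl (insert (e i) A)" "e k \<notin> cl (insert (e i) A)" "e k \<notin> cl (insert (e j) A)"
    if i: "i < j" "j < k" "k < 6" "{i, j, k} \<notin> quadrangle_lines" for i j k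
    using I[OF i] cl_mono[of "insert (e i) A" "insert (e j) (insert (e i) A)"]
      cl_mono[of "insert (e j) A" "insert (e j) (insert (e i) A)"] by auto
  have N0: "e i \<notin> cl A" if "i < 6" for i
  proof
    assume "e i \<in> cl A"
    then have "cl (insert (e i) A) \<subseteq> cl A" using AU by (intro cl_subset') (auto intro: cl_extensive)
    then have "set (?p i) \<subseteq> cl (A \<union> set [])" using e(2)[OF that] by simp
    then have "U_rank MM (?p i) A \<le> 0" using U_rank_le[of "[]" "?p i" A] by (simp add: zero_enat_def)
    then show False using Q1(2)[OF that] by simp
  qed
  have L: "line A (e i) (e j) (e k)" if i: "i < j" "j < k" "k < 6" "{i, j, k} \<in> quadrangle_lines"
      and g: "e j \<notin> cl (insert (e i) A)" "e k \<notin> cl (insert (e i) A)" "e k \<notin> cl (insert (e j) A)" for i j k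
  proof (rule rank_two_line[OF A(1) AU _ _ _ _ Q2[OF i] _ g])
    have lt: "i < 6" "j < 6" "k < 6" using i by auto
    show "e i \<in> U" "e j \<in> U" "e k \<in> U" "e i \<notin> cl A" using eU N0 lt by blast+
    show "{e i, e j, e k} \<subseteq> set (?p i @ ?p j @ ?p k)" using e(1)[OF lt(1)] e(1)[OF lt(2)] e(1)[OF lt(3)] by simp
  qed
  have nc0: "S \<notin> quadrangle_lines" if "\<not> S \<subseteq> {0, 1, 2}" "\<not> S \<subseteq> {0, 3, 4}" "\<not> S \<subseteq> {1, 4, 5}" "\<not> S \<subseteq> {2, 3, 5}" for S
    using that unfolding quadrangle_lines_def by auto
  have nc: "{0, 1, 4} \<notin> quadrangle_lines" "{0, 2, 3} \<notin> quadrangle_lines" "{1, 2, 3} \<notin> quadrangle_lines" "{0, 1, 3} \<notin> quadrangle_lines" "{1, 3, 4} \<notin> quadrangle_lines"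
      "{0, 1, 5} \<notin> quadrangle_lines" "{0, 4, 5} \<notin> quadrangle_lines" "{0, 2, 5} \<notin> quadrangle_lines" "{0, 3, 5} \<notin> quadrangle_lines"
    by (rule nc0; simp)+
  have co: "{0, 1, 2} \<in> quadrangle_lines" "{0, 3, 4} \<in> quadrangle_lines" "{1, 4, 5} \<in> quadrangle_lines" "{2, 3, 5} \<in> quadrangle_lines"
    unfolding quadrangle_lines_def by (rule insertI1 | rule insertI2)+
  \<comment> \<open>For every two points of a line, the independence needed is read off from a
    noncollinear triple containing them.\<close>
  note n014 = N[OF _ _ _ nc(1), simplified]
  note n023 = N[OF _ _ _ nc(2), simplified]
  note n123 = N[OF _ _ _ nc(3), simplified]
  note n013 = N[OF _ _ _ nc(4), simplified]
  note n134 = N[OF _ _ _ nc(5), simplified]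
  note n015 = N[OF _ _ _ nc(6), simplified]
  note n045 = N[OF _ _ _ nc(7), simplified]
  note n025 = N[OF _ _ _ nc(8), simplified]
  note n035 = N[OF _ _ _ nc(9), simplified]
  show ?thesis
  proof (rule that)
    show "line A (e 0) (e 1) (e 2)" by (rule L[OF _ _ _ co(1)]) (use n014(1) n023(1) n123(1) in simp_all)
    show "line A (e 0) (e 3) (e 4)" by (rule L[OF _ _ _ co(2)]) (use n013(2) n014(2) n134(3) in simp_all)
    show "line A (e 1) (e 4) (e 5)" by (rule L[OF _ _ _ co(3)]) (use n014(3) n015(3) n045(3) in simp_all)
    show "line A (e 2) (e 3) (e 5)" by (rule L[OF _ _ _ co(4)]) (use n023(3) n025(3) n035(3) in simp_all)
    show "ind A [e 0, e 1, e 4]" by (rule I[OF _ _ _ nc(1)]) simp_all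
  qed
qed

end

section \<open>The theorem\<close>

lemma (in quadrangle_frame) group_exists:
  assumes "geometric_monster U cl \<Gamma> MM"
  shows "\<exists>\<E>1. imag_rels MM \<E>1 \<and> imag_rels (eq_monster MM \<E>1) {eq_rel (eq_monster MM \<E>1)} \<and>
    (let MMeq = eq_monster MM \<E>1; MMeqeq = eq_monster MMeq {eq_rel MMeq}; A'' = home MMeq ` home MM ` A in
      \<exists>G. galois_definable_group MMeqeq A'' G \<and> (\<exists>g. generic MMeqeq A'' {[g] |g. g \<in> carrier G} g) \<and>
        (\<forall>g. generic MMeqeq A'' {[g] |g. g \<in> carrier G} g \<longrightarrow> U_rank MMeqeq g A'' = 1))"
proof -
  interpret geometric_monster U cl \<Gamma> MM by (rule assms)
  interpret monster_group U cl \<Gamma> A bbl zzl YY MM by unfold_locales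
  have "hm ` A = home MQ ` home MM ` A" by (simp add: hm_def image_image)
  then show ?thesis using imag_rels_germ group_exists
    by (intro exI[of _ rels1]) (simp only: Let_def simp_thms)
qed

lemma (in geometric_monster) quadrangle_group:
  shows "\<exists>\<E>1 \<E>2. imag_rels MM \<E>1 \<and> imag_rels (eq_monster MM \<E>1) \<E>2 \<and>
    (\<forall>A a b c x y z.
       finite A \<and> A \<subseteq> points MM \<and>
       strict_bounded_partial_quadrangle MM A a b c x y z \<and>
       stationary MM (a @ b @ c @ x @ y @ z) A \<longrightarrow>
       (\<exists>A' G. finite A' \<and> A' \<subseteq> points MM \<and>
          (let MMeq = eq_monster MM \<E>1;
               MMeqeq = eq_monster MMeq \<E>2;
               A'' = home MMeq ` home MM ` A';
               GG = {[g] |g. g \<in> carrier G}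
           in galois_definable_group MMeqeq A'' G \<and>
              (\<exists>g. generic MMeqeq A'' GG g) \<and>
              (\<forall>g. generic MMeqeq A'' GG g \<longrightarrow> U_rank MMeqeq g A'' = 1))))"
proof (cases "\<exists>A a b c x y z. finite A \<and> A \<subseteq> points MM \<and> strict_bounded_partial_quadrangle MM A a b c x y z")
    \<comment> \<open>Without a quadrangle the assertion about quadrangles is vacuous, and equality
      alone provides both stages.\<close>
    case False
    have c: "countable {eq_rel MM}" by simp
    show ?thesis
    proof (rule exI[of _ "{eq_rel MM}"], rule exI[of _ "{eq_rel (eq_monster MM {eq_rel MM})}"],
        intro conjI imag_rels_countable[OF imaginaries_eq_rel c] allI impI)
    qed (rule FalseE, use False in blast)
  next
    case True
    then obtain A0 a b c x y z where Q: "finite A0" "A0 \<subseteq> points MM" "strict_bounded_partial_quadrangle MM A0 a b c x y z" by blast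
    obtain a' b' c' x' y' z' where q: "line A0 a' b' c'" "line A0 a' x' y'" "line A0 b' y' z'" "line A0 c' x' z'" "ind A0 [a', b', y']"
      by (rule quadrangle_elements[OF Q])
    have A0U: "A0 \<subseteq> U" using Q(2) points by simp
    obtain A a1 c3 a23 x1 y2 x3 where
      "quadrangle_frame U cl \<Gamma> A0 A a' b' c' x' y' z' a1 c3 a23 x1 y2 x3"
      using quadrangle_frame_exists[OF Q(1) A0U q] by blast
    then interpret qf: quadrangle_frame U cl \<Gamma> A0 A a' b' c' x' y' z' a1 c3 a23 x1 y2 x3 .
    obtain \<E>1 where E: "imag_rels MM \<E>1" "imag_rels (eq_monster MM \<E>1) {eq_rel (eq_monster MM \<E>1)}"
      and G: "let MMeq = eq_monster MM \<E>1; MMeqeq = eq_monster MMeq {eq_rel MMeq}; A'' = home MMeq ` home MM ` A in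
      \<exists>G. galois_definable_group MMeqeq A'' G \<and> (\<exists>g. generic MMeqeq A'' {[g] |g. g \<in> carrier G} g) \<and>
        (\<forall>g. generic MMeqeq A'' {[g] |g. g \<in> carrier G} g \<longrightarrow> U_rank MMeqeq g A'' = 1)"
      using qf.group_exists[OF geometric_monster_axioms] by (elim exE conjE)
    have AU: "finite A" "A \<subseteq> points MM" using qf.A0(2,3) points by simp_all
    show ?thesis
    proof (rule exI[of _ \<E>1], rule exI[of _ "{eq_rel (eq_monster MM \<E>1)}"], intro conjI E allI impI)
      from G show "\<exists>A' G. finite A' \<and> A' \<subseteq> points MM \<and>
          (let MMeq = eq_monster MM \<E>1;
               MMeqeq = eq_monster MMeq {eq_rel (eq_monster MM \<E>1)};
               A'' = home MMeq ` home MM ` A';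
               GG = {[g] |g. g \<in> carrier G}
           in galois_definable_group MMeqeq A'' G \<and>
              (\<exists>g. generic MMeqeq A'' GG g) \<and>
              (\<forall>g. generic MMeqeq A'' GG g \<longrightarrow> U_rank MMeqeq g A'' = 1))"
        unfolding Let_def
        by (elim exE) (rule exI, rule exI, rule conjI, rule AU(1), rule conjI, rule AU(2), assumption)
    qed
  qed

section \<open>The monster model of a quasiminimal class as a geometric monster\<close>

context quasiminimal_monster
begin

lemma model_iff: "model Z \<longleftrightarrow> inf_dim_closed Z"
proof
  assume m: "model Z"
  then have Z: "Z \<subseteq> UU" "cl MO (Z \<inter> UU) = Z" by (simp_all add: model_def)
  show "inf_dim_closed Z"
  proof (rule inf_dim_closedI[OF Z(1)])
    show "cl MO Z = Z" using Z by (simp add: Int_absorb2)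
    fix D assume D: "finite D" "D \<subseteq> Z"
    then show "\<not> Z \<subseteq> cl MO D" using model_not_in_cl[OF m D(1)] Z(1) by (simp add: Int_absorb2)
  qed
next
  assume "inf_dim_closed Z"
  then have Z: "Z \<subseteq> UU" "cl MO Z = Z" "\<And>D. finite D \<Longrightarrow> D \<subseteq> Z \<Longrightarrow> cl MO D \<noteq> Z"
    by (simp_all add: inf_dim_closed_def)
  have "\<not> Z \<subseteq> cl MO (D \<inter> UU)" if D: "finite D" "D \<subseteq> Z" for D
  proof
    have DU: "D \<inter> UU = D" using D(2) Z(1) by blast
    assume "Z \<subseteq> cl MO (D \<inter> UU)"
    moreover have "cl MO D \<subseteq> cl MO Z" by (rule pregeometryD(3)[OF MO_pg D(2) Z(1)])
    ultimately show False using Z(2,3) D DU by auto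
  qed
  then show "model Z" using Z(1,2) by (simp add: model_def Int_absorb2)
qed

lemma mods_inf_dim:
  assumes "N \<in> KK" "closed_submodel L N MO"
  shows "inf_dim_closed (univ N)"
proof (rule inf_dim_closedI)
  note c = closed_submodelD[OF assms(2)]
  show "univ N \<subseteq> UU" "cl MO (univ N) = univ N" by (rule c(1), rule c(3))
  fix D assume D: "finite D" "D \<subseteq> univ N"
  show "\<not> univ N \<subseteq> cl MO D"
  proof
    assume "univ N \<subseteq> cl MO D"
    then have "univ N \<subseteq> cl N D" using c(2)[OF D(2)] by simp
    moreover have "pregeometry (univ N) (cl N)" using c(4) by (simp add: is_pstruct_def)
    then have "cl N D \<subseteq> univ N" using D(2) by (rule pregeometryD(2))
    ultimately show False using assms(1) D by (auto simp: finite_dimensional_def)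
  qed
qed

text \<open>Truncation forgets the closure operator, on which the notion of automorphism does not
  depend. The universes of strong submodels are infinite-dimensional because finite-dimensional
  structures were discarded from the class.\<close>

sublocale monster: geometric_monster UU "\<lambda>X. cl MO (X \<inter> UU)" "{f. fo_iso L f MO MO}" "monster_of L KK \<delta> MO"
proof unfold_locales
  let ?MM = "monster_of L KK \<delta> MO"
  have iso: "fo_iso L f (fo_struct.truncate MO) (fo_struct.truncate MO) \<longleftrightarrow> fo_iso L f MO MO" for f
    by (simp add: fo_iso_def fo_embedding_def fo_struct.truncate_def)
  show "is_struct (lng ?MM) (str ?MM)" using MO_struct by (simp add: monster_of_def is_struct_def fo_struct.truncate_def)
  show "points ?MM = UU" by (simp add: monster_of_def fo_struct.truncate_def)
  show "Aut ?MM {} = {f. fo_iso L f MO MO}" using iso by (simp add: Aut_def monster_of_def)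
  fix B
  { assume "B \<in> mods ?MM"
    then show "model B" unfolding model_iff using mods_inf_dim by (auto simp: monster_of_def) }
  assume B: "countable B" "model B"
  have "B = univ (MO\<lparr>univ := B\<rparr>)" by simp
  then show "B \<in> mods ?MM"
    using restrict_in_KK[OF B(2)[unfolded model_iff] B(1)] countable_bounded[OF B(1)] unfolding monster_of_def
    by (simp only: monster.simps) (intro CollectI exI[of _ "MO\<lparr>univ := B\<rparr>"], simp)
qed

end

theorem theorem3p10:
  fixes L :: "('f, 'r) lang"
    and K :: "('f, 'r, 'u) pstruct set"
    and \<delta> :: "'u rel"
    and M :: "('f, 'r, 'u) pstruct"
  defines "MM \<equiv> monster_of L K \<delta> M"
  assumes "countable_lang L"
    and "quasiminimal_class L K"
    and "monster_model L K \<delta> M"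
  shows "\<exists>\<E>1 \<E>2. imag_rels MM \<E>1 \<and> imag_rels (eq_monster MM \<E>1) \<E>2 \<and>
    (\<forall>A a b c x y z.
       finite A \<and> A \<subseteq> points MM \<and>
       strict_bounded_partial_quadrangle MM A a b c x y z \<and>
       stationary MM (a @ b @ c @ x @ y @ z) A \<longrightarrow>
       (\<exists>A' G. finite A' \<and> A' \<subseteq> points MM \<and>
          (let MMeq = eq_monster MM \<E>1;
               MMeqeq = eq_monster MMeq \<E>2;
               A'' = home MMeq ` home MM ` A';
               GG = {[g] |g. g \<in> carrier G}
           in galois_definable_group MMeqeq A'' G \<and>
              (\<exists>g. generic MMeqeq A'' GG g) \<and>
              (\<forall>g. generic MMeqeq A'' GG g \<longrightarrow> U_rank MMeqeq g A'' = 1))))"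
proof -
  obtain M0 where M0: "quasiminimal L M0" "K = {N \<in> Kclass L M0. \<not> finite_dimensional N}"
    using assms(3) by (auto simp: quasiminimal_class_def)
  interpret quasiminimal_structure L M0 by unfold_locales (rule M0(1))
  interpret quasiminimal_monster L M0 \<delta> M by unfold_locales (use assms(4) M0(2) in simp)
  show ?thesis unfolding MM_def M0(2) by (rule monster.quadrangle_group)
qed

end
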